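(* Let $f\in L^2(\Omega)$, let $m\in M_h$ be the HDG solution, i.e. $a(m,\mu)=\int_\Omega f\,\mathcal U\mu\,dx$ for all $\mu\in M_h$, and let $\tilde m_H\in\tilde M_H$ be the prototypical multiscale solution, i.e. $a(\tilde m_H,\tilde\mu_H)=\int_\Omega f\,\mathcal U\tilde\mu_H\,dx$ for all $\tilde\mu_H\in\tilde M_H$. Then $$\alpha^{1/2}\,\|\mathcal U m-\mathcal U\tilde m_H\|_0+\|A^{-1/2}(\mathcal Q m-\mathcal Q\tilde m_H)\|_0\;\lesssim\;\|m-\tilde m_H\|_a\;\lesssim\;\alpha^{-1/2}H\,\|f\|_0 .$$
   Context: **Setting.** Let $d\in\{1,2,3\}$ and let $\Omega\subset\mathbb R^d$ be a bounded Lipschitz polytope. $A\in L^\infty(\Omega;\mathbb R^{d\times d}_{\mathrm{sym}})$ satisfies $\alpha|\xi|^2\le A(x)\xi\cdot\xi\le\beta|\xi|^2$ for all $\xi\in\mathbb R^d$ and a.e. $x\in\Omega$, with constants $0<\alpha\le\beta<\infty$. $\mathcal E_H$ (coarse), $\mathcal E_\varepsilon$ (intermediate), $\mathcal E_h$ (fine) are geometrically conforming, shape-regular, simplicial meshes of $\Omega$ with mesh sizes $h<\varepsilon<H$; finer meshes are refinements of coarser ones and $\mathcal E_h$ is generated from $\mathcal E_H$ by uniform refinement. $A$ is constant, $A|_e=c_e>0$, on each $e\in\mathcal E_\varepsilon$ (a scalar is identified with a multiple of the identity), hence on each $e\in\mathcal E_h$. For $\star\in\{h,H\}$, $\mathcal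 F_\star$ is the set of faces of $\mathcal E_\star$; $L^2(\mathcal F_\star)$ is understood face-wise; $\gamma_\star$ is the trace onto the skeleton (union of faces in $\mathcal F_\star$); $\nu$ is the outward unit normal. **HDG spaces.** For degree $p\ge1$, the local spaces $M_F,V_E,\mathbf W_E$ and the stabilization $\tau\ge 0$ are those of one of the methods: LDG-H ($M_F=\mathbb P_p(F)$, $V_E=\mathbb P_p(E)$, $\mathbf W_E=\mathbb P_p(E)^d$, $\tau>0$ face-wise constant with $\tau h\lesssim1$); EDG (as LDG-H, but $M_\star$ additionally overall continuous on the skeleton); RT-H ($\tau=0$, $M_F=\mathbb P_p(F)$, $V_E=\mathbb P_p(E)$, $\mathbf W_E=\mathbb P_p(E)^d+x\,\mathbb P_p(E)$); BDM-H ($\tau=0$, $M_F=\mathbb P_p(F)$, $V_E=\mathbb P_{p-1}(E)$, $\mathbf W_E=\mathbb P_p(E)^d$; for BDM-H the dependence of the bounds on $\alpha,\beta$ may differ). Set $M_\star=\{m\in L^2(\mathcal F_\star): m|_F\in M_F\ \forall F\in\mathcal F_\star,\ m|_F=0\ \forall F\subset\partial\Omega\}$, $V_\star=\{v\in L^2(\Omega): v|_E\in V_E\ \forall E\in\mathcal E_\star\}$, $\mathbf W_\star=\{q\in L^2(\Omega;\mathbb R^d): q|_E\in\mathbf W_E\ \forall E\in\mathcal E_\star\}$. **Local solvers and bilinear form.** $\mathcal U:L^2(\mathcal F_h)\to V_h$, $\mathcal Q:L^2(\mathcal F_h)\to\mathbf W_h$ are defined element-wise: for $e\in\mathcal E_h$,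 $u_e=\mathcal Um|_e\in V_e$, $q_e=\mathcal Qm|_e\in\mathbf W_e$ solve, for all $p_e\in\mathbf W_e$, $v_e\in V_e$, $\int_e A^{-1}q_e\cdot p_e\,dx-\int_e u_e\operatorname{div}p_e\,dx=-\int_{\partial e}m\,p_e\cdot\nu\,d\sigma$ and $\int_{\partial e}(q_e\cdot\nu+\tau u_e)v_e\,d\sigma-\int_e q_e\cdot\nabla v_e\,dx=\int_{\partial e}\tau m v_e\,d\sigma$. Then $a(m,\mu)=\int_\Omega A^{-1}\mathcal Qm\cdot\mathcal Q\mu\,dx+\sum_{e\in\mathcal E_h}\int_{\partial e}\tau(\mathcal Um-m)(\mathcal U\mu-\mu)\,d\sigma$ and $\|m\|_a=a(m,m)^{1/2}$. $\|\cdot\|_0$ is the $L^2(\Omega)$-norm. **Norms and linear spaces.** $\langle m,\mu\rangle_\star=\sum_{E\in\mathcal E_\star}\frac{|E|}{|\partial E|}\int_{\partial E}m\mu\,d\sigma$, $\|m\|_\star=\langle m,m\rangle_\star^{1/2}$ (also for bulk functions via their element-wise traces); for a union $\omega$ of elements, $\|m\|_{\star,\omega}^2=\sum_{E'\in\mathcal E_\star,E'\subset\omega}\frac{|E'|}{|\partial E'|}\int_{\partial E'}m^2\,d\sigma$. $\overline V_\star$ is the space of continuous functions on $\overline\Omega$ that are affine on every element of $\mathcal E_\star$ and vanish on $\partial\Omega$; $\overline M_\star=\gamma_\star\overline V_\star\subset M_\star$. **Standing properties of the local solvers.** For all $\mu\in M_h$, $e\in\mathcal E_h$, with $\nabla_h$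 the element-wise gradient: (LS1) $\|\mathcal U\mu-\mu\|_h\lesssim h\|A^{-1}\mathcal Q\mu\|_0$; (LS2) $\|\mathcal Q\mu\|_{0,e}\le\beta\|A^{-1}\mathcal Q\mu\|_{0,e}\lesssim\beta h^{-1}\|\mu\|_{h,e}$ and $\|\mathcal U\mu\|_0\lesssim\|\mu\|_h$; (LS3) $\|\mathcal Q\mu+A\nabla_h\mathcal U\mu\|_0\lesssim\beta h^{-1}\|\mathcal U\mu-\mu\|_h$ and $\|A^{-1}\mathcal Q\mu+\nabla_h\mathcal U\mu\|_0\lesssim h^{-1}\|\mathcal U\mu-\mu\|_h$; (LS4) $\mathcal U\gamma_hw=w$, $\mathcal Q\gamma_hw=-A\nabla w$ for $w\in\overline V_h$; (LS5) $\alpha\|\mu\|_h^2\lesssim a(\mu,\mu)\lesssim\beta h^{-2}\|\mu\|_h^2$. **Mesh transfer.** $\mathcal I_h:M_H\to M_h$ is a linear injection operator with $\mathcal I_hm_H=v|_{\mathcal F_h}$ whenever $m_H=v|_{\mathcal F_H}$ for some $v\in\overline V_H$, and $\|m_H\|_{H,E}\eqsim\|\mathcal I_hm_H\|_{h,E}$ for $m_H\in\overline M_H$, $E\in\mathcal E_H$. $I_H^{\rm avg}:V_H\to\overline V_H$ assigns to each interior vertex $x$ of $\mathcal E_H$ the arithmetic mean of the values $u|_{E_i}(x)$ over the elements $E_i\in\mathcal E_H$ meeting in $x$, and $0$ at vertices on $\partial\Omega$. $I_h^{\rm avg}$ is defined similarly on $V_h$ but separately on each $E\in\mathcal E_H$,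 mapping $V_h|_E\to\overline V_h|_E$ by averaging only over fine elements $e_i\subset E$ meeting in the vertex (jumps across coarse element boundaries are allowed). $\mathcal P_H^{L^2}$ is the coarse element-wise $L^2$-projection onto $V_H$. Define $\Pi_H:M_h\to\overline M_H$, $\Pi_H\mu=\gamma_H I_H^{\rm avg}\mathcal P_H^{L^2}I_h^{\rm avg}\mathcal U\mu$. **Multiscale space.** $\mathcal W_h=\{\mu\in M_h:\Pi_H\mu=0\}$. $\mathcal C:M_h\to\mathcal W_h$ is defined by $a(\mathcal C\xi,\eta)=a(\xi,\eta)$ for all $\eta\in\mathcal W_h$. $\tilde M_H=(\mathbf 1-\mathcal C)M_h$. **Notation.** $b\lesssim c$ means $b\le Cc$ with a constant $C>0$ that might depend on the dimension (and on fixed discretization data such as shape regularity and $p$), but not on the mesh sizes or the functions involved; dependencies on $\alpha,\beta$ are tracked explicitly. $b\eqsim c$ means $b\lesssim c\lesssim b$. *)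

theory Defs
  imports "HOL-Analysis.Analysis"
begin

section \<open>Domain, meshes, coefficient\<close>

text \<open>A polytope in the finite element sense: possibly non-convex, its closure is a finite union
  of convex polytopes. Near each boundary point the domain lies strictly above a Lipschitz graph
  over the hyperplane orthogonal to some unit vector.\<close>

definition lipschitz_polytope :: "'a::euclidean_space set \<Rightarrow> bool" where
  "lipschitz_polytope \<Omega> \<longleftrightarrow>
     open \<Omega> \<and> bounded \<Omega> \<and> \<Omega> \<noteq> {} \<and>
     (\<exists>\<K>. finite \<K> \<and> (\<forall>K\<in>\<K>. polytope K) \<and> closure \<Omega> = \<Union>\<K>) \<and>
     (\<forall>x\<in>frontier \<Omega>. \<exists>r>0. \<exists>n L. \<exists>g::'a \<Rightarrow> real. norm n = 1 \<and> L-lipschitz_on {z. z \<bullet> n = 0} g \<and>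
        (\<forall>y\<in>ball x r. y \<in> \<Omega> \<longleftrightarrow> g (y - (y \<bullet> n) *\<^sub>R n) < y \<bullet> n))"

text \<open>Elements are closed simplices of full dimension; \<^const>\<open>triangulation\<close> is geometric
  conformity. The number \<open>\<kappa>\<close> bounds the ratio of the diameter to the radius of an inscribed ball.\<close>

definition simplicial_mesh :: "real \<Rightarrow> 'a::euclidean_space set \<Rightarrow> 'a set set \<Rightarrow> bool" where
  "simplicial_mesh \<kappa> \<Omega> \<T> \<longleftrightarrow>
     triangulation \<T> \<and> (\<forall>E\<in>\<T>. int DIM('a) simplex E) \<and> \<Union>\<T> = closure \<Omega> \<and>
     (\<forall>E\<in>\<T>. \<exists>x r. cball x r \<subseteq> E \<and> 0 < r \<and> diameter E \<le> \<kappa> * r)"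

definition mesh_size :: "'a::euclidean_space set set \<Rightarrow> real" where
  "mesh_size \<T> = Max (diameter ` \<T>)"

definition refines :: "'a::euclidean_space set set \<Rightarrow> 'a set set \<Rightarrow> bool" where
  "refines \<T>' \<T> \<longleftrightarrow> (\<forall>e\<in>\<T>'. \<exists>E\<in>\<T>. e \<subseteq> E)"

text \<open>Every coarse element is cut into the same number of fine elements of equal volume. This
  covers iterated regular refinement (\<open>2 ^ d\<close> children per step) and iterated bisection of all
  elements.\<close>

definition uniformly_refines :: "'a::euclidean_space set set \<Rightarrow> 'a set set \<Rightarrow> bool" where
  "uniformly_refines \<T>' \<T> \<longleftrightarrow> refines \<T>' \<T> \<and>
     (\<exists>N::nat. \<forall>E\<in>\<T>. card {e\<in>\<T>'. e \<subseteq> E} = N \<and>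
        (\<forall>e\<in>\<T>'. e \<subseteq> E \<longrightarrow> measure lebesgue e = measure lebesgue E / N))"

definition mesh_hierarchy ::
    "real \<Rightarrow> 'a::euclidean_space set \<Rightarrow> 'a set set \<Rightarrow> 'a set set \<Rightarrow> 'a set set \<Rightarrow> bool" where
  "mesh_hierarchy \<kappa> \<Omega> \<T>H \<T>\<epsilon> \<T>h \<longleftrightarrow>
     simplicial_mesh \<kappa> \<Omega> \<T>H \<and> simplicial_mesh \<kappa> \<Omega> \<T>\<epsilon> \<and> simplicial_mesh \<kappa> \<Omega> \<T>h \<and>
     mesh_size \<T>h < mesh_size \<T>\<epsilon> \<and> mesh_size \<T>\<epsilon> < mesh_size \<T>H \<and>
     refines \<T>\<epsilon> \<T>H \<and> refines \<T>h \<T>\<epsilon> \<and> uniformly_refines \<T>h \<T>H"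

definition faces :: "'a::euclidean_space set set \<Rightarrow> 'a set set" where
  "faces \<T> = {F. \<exists>E\<in>\<T>. F facet_of E}"

definition admissible_coefficient ::
    "(real^'n) set \<Rightarrow> (real^'n) set set \<Rightarrow> real \<Rightarrow> real \<Rightarrow> (real^'n \<Rightarrow> real^'n^'n) \<Rightarrow> bool" where
  "admissible_coefficient \<Omega> \<T>\<epsilon> \<alpha> \<beta> A \<longleftrightarrow>
     0 < \<alpha> \<and> \<alpha> \<le> \<beta> \<and>
     A \<in> borel_measurable (lebesgue_on \<Omega>) \<and> (\<exists>B. AE x in lebesgue_on \<Omega>. norm (A x) \<le> B) \<and>
     (AE x in lebesgue_on \<Omega>. transpose (A x) = A x \<and>
        (\<forall>\<xi>. \<alpha> * (norm \<xi>)\<^sup>2 \<le> (A x *v \<xi>) \<bullet> \<xi> \<and> (A x *v \<xi>) \<bullet> \<xi> \<le> \<beta> * (norm \<xi>)\<^sup>2)) \<and>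
     (\<forall>e\<in>\<T>\<epsilon>. \<exists>c>0. AE x in lebesgue_on e. A x = mat c)"

definition matrix_inv_sqrt :: "real^'n^'n \<Rightarrow> real^'n^'n" where
  "matrix_inv_sqrt M =
     (THE B. transpose B = B \<and> (\<forall>\<xi>. 0 \<le> (B *v \<xi>) \<bullet> \<xi>) \<and> B ** B = matrix_inv M)"


section \<open>Integration over faces and element boundaries\<close>

text \<open>Surface measure of a flat piece \<open>F\<close> of dimension \<open>d - 1\<close>: the surface measure of a subset of
  \<open>F\<close> is the \<open>d\<close>-dimensional Lebesgue measure of the prism of height one over it. For \<open>d = 1\<close> this
  is the Dirac measure at the point \<open>F\<close>. It does not depend on the choice of the unit normal.\<close>

definition unit_normal :: "'a::euclidean_space set \<Rightarrow> 'a" where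
  "unit_normal F = (SOME n. norm n = 1 \<and> (\<forall>x\<in>F. \<forall>y\<in>F. n \<bullet> (x - y) = 0))"

definition face_measure :: "'a::euclidean_space set \<Rightarrow> 'a measure" where
  "face_measure F =
     (let n = unit_normal F; z = (SOME z. z \<in> F) in
      distr (restrict_space lborel {x + t *\<^sub>R n | x t. x \<in> F \<and> t \<in> {0..1}}) borel
        (\<lambda>y. y - (n \<bullet> (y - z)) *\<^sub>R n))"

definition outer_normal :: "'a::euclidean_space set \<Rightarrow> 'a set \<Rightarrow> 'a" where
  "outer_normal e F = (THE n. norm n = 1 \<and> (\<forall>x\<in>e. \<forall>y\<in>F. n \<bullet> x \<le> n \<bullet> y))"

text \<open>Integrands on skeletons are indexed by the face, since they may be multi-valued where faces
  meet.\<close>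

definition bdry_integral :: "'a::euclidean_space set \<Rightarrow> ('a set \<Rightarrow> 'a \<Rightarrow> real) \<Rightarrow> real" where
  "bdry_integral e g = (\<Sum>F | F facet_of e. LINT x|face_measure F. g F x)"


section \<open>Function spaces\<close>

definition L2norm :: "'a::euclidean_space set \<Rightarrow> ('a \<Rightarrow> 'b::euclidean_space) \<Rightarrow> real" where
  "L2norm S g = sqrt (LINT x|lebesgue_on S. (norm (g x))\<^sup>2)"

definition L2 :: "'a::euclidean_space set \<Rightarrow> ('a \<Rightarrow> real) set" where
  "L2 S = {f. f \<in> borel_measurable (lebesgue_on S) \<and> integrable (lebesgue_on S) (\<lambda>x. (f x)\<^sup>2)}"

text \<open>Polynomial functions of total degree at most \<open>k\<close>.\<close>

definition polys :: "nat \<Rightarrow> (real^'n \<Rightarrow> real) set" where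
  "polys k = {f. \<exists>c :: ('n \<Rightarrow> nat) \<Rightarrow> real.
     f = (\<lambda>x. \<Sum>j | (\<Sum>i\<in>UNIV. j i) \<le> k. c j * (\<Prod>i\<in>UNIV. (x $ i) ^ j i))}"

definition vec_polys :: "nat \<Rightarrow> (real^'n \<Rightarrow> real^'n) set" where
  "vec_polys k = {q. \<forall>i. (\<lambda>x. q x $ i) \<in> polys k}"

datatype hdg_scheme = LDG_H | EDG | RT_H | BDM_H

text \<open>The local bulk spaces, with a polynomial on an element identified with the polynomial function
  on the whole space. They are then the same for all elements.\<close>

fun V_loc :: "hdg_scheme \<Rightarrow> nat \<Rightarrow> (real^'n \<Rightarrow> real) set" where
  "V_loc BDM_H p = polys (p - 1)"
| "V_loc _ p = polys p"

fun W_loc :: "hdg_scheme \<Rightarrow> nat \<Rightarrow> (real^'n \<Rightarrow> real^'n) set" where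
  "W_loc RT_H p = {q. \<exists>r\<in>vec_polys p. \<exists>s\<in>polys p. q = (\<lambda>x. r x + s x *\<^sub>R x)}"
| "W_loc _ p = vec_polys p"

text \<open>A broken function in \<open>V\<^sub>\<star>\<close> or \<open>W\<^sub>\<star>\<close> is the family \<open>v\<close> of its element polynomials, so that
  \<open>v E\<close> restricted to the boundary of \<open>E\<close> is its trace from \<open>E\<close>; \<open>bulk \<T> v\<close> is the corresponding
  function on the domain (up to the null set of the skeleton).\<close>

definition bulk ::
    "'a::euclidean_space set set \<Rightarrow> ('a set \<Rightarrow> 'a \<Rightarrow> 'b::euclidean_space) \<Rightarrow> 'a \<Rightarrow> 'b" where
  "bulk \<T> v x = (\<Sum>E\<in>\<T>. indicator (interior E) x *\<^sub>R v E x)"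

text \<open>Functions on the skeleton are face-wise: \<open>m F x\<close> is the value on the face \<open>F\<close> at \<open>x \<in> F\<close>. They are
  set to zero elsewhere, so that equality of such functions is equality on every face.\<close>

definition skel_support :: "'a::euclidean_space set set \<Rightarrow> ('a set \<Rightarrow> 'a \<Rightarrow> real) set" where
  "skel_support \<T> = {m. \<forall>F x. \<not> (F \<in> faces \<T> \<and> x \<in> F) \<longrightarrow> m F x = 0}"

definition L2_faces :: "'a::euclidean_space set set \<Rightarrow> ('a set \<Rightarrow> 'a \<Rightarrow> real) set" where
  "L2_faces \<T> = {m \<in> skel_support \<T>. \<forall>F\<in>faces \<T>.
     m F \<in> borel_measurable borel \<and> integrable (face_measure F) (\<lambda>x. (m F x)\<^sup>2)}"

definition M_space ::
    "hdg_scheme \<Rightarrow> nat \<Rightarrow> (real^'n) set \<Rightarrow> (real^'n) set set \<Rightarrow> ((real^'n) set \<Rightarrow> real^'n \<Rightarrow> real) set" where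
  "M_space S p \<Omega> \<T> = {m \<in> L2_faces \<T>.
     (\<forall>F\<in>faces \<T>. \<exists>g\<in>polys p. \<forall>x\<in>F. m F x = g x) \<and>
     (\<forall>F\<in>faces \<T>. F \<subseteq> frontier \<Omega> \<longrightarrow> (\<forall>x\<in>F. m F x = 0)) \<and>
     (S = EDG \<longrightarrow> (\<exists>c. continuous_on (\<Union>(faces \<T>)) c \<and> (\<forall>F\<in>faces \<T>. \<forall>x\<in>F. m F x = c x)))}"

definition skel_trace ::
    "'a::euclidean_space set set \<Rightarrow> ('a \<Rightarrow> real) \<Rightarrow> 'a set \<Rightarrow> 'a \<Rightarrow> real" where
  "skel_trace \<T> v = (\<lambda>F x. if F \<in> faces \<T> \<and> x \<in> F then v x else 0)"

text \<open>Continuous, piecewise affine functions on the union of the elements in \<open>S\<close>, set to zero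
  outside of it.\<close>

definition P1_conforming :: "(real^'n) set set \<Rightarrow> (real^'n \<Rightarrow> real) set" where
  "P1_conforming S = {w. continuous_on (\<Union>S) w \<and> (\<forall>E\<in>S. \<exists>g\<in>polys 1. \<forall>x\<in>E. w x = g x) \<and>
     (\<forall>x. x \<notin> \<Union>S \<longrightarrow> w x = 0)}"

definition Vbar :: "(real^'n) set \<Rightarrow> (real^'n) set set \<Rightarrow> (real^'n \<Rightarrow> real) set" where
  "Vbar \<Omega> \<T> = {w \<in> P1_conforming \<T>. \<forall>x\<in>frontier \<Omega>. w x = 0}"

definition Mbar ::
    "(real^'n) set \<Rightarrow> (real^'n) set set \<Rightarrow> ((real^'n) set \<Rightarrow> real^'n \<Rightarrow> real) set" where
  "Mbar \<Omega> \<T> = skel_trace \<T> ` Vbar \<Omega> \<T>"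

text \<open>The mesh-dependent inner product, summed over the elements in \<open>S\<close>. The arguments may depend on
  the element (traces of broken functions) and on the face.\<close>

definition mesh_ip :: "'a::euclidean_space set set \<Rightarrow> ('a set \<Rightarrow> 'a set \<Rightarrow> 'a \<Rightarrow> real) \<Rightarrow>
    ('a set \<Rightarrow> 'a set \<Rightarrow> 'a \<Rightarrow> real) \<Rightarrow> real" where
  "mesh_ip S g k = (\<Sum>E\<in>S. measure lebesgue E / bdry_integral E (\<lambda>F x. 1) *
     bdry_integral E (\<lambda>F x. g E F x * k E F x))"

definition mesh_norm ::
    "'a::euclidean_space set set \<Rightarrow> ('a set \<Rightarrow> 'a set \<Rightarrow> 'a \<Rightarrow> real) \<Rightarrow> real" where
  "mesh_norm S g = sqrt (mesh_ip S g g)"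


section \<open>Local solvers\<close>

definition grad :: "(real^'n \<Rightarrow> real) \<Rightarrow> real^'n \<Rightarrow> real^'n" where
  "grad v x = (THE D. GDERIV v x :> D)"

definition divergence :: "(real^'n \<Rightarrow> real^'n) \<Rightarrow> real^'n \<Rightarrow> real" where
  "divergence q x = trace (jacobian q (at x))"

text \<open>The stabilization is face-wise constant: \<open>\<tau> F\<close> is its value on \<open>F\<close>.\<close>

definition admissible_stabilization ::
    "real \<Rightarrow> hdg_scheme \<Rightarrow> 'a::euclidean_space set set \<Rightarrow> ('a set \<Rightarrow> real) \<Rightarrow> bool" where
  "admissible_stabilization K S \<T> \<tau> \<longleftrightarrow>
     (if S = LDG_H \<or> S = EDG then \<forall>F\<in>faces \<T>. 0 < \<tau> F \<and> \<tau> F * mesh_size \<T> \<le> K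
      else \<forall>F\<in>faces \<T>. \<tau> F = 0)"

definition is_local_solution where
  "is_local_solution S p A \<tau> e m u q \<longleftrightarrow>
     u \<in> V_loc S p \<and> q \<in> W_loc S p \<and>
     (\<forall>r\<in>W_loc S p.
        (LINT x|lebesgue_on e. (matrix_inv (A x) *v q x) \<bullet> r x) -
        (LINT x|lebesgue_on e. u x * divergence r x) =
        - bdry_integral e (\<lambda>F x. m F x * (r x \<bullet> outer_normal e F))) \<and>
     (\<forall>v\<in>V_loc S p.
        bdry_integral e (\<lambda>F x. (q x \<bullet> outer_normal e F + \<tau> F * u x) * v x) -
        (LINT x|lebesgue_on e. q x \<bullet> grad v x) =
        bdry_integral e (\<lambda>F x. \<tau> F * m F x * v x))"

definition local_solvers ::
    "hdg_scheme \<Rightarrow> nat \<Rightarrow> (real^'n) set set \<Rightarrow> (real^'n \<Rightarrow> real^'n^'n) \<Rightarrow> ((real^'n) set \<Rightarrow> real) \<Rightarrow>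
     (((real^'n) set \<Rightarrow> real^'n \<Rightarrow> real) \<Rightarrow> (real^'n) set \<Rightarrow> real^'n \<Rightarrow> real) \<Rightarrow>
     (((real^'n) set \<Rightarrow> real^'n \<Rightarrow> real) \<Rightarrow> (real^'n) set \<Rightarrow> real^'n \<Rightarrow> real^'n) \<Rightarrow> bool" where
  "local_solvers S p \<T>h A \<tau> U Q \<longleftrightarrow>
     (\<forall>m\<in>L2_faces \<T>h. \<forall>e\<in>\<T>h. is_local_solution S p A \<tau> e m (U m e) (Q m e))"

definition hdg_form where
  "hdg_form \<Omega> \<T>h A \<tau> U Q m \<mu> =
     (LINT x|lebesgue_on \<Omega>. (matrix_inv (A x) *v bulk \<T>h (Q m) x) \<bullet> bulk \<T>h (Q \<mu>) x) +
     (\<Sum>e\<in>\<T>h. bdry_integral e (\<lambda>F x. \<tau> F * (U m e x - m F x) * (U \<mu> e x - \<mu> F x)))"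

definition hdg_norm where
  "hdg_norm \<Omega> \<T>h A \<tau> U Q m = sqrt (hdg_form \<Omega> \<T>h A \<tau> U Q m m)"

text \<open>The properties assumed of the local solvers, with \<open>K\<close> bounding all implicit constants. The
  identity \<open>\<U> \<gamma>\<^sub>h w = w\<close> for conforming affine \<open>w\<close> is only meaningful if the local space contains
  the affine functions, that is, unless the scheme is BDM-H with \<open>p = 1\<close>.\<close>

definition local_solver_properties ::
    "real \<Rightarrow> hdg_scheme \<Rightarrow> nat \<Rightarrow> (real^'n) set \<Rightarrow> (real^'n) set set \<Rightarrow> (real^'n \<Rightarrow> real^'n^'n) \<Rightarrow>
     real \<Rightarrow> real \<Rightarrow> ((real^'n) set \<Rightarrow> real) \<Rightarrow>
     (((real^'n) set \<Rightarrow> real^'n \<Rightarrow> real) \<Rightarrow> (real^'n) set \<Rightarrow> real^'n \<Rightarrow> real) \<Rightarrow>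
     (((real^'n) set \<Rightarrow> real^'n \<Rightarrow> real) \<Rightarrow> (real^'n) set \<Rightarrow> real^'n \<Rightarrow> real^'n) \<Rightarrow> bool" where
  "local_solver_properties K S p \<Omega> \<T>h A \<alpha> \<beta> \<tau> U Q \<longleftrightarrow>
     (let h = mesh_size \<T>h;
          Mh = M_space S p \<Omega> \<T>h;
          a = hdg_form \<Omega> \<T>h A \<tau> U Q;
          jump = (\<lambda>\<mu>. mesh_norm \<T>h (\<lambda>e F x. U \<mu> e x - \<mu> F x));
          AiQ = (\<lambda>\<mu> x. matrix_inv (A x) *v bulk \<T>h (Q \<mu>) x);
          gradU = (\<lambda>\<mu>. bulk \<T>h (\<lambda>e. grad (U \<mu> e)))
      in (\<forall>\<mu>\<in>Mh. jump \<mu> \<le> K * h * L2norm \<Omega> (AiQ \<mu>)) \<and>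
         (\<forall>\<mu>\<in>Mh. \<forall>e\<in>\<T>h. L2norm e (bulk \<T>h (Q \<mu>)) \<le> \<beta> * L2norm e (AiQ \<mu>) \<and>
            \<beta> * L2norm e (AiQ \<mu>) \<le> K * \<beta> * inverse h * mesh_norm {e'\<in>\<T>h. e' \<subseteq> e} (\<lambda>_. \<mu>)) \<and>
         (\<forall>\<mu>\<in>Mh. L2norm \<Omega> (bulk \<T>h (U \<mu>)) \<le> K * mesh_norm \<T>h (\<lambda>_. \<mu>)) \<and>
         (\<forall>\<mu>\<in>Mh. L2norm \<Omega> (\<lambda>x. bulk \<T>h (Q \<mu>) x + A x *v gradU \<mu> x) \<le> K * \<beta> * inverse h * jump \<mu>) \<and>
         (\<forall>\<mu>\<in>Mh. L2norm \<Omega> (\<lambda>x. AiQ \<mu> x + gradU \<mu> x) \<le> K * inverse h * jump \<mu>) \<and>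
         (\<forall>w\<in>Vbar \<Omega> \<T>h. \<forall>e\<in>\<T>h.
            ((polys 1 :: (real^'n \<Rightarrow> real) set) \<subseteq> V_loc S p \<longrightarrow>
               (\<forall>x\<in>e. U (skel_trace \<T>h w) e x = w x)) \<and>
            (AE x in lebesgue_on e. Q (skel_trace \<T>h w) e x = - (A x *v grad w x))) \<and>
         (\<forall>\<mu>\<in>Mh. \<alpha> * (mesh_norm \<T>h (\<lambda>_. \<mu>))\<^sup>2 \<le> K * a \<mu> \<mu> \<and>
            a \<mu> \<mu> \<le> K * \<beta> * inverse (h\<^sup>2) * (mesh_norm \<T>h (\<lambda>_. \<mu>))\<^sup>2))"


section \<open>Mesh transfer and multiscale space\<close>

definition mesh_injection where
  "mesh_injection K S p \<Omega> \<T>H \<T>h J \<longleftrightarrow>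
     (\<forall>m\<in>M_space S p \<Omega> \<T>H. J m \<in> M_space S p \<Omega> \<T>h) \<and>
     (\<forall>m\<in>M_space S p \<Omega> \<T>H. \<forall>m'\<in>M_space S p \<Omega> \<T>H. \<forall>c c'.
        J (\<lambda>F x. c * m F x + c' * m' F x) = (\<lambda>F x. c * J m F x + c' * J m' F x)) \<and>
     inj_on J (M_space S p \<Omega> \<T>H) \<and>
     (\<forall>v\<in>Vbar \<Omega> \<T>H. J (skel_trace \<T>H v) = skel_trace \<T>h v) \<and>
     (\<forall>m\<in>Mbar \<Omega> \<T>H. \<forall>E\<in>\<T>H.
        mesh_norm {E'\<in>\<T>H. E' \<subseteq> E} (\<lambda>_. m) \<le> K * mesh_norm {e\<in>\<T>h. e \<subseteq> E} (\<lambda>_. J m) \<and>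
        mesh_norm {e\<in>\<T>h. e \<subseteq> E} (\<lambda>_. J m) \<le> K * mesh_norm {E'\<in>\<T>H. E' \<subseteq> E} (\<lambda>_. m))"

text \<open>Nodal averaging over the elements in \<open>S\<close>, with value zero at the vertices on the boundary of
  \<open>\<Omega>\<close>. With \<open>S\<close> the coarse mesh this is \<open>I\<^sub>H\<^sup>avg\<close>; with \<open>S\<close> the set of fine elements contained in a
  coarse element it is the restriction of \<open>I\<^sub>h\<^sup>avg\<close> to that coarse element.\<close>

definition avg_interp ::
    "(real^'n) set \<Rightarrow> (real^'n) set set \<Rightarrow> ((real^'n) set \<Rightarrow> real^'n \<Rightarrow> real) \<Rightarrow> real^'n \<Rightarrow> real" where
  "avg_interp \<Omega> S v = (THE w. w \<in> P1_conforming S \<and>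
     (\<forall>x. (\<exists>e\<in>S. x extreme_point_of e) \<longrightarrow>
        w x = (if x \<in> frontier \<Omega> then 0 else (\<Sum>e | e \<in> S \<and> x \<in> e. v e x) / card {e\<in>S. x \<in> e})))"

definition L2_proj ::
    "hdg_scheme \<Rightarrow> nat \<Rightarrow> ((real^'n) set \<Rightarrow> real^'n \<Rightarrow> real) \<Rightarrow> (real^'n) set \<Rightarrow> real^'n \<Rightarrow> real" where
  "L2_proj S p v E = (THE g. g \<in> V_loc S p \<and>
     (\<forall>\<phi>\<in>V_loc S p. (LINT x|lebesgue_on E. g x * \<phi> x) = (LINT x|lebesgue_on E. v E x * \<phi> x)))"

definition Pi_H where
  "Pi_H S p \<Omega> \<T>H \<T>h U \<mu> =
     skel_trace \<T>H (avg_interp \<Omega> \<T>H (L2_proj S p (\<lambda>E. avg_interp \<Omega> {e\<in>\<T>h. e \<subseteq> E} (U \<mu>))))"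

definition fine_space where
  "fine_space S p \<Omega> \<T>H \<T>h U =
     {\<mu> \<in> M_space S p \<Omega> \<T>h. Pi_H S p \<Omega> \<T>H \<T>h U \<mu> = (\<lambda>F x. 0)}"

definition is_corrector where
  "is_corrector S p \<Omega> \<T>H \<T>h A \<tau> U Q C \<longleftrightarrow>
     (\<forall>\<xi>\<in>M_space S p \<Omega> \<T>h. C \<xi> \<in> fine_space S p \<Omega> \<T>H \<T>h U \<and>
        (\<forall>\<eta>\<in>fine_space S p \<Omega> \<T>H \<T>h U.
           hdg_form \<Omega> \<T>h A \<tau> U Q (C \<xi>) \<eta> = hdg_form \<Omega> \<T>h A \<tau> U Q \<xi> \<eta>))"

definition multiscale_space where
  "multiscale_space S p \<Omega> \<T>h C = {(\<lambda>F x. \<xi> F x - C \<xi> F x) | \<xi>. \<xi> \<in> M_space S p \<Omega> \<T>h}"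

definition is_hdg_solution where
  "is_hdg_solution \<Omega> \<T>h A \<tau> U Q f X m \<longleftrightarrow>
     m \<in> X \<and> (\<forall>\<mu>\<in>X. hdg_form \<Omega> \<T>h A \<tau> U Q m \<mu> = (LINT x|lebesgue_on \<Omega>. f x * bulk \<T>h (U \<mu>) x))"

end

theory Submission
  imports Defs
begin

text \<open>
The proof reduces everything to one estimate. Let \<open>w = C m\<close> be the corrector of the full solution. Galerkin
orthogonality and the definition of the corrector give \<open>a(m - mH, m - mH) = a(w, w) = \<integral> f U w\<close>
(\<open>multiscale_error_energy\<close>), and \<open>w\<close> lies in the kernel of the quasi-interpolation \<open>\<Pi>\<^sub>H\<close>. So it suffices
that \<open>\<parallel>U w\<parallel> \<le> C H \<parallel>A\<^sup>-\<^sup>1 Q w\<parallel>\<close> for functions in that kernel (\<open>fine_space_bound\<close>): the flux norm is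
bounded by \<open>\<alpha> powr (- 1/2)\<close> times the energy norm of \<open>w\<close>, and one factor of the energy norm cancels. In the
other inequality the flux term is a part of the energy, and the scalar term is bounded by the comparison of norms in
the properties of the local solvers. Bilinearity of the form
requires that the local solvers are linear on the skeleton space, that is, that the local problems have unique
solutions (\<open>homogeneous_local_problem\<close>). Since the coefficient is a number on each element, this is
integration by parts for polynomials on simplices, which comes down to the formula for integrals of homogeneous functions
over cones (\<open>cone_formula\<close>).

For the kernel estimate, let \<open>v = U w\<close>. The properties of the local solvers bound the differences of the traces of
\<open>v\<close> and \<open>w\<close>, and the broken gradient of \<open>v\<close>, by the flux. Inverse estimates turn these \<open>L\<^sup>2\<close>-bounds into pointwise
ones. Around a vertex the elements are connected through facets that contain this vertex (\<open>reach_covers\<close>), on which \<open>w\<close> is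
single-valued, so the values of \<open>v\<close> in the star of a vertex are close to each other and to any average. Hence the nodal
averages of \<open>v\<close> are close to \<open>v\<close>, and the conforming one, \<open>ghat\<close>, has a gradient bounded by the flux.

On the coarse mesh \<open>ghat\<close> is close to a constant on each element, by the Poincare inequality, and so are its means over
the facets and the projection that enters \<open>\<Pi>\<^sub>H\<close>. The constants of neighbouring elements are compared through the facet
means, so they differ little within the star of a vertex. At a boundary vertex some facet mean is zero, since
\<open>ghat\<close> vanishes on the boundary. At an interior vertex the average of the projections is zero, since \<open>w\<close> is in
the kernel. So all the constants are small (\<open>el_mean_bound\<close>), and \<open>v\<close> is small (\<open>kernel_estimate\<close>).

The constants depend on the meshes only through the given bounds, because uniform refinement makes the ratio of coarse and
fine sizes nearly the same everywhere (\<open>size_ratio\<close>) and because neighbours have comparable sizes. In dimension two or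
more the latter follows from shape regularity (\<open>neighbour_size\<close>). In dimension one it is a consequence of the stability
of the flux, tested with hat functions (\<open>vertex_size\<close>), for the fine mesh, and then of uniform refinement for
the coarse mesh.
\<close>

abbreviation vol :: "'a::euclidean_space set => real" where "vol == measure lborel"

section \<open>Polynomial functions\<close>

text \<open>The same functions as \<^const>\<open>polys\<close>, in a form with an induction principle: it makes sums,
  products, gradients and restrictions to lines routine. The parameter bounds the degree.\<close>

inductive polyfn :: "nat => (real^'n => real) => bool" where
 const: "polyfn k (%x. c)"
| coord: "polyfn k f ==> polyfn (Suc k) (%x. x $ i * f x)"
| add: "polyfn k f ==> polyfn k g ==> polyfn k (%x. f x + g x)"

lemma polyfn_mono: "polyfn k f ==> k <= l ==> polyfn l f"
proof (induction arbitrary: l rule: polyfn.induct)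
 case (coord k f i)
 then obtain l' where "l = Suc l'" "k <= l'" by (cases l) auto
 with coord show ?case by (auto intro: polyfn.coord)
qed (auto intro: polyfn.const polyfn.add)

lemma polyfn_cmult: "polyfn k f ==> polyfn k (%x. c * f x)"
proof (induction rule: polyfn.induct)
 case (coord k f i)
 then show ?case using polyfn.coord[OF coord.IH, of i] by (simp add: mult.left_commute)
qed (auto intro: polyfn.const polyfn.add simp: distrib_left)

lemma polyfn_diff: "polyfn k f ==> polyfn k g ==> polyfn k (%x. f x - g x)"
 using polyfn.add[OF _ polyfn_cmult[of k g "-1"], of f] by simp

lemma polyfn_sum: "(!!i. i \<in> I ==> polyfn k (f i)) ==> polyfn k (%x. \<Sum>i\<in>I. f i x)"
 by (induction I rule: infinite_finite_induct) (auto intro: polyfn.const polyfn.add)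

lemma polyfn_mult: "polyfn k f ==> polyfn l g ==> polyfn (k + l) (%x. f x * g x)"
proof (induction rule: polyfn.induct)
 case (const k c)
 then show ?case by (auto intro: polyfn_cmult polyfn_mono)
next
 case (coord k f i)
 then show ?case using polyfn.coord[OF coord.IH, of i] by (simp add: mult.assoc)
qed (auto intro: polyfn.add simp: distrib_right)

lemma polyfn_coord: "polyfn 1 (%x. x $ i)"
 using polyfn.coord[OF polyfn.const[of 0 1], of i] by simp

lemma polyfn_inner: "polyfn 1 (%x. b \<bullet> x)"
 unfolding inner_vec_def by (auto intro!: polyfn_sum polyfn_cmult polyfn_coord[unfolded One_nat_def])

lemma polyfn_continuous [continuous_intros]: "polyfn k f ==> continuous_on S f"
 by (induction rule: polyfn.induct) (auto intro!: continuous_intros)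

lemma polyfn_borel: "polyfn k f ==> f \<in> borel_measurable borel"
 by (intro borel_measurable_continuous_onI polyfn_continuous)

lemma finite_multiindices: "finite {j :: 'n::finite => nat. (\<Sum>i\<in>UNIV. j i) <= k}"
proof (rule finite_subset)
 show "{j :: 'n => nat. (\<Sum>i\<in>UNIV. j i) <= k} \<subseteq> (\<Pi>\<^sub>E i\<in>UNIV. {..k})"
  by (auto simp: PiE_def Pi_def) (meson finite_UNIV member_le_sum UNIV_I le_trans zero_le finite)
qed (auto intro: finite_PiE)

lemma polyfn_monomial: "(\<Sum>i\<in>UNIV. j i) <= k ==> polyfn k (%x. \<Prod>i\<in>UNIV. (x $ i) ^ j i)"
proof (induction k arbitrary: j)
 case 0
 then show ?case by (auto intro: polyfn.const)
next
 case (Suc k)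
 show ?case
 proof (cases "\<exists>l. j l > 0")
  case True
  then obtain l where l: "j l > 0" by blast
  define j' where "j' = j(l := j l - 1)"
  have "(\<Sum>i\<in>UNIV. j i) = j l + (\<Sum>i\<in>UNIV - {l}. j i)" by (simp add: sum.remove[of UNIV l])
  moreover have "(\<Sum>i\<in>UNIV. j' i) = (j l - 1) + (\<Sum>i\<in>UNIV - {l}. j i)"
   by (subst sum.remove[of UNIV l]) (auto simp: j'_def)
  ultimately have "polyfn k (%x. \<Prod>i\<in>UNIV. (x $ i) ^ j' i)" using Suc l by auto
  then have "polyfn (Suc k) (%x. x $ l * (\<Prod>i\<in>UNIV. (x $ i) ^ j' i))" by (rule polyfn.coord)
  moreover have "x $ l * (\<Prod>i\<in>UNIV. (x $ i) ^ j' i) = (\<Prod>i\<in>UNIV. (x $ i) ^ j i)" for x :: "real^'a"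
  proof -
   have "(\<Prod>i\<in>UNIV. (x $ i) ^ j i) = (x $ l) ^ j l * (\<Prod>i\<in>UNIV - {l}. (x $ i) ^ j i)"
    by (simp add: prod.remove[of UNIV l])
   moreover have "(\<Prod>i\<in>UNIV. (x $ i) ^ j' i) = (x $ l) ^ (j l - 1) * (\<Prod>i\<in>UNIV - {l}. (x $ i) ^ j i)"
    by (subst prod.remove[of UNIV l]) (auto simp: j'_def)
   ultimately show ?thesis using l by (simp add: power_eq_if)
  qed
  ultimately show ?thesis by simp
 next
  case False
  then show ?thesis by (auto intro: polyfn.const)
 qed
qed

lemma polys_add: "f \<in> polys k ==> g \<in> polys k ==> (%x. f x + g x) \<in> polys k"
 unfolding polys_def
 apply clarsimp
 subgoal for c c' by (rule exI[of _ "%j. c j + c' j"]) (simp add: distrib_right sum.distrib)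
 done

lemma polys_monomial: "(\<Sum>i\<in>UNIV. j i) <= k ==> (%x. c * (\<Prod>i\<in>UNIV. (x $ i) ^ j i)) \<in> polys k"
 unfolding polys_def
 by (auto intro!: exI[of _ "%j'. if j' = j then c else 0"]
   simp: if_distrib[of "%c. c * _"] sum.delta finite_multiindices cong: if_cong)

lemma polys_const: "(%x. c) \<in> polys k"
 using polys_monomial[of "%_. 0" k c] by simp

lemma polys_sum: "(!!i. i \<in> I ==> f i \<in> polys k) ==> (%x. \<Sum>i\<in>I. f i x) \<in> polys k"
 by (induction I rule: infinite_finite_induct) (auto intro: polys_const polys_add)

lemma polys_coord: assumes "f \<in> polys k" shows "(%x. x $ l * f x) \<in> polys (Suc k)"
proof -
 obtain c where f: "f = (%x. \<Sum>j | (\<Sum>i\<in>UNIV. j i) <= k. c j * (\<Prod>i\<in>UNIV. (x $ i) ^ j i))"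
  using assms by (auto simp: polys_def)
 have "(%x. c j * (x $ l * (\<Prod>i\<in>UNIV. (x $ i) ^ j i))) \<in> polys (Suc k)" if "(\<Sum>i\<in>UNIV. j i) <= k" for j
 proof -
  define j' where "j' = j(l := Suc (j l))"
  have "(\<Sum>i\<in>UNIV. j i) = j l + (\<Sum>i\<in>UNIV - {l}. j i)" by (simp add: sum.remove[of UNIV l])
  moreover have "(\<Sum>i\<in>UNIV. j' i) = Suc (j l) + (\<Sum>i\<in>UNIV - {l}. j i)"
   by (subst sum.remove[of UNIV l]) (auto simp: j'_def)
  ultimately have "(%x. c j * (\<Prod>i\<in>UNIV. (x $ i) ^ j' i)) \<in> polys (Suc k)"
   using that by (intro polys_monomial) auto
  moreover have "x $ l * (\<Prod>i\<in>UNIV. (x $ i) ^ j i) = (\<Prod>i\<in>UNIV. (x $ i) ^ j' i)" for x :: "real^'a"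
  proof -
   have "(\<Prod>i\<in>UNIV. (x $ i) ^ j i) = (x $ l) ^ j l * (\<Prod>i\<in>UNIV - {l}. (x $ i) ^ j i)"
    by (simp add: prod.remove[of UNIV l])
   moreover have "(\<Prod>i\<in>UNIV. (x $ i) ^ j' i) = (x $ l) ^ Suc (j l) * (\<Prod>i\<in>UNIV - {l}. (x $ i) ^ j i)"
    by (subst prod.remove[of UNIV l]) (auto simp: j'_def)
   ultimately show ?thesis by simp
  qed
  ultimately show ?thesis by simp
 qed
 then show ?thesis unfolding f sum_distrib_left
  by (intro polys_sum) (auto simp: mult.left_commute)
qed

lemma polys_iff_polyfn: "f \<in> polys k \<longleftrightarrow> polyfn k f"
proof
 assume "f \<in> polys k"
 then show "polyfn k f"
  by (auto simp: polys_def intro!: polyfn_sum polyfn_cmult polyfn_monomial)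
next
 assume "polyfn k f"
 then show "f \<in> polys k"
  by (induction rule: polyfn.induct) (auto intro: polys_const polys_coord polys_add)
qed

lemma polyfn_line:
 "polyfn k f ==> \<exists>q. degree q <= k \<and> (\<forall>t. f (x + t *\<^sub>R y) = poly q t)"
proof (induction rule: polyfn.induct)
 case (const k c)
 then show ?case by (intro exI[of _ "[:c:]"]) auto
next
 case (coord k f i)
 then obtain q where q: "degree q <= k" "!!t. f (x + t *\<^sub>R y) = poly q t" by blast
 have "degree ([:x $ i, y $ i:] * q) <= Suc k"
  using degree_mult_le[of "[:x $ i, y $ i:]" q] q(1) by (auto split: if_splits)
 then show ?case using q by (intro exI[of _ "[:x $ i, y $ i:] * q"]) (auto simp: algebra_simps)
next
 case (add k f g)
 then obtain q r where "degree q <= k" "!!t. f (x + t *\<^sub>R y) = poly q t"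
  "degree r <= k" "!!t. g (x + t *\<^sub>R y) = poly r t" by blast
 then show ?case by (intro exI[of _ "q + r"]) (auto simp: degree_add_le)
qed

lemma polyfn_has_gradient:
 "polyfn k f ==> \<exists>G. (\<forall>x. GDERIV f x :> G x) \<and> (\<forall>i. polyfn k (%x. G x $ i))"
proof (induction rule: polyfn.induct)
 case (const k c)
 then show ?case by (intro exI[of _ "%_. 0"]) (auto intro: polyfn.const GDERIV_const)
next
 case (coord k f l)
 then obtain G where G: "!!x. GDERIV f x :> G x" "!!i. polyfn k (%x. G x $ i)" by blast
 have "GDERIV (%x. x $ l * f x) x :> x $ l *\<^sub>R G x + f x *\<^sub>R axis l 1" for x
  using G(1)[of x] unfolding gderiv_def
  by (auto intro!: derivative_eq_intros bounded_linear.has_derivative[OF bounded_linear_vec_nth] simp: inner_axis algebra_simps inner_add_right)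
 moreover have "polyfn (Suc k) (%x. (x $ l *\<^sub>R G x + f x *\<^sub>R axis l 1) $ i)" for i
  using polyfn.coord[OF G(2)[of i], of l] polyfn_mono[OF coord.hyps, of "Suc k"]
  by (cases "i = l") (auto simp: axis_def intro: polyfn.add)
 ultimately show ?case by (intro exI[of _ "%x. x $ l *\<^sub>R G x + f x *\<^sub>R axis l 1"]) auto
next
 case (add k f g)
 then obtain G H where "!!x. GDERIV f x :> G x" "!!i. polyfn k (%x. G x $ i)"
   "!!x. GDERIV g x :> H x" "!!i. polyfn k (%x. H x $ i)" by blast
 then show ?case by (intro exI[of _ "%x. G x + H x"]) (auto intro: GDERIV_add polyfn.add)
qed

lemma grad_eqI: "GDERIV f x :> D ==> grad f x = D"
proof -
 assume D: "GDERIV f x :> D"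
 have "D' = D" if "GDERIV f x :> D'" for D'
 proof -
  have "(%h. h \<bullet> D') = (%h. h \<bullet> D)"
   using that D unfolding gderiv_def by (rule has_derivative_unique)
  then have "h \<bullet> D' = h \<bullet> D" for h by (rule fun_cong)
  then show ?thesis using vector_eq_ldot[of D' D] by auto
 qed
 with D show ?thesis unfolding grad_def by (intro the_equality)
qed

section \<open>Inverse estimates on convex sets\<close>

lemma finite_difference_poly:
 fixes q :: "real poly"
 shows "degree q < n ==> (\<Sum>i\<le>n. (-1) ^ i * real (n choose i) * poly q (real i)) = 0"
proof (induction n arbitrary: q)
 case (Suc n)
 obtain a r where q: "q = pCons a r" by (cases q)
 have "(\<Sum>i\<le>Suc n. (-1) ^ i * real (Suc n choose i) * (real i * poly r (real i))) = 0"
 proof -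
  have "(\<Sum>i\<le>Suc n. (-1) ^ i * real (Suc n choose i) * (real i * poly r (real i)))
    = (\<Sum>i\<le>n. (-1) ^ Suc i * real (Suc n choose Suc i) * (real (Suc i) * poly r (real (Suc i))))"
   by (subst sum.atMost_Suc_shift) simp
  also have "... = (\<Sum>i\<le>n. - real (Suc n) * ((-1) ^ i * real (n choose i) * poly (pcompose r [:1, 1:]) (real i)))"
  proof (rule sum.cong[OF refl])
   fix i
   have "real (Suc i) * real (Suc n choose Suc i) = real (Suc n) * real (n choose i)"
    by (metis Suc_times_binomial of_nat_mult)
   moreover have "poly (pcompose r [:1, 1:]) (real i) = poly r (real (Suc i))"
    by (simp add: poly_pcompose add.commute)
   ultimately show "(-1) ^ Suc i * real (Suc n choose Suc i) * (real (Suc i) * poly r (real (Suc i)))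
     = - real (Suc n) * ((-1) ^ i * real (n choose i) * poly (pcompose r [:1, 1:]) (real i))"
    by (metis (no_types, lifting) mult.assoc mult.commute mult_minus_left power_Suc minus_mult_left mult_1)
  qed
  also have "... = - real (Suc n) * (\<Sum>i\<le>n. (-1) ^ i * real (n choose i) * poly (pcompose r [:1, 1:]) (real i))"
   by (rule sum_distrib_left[symmetric])
  also have "... = 0"
  proof (cases "r = 0")
   case False
   then have "degree (pcompose r [:1, 1:]) < n" using Suc.prems q by (simp add: degree_pcompose)
   from Suc.IH[OF this] show ?thesis by simp
  qed simp
  finally show ?thesis .
 qed
 moreover have "(\<Sum>i\<le>Suc n. (-1) ^ i * real (Suc n choose i) * a) = 0"
  using choose_alternating_sum[of "Suc n", where 'a=real]
  by (simp add: sum_distrib_right[symmetric] del: sum.atMost_Suc)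
 ultimately show ?case
  by (simp add: q distrib_left sum.distrib del: sum.atMost_Suc)
qed simp

text \<open>A vanishing finite difference expresses the value at \<open>0\<close> through the values at the other nodes,
  with binomial weights that are at most \<open>2 ^ (p + 1)\<close>.\<close>

lemma poly_extrapolation:
 fixes q :: "real poly"
 assumes "degree q <= p"
 shows "(poly q 0)^2 <= real (p + 1) * 4 ^ (p + 1) * (\<Sum>i=1..p+1. (poly q (real i / real (p + 1)))^2)"
proof -
 define r where "r = pcompose q [:0, 1 / real (p + 1):]"
 have r: "poly r (real i) = poly q (real i / real (p + 1))" for i by (simp add: r_def poly_pcompose)
 have "degree r <= degree q * degree [:0, 1 / real (p + 1):]" unfolding r_def by (rule degree_pcompose_le)
 then have "degree r < p + 1" using assms by auto
 from finite_difference_poly[OF this]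
 have "poly r 0 + (\<Sum>i=1..p+1. (-1) ^ i * real ((p+1) choose i) * poly r (real i)) = 0"
  by (simp add: atMost_atLeast0 sum.atLeast_Suc_atMost del: sum.cl_ivl_Suc)
 then have "poly q 0 = - (\<Sum>i=1..p+1. (-1) ^ i * real ((p+1) choose i) * poly r (real i))"
  using r[of 0] by simp
 then have "(poly q 0)^2 = (\<Sum>i=1..p+1. (-1) ^ i * real ((p+1) choose i) * poly r (real i))^2"
  by (simp only: power2_minus)
 also have "... <= (\<Sum>i=1..p+1. 1^2) * (\<Sum>i=1..p+1. ((-1) ^ i * real ((p+1) choose i) * poly r (real i))^2)"
  using Cauchy_Schwarz_ineq_sum[of "%_. 1" "%i. (-1) ^ i * real ((p+1) choose i) * poly r (real i)" "{1..p+1}"]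
  by simp
 also have "... <= real (p + 1) * (\<Sum>i=1..p+1. 4 ^ (p + 1) * (poly r (real i))^2)"
 proof -
  have "((-1) ^ i * real ((p+1) choose i) * poly r (real i))^2 <= 4 ^ (p + 1) * (poly r (real i))^2" for i
  proof -
   have "real ((p+1) choose i) <= 2 ^ (p + 1)"
    using binomial_le_pow2[of "p+1" i] by (metis of_nat_le_iff of_nat_power of_nat_numeral)
   then have "(real ((p+1) choose i))^2 <= (2 ^ (p + 1))^2" by (intro power_mono) auto
   also have "(2 ^ (p + 1))^2 = (4::real) ^ (p + 1)" by (simp add: power2_eq_square flip: power_mult_distrib)
   finally show ?thesis by (simp add: power_mult_distrib mult_right_mono power_mult[symmetric])
  qed
  then show ?thesis by (intro mult_mono sum_mono sum_nonneg) auto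
 qed
 finally show ?thesis by (simp add: sum_distrib_left r mult.assoc del: sum.cl_ivl_Suc)
qed

lemma nn_integral_homothety:
 fixes c :: "'a::euclidean_space" and g :: "'a => ennreal"
 assumes [measurable]: "g \<in> borel_measurable borel" and "\<theta> \<noteq> 0"
 shows "(\<integral>\<^sup>+y. g y \<partial>lborel) = ennreal (\<bar>\<theta>\<bar> ^ DIM('a)) * (\<integral>\<^sup>+y. g (c + \<theta> *\<^sub>R y) \<partial>lborel)"
 by (subst lborel_affine[OF assms(2), of c])
   (simp add: nn_integral_density nn_integral_distr nn_integral_cmult)

text \<open>Contracting a convex set towards one of its points stays inside the set.\<close>

lemma nn_integral_contraction:
 fixes x :: "'a::euclidean_space" and g :: "'a => ennreal"
 assumes [measurable]: "g \<in> borel_measurable borel" "K \<in> sets borel" and "convex K" "x \<in> K" "0 < \<theta>" "\<theta> <= 1"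
 shows "(\<integral>\<^sup>+y. g ((1 - \<theta>) *\<^sub>R x + \<theta> *\<^sub>R y) * indicator K y \<partial>lborel)
  <= ennreal ((1 / \<theta>) ^ DIM('a)) * (\<integral>\<^sup>+y. g y * indicator K y \<partial>lborel)"
proof -
 have "(\<integral>\<^sup>+y. g ((1 - \<theta>) *\<^sub>R x + \<theta> *\<^sub>R y) * indicator K y \<partial>lborel) <=
   (\<integral>\<^sup>+y. g ((1 - \<theta>) *\<^sub>R x + \<theta> *\<^sub>R y) * indicator K ((1 - \<theta>) *\<^sub>R x + \<theta> *\<^sub>R y) \<partial>lborel)"
  (is "?L <= ?M")
  using assms by (intro nn_integral_mono) (auto simp: indicator_def convex_alt)
 moreover have "ennreal ((1 / \<theta>) ^ DIM('a)) * (\<integral>\<^sup>+y. g y * indicator K y \<partial>lborel) = ?M"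
  using assms by (subst nn_integral_homothety[where \<theta>=\<theta> and c="(1 - \<theta>) *\<^sub>R x"])
   (auto simp: mult.assoc[symmetric] ennreal_mult[symmetric] power_divide)
 ultimately show ?thesis by simp
qed

text \<open>The number of nodes, times the extrapolation factor, times the Jacobian of the strongest
  contraction, the one by \<open>1 / (p + 1)\<close>.\<close>

definition inverse_const :: "nat => nat => real" where
 "inverse_const p d = real (p + 1) * ((real (p + 1) * 4 ^ (p + 1)) * real (p + 1) ^ d)"

lemma inverse_const_pos: "inverse_const p d > 0"
 by (simp add: inverse_const_def)

text \<open>On each segment from \<open>x\<close> to a point \<open>y\<close> of \<open>K\<close> the value at \<open>x\<close> is extrapolated from equidistant
  nodes, which are images of \<open>y\<close> under contractions of \<open>K\<close> towards \<open>x\<close>. Integration over \<open>y\<close> gives the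
  estimate, with a constant that depends neither on the shape nor on the size of \<open>K\<close>.\<close>

lemma inverse_estimate_nn:
 fixes f :: "'a::euclidean_space => real"
 assumes line: "!!x y. \<exists>q. degree q <= p \<and> (\<forall>t. f (x + t *\<^sub>R y) = poly q t)"
  and [measurable]: "f \<in> borel_measurable borel" "K \<in> sets borel" and K: "convex K" "x \<in> K"
 shows "emeasure lborel K * ennreal ((f x)^2)
  <= ennreal (inverse_const p DIM('a)) * (\<integral>\<^sup>+y. ennreal ((f y)^2) * indicator K y \<partial>lborel)"
proof -
 define \<theta> where "\<theta> i = real i / real (p + 1)" for i
 define c where "c = real (p + 1) * 4 ^ (p + 1)"
 let ?I = "\<integral>\<^sup>+y. ennreal ((f y)^2) * indicator K y \<partial>lborel"
 have pt: "(f x)^2 <= c * (\<Sum>i=1..p+1. (f ((1 - \<theta> i) *\<^sub>R x + \<theta> i *\<^sub>R y))^2)" for y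
 proof -
  obtain q where q: "degree q <= p" "!!t. f (x + t *\<^sub>R (y - x)) = poly q t" using line by blast
  have "f ((1 - \<theta> i) *\<^sub>R x + \<theta> i *\<^sub>R y) = poly q (\<theta> i)" for i
   using q(2)[of "\<theta> i"] by (simp add: algebra_simps)
  moreover have "f x = poly q 0" using q(2)[of 0] by simp
  ultimately show ?thesis using poly_extrapolation[OF q(1)] by (simp add: \<theta>_def c_def)
 qed
 have "emeasure lborel K * ennreal ((f x)^2) = (\<integral>\<^sup>+y. ennreal ((f x)^2) * indicator K y \<partial>lborel)"
  by (subst nn_integral_cmult) (simp_all add: mult.commute)
 also have "... <= (\<integral>\<^sup>+y. (\<Sum>i=1..p+1. ennreal c * (ennreal ((f ((1 - \<theta> i) *\<^sub>R x + \<theta> i *\<^sub>R y))^2) * indicator K y)) \<partial>lborel)"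
 proof (intro nn_integral_mono)
  fix y
  have "ennreal ((f x)^2) <= (\<Sum>i=1..p+1. ennreal c * ennreal ((f ((1 - \<theta> i) *\<^sub>R x + \<theta> i *\<^sub>R y))^2))"
  proof -
   have "(\<Sum>i=1..p+1. ennreal c * ennreal ((f ((1 - \<theta> i) *\<^sub>R x + \<theta> i *\<^sub>R y))^2))
     = (\<Sum>i=1..p+1. ennreal (c * (f ((1 - \<theta> i) *\<^sub>R x + \<theta> i *\<^sub>R y))^2))"
    by (intro sum.cong ennreal_mult[symmetric]) (auto simp: c_def)
   also have "... = ennreal (\<Sum>i=1..p+1. c * (f ((1 - \<theta> i) *\<^sub>R x + \<theta> i *\<^sub>R y))^2)"
    by (rule sum_ennreal) (auto simp: c_def)
   finally show ?thesis using pt[of y] by (simp add: sum_distrib_left ennreal_leI del: sum.cl_ivl_Suc)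
  qed
  then show "ennreal ((f x)^2) * indicator K y <= (\<Sum>i=1..p+1. ennreal c * (ennreal ((f ((1 - \<theta> i) *\<^sub>R x + \<theta> i *\<^sub>R y))^2) * indicator K y))"
   by (auto simp: indicator_def)
 qed
 also have "... = (\<Sum>i=1..p+1. ennreal c * (\<integral>\<^sup>+y. ennreal ((f ((1 - \<theta> i) *\<^sub>R x + \<theta> i *\<^sub>R y))^2) * indicator K y \<partial>lborel))"
  by (subst nn_integral_sum) (auto simp: nn_integral_cmult)
 also have "... <= (\<Sum>i=1..p+1. ennreal c * (ennreal (real (p + 1) ^ DIM('a)) * ?I))"
 proof (intro sum_mono mult_left_mono)
  fix i assume i: "i \<in> {1..p+1}"
  have "(\<integral>\<^sup>+y. ennreal ((f ((1 - \<theta> i) *\<^sub>R x + \<theta> i *\<^sub>R y))^2) * indicator K y \<partial>lborel)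
   <= ennreal ((1 / \<theta> i) ^ DIM('a)) * ?I"
   using nn_integral_contraction[of "%y. ennreal ((f y)^2)" K x "\<theta> i"] K i by (auto simp: \<theta>_def)
  also have "... <= ennreal (real (p + 1) ^ DIM('a)) * ?I"
  proof -
   have "1 / \<theta> i <= real (p + 1)"
    using i mult_left_mono[of 1 "real i" "real (p + 1)"] by (simp add: \<theta>_def pos_divide_le_eq)
   then show ?thesis by (intro mult_right_mono ennreal_leI power_mono) (auto simp: \<theta>_def)
  qed
  finally show "(\<integral>\<^sup>+y. ennreal ((f ((1 - \<theta> i) *\<^sub>R x + \<theta> i *\<^sub>R y))^2) * indicator K y \<partial>lborel)
   <= ennreal (real (p + 1) ^ DIM('a)) * ?I" .
 qed auto
 also have "... = ennreal (real (p + 1)) * (ennreal c * (ennreal (real (p + 1) ^ DIM('a)) * ?I))"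
  by (simp add: ennreal_of_nat_eq_real_of_nat)
 also have "... = ennreal (inverse_const p DIM('a)) * ?I"
 proof -
  have "c \<ge> 0" by (simp add: c_def)
  then have "ennreal (inverse_const p DIM('a)) = ennreal (real (p + 1)) * (ennreal c * ennreal (real (p + 1) ^ DIM('a)))"
   unfolding inverse_const_def c_def[symmetric] by (subst ennreal_mult, simp, simp) (subst ennreal_mult, auto)
  then show ?thesis by (simp only: mult.assoc)
 qed
 finally show ?thesis .
qed

lemma inverse_estimate:
 fixes f :: "'a::euclidean_space => real"
 assumes "!!x y. \<exists>q. degree q <= p \<and> (\<forall>t. f (x + t *\<^sub>R y) = poly q t)"
  and "continuous_on UNIV f" and K: "compact K" "convex K" "x \<in> K"
 shows "vol K * (f x)^2 <= inverse_const p DIM('a) * (LBINT y:K. (f y)^2)"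
proof -
 have [measurable]: "f \<in> borel_measurable borel" "K \<in> sets borel"
  using borel_measurable_continuous_onI[OF assms(2)] borel_compact[OF K(1)] by auto
 have int: "set_integrable lborel K (%y. (f y)^2)"
  unfolding set_integrable_def using K(1)
  by (rule borel_integrable_compact) (intro continuous_intros continuous_on_subset[OF assms(2)], auto)
 have "(\<integral>\<^sup>+y. ennreal ((f y)^2) * indicator K y \<partial>lborel) = ennreal (LBINT y:K. (f y)^2)"
  using nn_integral_eq_integral[OF int[unfolded set_integrable_def]]
  by (simp add: set_lebesgue_integral_def ennreal_indicator[symmetric] ennreal_mult'' mult.commute)
 moreover have "emeasure lborel K = ennreal (vol K)"
  using emeasure_compact_finite[OF K(1)] by (intro emeasure_eq_ennreal_measure) auto
 moreover have "emeasure lborel K * ennreal ((f x)^2)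
  <= ennreal (inverse_const p DIM('a)) * (\<integral>\<^sup>+y. ennreal ((f y)^2) * indicator K y \<partial>lborel)"
  using assms by (intro inverse_estimate_nn) auto
 ultimately show ?thesis
  using inverse_const_pos[of p "DIM('a)"]
  by (simp add: ennreal_mult[symmetric] set_lebesgue_integral_def integral_nonneg_AE ennreal_le_iff)
qed

section \<open>Integration over cones\<close>

text \<open>The change of variables theorem for \<^typ>\<open>real^'n\<close> wants a well-ordered index type. Any finite
  index type has a well-ordered copy, and renaming the coordinates preserves Lebesgue measure.\<close>

typedef 'a ranked = "UNIV :: 'a set" morphisms unrank rank ..

lemma bij_unrank: "bij unrank"
 by (metis UNIV_I bijI' rank_inverse unrank_inject)

instance ranked :: (finite) finite
proof
 have "(UNIV :: 'a ranked set) = rank ` UNIV" by (metis UNIV_eq_I rangeI unrank_inverse)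
 then show "finite (UNIV :: 'a ranked set)" by (metis finite_imageI finite)
qed

definition numbering :: "'a::finite => nat" where
 "numbering = (SOME f. inj f)"

lemma inj_numbering: "inj (numbering :: 'a::finite => nat)"
 unfolding numbering_def using finite_imp_inj_to_nat_seg[of "UNIV :: 'a set"] by (intro someI_ex[of inj]) auto

instantiation ranked :: (finite) linorder
begin
definition "x <= y \<longleftrightarrow> numbering (unrank x) <= numbering (unrank y)"
definition "x < y \<longleftrightarrow> numbering (unrank x) < numbering (unrank y)"
instance
 by standard (auto simp: less_eq_ranked_def less_ranked_def dest: injD[OF inj_numbering] simp: unrank_inject)
end

instance ranked :: (finite) wellorder
proof
 fix P :: "'a ranked => bool" and a
 assume step: "!!x. (!!y. y < x ==> P y) ==> P x"
 show "P a"
  by (induction a rule: measure_induct_rule[of "%x. numbering (unrank x)"])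
    (auto intro: step simp: less_ranked_def)
qed

definition relabel :: "real^'n => real^('n ranked)" where
 "relabel x = (\<chi> i. x $ unrank i)"

definition unlabel :: "real^('n ranked) => real^'n" where
 "unlabel x = (\<chi> i. x $ rank i)"

lemma unlabel_relabel [simp]: "unlabel (relabel x) = x"
 and relabel_unlabel [simp]: "relabel (unlabel z) = z"
 by (auto simp: relabel_def unlabel_def vec_eq_iff rank_inverse unrank_inverse)

lemma linear_relabel: "linear relabel"
 by (rule linearI) (auto simp: relabel_def vec_eq_iff)

lemma relabel_simps:
 "relabel (x + y) = relabel x + relabel y" "relabel (x - y) = relabel x - relabel y"
 "relabel (c *\<^sub>R x) = c *\<^sub>R relabel x"
 by (auto simp: relabel_def vec_eq_iff)

lemma inner_relabel [simp]: "relabel (x :: real^'n::finite) \<bullet> relabel y = x \<bullet> y"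
 unfolding inner_vec_def relabel_def
 using sum.reindex_bij_betw[OF bij_unrank, of "%i. x $ i * y $ i"] by simp

lemma norm_relabel [simp]: "norm (relabel (x :: real^'n::finite)) = norm x"
 by (simp add: norm_eq_sqrt_inner)

lemma continuous_relabel [continuous_intros]: "continuous_on S (relabel :: real^'n::finite => _)"
 by (rule linear_continuous_on) (simp add: linear_conv_bounded_linear[symmetric] linear_relabel)

lemma measurable_relabel [measurable]: "(relabel :: real^'n::finite => _) \<in> borel_measurable borel"
 by (intro borel_measurable_continuous_onI continuous_relabel)

lemma continuous_unlabel [continuous_intros]: "continuous_on S (unlabel :: _ => real^'n::finite)"
 unfolding unlabel_def by (intro continuous_intros)

lemma measurable_unlabel [measurable]: "(unlabel :: _ => real^'n::finite) \<in> borel_measurable borel"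
 by (intro borel_measurable_continuous_onI continuous_unlabel)

lemma relabel_axis: "relabel (axis i 1 :: real^'n) = axis (rank i) 1"
 by (auto simp: relabel_def axis_def vec_eq_iff rank_inverse unrank_inverse)

lemma bij_betw_relabel_Basis: "bij_betw relabel (Basis :: (real^'n::finite) set) Basis"
proof (rule bij_betwI[where g=unlabel])
 have *: "\<exists>k. i = rank k" for i :: "'n ranked" by (metis unrank_inverse)
 show "relabel \<in> Basis \<rightarrow> Basis" by (auto simp: Basis_vec_def relabel_axis)
 show "unlabel \<in> Basis \<rightarrow> (Basis :: (real^'n) set)"
  using * by (auto simp: Basis_vec_def) (metis relabel_axis unlabel_relabel)
qed auto

lemma relabel_measure_preserving:
 "distr lborel borel (relabel :: real^'n::finite => real^('n ranked)) = lborel"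
proof (rule lborel_eqI[symmetric])
 fix l u :: "real^('n ranked)"
 assume le: "!!b. b \<in> Basis ==> l \<bullet> b <= u \<bullet> b"
 have ib: "unlabel x \<bullet> b = x \<bullet> relabel b" for x :: "real^('n ranked)" and b
  by (metis inner_relabel relabel_unlabel)
 have B: "(Basis :: (real^('n ranked)) set) = relabel ` Basis"
  using bij_betw_relabel_Basis[where 'n='n] by (simp add: bij_betw_def)
 have "relabel -` box l u = box (unlabel l) (unlabel u)"
  by (auto simp: mem_box ib B)
 moreover have "emeasure lborel (box (unlabel l) (unlabel u)) = (\<Prod>b\<in>Basis. (unlabel u - unlabel l) \<bullet> b)"
  using le bij_betw_relabel_Basis[where 'n='n] by (intro emeasure_lborel_box) (auto simp: ib bij_betw_def)
 moreover have "(\<Prod>b\<in>Basis. (unlabel u - unlabel l) \<bullet> b) = (\<Prod>b\<in>Basis. (u - l) \<bullet> b)"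
  using prod.reindex_bij_betw[OF bij_betw_relabel_Basis[where 'n='n], of "%b. (u - l) \<bullet> b"]
  by (simp add: ib inner_diff_left)
 ultimately show "emeasure (distr lborel borel relabel) (box l u) = (\<Prod>b\<in>Basis. (u - l) \<bullet> b)"
  by (subst emeasure_distr) auto
qed simp

text \<open>A rotation moves \<open>n\<close> to a coordinate axis; the matrix then differs from a multiple of the identity
  in one column only.\<close>

lemma det_rank_one_update:
 fixes n w :: "real^'m"
 assumes "norm n = 1" "\<alpha> \<noteq> 0"
 shows "det (matrix (%h. \<alpha> *\<^sub>R h + (n \<bullet> h) *\<^sub>R w)) = \<alpha> ^ (CARD('m) - 1) * (\<alpha> + n \<bullet> w)"
proof -
 let ?L = "%h. \<alpha> *\<^sub>R h + (n \<bullet> h) *\<^sub>R w"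
 obtain k :: 'm where True by blast
 have "norm (axis k 1 :: real^'m) = norm n" using assms(1) by simp
 then have "\<exists>T :: real^'m => real^'m. orthogonal_transformation T \<and> T (axis k 1) = n"
  by (rule orthogonal_transformation_exists) blast
 then obtain T :: "real^'m => real^'m" where T: "orthogonal_transformation T" "T (axis k 1) = n" by blast
 then have linT: "linear T" by (simp add: orthogonal_transformation_linear)
 obtain w' where w': "w = T w'" using T(1) by (metis orthogonal_transformation_surj surjD)
 let ?M = "%h :: real^'m. \<alpha> *\<^sub>R h + (axis k 1 \<bullet> h) *\<^sub>R w'"
 have linL: "linear ?L" "linear ?M" by (auto intro!: linearI simp: algebra_simps inner_add_right)
 have "?L \<circ> T = T \<circ> ?M"
 proof
  fix h
  have "n \<bullet> T h = axis k 1 \<bullet> h" using T by (metis orthogonal_transformation_def)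
  then show "(?L \<circ> T) h = (T \<circ> ?M) h"
   by (simp add: w' linear_add[OF linT] linear_scale[OF linT])
 qed
 then have "matrix ?L ** matrix T = matrix T ** matrix ?M"
  using matrix_compose[OF linT linL(1)] matrix_compose[OF linL(2) linT] by simp
 then have "det (matrix ?L) * det (matrix T) = det (matrix T) * det (matrix ?M)"
  by (simp flip: det_mul)
 moreover have "det (matrix T) \<noteq> 0"
  using T(1) by (simp add: det_nz_iff_inj linT orthogonal_transformation_inj)
 ultimately have "det (matrix ?L) = det (matrix ?M)" by simp
 also have "... = det ((\<chi> i j. if j = k then (matrix ((*\<^sub>R) \<alpha>) *v (axis k 1 + (1/\<alpha>) *\<^sub>R w')) $ i
   else matrix ((*\<^sub>R) \<alpha>) $ i $ j) :: real^'m^'m)"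
 proof (rule arg_cong[where f=det])
  have "matrix ((*\<^sub>R) \<alpha>) *v x = \<alpha> *\<^sub>R x" for x :: "real^'m"
   by (simp add: vec_eq_iff matrix_def matrix_vector_mult_def axis_def if_distrib[of "%r. r * _"] if_distrib[of "%r. _ * r"] cong: if_cong)
  moreover have "matrix ?M $ i $ j = (if i = j then \<alpha> else 0) + (if j = k then w' $ i else 0)" for i j
   using inner_axis_axis[of k "1::real" j 1] by (simp add: matrix_def axis_def[of j])
  moreover have "matrix ((*\<^sub>R) \<alpha>) $ i $ j = (if i = j then \<alpha> else 0)" for i j :: 'm
   by (simp add: matrix_def axis_def)
  ultimately show "matrix ?M = (\<chi> i j. if j = k then (matrix ((*\<^sub>R) \<alpha>) *v (axis k 1 + (1/\<alpha>) *\<^sub>R w')) $ i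
   else matrix ((*\<^sub>R) \<alpha>) $ i $ j)"
   using assms(2) by (auto simp: vec_eq_iff axis_def algebra_simps)
 qed
 also have "... = (axis k 1 + (1/\<alpha>) *\<^sub>R w') $ k * det (matrix ((*\<^sub>R) \<alpha>) :: real^'m^'m)"
  by (rule cramer_lemma)
 also have "... = (1 + w' $ k / \<alpha>) * \<alpha> ^ CARD('m)"
  by (simp add: axis_def)
 also have "... = \<alpha> ^ (CARD('m) - 1) * (\<alpha> + w' $ k)"
  using assms(2) by (cases "CARD('m)") (auto simp: field_simps)
 also have "w' $ k = n \<bullet> w"
  using T by (metis w' cart_eq_inner_axis inner_commute orthogonal_transformation_def)
 finally show ?thesis .
qed

text \<open>The prism of height one over the base \<open>F\<close> is mapped onto the cone by
  \<open>y + t n \<mapsto> a + t powr (1 / (d + k)) (y - a)\<close>. For \<open>f\<close> homogeneous of degree \<open>k\<close> about the apex,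
  the exponent makes \<open>f\<close> times the Jacobian independent of the height \<open>t\<close>.\<close>

lemma cone_integral_ranked:
 fixes a n :: "real^'m::{finite,wellorder}" and f :: "real^'m::_ => real"
 assumes n: "norm n = 1" and F: "compact F" and plane: "!!y. y \<in> F ==> n \<bullet> y = c"
  and \<delta>: "\<delta> = c - n \<bullet> a" "\<delta> \<noteq> 0"
  and f[measurable]: "f \<in> borel_measurable borel" and B: "!!y. y \<in> F ==> \<bar>f y\<bar> <= B"
  and hom: "!!y s. y \<in> F ==> 0 < s ==> s <= 1 ==> f (a + s *\<^sub>R (y - a)) = s ^ k * f y"
 defines "e \<equiv> {a + s *\<^sub>R (y - a) |y s. y \<in> F \<and> s \<in> {0..1}}"
  and "P \<equiv> {y + t *\<^sub>R n |y t. y \<in> F \<and> t \<in> {0..1}}"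
 shows "set_integrable lborel e f \<and>
  real (CARD('m) + k) * (LBINT y:e. f y) = \<bar>\<delta>\<bar> * (LBINT Y:P. f (Y - (n \<bullet> Y - c) *\<^sub>R n))"
proof -
 define m where "m = CARD('m) + k"
 have m: "m > 0" "CARD('m) > 0" by (simp_all add: m_def)
 define S where "S = {y + t *\<^sub>R n |y t. y \<in> F \<and> t \<in> {0<..1}}"
 define \<pi> where "\<pi> Y = Y - (n \<bullet> Y - c) *\<^sub>R n" for Y
 \<comment> \<open>the radial scale, and its derivative\<close>
 define \<rho> where "\<rho> t = t powr (1 / m)" for t :: real
 define \<rho>' where "\<rho>' t = (1 / m) * t powr (1 / m - 1)" for t :: real
 define g where "g Y = a + \<rho> (n \<bullet> Y - c) *\<^sub>R (\<pi> Y - a)" for Y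
 define w where "w Y = \<rho>' (n \<bullet> Y - c) *\<^sub>R (\<pi> Y - a) - \<rho> (n \<bullet> Y - c) *\<^sub>R n" for Y
 define g' where "g' Y h = \<rho> (n \<bullet> Y - c) *\<^sub>R h + (n \<bullet> h) *\<^sub>R w Y" for Y h
 have nn: "n \<bullet> n = 1" using n by (simp add: norm_eq_1)
 have \<pi>: "\<pi> (y + t *\<^sub>R n) = y" "n \<bullet> (y + t *\<^sub>R n) - c = t" if "y \<in> F" for y t
  using plane[OF that] nn by (auto simp: \<pi>_def inner_add_right)
 have \<rho>01: "0 < \<rho> t" "\<rho> t <= 1" "\<rho> t ^ m = t" if "t \<in> {0<..1}" for t
  using that m by (auto simp: \<rho>_def powr_le_one_le powr_mono_both powr_le1 powr_realpow[symmetric] powr_powr)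
 have n\<pi>: "n \<bullet> \<pi> Y = c" for Y by (simp add: \<pi>_def inner_diff_right nn)
 have P_eq: "P = (%(y, t). y + t *\<^sub>R n) ` (F \<times> {0..1})" by (auto simp: P_def image_iff) fastforce
 have comP: "compact P" unfolding P_eq
  by (intro compact_continuous_image compact_Times F) (auto intro!: continuous_intros simp: case_prod_unfold)
 have e_eq: "e = (%(y, s). a + s *\<^sub>R (y - a)) ` (F \<times> {0..1})" by (auto simp: e_def image_iff) fastforce
 have come: "compact e" unfolding e_eq
  by (intro compact_continuous_image compact_Times F) (auto intro!: continuous_intros simp: case_prod_unfold)
 have S_eq: "S = P - F"
 proof -
  have "y + t *\<^sub>R n \<in> F \<longleftrightarrow> t = 0" if "y \<in> F" for y t
   using \<pi>(2)[OF that, of t] plane that by fastforce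
  then show ?thesis unfolding S_def P_def by (auto simp: less_le) blast
 qed
 have [measurable]: "P \<in> sets borel" "F \<in> sets borel" "e \<in> sets borel"
  using comP F come by (auto intro: borel_compact)
 have Sm[measurable]: "S \<in> sets borel" by (simp add: S_eq)
 have S_bdd: "bounded S" using comP S_eq by (meson Diff_subset bounded_subset compact_imp_bounded)
 have inS: "\<exists>y t. Y = y + t *\<^sub>R n \<and> y \<in> F \<and> t \<in> {0<..1} \<and> \<pi> Y = y \<and> n \<bullet> Y - c = t" if "Y \<in> S" for Y
  using that \<pi> unfolding S_def by blast
 have der: "(g has_derivative g' Y) (at Y within S)" if "Y \<in> S" for Y
 proof -
  have t: "n \<bullet> Y - c > 0" using inS[OF that] by auto
  have "((%t. \<rho> t) has_real_derivative \<rho>' (n \<bullet> Y - c)) (at (n \<bullet> Y - c))"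
   unfolding \<rho>_def \<rho>'_def using t by (rule has_real_derivative_powr)
  moreover have "((%Y. n \<bullet> Y - c) has_derivative (%h. n \<bullet> h)) (at Y within S)"
   by (auto intro!: derivative_eq_intros)
  ultimately have 1: "((%Y. \<rho> (n \<bullet> Y - c)) has_derivative (%h. (n \<bullet> h) * \<rho>' (n \<bullet> Y - c))) (at Y within S)"
   using has_derivative_compose[of "%Y. n \<bullet> Y - c" "%h. n \<bullet> h" Y S \<rho> "%h. h * \<rho>' (n \<bullet> Y - c)"]
   by (simp add: has_field_derivative_def mult.commute[of _ "\<rho>' _"])
  have 2: "(\<pi> has_derivative (%h. h - (n \<bullet> h) *\<^sub>R n)) (at Y within S)"
   unfolding \<pi>_def by (auto intro!: derivative_eq_intros)
  show ?thesis unfolding g_def[abs_def] g'_def[abs_def] w_def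
   by (rule derivative_eq_intros 1 2 refl)+ (auto simp: algebra_simps)
 qed
 have detg: "det (matrix (g' Y)) = \<rho> t ^ (CARD('m) - 1) * (\<rho>' t * \<delta>)" if "Y \<in> S" "t = n \<bullet> Y - c" for Y t
 proof -
  have "\<rho> t \<noteq> 0" using inS[OF that(1)] that(2) \<rho>01(1)[of t] by auto
  moreover have "\<rho> t + n \<bullet> w Y = \<rho>' t * \<delta>"
   using that by (simp add: w_def inner_diff_right nn n\<pi> \<delta>(1))
  ultimately show ?thesis
   using det_rank_one_update[OF n, of "\<rho> t" "w Y"] unfolding g'_def[abs_def] that(2) by simp
 qed
 have inj: "inj_on g S"
 proof (rule inj_onI)
  fix Y Z assume YZ: "Y \<in> S" "Z \<in> S" and eq: "g Y = g Z"
  obtain y t where Y: "Y = y + t *\<^sub>R n" "y \<in> F" "t \<in> {0<..1}" "\<pi> Y = y" "n \<bullet> Y - c = t" using inS[OF YZ(1)] by blast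
  obtain z s where Z: "Z = z + s *\<^sub>R n" "z \<in> F" "s \<in> {0<..1}" "\<pi> Z = z" "n \<bullet> Z - c = s" using inS[OF YZ(2)] by blast
  have eq': "\<rho> t *\<^sub>R (y - a) = \<rho> s *\<^sub>R (z - a)" using eq Y Z by (simp add: g_def)
  then have "\<rho> t * (n \<bullet> (y - a)) = \<rho> s * (n \<bullet> (z - a))" by (metis inner_scaleR_right)
  then have "\<rho> t = \<rho> s" using Y Z plane \<delta> by (simp add: inner_diff_right)
  moreover from this have "t = s" using \<rho>01(3) Y(3) Z(3) by metis
  moreover have "\<rho> s > 0" using \<rho>01(1) Z(3) by blast
  ultimately show "Y = Z" using eq' Y Z by auto
 qed
 have img: "g ` S = e - {a}"
 proof -
  have "y \<noteq> a" if "y \<in> F" for y using plane[OF that] \<delta> by auto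
  moreover have "g (y + t *\<^sub>R n) = a + \<rho> t *\<^sub>R (y - a)" if "y \<in> F" for y t
   using \<pi>[OF that] by (simp add: g_def)
  moreover have "s = \<rho> (s ^ m)" if "s \<in> {0<..1}" for s
   using that m by (auto simp: \<rho>_def powr_realpow[symmetric] powr_powr)
  moreover have "s ^ m \<in> {0<..1}" if "s \<in> {0<..1}" for s :: real
   using that by (auto simp: power_le_one)
  ultimately have 1: "g (y + t *\<^sub>R n) = a + \<rho> t *\<^sub>R (y - a)" "y \<noteq> a"
   and 2: "s \<in> {0<..1} ==> s = \<rho> (s ^ m) \<and> s ^ m \<in> {0<..1}" if "y \<in> F" for y t s
   using that by blast+
  show ?thesis
  proof (intro equalityI subsetI)
   fix z assume "z \<in> g ` S"
   then obtain y t where "y \<in> F" "t \<in> {0<..1}" "z = g (y + t *\<^sub>R n)" unfolding S_def by blast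
   with 1 \<rho>01[of t] show "z \<in> e - {a}" unfolding e_def by force
  next
   fix z assume "z \<in> e - {a}"
   then obtain y s where ys: "y \<in> F" "s \<in> {0..1}" "z = a + s *\<^sub>R (y - a)" "z \<noteq> a" unfolding e_def by blast
   then have "s \<noteq> 0" by auto
   with ys have "y \<in> F" "s \<in> {0<..1}" "z = a + s *\<^sub>R (y - a)" by auto
   then have "z = g (y + (s ^ m) *\<^sub>R n)" "s ^ m \<in> {0<..1}" using 1 2[of y s] by auto
   with ys(1) have "z = g (y + (s ^ m) *\<^sub>R n)" "y + (s ^ m) *\<^sub>R n \<in> S" unfolding S_def by blast+
   then show "z \<in> g ` S" by blast
  qed
 qed
 have val: "\<bar>det (matrix (g' Y))\<bar> * f (g Y) = (\<bar>\<delta>\<bar> / m) * f (\<pi> Y)" if YS: "Y \<in> S" for Y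
 proof -
  obtain y t where Y: "Y = y + t *\<^sub>R n" "y \<in> F" "t \<in> {0<..1}" "\<pi> Y = y" "n \<bullet> Y - c = t" using inS[OF YS] by blast
  have d1: "f (g Y) = \<rho> t ^ k * f y" using hom[OF Y(2) \<rho>01(1,2)[OF Y(3)]] Y by (simp add: g_def)
  have d2: "\<bar>det (matrix (g' Y))\<bar> = \<rho> t ^ (CARD('m) - 1) * \<rho>' t * \<bar>\<delta>\<bar>"
   using detg[OF YS Y(5)[symmetric]] \<rho>01(1)[OF Y(3)] Y(3) by (simp add: abs_mult \<rho>'_def)
  have d3: "\<rho> t ^ (CARD('m) - 1) * \<rho>' t * \<rho> t ^ k = 1 / m"
  proof -
   have "\<rho> t ^ (CARD('m) - 1) * \<rho> t ^ k = \<rho> t ^ (m - 1)" using m by (simp add: m_def power_add[symmetric])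
   also have "... = t powr ((1 / m) * (m - 1))"
    using \<rho>01(1)[OF Y(3)] by (simp add: powr_realpow[symmetric]) (simp add: \<rho>_def powr_powr)
   finally have "\<rho> t ^ (CARD('m) - 1) * \<rho>' t * \<rho> t ^ k = (1 / m) * t powr ((1 / m) * (m - 1) + (1 / m - 1))"
    by (simp add: \<rho>'_def powr_add)
   also have "(1 / m) * (m - 1) + (1 / m - 1) = 0" using m by (simp add: of_nat_diff field_simps)
   finally show ?thesis using Y(3) by simp
  qed
  have "\<bar>det (matrix (g' Y))\<bar> * f (g Y) = (\<rho> t ^ (CARD('m) - 1) * \<rho>' t * \<rho> t ^ k) * (\<bar>\<delta>\<bar> * f y)"
   unfolding d1 d2 by (simp only: mult_ac)
  then have "\<bar>det (matrix (g' Y))\<bar> * f (g Y) = (1 / m) * (\<bar>\<delta>\<bar> * f y)" unfolding d3 .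
  then show ?thesis using Y by simp
 qed
 define I where "I = integral S (%Y. (\<bar>\<delta>\<bar> / m) * f (\<pi> Y))"
 have [measurable]: "\<pi> \<in> borel_measurable borel"
  unfolding \<pi>_def by (intro borel_measurable_continuous_onI continuous_intros)
 have fin: "emeasure lborel S < \<infinity>" by (rule emeasure_bounded_finite[OF S_bdd])
 have intS: "set_integrable lborel S (%Y. (\<bar>\<delta>\<bar> / m) * f (\<pi> Y))"
  unfolding set_integrable_def
 proof (rule integrableI_bounded_set_indicator[where B="\<bar>\<delta>\<bar> / m * B"])
  show "AE x in lborel. x \<in> S \<longrightarrow> norm (\<bar>\<delta>\<bar> / m * f (\<pi> x)) <= \<bar>\<delta>\<bar> / m * B"
  proof (intro AE_I2 impI)
   fix x assume "x \<in> S"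
   then have "\<pi> x \<in> F" using inS by blast
   then show "norm (\<bar>\<delta>\<bar> / m * f (\<pi> x)) <= \<bar>\<delta>\<bar> / m * B"
    using B by (simp add: abs_mult mult_left_mono divide_right_mono)
  qed
 qed (use fin in auto)
 have absS: "(%Y. (\<bar>\<delta>\<bar> / m) * f (\<pi> Y)) absolutely_integrable_on S"
  using intS unfolding set_integrable_def by (simp add: integrable_completion)
 have lift: "h absolutely_integrable_on T \<longleftrightarrow> (%x. vec (h x) :: real^1) absolutely_integrable_on T"
  "h absolutely_integrable_on T ==> integral T (%x. vec (h x) :: real^1) = vec (integral T h)"
  for h :: "real^'m::_ => real" and T
 proof -
  have v: "(%x. vec (h x)) = (%x. h x *\<^sub>R (vec 1 :: real^1))" by (auto simp: vec_eq_iff)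
  show "h absolutely_integrable_on T \<longleftrightarrow> (%x. vec (h x) :: real^1) absolutely_integrable_on T"
  proof
   assume "h absolutely_integrable_on T"
   then show "(%x. vec (h x) :: real^1) absolutely_integrable_on T"
    by (subst v) (rule absolutely_integrable_scaleR_right)
  next
   assume "(%x. vec (h x) :: real^1) absolutely_integrable_on T"
   from absolutely_integrable_component[OF this, of "axis 1 1"]
   show "h absolutely_integrable_on T" by (simp add: inner_axis)
  qed
  show "integral T (%x. vec (h x) :: real^1) = vec (integral T h)" if "h absolutely_integrable_on T"
   using integral_linear[of h T "%r. r *\<^sub>R (vec 1 :: real^1)"] that
   by (subst v) (auto simp: o_def absolutely_integrable_on_def bounded_linear_scaleR_left vec_eq_iff)
 qed
 have cov: "(%x. vec (f x) :: real^1) absolutely_integrable_on g ` S \<and> integral (g ` S) (%x. vec (f x) :: real^1) = vec I"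
 proof -
  have S': "S \<in> sets lebesgue" using Sm by auto
  have eq: "\<bar>det (matrix (g' Y))\<bar> *\<^sub>R (vec (f (g Y)) :: real^1) = vec ((\<bar>\<delta>\<bar> / m) * f (\<pi> Y))" if "Y \<in> S" for Y
   using val[OF that] by (simp add: vec_eq_iff)
  have "(%x. \<bar>det (matrix (g' x))\<bar> *\<^sub>R (vec (f (g x)) :: real^1)) absolutely_integrable_on S \<longleftrightarrow>
    (%x. vec ((\<bar>\<delta>\<bar> / m) * f (\<pi> x)) :: real^1) absolutely_integrable_on S"
   using eq by (intro set_integrable_cong) auto
  moreover have "integral S (%x. \<bar>det (matrix (g' x))\<bar> *\<^sub>R (vec (f (g x)) :: real^1)) =
    integral S (%x. vec ((\<bar>\<delta>\<bar> / m) * f (\<pi> x)) :: real^1)"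
   using eq by (intro Henstock_Kurzweil_Integration.integral_cong) auto
  ultimately have "(%x. \<bar>det (matrix (g' x))\<bar> *\<^sub>R (vec (f (g x)) :: real^1)) absolutely_integrable_on S \<and>
    integral S (%x. \<bar>det (matrix (g' x))\<bar> *\<^sub>R (vec (f (g x)) :: real^1)) = vec I"
   using lift[where h="%Y. (\<bar>\<delta>\<bar> / m) * f (\<pi> Y)" and T=S] absS unfolding I_def by simp
  then show ?thesis
   using has_absolute_integral_change_of_variables[OF S' der inj, of "%x. vec (f x) :: real^1" "vec I"] by blast
 qed
 have f_abs: "f absolutely_integrable_on (e - {a})" "integral (e - {a}) f = I"
 proof -
  show 1: "f absolutely_integrable_on (e - {a})" using cov lift(1)[where h=f and T="e - {a}"] by (simp add: img)
  have "vec (integral (e - {a}) f) = (vec I :: real^1)" using cov lift(2)[OF 1] by (simp add: img)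
  then show "integral (e - {a}) f = I" by (simp add: vec_eq_iff)
 qed
 have spike: "negligible {x \<in> e - (e - {a}). f x \<noteq> 0}" "negligible {x \<in> (e - {a}) - e. f x \<noteq> 0}"
  by (rule negligible_subset[OF negligible_sing[of a]], force)+
 have f_e: "f absolutely_integrable_on e" "integral e f = I"
  using absolutely_integrable_spike_set[OF f_abs(1) spike(2,1)] integral_spike_set[OF spike] f_abs(2) by auto
 have int_e: "set_integrable lborel e f"
  using f_e(1) unfolding set_integrable_def by (subst (asm) integrable_completion) auto
 have "(LBINT y:e. f y) = I"
  using set_borel_integral_eq_integral(2)[OF int_e] f_e by simp
 moreover have "I = (LBINT Y:S. (\<bar>\<delta>\<bar> / m) * f (\<pi> Y))"
  unfolding I_def by (rule set_borel_integral_eq_integral(2)[OF intS, symmetric])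
 moreover have "(LBINT Y:S. (\<bar>\<delta>\<bar> / m) * f (\<pi> Y)) = (\<bar>\<delta>\<bar> / m) * (LBINT Y:P. f (\<pi> Y))"
 proof -
  have "F \<subseteq> {y. n \<bullet> y = c}" using plane by auto
  moreover have "negligible {y. n \<bullet> y = c}" using n by (intro negligible_hyperplane) auto
  ultimately have "AE y in lebesgue. y \<notin> F"
   by (metis negligible_subset negligible_iff_null_sets AE_not_in)
  then have "AE y in lborel. y \<notin> F" by (simp add: AE_completion_iff)
  then have "(LBINT Y:S. f (\<pi> Y)) = (LBINT Y:P. f (\<pi> Y))"
   unfolding set_lebesgue_integral_def by (intro integral_cong_AE) (auto simp: S_eq indicator_def)
  then show ?thesis by simp
 qed
 ultimately have "(LBINT y:e. f y) = (\<bar>\<delta>\<bar> / m) * (LBINT Y:P. f (\<pi> Y))" by simp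
 then have "real m * (LBINT y:e. f y) = \<bar>\<delta>\<bar> * (LBINT Y:P. f (\<pi> Y))" using m by simp
 then show ?thesis using int_e unfolding \<pi>_def m_def by simp
qed

lemma relabel_image_borel [measurable]: "A \<in> sets borel ==> relabel ` (A :: (real^'n::finite) set) \<in> sets borel"
proof -
 assume A: "A \<in> sets borel"
 have "relabel ` A = unlabel -` A" by (auto simp: image_iff) (metis relabel_unlabel)
 then show ?thesis using measurable_sets[OF measurable_unlabel A] by simp
qed

lemma set_integral_relabel:
 fixes A :: "(real^'n::finite) set" and g :: "real^('n ranked) => real"
 assumes [measurable]: "A \<in> sets borel" "g \<in> borel_measurable borel"
 shows "(LBINT y:(relabel ` A). g y) = (LBINT x:A. g (relabel x))"
  "set_integrable lborel (relabel ` A) g \<longleftrightarrow> set_integrable lborel A (%x. g (relabel x))"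
proof -
 have ind: "indicator (relabel ` A) (relabel x) = (indicator A x :: real)" for x
  by (auto simp: indicator_def) (metis unlabel_relabel)
 show "(LBINT y:(relabel ` A). g y) = (LBINT x:A. g (relabel x))"
  unfolding set_lebesgue_integral_def
  by (subst relabel_measure_preserving[symmetric], subst integral_distr) (auto simp: ind)
 show "set_integrable lborel (relabel ` A) g \<longleftrightarrow> set_integrable lborel A (%x. g (relabel x))"
  unfolding set_integrable_def
  by (subst relabel_measure_preserving[symmetric], subst integrable_distr_eq) (auto simp: ind)
qed

lemma cone_integral:
 fixes a n :: "real^'n" and f :: "real^'n => real"
 assumes n: "norm n = 1" and F: "compact F" and plane: "!!y. y \<in> F ==> n \<bullet> y = c"
  and \<delta>: "\<delta> = c - n \<bullet> a" "\<delta> \<noteq> 0"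
  and f[measurable]: "f \<in> borel_measurable borel" and B: "!!y. y \<in> F ==> \<bar>f y\<bar> <= B"
  and hom: "!!y s. y \<in> F ==> 0 < s ==> s <= 1 ==> f (a + s *\<^sub>R (y - a)) = s ^ k * f y"
 defines "e \<equiv> {a + s *\<^sub>R (y - a) |y s. y \<in> F \<and> s \<in> {0..1}}"
  and "P \<equiv> {y + t *\<^sub>R n |y t. y \<in> F \<and> t \<in> {0..1}}"
 shows "set_integrable lborel e f \<and>
  real (CARD('n) + k) * (LBINT y:e. f y) = \<bar>\<delta>\<bar> * (LBINT Y:P. f (Y - (n \<bullet> Y - c) *\<^sub>R n))"
proof -
 have e_eq: "e = (%(y, s). a + s *\<^sub>R (y - a)) ` (F \<times> {0..1})" by (auto simp: e_def image_iff) fastforce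
 have come: "compact e" unfolding e_eq
  by (intro compact_continuous_image compact_Times F) (auto intro!: continuous_intros simp: case_prod_unfold)
 have P_eq: "P = (%(y, t). y + t *\<^sub>R n) ` (F \<times> {0..1})" by (auto simp: P_def image_iff) fastforce
 have comP: "compact P" unfolding P_eq
  by (intro compact_continuous_image compact_Times F) (auto intro!: continuous_intros simp: case_prod_unfold)
 have [measurable]: "P \<in> sets borel" "e \<in> sets borel" using comP come by (auto intro: borel_compact)
 have card: "CARD('n ranked) = CARD('n)" using bij_unrank by (rule bij_betw_same_card)
 have e': "{relabel a + s *\<^sub>R (y - relabel a) |y s. y \<in> relabel ` F \<and> s \<in> {0..1}} = relabel ` e"
  unfolding e_def by (force simp: relabel_simps)
 have P': "{y + t *\<^sub>R relabel n |y t. y \<in> relabel ` F \<and> t \<in> {0..1}} = relabel ` P"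
  unfolding P_def by (force simp: relabel_simps)
 have meas: "(%x. f (unlabel x)) \<in> borel_measurable borel" by measurable
 have 1: "set_integrable lborel (relabel ` e) (%x. f (unlabel x)) \<and>
  real (CARD('n ranked) + k) * (LBINT y:relabel ` e. f (unlabel y)) =
  \<bar>\<delta>\<bar> * (LBINT Y:relabel ` P. f (unlabel (Y - (relabel n \<bullet> Y - c) *\<^sub>R relabel n)))"
  unfolding e'[symmetric] P'[symmetric]
 proof (rule cone_integral_ranked[where B=B])
  show "compact (relabel ` F)" using F by (intro compact_continuous_image continuous_intros)
  show "\<delta> = c - relabel n \<bullet> relabel a" "\<delta> \<noteq> 0" "norm (relabel n) = 1" using \<delta> n by auto
  show "relabel n \<bullet> y = c" "\<bar>f (unlabel y)\<bar> <= B" if "y \<in> relabel ` F" for y using that plane B by auto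
  show "f (unlabel (relabel a + s *\<^sub>R (y - relabel a))) = s ^ k * f (unlabel y)"
   if "y \<in> relabel ` F" "0 < s" "s <= 1" for y s
   using that hom by (auto simp: relabel_simps[symmetric])
 qed (rule meas)
 have "(%Y. f (unlabel (Y - (relabel n \<bullet> Y - c) *\<^sub>R relabel n))) \<in> borel_measurable borel" by measurable
 with 1 show ?thesis
  by (simp add: set_integral_relabel card meas relabel_simps[symmetric] del: inner_relabel)
    (simp add: set_integral_relabel meas relabel_simps[symmetric])
qed

section \<open>Surface integrals over flat pieces\<close>

text \<open>A nonempty compact piece of a hyperplane. Its surface integral is an integral over the prism of height
  one, by the definition of the surface measure.\<close>

definition flat :: "(real^'n) set => bool" where
 "flat F \<longleftrightarrow> compact F \<and> F \<noteq> {} \<and> (\<exists>n. norm n = 1 \<and> (\<forall>x\<in>F. \<forall>y\<in>F. n \<bullet> (x - y) = 0))"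

abbreviation surface_integral :: "(real^'n) set => (real^'n => real) => real" where
 "surface_integral F f \<equiv> integral\<^sup>L (face_measure F) f"

definition prism :: "(real^'n) set => (real^'n) set" where
 "prism F = {x + t *\<^sub>R unit_normal F | x t. x \<in> F \<and> t \<in> {0..1}}"

definition plane_proj :: "(real^'n) set => real^'n => real^'n" where
 "plane_proj F y = y - (unit_normal F \<bullet> (y - (SOME z. z \<in> F))) *\<^sub>R unit_normal F"

lemma unit_normal:
 assumes "flat F"
 shows "norm (unit_normal F) = 1" "!!x y. x \<in> F ==> y \<in> F ==> unit_normal F \<bullet> x = unit_normal F \<bullet> y"
proof -
 have h: "norm (unit_normal F) = 1 \<and> (\<forall>x\<in>F. \<forall>y\<in>F. unit_normal F \<bullet> (x - y) = 0)"
  unfolding unit_normal_def by (rule someI_ex) (use assms in \<open>simp add: flat_def\<close>)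
 then show "norm (unit_normal F) = 1" by blast
 fix x y assume "x \<in> F" "y \<in> F"
 with h have "unit_normal F \<bullet> (x - y) = 0" by blast
 then show "unit_normal F \<bullet> x = unit_normal F \<bullet> y" by (simp add: inner_diff_right)
qed

lemma some_in_flat: "flat F ==> (SOME z. z \<in> F) \<in> F"
 unfolding flat_def by (metis some_in_eq)

lemma plane_proj_prism:
 assumes "flat F" "x \<in> F"
 shows "plane_proj F (x + t *\<^sub>R unit_normal F) = x"
proof -
 have "unit_normal F \<bullet> (x - (SOME z. z \<in> F)) = 0"
  using unit_normal(2)[OF assms(1) assms(2) some_in_flat[OF assms(1)]] by (simp add: inner_diff_right)
 then show ?thesis using unit_normal(1)[OF assms(1)]
  by (simp add: plane_proj_def inner_add_right inner_diff_right norm_eq_1)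
qed

lemma plane_proj_in: "flat F ==> Y \<in> prism F ==> plane_proj F Y \<in> F"
 by (auto simp: prism_def plane_proj_prism)

lemma compact_prism: "flat F ==> compact (prism F)"
proof -
 assume "flat F"
 have "prism F = (%(y, t). y + t *\<^sub>R unit_normal F) ` (F \<times> {0..1})" by (auto simp: prism_def image_iff) fastforce
 moreover have "compact ((%(y, t). y + t *\<^sub>R unit_normal F) ` (F \<times> {0..1}))"
  using \<open>flat F\<close> by (intro compact_continuous_image compact_Times) (auto intro!: continuous_intros simp: case_prod_unfold flat_def)
 ultimately show ?thesis by simp
qed

lemma prism_borel [measurable]: "flat F ==> prism F \<in> sets borel"
 by (intro borel_compact compact_prism)

lemma continuous_plane_proj: "continuous_on S (plane_proj F)"
 unfolding plane_proj_def by (intro continuous_intros)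

lemma plane_proj_borel [measurable]: "plane_proj F \<in> borel_measurable borel"
 by (intro borel_measurable_continuous_onI continuous_plane_proj)

lemma face_measure_eq: "face_measure F = distr (restrict_space lborel (prism F)) borel (plane_proj F)"
 unfolding face_measure_def Let_def prism_def plane_proj_def[abs_def] ..

lemma sets_face_measure [simp, measurable_cong]: "sets (face_measure (F :: (real^'n) set)) = sets borel"
 by (simp add: face_measure_eq)

lemma space_face_measure [simp]: "space (face_measure (F :: (real^'n) set)) = UNIV"
 by (simp add: face_measure_eq)

lemma surface_integral_eq:
 assumes F: "flat F" and [measurable]: "f \<in> borel_measurable borel"
 shows "surface_integral F f = (LBINT Y:prism F. f (plane_proj F Y))"
proof -
 have pm: "prism F \<in> sets borel" using F by simp
 have m: "plane_proj F \<in> measurable (restrict_space lborel (prism F)) borel"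
  using plane_proj_borel[of F] by (simp add: measurable_restrict_space1)
 show ?thesis unfolding face_measure_eq set_lebesgue_integral_def
  by (subst integral_distr[OF m]) (auto simp: integral_restrict_space pm)
qed

lemma finite_face_measure: "flat F ==> finite_measure (face_measure F)"
proof (rule finite_measureI)
 assume F: "flat F"
 then have pm: "prism F \<in> sets borel" by simp
 have m: "plane_proj F \<in> measurable (restrict_space lborel (prism F)) borel"
  using plane_proj_borel[of F] by (simp add: measurable_restrict_space1)
 have "emeasure (face_measure F) (space (face_measure F)) = emeasure lborel (prism F)"
  unfolding face_measure_eq by (subst emeasure_distr[OF m]) (auto simp: emeasure_restrict_space space_restrict_space pm)
 then show "emeasure (face_measure F) (space (face_measure F)) \<noteq> \<infinity>"
  using emeasure_compact_finite[OF compact_prism[OF F]] by simp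
qed

lemma AE_face_measure: "flat F ==> AE x in face_measure F. x \<in> F"
proof -
 assume F: "flat F"
 then have pm: "prism F \<in> sets borel" "F \<in> sets borel" by (auto simp: flat_def borel_compact)
 have m: "plane_proj F \<in> measurable (restrict_space lborel (prism F)) borel"
  using plane_proj_borel[of F] by (simp add: measurable_restrict_space1)
 show ?thesis unfolding face_measure_eq
  by (subst AE_distr_iff[OF m]) (auto simp: AE_restrict_space_iff plane_proj_in F pm)
qed

lemma surface_integrable:
 fixes f :: "real^'n => real"
 assumes F: "flat F" and "f \<in> borel_measurable borel" and "!!x. x \<in> F ==> \<bar>f x\<bar> <= B"
 shows "integrable (face_measure F) f"
 using assms(2,3) AE_face_measure[OF F]
 by (intro finite_measure.integrable_const_bound[OF finite_face_measure[OF F], of _ B]) auto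

lemma surface_integral_cong:
 assumes F: "flat F" and "f \<in> borel_measurable borel" "g \<in> borel_measurable borel" and "!!x. x \<in> F ==> f x = g x"
 shows "surface_integral F f = surface_integral F g"
 using assms(2-) AE_face_measure[OF F] by (intro integral_cong_AE) auto

lemma surface_integral_mono:
 assumes F: "flat F" and "integrable (face_measure F) f" "integrable (face_measure F) g"
  and "!!x. x \<in> F ==> f x <= g x"
 shows "surface_integral F f <= surface_integral F g"
 using assms(2-) AE_face_measure[OF F] by (intro integral_mono_AE) auto

lemma surface_integral_nonneg:
 assumes F: "flat F" and "!!x. x \<in> F ==> 0 <= f x"
 shows "0 <= surface_integral F f"
 using assms(2-) AE_face_measure[OF F] by (intro integral_nonneg_AE) auto

definition area :: "(real^'n) set => real" where
 "area F = surface_integral F (%_. 1)"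

lemma area_eq: "flat F ==> area F = vol (prism F)"
 unfolding area_def by (subst surface_integral_eq) (auto simp: set_lebesgue_integral_def)

text \<open>The polynomial, extended to the prism over the face constantly in normal direction, is still a
  polynomial along lines, so the inverse estimate on the prism applies.\<close>

lemma surface_inverse_estimate:
 assumes F: "flat F" "convex F" "x \<in> F" and f: "polyfn p f"
 shows "area F * (f x)^2 <= inverse_const p CARD('n) * surface_integral F (%x. (f (x :: real^'n))^2)"
proof -
 have px: "plane_proj F x = x" using plane_proj_prism[OF F(1,3), of 0] by simp
 have line: "\<exists>q. degree q <= p \<and> (\<forall>t. f (plane_proj F (x + t *\<^sub>R y)) = poly q t)" for x y
 proof -
  have "plane_proj F (x + t *\<^sub>R y) = plane_proj F x + t *\<^sub>R (y - (unit_normal F \<bullet> y) *\<^sub>R unit_normal F)" for t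
   by (simp add: plane_proj_def inner_add_right inner_diff_right algebra_simps)
  then show ?thesis using polyfn_line[OF f] by metis
 qed
 have "continuous_on UNIV (%Y. f (plane_proj F Y))"
  by (rule continuous_on_compose2[OF polyfn_continuous[OF f] continuous_plane_proj]) auto
 moreover have "convex (prism F)"
 proof -
  have "prism F = (\<Union>x\<in>F. \<Union>y\<in>closed_segment 0 (unit_normal F). {x + y})"
   by (auto simp: prism_def closed_segment_def)
  then show ?thesis using convex_sums[OF F(2) convex_closed_segment] by simp
 qed
 moreover have "x \<in> prism F" unfolding prism_def using F(3) by force
 ultimately have "vol (prism F) * (f (plane_proj F x))^2 <=
   inverse_const p CARD('n) * (LBINT y:prism F. (f (plane_proj F y))^2)"
  using inverse_estimate[OF line _ compact_prism[OF F(1)]] by simp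
 then show ?thesis using F(1) f
  by (simp add: px area_eq[OF F(1)])
    (subst surface_integral_eq[OF F(1)], auto intro!: borel_measurable_power polyfn_borel[OF f])
qed

section \<open>Barycentric coordinates\<close>

abbreviation full_simplex :: "'a::euclidean_space set => bool" where
 "full_simplex e \<equiv> int DIM('a) simplex e"

definition verts :: "'a::euclidean_space set => 'a set" where
 "verts e = {x. x extreme_point_of e}"

text \<open>The coefficients are unique because the vertices are affinely independent, and they exist for every
  point of the space because a simplex of full dimension has an affine hull of full dimension.\<close>

definition bary :: "'a::euclidean_space set => 'a => 'a => real" where
 "bary e a z = (SOME u. sum u (verts e) = 1 \<and> (\<Sum>b\<in>verts e. u b *\<^sub>R b) = z) a"

definition bary_grad :: "'a::euclidean_space set => 'a => 'a" where
 "bary_grad e a = (\<Sum>b\<in>Basis. (bary e a b - bary e a 0) *\<^sub>R b)"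

definition opp_face :: "'a::euclidean_space set => 'a => 'a set" where
 "opp_face e a = {z\<in>e. bary e a z = 0}"

lemma simplex_verts:
 fixes e :: "'a::euclidean_space set"
 assumes "full_simplex e"
 shows "\<not> affine_dependent (verts e)" "finite (verts e)" "card (verts e) = DIM('a) + 1"
  "e = convex hull (verts e)" "affine hull (verts e) = UNIV"
proof -
 obtain C where C: "\<not> affine_dependent C" "int (card C) = int DIM('a) + 1" "e = convex hull C"
  using assms unfolding simplex_def by blast
 have v: "verts e = C" using extreme_point_of_convex_hull_affine_independent[OF C(1)] C(3)
  by (auto simp: verts_def)
 show "\<not> affine_dependent (verts e)" "e = convex hull (verts e)" "finite (verts e)" "card (verts e) = DIM('a) + 1"
  using C v aff_independent_finite by auto
 have "aff_dim C = int DIM('a)" using C aff_dim_affine_independent by fastforce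
 then show "affine hull (verts e) = UNIV" using v aff_dim_eq_full by metis
qed

lemma simplex_compact: "full_simplex e ==> compact e"
 using simplex_verts(2,4) by (metis finite_imp_compact_convex_hull)

lemma simplex_convex: "full_simplex e ==> convex e"
 using simplex_verts(4) by (metis convex_convex_hull)

lemma verts_nonempty: "full_simplex e ==> verts e \<noteq> {}"
 using simplex_verts(3) by fastforce

lemma verts_subset: "verts e \<subseteq> e"
 by (auto simp: verts_def extreme_point_of_def)

lemma other_vertex: "full_simplex (e :: 'a::euclidean_space set) ==> \<exists>b\<in>verts e. b \<noteq> a"
proof -
 assume e: "full_simplex e"
 have "\<not> verts e \<subseteq> {a}" using simplex_verts(3)[OF e] card_mono[of "{a}" "verts e"] DIM_positive[where 'a='a] by auto
 then show ?thesis by blast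
qed

lemma bary_sum:
 assumes "full_simplex e"
 shows "(\<Sum>b\<in>verts e. bary e b z) = 1" "(\<Sum>b\<in>verts e. bary e b z *\<^sub>R b) = z"
proof -
 have "z \<in> affine hull (verts e)" using simplex_verts(5)[OF assms] by simp
 then have "\<exists>u. sum u (verts e) = 1 \<and> (\<Sum>b\<in>verts e. u b *\<^sub>R b) = z"
  using affine_hull_finite[OF simplex_verts(2)[OF assms]] by auto
 from someI_ex[OF this]
 show "(\<Sum>b\<in>verts e. bary e b z) = 1" "(\<Sum>b\<in>verts e. bary e b z *\<^sub>R b) = z"
  unfolding bary_def by auto
qed

lemma bary_unique:
 assumes e: "full_simplex e" and u: "sum u (verts e) = 1" "(\<Sum>b\<in>verts e. u b *\<^sub>R b) = z" and a: "a \<in> verts e"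
 shows "bary e a z = u a"
proof (rule ccontr)
 assume "bary e a z \<noteq> u a"
 then have "(\<exists>U. sum U (verts e) = 0 \<and> (\<exists>v\<in>verts e. U v \<noteq> 0) \<and> (\<Sum>v\<in>verts e. U v *\<^sub>R v) = 0)"
  using a bary_sum[OF e, of z] u
  by (intro exI[of _ "%b. bary e b z - u b"]) (auto simp: sum_subtractf scaleR_diff_left)
 then have "affine_dependent (verts e)"
  using affine_dependent_explicit_finite[OF simplex_verts(2)[OF e]] by blast
 with simplex_verts(1)[OF e] show False by simp
qed

lemma bary_vert:
 assumes "full_simplex e" "a \<in> verts e" "b \<in> verts e"
 shows "bary e a b = (if a = b then 1 else 0)"
 using assms simplex_verts(2)[OF assms(1)]
 by (intro bary_unique) (auto simp: if_distrib[of "%c. c *\<^sub>R _"] sum.delta cong: if_cong)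

lemma bary_affine:
 assumes e: "full_simplex e" and a: "a \<in> verts e"
 shows "bary e a z = bary e a 0 + bary_grad e a \<bullet> z"
proof -
 let ?l = "%z. bary e a z - bary e a 0"
 have "linear ?l"
 proof (rule linearI)
  fix x y :: 'a and c :: real
  have "bary e a (x + y) = bary e a x + bary e a y - bary e a 0"
   using bary_sum[OF e]
   by (intro bary_unique[OF e _ _ a, of "%b. bary e b x + bary e b y - bary e b 0"])
     (auto simp: sum.distrib sum_subtractf scaleR_add_left scaleR_diff_left)
  then show "?l (x + y) = ?l x + ?l y" by simp
  have "bary e a (c *\<^sub>R x) = c * bary e a x + (1 - c) * bary e a 0"
   using bary_sum[OF e]
   by (intro bary_unique[OF e _ _ a, of "%b. c * bary e b x + (1 - c) * bary e b 0"])
     (auto simp: sum.distrib scaleR_add_left sum_distrib_left[symmetric] scaleR_scaleR[symmetric]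
      scaleR_sum_right[symmetric] simp del: scaleR_scaleR)
  then show "?l (c *\<^sub>R x) = c *\<^sub>R ?l x" by (simp add: algebra_simps)
 qed
 then have "?l z = (\<Sum>b\<in>Basis. (z \<bullet> b) * ?l b)"
 proof -
  have "?l (\<Sum>b\<in>Basis. (z \<bullet> b) *\<^sub>R b) = (\<Sum>b\<in>Basis. ?l ((z \<bullet> b) *\<^sub>R b))"
   by (rule linear_sum[OF \<open>linear ?l\<close>])
  also have "... = (\<Sum>b\<in>Basis. (z \<bullet> b) * ?l b)"
   by (intro sum.cong refl) (use linear_scale[OF \<open>linear ?l\<close>] in simp)
  finally show ?thesis by (simp only: euclidean_representation)
 qed
 also have "... = bary_grad e a \<bullet> z"
  by (simp add: bary_grad_def inner_sum_left inner_commute[of z] mult.commute)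
 finally show ?thesis by simp
qed

lemma bary_continuous:
 assumes "full_simplex e" "a \<in> verts e" shows "continuous_on S (bary e a)"
proof -
 have "bary e a = (%z. bary e a 0 + bary_grad e a \<bullet> z)" using bary_affine[OF assms] by blast
 moreover have "continuous_on S (%z. bary e a 0 + bary_grad e a \<bullet> z)" by (intro continuous_intros)
 ultimately show ?thesis by metis
qed

lemma bary_diff:
 assumes "full_simplex e" "a \<in> verts e"
 shows "bary e a x - bary e a y = bary_grad e a \<bullet> (x - y)"
 using bary_affine[OF assms, of x] bary_affine[OF assms, of y] by (simp add: inner_diff_right)

lemma bary_line:
 assumes "full_simplex e" "a \<in> verts e"
 shows "bary e a (x + t *\<^sub>R (y - x)) = (1 - t) * bary e a x + t * bary e a y"
 using bary_affine[OF assms, of x] bary_affine[OF assms, of y] bary_affine[OF assms, of "x + t *\<^sub>R (y - x)"]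
 by (simp add: algebra_simps inner_diff_right inner_add_right)

lemma affine_bary:
 assumes e: "full_simplex e" and h: "!!z. h z = h0 + g \<bullet> z"
 shows "h z = (\<Sum>b\<in>verts e. bary e b z * h b)"
proof -
 have "h z = (\<Sum>b\<in>verts e. bary e b z) * h0 + g \<bullet> (\<Sum>b\<in>verts e. bary e b z *\<^sub>R b)"
  by (simp add: bary_sum[OF e] h)
 then show ?thesis by (simp add: h distrib_left sum.distrib sum_distrib_right inner_sum_right)
qed

lemma simplex_iff_bary:
 assumes e: "full_simplex e"
 shows "z \<in> e \<longleftrightarrow> (\<forall>a\<in>verts e. 0 <= bary e a z)"
proof
 assume "z \<in> e"
 then have "z \<in> convex hull (verts e)" using simplex_verts(4)[OF e] by simp
 then obtain u where "\<forall>x\<in>verts e. 0 <= u x" "sum u (verts e) = 1" "(\<Sum>x\<in>verts e. u x *\<^sub>R x) = z"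
  using convex_hull_finite[OF simplex_verts(2)[OF e]] by auto
 with bary_unique[OF e] show "\<forall>a\<in>verts e. 0 <= bary e a z" by auto
next
 assume "\<forall>a\<in>verts e. 0 <= bary e a z"
 then have "z \<in> convex hull (verts e)"
  using bary_sum[OF e, of z] convex_hull_finite[OF simplex_verts(2)[OF e]]
  by (auto intro!: exI[of _ "%b. bary e b z"])
 then show "z \<in> e" using simplex_verts(4)[OF e] by simp
qed

lemma bary_le_1: "full_simplex e ==> z \<in> e ==> a \<in> verts e ==> bary e a z <= 1"
 using bary_sum(1)[of e z] simplex_iff_bary[of e z] member_le_sum[of a "verts e" "%b. bary e b z"] simplex_verts(2)
 by fastforce

lemma bary_pos_interior:
 assumes e: "full_simplex e" and "!!a. a \<in> verts e ==> 0 < bary e a z"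
 shows "z \<in> interior e"
proof -
 have "open (\<Inter>a\<in>verts e. {z. 0 < bary e a z})"
  using simplex_verts(2)[OF e]
  by (intro open_INT ballI open_Collect_less continuous_on_const bary_continuous[OF e]) auto
 moreover have "(\<Inter>a\<in>verts e. {z. 0 < bary e a z}) \<subseteq> e" using simplex_iff_bary[OF e] by force
 ultimately show ?thesis using assms by (intro interiorI) auto
qed

lemma simplex_interior_nonempty: assumes e: "full_simplex e" shows "interior e \<noteq> {}"
proof -
 let ?c = "\<Sum>b\<in>verts e. (1 / card (verts e)) *\<^sub>R b"
 have "bary e a ?c = 1 / card (verts e)" if "a \<in> verts e" for a
  using simplex_verts(3)[OF e] that by (intro bary_unique[OF e]) auto
 then have "?c \<in> interior e" using simplex_verts(3)[OF e] by (intro bary_pos_interior[OF e]) auto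
 then show ?thesis by blast
qed

lemma opp_face_hull:
 assumes e: "full_simplex e" and a: "a \<in> verts e"
 shows "opp_face e a = convex hull (verts e - {a})"
proof (intro equalityI subsetI)
 have fin: "finite (verts e)" by (rule simplex_verts(2)[OF e])
 fix z assume "z \<in> opp_face e a"
 then have z: "z \<in> e" "bary e a z = 0" by (auto simp: opp_face_def)
 have "(\<Sum>b\<in>verts e - {a}. bary e b z) = 1" "(\<Sum>b\<in>verts e - {a}. bary e b z *\<^sub>R b) = z"
  using bary_sum[OF e, of z] a z(2) by (auto simp: sum.remove[OF fin a])
 then show "z \<in> convex hull (verts e - {a})"
  using simplex_iff_bary[OF e, of z] z(1) fin
  by (auto simp: convex_hull_finite intro!: exI[of _ "%b. bary e b z"])
next
 have fin: "finite (verts e)" by (rule simplex_verts(2)[OF e])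
 fix z assume "z \<in> convex hull (verts e - {a})"
 then obtain u where u: "\<forall>x\<in>verts e - {a}. 0 <= u x" "sum u (verts e - {a}) = 1"
   "(\<Sum>x\<in>verts e - {a}. u x *\<^sub>R x) = z" using fin by (auto simp: convex_hull_finite)
 let ?u = "u(a := 0)"
 have s: "sum ?u (verts e) = 1" "(\<Sum>x\<in>verts e. ?u x *\<^sub>R x) = z"
  using u by (auto simp: sum.remove[OF fin a])
 have "bary e b z = ?u b" if "b \<in> verts e" for b by (rule bary_unique[OF e s that])
 with u(1) a show "z \<in> opp_face e a"
  by (auto simp: opp_face_def simplex_iff_bary[OF e])
qed

lemma facet_iff:
 assumes e: "full_simplex e"
 shows "F facet_of e \<longleftrightarrow> (\<exists>a\<in>verts e. F = opp_face e a)"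
proof -
 have "F facet_of (convex hull (verts e)) \<longleftrightarrow> 2 <= card (verts e) \<and> (\<exists>u. u \<in> verts e \<and> F = convex hull (verts e - {u}))"
  by (rule facet_of_convex_hull_affine_independent_alt[OF simplex_verts(1)[OF e]])
 moreover have "2 <= card (verts e)" using simplex_verts(3)[OF e] DIM_positive[where 'a='a] by simp
 ultimately show ?thesis using simplex_verts(4)[OF e] opp_face_hull[OF e] by metis
qed

lemma vert_in_opp_face:
 "full_simplex e ==> a \<in> verts e ==> b \<in> verts e ==> b \<in> opp_face e a \<longleftrightarrow> b \<noteq> a"
 using bary_vert[of e a b] verts_subset[of e] by (auto simp: opp_face_def)

lemma inj_opp_face: "full_simplex e ==> inj_on (opp_face e) (verts e)"
 by (rule inj_onI) (metis vert_in_opp_face)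

lemma bary_grad_nonzero:
 assumes e: "full_simplex e" "a \<in> verts e" shows "bary_grad e a \<noteq> 0"
proof -
 obtain b where "b \<in> verts e" "b \<noteq> a" using other_vertex[OF e(1)] by blast
 then have "bary_grad e a \<bullet> (a - b) = 1" using bary_diff[OF e, of a b] bary_vert[OF e(1)] e by auto
 then show ?thesis by auto
qed

lemma opp_face_flat:
 fixes e :: "(real^'n) set"
 assumes e: "full_simplex e" "a \<in> verts e" shows "flat (opp_face e a)"
 unfolding flat_def
proof (intro conjI)
 have "opp_face e a = e \<inter> {z. bary e a z = 0}" by (auto simp: opp_face_def)
 moreover have "closed {z. bary e a z = 0}"
  by (intro closed_Collect_eq bary_continuous[OF e] continuous_intros)
 ultimately show "compact (opp_face e a)" using simplex_compact[OF e(1)] by (simp add: compact_Int_closed)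
 show "opp_face e a \<noteq> {}" using other_vertex[OF e(1)] vert_in_opp_face[OF e] by blast
 show "\<exists>n. norm n = 1 \<and> (\<forall>x\<in>opp_face e a. \<forall>y\<in>opp_face e a. n \<bullet> (x - y) = 0)"
  using bary_grad_nonzero[OF e] bary_diff[OF e, symmetric]
  by (intro exI[of _ "bary_grad e a /\<^sub>R norm (bary_grad e a)"]) (auto simp: opp_face_def)
qed

lemma opp_face_convex: "full_simplex e ==> a \<in> verts e ==> convex (opp_face e a)"
 by (simp add: opp_face_hull)

text \<open>The linear function given by \<open>n\<close> has the same value at all vertices but \<open>a\<close>, so it is an affine function of
  the barycentric coordinate of \<open>a\<close>.\<close>

lemma normal_of_opp_face:
 assumes e: "full_simplex e" and a: "a \<in> verts e"
  and n: "!!b. b \<in> verts e ==> b \<noteq> a ==> n \<bullet> b = c"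
 shows "n = (n \<bullet> a - c) *\<^sub>R bary_grad e a"
proof -
 have "n \<bullet> z = c + (n \<bullet> a - c) * bary e a z" for z
 proof -
  have "n \<bullet> z = (\<Sum>b\<in>verts e. bary e b z * (n \<bullet> b))"
   by (rule affine_bary[OF e, of "%z. n \<bullet> z" 0 n]) simp
  also have "... = (\<Sum>b\<in>verts e. bary e b z * c + (if b = a then (n \<bullet> a - c) * bary e a z else 0))"
   using n by (intro sum.cong) (auto simp: algebra_simps)
  also have "... = c + (n \<bullet> a - c) * bary e a z"
   using a simplex_verts(2)[OF e] bary_sum(1)[OF e, of z]
   by (simp add: sum.distrib sum_distrib_right[symmetric])
  finally show ?thesis .
 qed
 note nz = this
 have nz0: "n \<bullet> z = (n \<bullet> a - c) * (bary e a z - bary e a 0)" for z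
  using nz[of z] nz[of 0] by (simp add: right_diff_distrib)
 have "\<forall>z. n \<bullet> z = ((n \<bullet> a - c) *\<^sub>R bary_grad e a) \<bullet> z"
  using nz0 bary_diff[OF e a, of _ 0] by (metis diff_zero inner_scaleR_left)
 then show ?thesis by (rule iffD1[OF vector_eq_rdot])
qed

lemma outer_normal_opp_face:
 assumes e: "full_simplex e" "a \<in> verts e"
 shows "outer_normal e (opp_face e a) = - (bary_grad e a /\<^sub>R norm (bary_grad e a))"
 unfolding outer_normal_def
proof (rule the_equality)
 let ?n = "- (bary_grad e a /\<^sub>R norm (bary_grad e a))"
 have nz: "bary_grad e a \<noteq> 0" by (rule bary_grad_nonzero[OF e])
 have "?n \<bullet> x <= ?n \<bullet> y" if "x \<in> e" "y \<in> opp_face e a" for x y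
 proof -
  have "0 <= bary_grad e a \<bullet> (x - y)"
   using bary_diff[OF e, of x y] that simplex_iff_bary[OF e(1)] e(2) by (auto simp: opp_face_def)
  then show ?thesis using nz by (simp add: inner_diff_right divide_right_mono inverse_eq_divide)
 qed
 then show "norm ?n = 1 \<and> (\<forall>x\<in>e. \<forall>y\<in>opp_face e a. ?n \<bullet> x <= ?n \<bullet> y)" using nz by simp
 fix n assume n: "norm n = 1 \<and> (\<forall>x\<in>e. \<forall>y\<in>opp_face e a. n \<bullet> x <= n \<bullet> y)"
 obtain b0 where b0: "b0 \<in> verts e" "b0 \<noteq> a" using other_vertex[OF e(1)] by blast
 then have b0F: "b0 \<in> opp_face e a" "b0 \<in> e" using vert_in_opp_face[OF e] verts_subset by blast+
 have "n \<bullet> b = n \<bullet> b0" if "b \<in> verts e" "b \<noteq> a" for b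
  using n b0F vert_in_opp_face[OF e that(1)] that verts_subset[of e] by (auto intro!: antisym)
 from normal_of_opp_face[OF e this] have neq: "n = (n \<bullet> a - n \<bullet> b0) *\<^sub>R bary_grad e a" by blast
 moreover have le: "n \<bullet> a - n \<bullet> b0 <= 0" using n b0F e verts_subset by fastforce
 moreover have "\<bar>n \<bullet> a - n \<bullet> b0\<bar> * norm (bary_grad e a) = 1"
  using n arg_cong[OF neq, of norm] by (simp only: norm_scaleR)
 ultimately have "n \<bullet> a - n \<bullet> b0 = - 1 / norm (bary_grad e a)"
  using nz by (simp add: field_simps)
 with neq show "n = ?n" by (metis (no_types) divide_inverse minus_divide_left mult_1 scaleR_minus_left)
qed

lemma bdry_integral_simplex:
 assumes e: "full_simplex e"
 shows "bdry_integral e g = (\<Sum>a\<in>verts e. surface_integral (opp_face e a) (g (opp_face e a)))"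
proof -
 have "{F. F facet_of e} = opp_face e ` verts e" using facet_iff[OF e] by auto
 then show ?thesis unfolding bdry_integral_def
  by (simp add: sum.reindex[OF inj_opp_face[OF e]])
qed

section \<open>The cone formula and the divergence theorem on simplices\<close>

lemma simplex_as_cone:
 assumes e: "full_simplex e" "a \<in> verts e"
 shows "e = {a + s *\<^sub>R (y - a) |y s. y \<in> opp_face e a \<and> s \<in> {0..1}}" (is "e = ?R")
proof (intro equalityI subsetI)
 fix z assume z: "z \<in> e"
 define s where "s = 1 - bary e a z"
 have s01: "s \<in> {0..1}" using z bary_le_1[OF e(1) z e(2)] simplex_iff_bary[OF e(1)] e(2) by (auto simp: s_def)
 show "z \<in> ?R"
 proof (cases "s = 0")
  case True
  have "bary e b z = (if a = b then 1 else 0)" if b: "b \<in> verts e" for b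
  proof (cases "a = b")
   case False
   have "bary e a z + bary e b z <= (\<Sum>c\<in>verts e. bary e c z)"
    using sum_mono2[of "verts e" "{a, b}" "%c. bary e c z"] False simplex_verts(2)[OF e(1)] e(2) b
     simplex_iff_bary[OF e(1)] z by auto
   then show ?thesis using False True bary_sum(1)[OF e(1), of z] simplex_iff_bary[OF e(1), of z] z b by (auto simp: s_def)
  qed (use True in \<open>auto simp: s_def\<close>)
  then have "z = a" using bary_sum(2)[OF e(1), of z] e(2) simplex_verts(2)[OF e(1)]
   by (simp add: if_distrib[of "%c. c *\<^sub>R _"] sum.delta cong: if_cong)
  moreover obtain b where "b \<in> opp_face e a" using opp_face_flat other_vertex[OF e(1), of a] vert_in_opp_face[OF e] by blast
  ultimately show ?thesis by (intro CollectI exI[of _ b] exI[of _ 0]) auto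
 next
  case False
  with s01 have s: "0 < s" "s <= 1" by auto
  define y where "y = a + (1 / s) *\<^sub>R (z - a)"
  have "bary e b y = (if b = a then 0 else (1 / s) * bary e b z)" if "b \<in> verts e" for b
  proof -
   have "bary e b y = (1 - 1 / s) * bary e b a + (1 / s) * bary e b z"
    unfolding y_def by (rule bary_line[OF e(1) that])
   moreover have "bary e a z = 1 - s" by (simp add: s_def)
   ultimately show ?thesis using bary_vert[OF e(1) that e(2)] s by (auto simp: field_simps)
  qed
  then have "y \<in> opp_face e a" using z s e(2) by (auto simp: opp_face_def simplex_iff_bary[OF e(1)])
  moreover have "z = a + s *\<^sub>R (y - a)" using s by (simp add: y_def)
  ultimately show ?thesis using s01 by blast
 qed
next
 fix z assume "z \<in> ?R"
 then obtain y s where ys: "y \<in> opp_face e a" "s \<in> {0..1}" "z = a + s *\<^sub>R (y - a)" by blast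
 then have "z = (1 - s) *\<^sub>R a + s *\<^sub>R y" by (simp add: algebra_simps)
 then show "z \<in> e" using simplex_convex[OF e(1)] ys verts_subset[of e] e(2)
  by (auto simp: convex_alt opp_face_def)
qed

text \<open>A simplex is the cone over a facet with the opposite vertex as apex, whose distance from the plane of
  the facet is the inverse of the length of the barycentric gradient.\<close>

lemma cone_formula:
 fixes e :: "(real^'n) set" and f :: "real^'n => real"
 assumes e: "full_simplex e" "a \<in> verts e" and f[measurable]: "f \<in> borel_measurable borel"
  and B: "!!y. y \<in> opp_face e a ==> \<bar>f y\<bar> <= B"
  and hom: "!!y s. y \<in> opp_face e a ==> 0 < s ==> s <= 1 ==> f (a + s *\<^sub>R (y - a)) = s ^ k * f y"
 shows "set_integrable lborel e f"
  and "real (CARD('n) + k) * (LBINT y:e. f y) = surface_integral (opp_face e a) f / norm (bary_grad e a)"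
proof -
 let ?F = "opp_face e a"
 have F: "flat ?F" by (rule opp_face_flat[OF e])
 define n where "n = unit_normal ?F"
 define z where "z = (SOME z. z \<in> ?F)"
 have z: "z \<in> ?F" unfolding z_def by (rule some_in_flat[OF F])
 have n: "norm n = 1" "!!y. y \<in> ?F ==> n \<bullet> y = n \<bullet> z"
  unfolding n_def by (rule unit_normal(1)[OF F]) (rule unit_normal(2)[OF F _ z])
 have "n = (n \<bullet> a - n \<bullet> z) *\<^sub>R bary_grad e a"
  using n(2) vert_in_opp_face[OF e] by (intro normal_of_opp_face[OF e]) auto
 then have \<delta>: "\<bar>n \<bullet> z - n \<bullet> a\<bar> * norm (bary_grad e a) = 1"
  using n(1) by (metis abs_minus_commute norm_scaleR)
 then have nz: "n \<bullet> z - n \<bullet> a \<noteq> 0" by auto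
 have "set_integrable lborel {a + s *\<^sub>R (y - a) |y s. y \<in> ?F \<and> s \<in> {0..1}} f \<and>
  real (CARD('n) + k) * (LINT y:{a + s *\<^sub>R (y - a) |y s. y \<in> ?F \<and> s \<in> {0..1}}|lborel. f y) = \<bar>n \<bullet> z - n \<bullet> a\<bar> *
   (LINT Y:{y + t *\<^sub>R n |y t. y \<in> ?F \<and> t \<in> {0..1}}|lborel. f (Y - (n \<bullet> Y - n \<bullet> z) *\<^sub>R n))"
 proof (rule cone_integral[where B=B and f=f and a=a and n=n and F="?F" and c="n \<bullet> z" and \<delta>="n \<bullet> z - n \<bullet> a" and k=k])
  show "compact ?F" using F by (simp add: flat_def)
  show "n \<bullet> z - n \<bullet> a \<noteq> 0" by (rule nz)
 qed (use n f B hom in auto)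
 then have *: "set_integrable lborel e f \<and>
  real (CARD('n) + k) * (LBINT y:e. f y) = \<bar>n \<bullet> z - n \<bullet> a\<bar> *
   (LBINT Y:prism ?F. f (Y - (n \<bullet> Y - n \<bullet> z) *\<^sub>R n))"
  unfolding simplex_as_cone[OF e, symmetric] by (simp add: prism_def n_def)
 then show "set_integrable lborel e f" by blast
 have "(LBINT Y:prism ?F. f (Y - (n \<bullet> Y - n \<bullet> z) *\<^sub>R n)) = surface_integral ?F f"
  using surface_integral_eq[OF F f] by (simp add: plane_proj_def n_def z_def inner_diff_right)
 moreover have "\<bar>n \<bullet> z - n \<bullet> a\<bar> = 1 / norm (bary_grad e a)"
  using \<delta> bary_grad_nonzero[OF e] by (simp add: field_simps)
 ultimately show "real (CARD('n) + k) * (LBINT y:e. f y) = surface_integral (opp_face e a) f / norm (bary_grad e a)"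
  using * by simp
qed

text \<open>Sums of polynomials that are homogeneous about \<open>a\<close>. Every polynomial is one, but the summands are
  subject to Euler's identity and to the cone formula.\<close>

inductive hom_sum :: "real^'n => (real^'n => real) => bool" for a where
 hom: "(!!y s. f (a + s *\<^sub>R (y - a)) = s ^ k * f y) ==> polyfn l f ==> hom_sum a f"
| add: "hom_sum a f ==> hom_sum a g ==> hom_sum a (%x. f x + g x)"

lemma hom_sum_polyfn: "hom_sum a f ==> \<exists>l. polyfn l f"
proof (induction rule: hom_sum.induct)
 case (add f g)
 then obtain k l where "polyfn k f" "polyfn l g" by blast
 then have "polyfn (max k l) f" "polyfn (max k l) g" by (auto elim: polyfn_mono)
 then show ?case by (blast intro: polyfn.add)
qed blast

lemma hom_sum_mult_hom:
 assumes g: "!!y s. g (a + s *\<^sub>R (y - a)) = s ^ k * g y" "polyfn l g" and f: "hom_sum a f"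
 shows "hom_sum a (%x. g x * f x)"
 using f
proof (induction rule: hom_sum.induct)
 case (hom f k' l')
 show ?case
 proof (rule hom_sum.hom[where k="k + k'" and l="l + l'"])
  show "g (a + s *\<^sub>R (y - a)) * f (a + s *\<^sub>R (y - a)) = s ^ (k + k') * (g y * f y)" for y s
   by (simp add: hom(1) g(1) power_add)
 qed (rule polyfn_mult[OF g(2) hom(2)])
qed (auto simp: distrib_left intro: hom_sum.add)

lemma polyfn_hom_sum: "polyfn k f ==> hom_sum a f"
proof (induction rule: polyfn.induct)
 case (const k c)
 show ?case by (rule hom_sum.hom[where k=0]) (auto intro: polyfn.const)
next
 case (coord k f i)
 have "hom_sum a (%x. (x $ i - a $ i) * f x)"
  using coord by (intro hom_sum_mult_hom[where k=1 and l=1] polyfn_diff polyfn_coord polyfn.const) auto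
 moreover have "hom_sum a (%x. a $ i * f x)"
  using coord by (intro hom_sum_mult_hom[where k=0 and l=1] polyfn.const) auto
 ultimately have "hom_sum a (%x. (x $ i - a $ i) * f x + a $ i * f x)" by (rule hom_sum.add)
 then show ?case by (simp add: algebra_simps)
qed (rule hom_sum.add)

lemma polyfn_gderiv: "polyfn k f ==> GDERIV f x :> grad f x"
 using polyfn_has_gradient grad_eqI by metis

lemma polyfn_grad: "polyfn k f ==> polyfn k (%x. grad f x $ i)"
proof -
 assume "polyfn k f"
 then obtain G where "!!x. GDERIV f x :> G x" "!!i. polyfn k (%x. G x $ i)" using polyfn_has_gradient by blast
 moreover from this have "grad f = G" using grad_eqI by blast
 ultimately show ?thesis by simp
qed

lemma polyfn_grad_inner:
 assumes f: "polyfn k f" and g: "!!i. polyfn l (%x. g x $ i)"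
 shows "polyfn (l + k) (%x. g x \<bullet> grad f x)"
 unfolding inner_vec_def using polyfn_mult[OF g polyfn_grad[OF f]] by (auto intro!: polyfn_sum)

lemma polyfn_set_integrable: "polyfn k f ==> compact K ==> set_integrable lborel K f"
 unfolding set_integrable_def by (intro borel_integrable_compact polyfn_continuous)

text \<open>The divergence theorem for the field \<open>\<psi> x *\<^sub>R (x - a)\<close>: it is tangential to all faces
  that contain the vertex \<open>a\<close>, and homogeneity reduces it to the cone formula via Euler's identity.\<close>

lemma euler_divergence:
 fixes e :: "(real^'n) set" and \<psi> :: "real^'n => real"
 assumes e: "full_simplex e" "a \<in> verts e" and \<psi>: "polyfn k \<psi>"
 shows "(LBINT x:e. real CARD('n) * \<psi> x + (x - a) \<bullet> grad \<psi> x) =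
  surface_integral (opp_face e a) \<psi> / norm (bary_grad e a)"
 using polyfn_hom_sum[OF \<psi>, of a]
proof (induction rule: hom_sum.induct)
 case (hom f k l)
 have F: "flat (opp_face e a)" by (rule opp_face_flat[OF e])
 have "compact (opp_face e a)" using F by (simp add: flat_def)
 then have "bounded (f ` opp_face e a)"
  using polyfn_continuous[OF hom(2)] by (intro compact_imp_bounded compact_continuous_image)
 then obtain B where B: "!!y. y \<in> opp_face e a ==> \<bar>f y\<bar> <= B" unfolding bounded_iff by auto
 have "real CARD('n) * f x + (x - a) \<bullet> grad f x = real (CARD('n) + k) * f x" for x
 proof -
  have "((%s. f (a + s *\<^sub>R (x - a))) has_real_derivative (x - a) \<bullet> grad f x) (at 1)"
  proof -
   have d1: "(f has_derivative (%h. h \<bullet> grad f x)) (at (a + 1 *\<^sub>R (x - a)))"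
    using polyfn_gderiv[OF hom(2), of x] by (simp add: gderiv_def)
   have d2: "((%s. a + s *\<^sub>R (x - a)) has_derivative (%h. h *\<^sub>R (x - a))) (at 1)"
    by (auto intro!: derivative_eq_intros)
   show ?thesis
    by (rule has_derivative_imp_has_field_derivative[OF has_derivative_compose[OF d2 d1]]) simp
  qed
  moreover have "((%s. s ^ k * f x) has_real_derivative k * f x) (at 1)"
   by (auto intro!: derivative_eq_intros)
  ultimately have "(x - a) \<bullet> grad f x = k * f x" using hom(1) by (simp add: DERIV_unique)
  then show ?thesis by (simp add: distrib_right)
 qed
 then show ?case
  using cone_formula(2)[OF e polyfn_borel[OF hom(2)] B hom(1)] by simp
next
 case (add f g)
 obtain k where f: "polyfn k f" using hom_sum_polyfn[OF add(1)] by blast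
 obtain l where g: "polyfn l g" using hom_sum_polyfn[OF add(2)] by blast
 have grad: "grad (%x. f x + g x) x = grad f x + grad g x" for x
  by (intro grad_eqI GDERIV_add polyfn_gderiv[OF f] polyfn_gderiv[OF g])
 have F: "flat (opp_face e a)" by (rule opp_face_flat[OF e])
 have bd: "\<exists>B. \<forall>y\<in>opp_face e a. \<bar>h y\<bar> <= B" if "polyfn j h" for h j
 proof -
  have "bounded (h ` opp_face e a)"
   using polyfn_continuous[OF that] F by (intro compact_imp_bounded compact_continuous_image) (auto simp: flat_def)
  then show ?thesis by (auto simp: bounded_iff)
 qed
 have si: "integrable (face_measure (opp_face e a)) h" if "polyfn j h" for h j
  using bd[OF that] surface_integrable[OF F polyfn_borel[OF that]] by blast
 have lin: "polyfn 1 (%x. (x - a) $ i)" for i using polyfn_diff[OF polyfn_coord polyfn.const] by simp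
 have vi: "set_integrable lborel e (%x. real CARD('n) * h x + (x - a) \<bullet> grad h x)" if "polyfn j h" for h j
  using simplex_compact[OF e(1)] polyfn_mono[OF polyfn_cmult[OF that], of "1 + j"] polyfn_grad_inner[OF that lin]
  by (intro polyfn_set_integrable[of "1 + j"] polyfn.add) auto
 have "(LBINT x:e. real CARD('n) * (f x + g x) + (x - a) \<bullet> grad (%x. f x + g x) x) =
  (LBINT x:e. (real CARD('n) * f x + (x - a) \<bullet> grad f x) + (real CARD('n) * g x + (x - a) \<bullet> grad g x))"
  by (simp add: grad inner_add_right algebra_simps)
 also have "... = surface_integral (opp_face e a) f / norm (bary_grad e a) + surface_integral (opp_face e a) g / norm (bary_grad e a)"
  using add by (subst set_integral_add(2)[OF vi[OF f] vi[OF g]]) simp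
 also have "... = surface_integral (opp_face e a) (%x. f x + g x) / norm (bary_grad e a)"
  using si[OF f] si[OF g] by (simp add: add_divide_distrib)
 finally show ?case .
qed

lemma simplex_set_integral_lebesgue:
 fixes e :: "(real^'n) set" and f :: "real^'n => real"
 assumes "compact e" "f \<in> borel_measurable borel"
 shows "(LBINT x:e. f x) = (LINT x|lebesgue_on e. f x)"
proof -
 have [measurable]: "e \<in> sets borel" "f \<in> borel_measurable borel" using assms by (auto intro: borel_compact)
 have "(LINT x|lebesgue_on e. f x) = (LINT x|lebesgue. indicator e x *\<^sub>R f x)"
  by (subst integral_restrict_space) auto
 also have "... = (LBINT x. indicator e x *\<^sub>R f x)" by (rule integral_completion) (intro borel_measurable_scaleR borel_measurable_indicator, auto)
 finally show ?thesis by (simp add: set_lebesgue_integral_def)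
qed

lemma polyfn_surface_integrable:
 assumes "flat F" "polyfn k f" shows "integrable (face_measure F) f"
proof -
 have "bounded (f ` F)"
  using polyfn_continuous[OF assms(2)] assms(1) by (intro compact_imp_bounded compact_continuous_image) (auto simp: flat_def)
 then obtain B where "!!y. y \<in> F ==> \<bar>f y\<bar> <= B" by (auto simp: bounded_iff)
 then show ?thesis using surface_integrable[OF assms(1) polyfn_borel[OF assms(2)]] by blast
qed

lemma grad_add: "polyfn k f ==> polyfn l g ==> grad (%x. f x + g x) x = grad f x + grad g x"
 by (intro grad_eqI GDERIV_add polyfn_gderiv)

lemma grad_mult: "polyfn k f ==> polyfn l g ==> grad (%x. f x * g x) x = f x *\<^sub>R grad g x + g x *\<^sub>R grad f x"
 by (intro grad_eqI GDERIV_mult polyfn_gderiv)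

lemma grad_coord: "grad (%x. x $ i) x = axis i 1"
 by (rule grad_eqI) (simp add: gderiv_def inner_axis bounded_linear_imp_has_derivative bounded_linear_vec_nth)

text \<open>A constant vector is a combination of the fields \<open>x - a\<close> over the vertices \<open>a\<close>, so the
  divergence theorem for those fields gives it for constant directions.\<close>

lemma divergence_theorem_direction:
 fixes e :: "(real^'n) set"
 assumes e: "full_simplex e" and \<psi>: "polyfn k \<psi>"
 shows "(LBINT x:e. b \<bullet> grad \<psi> x) =
  (\<Sum>a\<in>verts e. surface_integral (opp_face e a) \<psi> * (b \<bullet> outer_normal e (opp_face e a)))"
proof -
 define \<beta> where "\<beta> a = bary_grad e a \<bullet> b" for a
 have \<beta>: "\<beta> a = bary e a b - bary e a 0" if "a \<in> verts e" for a
  using bary_diff[OF e that, of b 0] by (simp add: \<beta>_def)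
 have s0: "(\<Sum>a\<in>verts e. \<beta> a) = 0" using bary_sum(1)[OF e] by (simp add: \<beta> sum_subtractf)
 have s1: "(\<Sum>a\<in>verts e. \<beta> a *\<^sub>R a) = b" using bary_sum(2)[OF e] by (simp add: \<beta> sum_subtractf scaleR_diff_left)
 have pt: "b \<bullet> grad \<psi> x = (\<Sum>a\<in>verts e. - \<beta> a * (real CARD('n) * \<psi> x + (x - a) \<bullet> grad \<psi> x))" for x
 proof -
  have "(\<Sum>a\<in>verts e. - \<beta> a * (real CARD('n) * \<psi> x + (x - a) \<bullet> grad \<psi> x)) =
   - (\<Sum>a\<in>verts e. \<beta> a) * (real CARD('n) * \<psi> x + x \<bullet> grad \<psi> x) + (\<Sum>a\<in>verts e. \<beta> a *\<^sub>R a) \<bullet> grad \<psi> x"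
  proof -
   have "(\<Sum>a\<in>verts e. - \<beta> a * (real CARD('n) * \<psi> x + (x - a) \<bullet> grad \<psi> x)) =
    (\<Sum>a\<in>verts e. - (\<beta> a * (real CARD('n) * \<psi> x + x \<bullet> grad \<psi> x)) + (\<beta> a *\<^sub>R a) \<bullet> grad \<psi> x)"
    by (intro sum.cong refl) (simp add: inner_diff_left algebra_simps)
   then show ?thesis by (simp add: sum_subtractf inner_sum_left sum_distrib_right sum.distrib sum_negf)
  qed
  then show ?thesis by (simp add: s0 s1)
 qed
 have lin: "polyfn 1 (%x. (x - a) $ i)" for a :: "real^'n" and i using polyfn_diff[OF polyfn_coord polyfn.const] by simp
 have vi: "set_integrable lborel e (%x. real CARD('n) * \<psi> x + (x - a) \<bullet> grad \<psi> x)" for a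
  using simplex_compact[OF e(1)] polyfn_mono[OF polyfn_cmult[OF \<psi>], of "1 + k"] polyfn_grad_inner[OF \<psi> lin]
  by (intro polyfn_set_integrable[of "1 + k"] polyfn.add) auto
 have "(LBINT x:e. b \<bullet> grad \<psi> x) =
  (LBINT x:e. (\<Sum>a\<in>verts e. - \<beta> a * (real CARD('n) * \<psi> x + (x - a) \<bullet> grad \<psi> x)))"
  by (simp only: pt)
 also have "... = (\<Sum>a\<in>verts e. (LBINT x:e. - \<beta> a * (real CARD('n) * \<psi> x + (x - a) \<bullet> grad \<psi> x)))"
  unfolding set_lebesgue_integral_def scaleR_sum_right using vi
  by (intro Bochner_Integration.integral_sum) (simp add: set_integrable_def mult.left_commute[of "indicator _ _"])
 also have "... = (\<Sum>a\<in>verts e. - \<beta> a * (surface_integral (opp_face e a) \<psi> / norm (bary_grad e a)))"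
  by (intro sum.cong refl) (simp only: set_integral_mult_right euler_divergence[OF e _ \<psi>])
 also have "... = (\<Sum>a\<in>verts e. surface_integral (opp_face e a) \<psi> * (b \<bullet> outer_normal e (opp_face e a)))"
  by (intro sum.cong refl) (simp add: outer_normal_opp_face[OF e] \<beta>_def inner_commute divide_inverse)
 finally show ?thesis .
qed

lemma divergence_eq:
 fixes q :: "real^'n => real^'n"
 assumes q: "!!i. polyfn l (%x. q x $ i)"
 shows "divergence q x = (\<Sum>i\<in>UNIV. grad (%x. q x $ i) x $ i)"
proof -
 have "(q has_derivative (%h. \<chi> i. h \<bullet> grad (%x. q x $ i) x)) (at x)"
 proof (subst has_derivative_componentwise_within, intro ballI)
  fix b :: "real^'n" assume "b \<in> Basis"
  then obtain i where b: "b = axis i 1" by (auto simp: Basis_vec_def)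
  show "((%x. q x \<bullet> b) has_derivative (%y. (\<chi> i. y \<bullet> grad (%x. q x $ i) x) \<bullet> b)) (at x)"
   using polyfn_gderiv[OF q, of i x] by (simp add: gderiv_def b inner_axis)
 qed
 then have "frechet_derivative q (at x) = (%h. \<chi> i. h \<bullet> grad (%x. q x $ i) x)"
  by (rule frechet_derivative_at[symmetric])
 then show ?thesis
  by (simp add: divergence_def trace_def jacobian_def matrix_def inner_commute[of "axis _ _"] inner_axis)
qed

lemma polyfn_inner_components:
 "(!!i. polyfn k (%x. f x $ i)) ==> (!!i. polyfn l (%x. g x $ i)) ==> polyfn (k + l) (%x. f x \<bullet> g x)"
 unfolding inner_vec_def by (auto intro!: polyfn_sum polyfn_mult)

lemma polyfn_divergence: "(!!i. polyfn l (%x. q x $ i)) ==> polyfn l (divergence q)"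
proof -
 assume q: "!!i. polyfn l (%x. q x $ i)"
 then have "divergence q = (%x. \<Sum>i\<in>UNIV. grad (%x. q x $ i) x $ i)" using divergence_eq by blast
 then show ?thesis using polyfn_grad[OF q] by (simp add: polyfn_sum)
qed

theorem integration_by_parts:
 fixes e :: "(real^'n) set"
 assumes e: "full_simplex e" and u: "polyfn k u" and q: "!!i. polyfn l (%x. q x $ i)"
 shows "(LBINT x:e. u x * divergence q x) + (LBINT x:e. q x \<bullet> grad u x) =
  bdry_integral e (%F x. u x * (q x \<bullet> outer_normal e F))"
proof -
 have uq: "polyfn (k + l) (%x. u x * q x $ i)" for i by (rule polyfn_mult[OF u q])
 have div: "polyfn l (divergence q)" by (rule polyfn_divergence[OF q])
 have pt: "u x * divergence q x + q x \<bullet> grad u x = (\<Sum>i\<in>UNIV. axis i 1 \<bullet> grad (%x. u x * q x $ i) x)" for x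
 proof -
  have "axis i 1 \<bullet> grad (%x. u x * q x $ i) x = u x * grad (%x. q x $ i) x $ i + q x $ i * grad u x $ i" for i
   by (simp add: grad_mult[OF u q] inner_axis')
  then show ?thesis by (simp add: divergence_eq[OF q] sum.distrib sum_distrib_left inner_vec_def)
 qed
 have i1: "set_integrable lborel e (%x. u x * divergence q x)"
  by (rule polyfn_set_integrable[OF polyfn_mult[OF u div] simplex_compact[OF e]])
 have i2: "set_integrable lborel e (%x. q x \<bullet> grad u x)"
  by (rule polyfn_set_integrable[OF polyfn_grad_inner[OF u q] simplex_compact[OF e]])
 have i3: "set_integrable lborel e (%x. axis i 1 \<bullet> grad (%x. u x * q x $ i) x)" for i
  using polyfn_set_integrable[OF polyfn_grad[OF uq[of i], of i] simplex_compact[OF e]] by (simp add: inner_axis')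
 have "(LBINT x:e. u x * divergence q x) + (LBINT x:e. q x \<bullet> grad u x) =
   (LBINT x:e. (\<Sum>i\<in>UNIV. axis i 1 \<bullet> grad (%x. u x * q x $ i) x))"
  using set_integral_add(2)[OF i1 i2] by (simp only: pt)
 also have "... = (\<Sum>i\<in>UNIV. LBINT x:e. axis i 1 \<bullet> grad (%x. u x * q x $ i) x)"
  unfolding set_lebesgue_integral_def scaleR_sum_right using i3
  by (intro Bochner_Integration.integral_sum) (simp add: set_integrable_def)
 also have "... = (\<Sum>i\<in>UNIV. \<Sum>a\<in>verts e. surface_integral (opp_face e a) (%x. u x * q x $ i) * (axis i 1 \<bullet> outer_normal e (opp_face e a)))"
  by (intro sum.cong refl divergence_theorem_direction[OF e uq])
 also have "... = (\<Sum>a\<in>verts e. \<Sum>i\<in>UNIV. surface_integral (opp_face e a) (%x. (u x * q x $ i) * outer_normal e (opp_face e a) $ i))"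
  by (subst sum.swap) (simp add: inner_axis')
 also have "... = (\<Sum>a\<in>verts e. surface_integral (opp_face e a) (%x. \<Sum>i\<in>UNIV. (u x * q x $ i) * outer_normal e (opp_face e a) $ i))"
  using polyfn_surface_integrable[OF opp_face_flat[OF e] uq]
  by (intro sum.cong refl Bochner_Integration.integral_sum[symmetric]) auto
 also have "... = bdry_integral e (%F x. u x * (q x \<bullet> outer_normal e F))"
  by (simp add: bdry_integral_simplex[OF e] inner_vec_def sum_distrib_left mult.assoc)
 finally show ?thesis .
qed

section \<open>Unique solvability of the local problems\<close>

definition V_deg :: "hdg_scheme => nat => nat" where
 "V_deg S p = (if S = BDM_H then p - 1 else p)"

lemma V_loc_iff: "v \<in> V_loc S p \<longleftrightarrow> polyfn (V_deg S p) v"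
 by (cases S) (auto simp: V_deg_def polys_iff_polyfn)

lemma V_loc_polyfn: "v \<in> V_loc S p ==> polyfn p v"
 by (auto simp: V_loc_iff V_deg_def elim: polyfn_mono split: if_splits)

lemma W_loc_vec_polys: "S \<noteq> RT_H ==> W_loc S p = vec_polys p"
 by (cases S) auto

lemma W_loc_polyfn:
 assumes q: "q \<in> W_loc S p" shows "polyfn (Suc p) (%x. q x $ i)"
proof -
 have vp: "polyfn (Suc p) (%x. r x $ i)" if "r \<in> vec_polys p" for r
  using that by (auto simp: vec_polys_def polys_iff_polyfn intro: polyfn_mono)
 show ?thesis
 proof (cases "S = RT_H")
  case True
  with q obtain r s where "r \<in> vec_polys p" "polyfn p s" "q = (%x. r x + s x *\<^sub>R x)"
   by (auto simp: polys_iff_polyfn)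
  then have "polyfn (Suc p) (%x. r x $ i)" "polyfn (Suc p) (%x. x $ i * s x)" "q = (%x. r x + s x *\<^sub>R x)"
   using vp polyfn.coord by blast+
  from polyfn.add[OF this(1,2)] this(3) show ?thesis by (simp add: mult.commute)
 next
  case False
  with q have "q \<in> vec_polys p" by (simp add: W_loc_vec_polys)
  then show ?thesis by (rule vp)
 qed
qed

lemma vec_polys_diff: "q \<in> vec_polys p ==> r \<in> vec_polys p ==> (%x. q x - r x) \<in> vec_polys p"
 by (auto simp: vec_polys_def polys_iff_polyfn intro: polyfn_diff)

lemma W_loc_diff:
 assumes qr: "q \<in> W_loc S p" "r \<in> W_loc S p" shows "(%x. q x - r x) \<in> W_loc S p"
proof (cases "S = RT_H")
 case True
 with qr obtain q' s r' t where "q' \<in> vec_polys p" "s \<in> polys p" "q = (%x. q' x + s x *\<^sub>R x)"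
  "r' \<in> vec_polys p" "t \<in> polys p" "r = (%x. r' x + t x *\<^sub>R x)" by auto
 then have "(%x. q' x - r' x) \<in> vec_polys p" "(%x. s x - t x) \<in> polys p"
  "(%x. q x - r x) = (%x. (q' x - r' x) + (s x - t x) *\<^sub>R x)"
  by (auto intro: vec_polys_diff polyfn_diff simp: polys_iff_polyfn algebra_simps)
 then have "(%x. q x - r x) \<in> W_loc RT_H p" unfolding W_loc.simps
  by (intro CollectI bexI[of _ "%x. q' x - r' x"] bexI[of _ "%x. s x - t x"])
 then show ?thesis using True by simp
next
 case False
 then show ?thesis using qr vec_polys_diff by (simp add: W_loc_vec_polys)
qed

text \<open>The operator \<open>s \<mapsto> c s + x \<bullet> grad s\<close> multiplies a monomial of degree \<open>k\<close> by \<open>c + k\<close>. With \<open>c\<close> the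
  dimension it is the divergence of \<open>s x\<close>, which is why the divergence maps the flux space of RT-H and
  BDM-H onto the scalar space.\<close>

lemma euler_surjective:
 "polyfn k f ==> c > 0 ==> \<exists>s. polyfn k s \<and> (\<forall>x. c * s x + x \<bullet> grad s x = f x)"
proof (induction arbitrary: c rule: polyfn.induct)
 case (const k r)
 have "grad (%x. r / c) x = 0" for x :: "real^'a" by (intro grad_eqI GDERIV_const)
 with const show ?case by (intro exI[of _ "%x. r / c"]) (auto intro: polyfn.const)
next
 case (coord k f i)
 then obtain s where s: "polyfn k s" "!!x. (c + 1) * s x + x \<bullet> grad s x = f x"
  by (metis add_pos_pos zero_less_one)
 have "c * (x $ i * s x) + x \<bullet> grad (%x. x $ i * s x) x = x $ i * f x" for x
 proof -
  have g: "grad (%x. x $ i * s x) x = x $ i *\<^sub>R grad s x + s x *\<^sub>R axis i 1"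
   by (simp add: grad_mult[OF polyfn_coord s(1)] grad_coord)
  show ?thesis using s(2)[of x, symmetric] unfolding g by (simp add: inner_add_right inner_axis algebra_simps)
 qed
 then show ?case using polyfn.coord[OF s(1), of i] by blast
next
 case (add k f g)
 then obtain s t where s: "polyfn k s" "!!x. c * s x + x \<bullet> grad s x = f x"
  and t: "polyfn k t" "!!x. c * t x + x \<bullet> grad t x = g x" by metis
 have "c * (s x + t x) + x \<bullet> grad (%x. s x + t x) x = f x + g x" for x
  using s(2)[of x] t(2)[of x] by (simp add: grad_add[OF s(1) t(1)] inner_add_right algebra_simps)
 then show ?case using polyfn.add[OF s(1) t(1)] by blast
qed

lemma divergence_surjective:
 assumes S: "S = RT_H \<or> S = BDM_H" and p: "p \<ge> 1" and v: "v \<in> V_loc S p"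
 shows "\<exists>r\<in>W_loc S p. \<forall>x :: real^'n. divergence r x = v x"
proof -
 obtain s where s: "polyfn (V_deg S p) s" "!!x. real CARD('n) * s x + x \<bullet> grad s x = v x"
  using euler_surjective[OF v[unfolded V_loc_iff], of "real CARD('n)"] by auto
 define r where "r = (%x. s x *\<^sub>R x)"
 have rc: "polyfn (Suc (V_deg S p)) (%x. r x $ i)" for i
  using polyfn.coord[OF s(1), of i] by (simp add: r_def mult.commute)
 have "r \<in> W_loc S p"
 proof (cases "S = RT_H")
  case True
  have "(%x. 0) \<in> vec_polys p" by (simp add: vec_polys_def polys_const)
  moreover have "s \<in> polys p" using s(1) True by (simp add: V_deg_def polys_iff_polyfn)
  ultimately show ?thesis using True unfolding r_def by force
 next
  case False
  then have "S = BDM_H" using S by simp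
  then show ?thesis using rc p by (auto simp: vec_polys_def polys_iff_polyfn V_deg_def)
 qed
 moreover have "divergence r x = v x" for x
 proof -
  have "grad (%x. r x $ i) x $ i = s x + x $ i * grad s x $ i" for i
   using grad_mult[OF s(1) polyfn_coord[of i], of x] by (simp add: r_def grad_coord)
  then have "divergence r x = (\<Sum>i\<in>UNIV. s x + x $ i * grad s x $ i)"
   using divergence_eq[OF rc] by simp
  also have "... = real CARD('n) * s x + x \<bullet> grad s x" by (simp add: sum.distrib inner_vec_def)
  finally show ?thesis using s(2) by simp
 qed
 ultimately show ?thesis by blast
qed

lemma simplex_measure_pos: "full_simplex (e :: 'a::euclidean_space set) ==> 0 < vol e"
proof -
 assume e: "full_simplex e"
 have "\<not> negligible (interior e)" using simplex_interior_nonempty[OF e] open_not_negligible[of "interior e"] by simp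
 then have "\<not> negligible e" using negligible_subset interior_subset by blast
 moreover have "e \<in> lmeasurable" using simplex_compact[OF e] by (rule lmeasurable_compact)
 ultimately have "measure lebesgue e \<noteq> 0" using negligible_iff_measure0 by blast
 moreover have "measure lebesgue e = vol e"
  using simplex_compact[OF e] by (intro measure_completion) (simp add: borel_compact)
 ultimately show ?thesis using measure_nonneg[of lborel e] by linarith
qed

lemma simplex_inverse_estimate:
 fixes e :: "(real^'n) set"
 assumes "full_simplex e" "polyfn p f" "x \<in> e"
 shows "vol e * (f x)^2 <= inverse_const p CARD('n) * (LBINT y:e. (f y)^2)"
 using inverse_estimate[OF polyfn_line[OF assms(2)] polyfn_continuous[OF assms(2)]
   simplex_compact[OF assms(1)] simplex_convex[OF assms(1)] assms(3)] by simp

lemma square_component_le: "((v :: real^'n) $ i)^2 <= v \<bullet> v"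
 by (metis abs_ge_zero component_le_norm_cart power2_abs power2_norm_eq_inner power_mono)

lemma polyfn_zero_of_L2:
 fixes e :: "(real^'n) set"
 assumes "full_simplex e" "polyfn p f" "(LBINT y:e. (f y)^2) = 0" "x \<in> e"
 shows "f x = 0"
 using simplex_inverse_estimate[OF assms(1,2,4)] assms(3) simplex_measure_pos[OF assms(1)]
 by (simp add: mult_le_0_iff)

lemma polyfn_field_zero:
 fixes e :: "(real^'n) set" and q :: "real^'n => real^'n"
 assumes e: "full_simplex e" and q: "!!i. polyfn k (%x. q x $ i)" and z: "(LBINT x:e. q x \<bullet> q x) = 0" and x: "x \<in> e"
 shows "q x = 0"
proof -
 have "q x $ i = 0" for i
 proof (rule polyfn_zero_of_L2[OF e q _ x])
  have "(LBINT y:e. (q y $ i)^2) <= (LBINT x:e. q x \<bullet> q x)"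
  proof (rule set_integral_mono)
   show "set_integrable lborel e (%y. (q y $ i)^2)"
    using polyfn_set_integrable[OF polyfn_mult[OF q q] simplex_compact[OF e]] by (simp add: power2_eq_square)
   show "set_integrable lborel e (%x. q x \<bullet> q x)"
    by (rule polyfn_set_integrable[OF polyfn_inner_components[OF q q] simplex_compact[OF e]])
   show "(q y $ i)^2 <= q y \<bullet> q y" for y by (rule square_component_le)
  qed
  moreover have "0 <= (LBINT y:e. (q y $ i)^2)"
   unfolding set_lebesgue_integral_def by (intro integral_nonneg_AE) auto
  ultimately show "(LBINT y:e. (q y $ i)^2) = 0" using z by linarith
 qed
 then show ?thesis by (simp add: vec_eq_iff)
qed

lemma area_pos:
 fixes e :: "(real^'n) set"
 assumes e: "full_simplex e" "a \<in> verts e"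
 shows "area (opp_face e a) = real CARD('n) * vol e * norm (bary_grad e a)" "0 < area (opp_face e a)"
proof -
 have "real (CARD('n) + 0) * (LBINT y:e. 1) = surface_integral (opp_face e a) (%_. 1) / norm (bary_grad e a)"
  by (rule cone_formula(2)[OF e, where B=1]) auto
 moreover have "(LBINT y:e. 1) = vol e"
  using simplex_compact[OF e(1)] by (simp add: set_lebesgue_integral_def borel_compact)
 ultimately show "area (opp_face e a) = real CARD('n) * vol e * norm (bary_grad e a)"
  using bary_grad_nonzero[OF e] by (simp add: area_def field_simps)
 then show "0 < area (opp_face e a)" using bary_grad_nonzero[OF e] simplex_measure_pos[OF e(1)] by simp
qed

lemma polyfn_zero_of_face_L2:
 fixes e :: "(real^'n) set"
 assumes e: "full_simplex e" "a \<in> verts e" and f: "polyfn p f"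
  and z: "surface_integral (opp_face e a) (%x. (f x)^2) = 0" "x \<in> opp_face e a"
 shows "f x = 0"
 using surface_inverse_estimate[OF opp_face_flat[OF e] opp_face_convex[OF e] z(2) f] z(1) area_pos(2)[OF e]
 by (simp add: mult_le_0_iff)

text \<open>Testing with the solution itself gives \<open>q = 0\<close> and \<open>\<tau> u\<^sup>2 = 0\<close> on the boundary. Without
  stabilization \<open>u\<close> is orthogonal to the range of the divergence, hence zero. With stabilization \<open>u\<close>
  vanishes on the boundary, and testing the first equation with \<open>grad u\<close> shows that \<open>u\<close> is constant.\<close>

lemma homogeneous_local_problem:
 fixes e :: "(real^'n) set"
 assumes e: "full_simplex e" and p: "p \<ge> 1" and c: "c > (0::real)"
  and u: "u \<in> V_loc S p" and q: "q \<in> W_loc S p"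
  and \<tau>: "if S = LDG_H \<or> S = EDG then \<forall>a\<in>verts e. 0 < \<tau> (opp_face e a) else \<forall>a\<in>verts e. \<tau> (opp_face e a) = 0"
  and H1: "!!r. r \<in> W_loc S p ==> (1 / c) * (LBINT x:e. q x \<bullet> r x) - (LBINT x:e. u x * divergence r x) = 0"
  and H2: "!!v. v \<in> V_loc S p ==> bdry_integral e (%F x. (q x \<bullet> outer_normal e F + \<tau> F * u x) * v x) -
    (LBINT x:e. q x \<bullet> grad v x) = 0"
  and x: "x \<in> e"
 shows "u x = 0" "q x = 0"
proof -
 have up: "polyfn p u" by (rule V_loc_polyfn[OF u])
 have qp: "!!i. polyfn (Suc p) (%x. q x $ i)" by (rule W_loc_polyfn[OF q])
 have u2: "polyfn (p + p) (%x. (u x)^2)" using polyfn_mult[OF up up] by (simp add: power2_eq_square)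
 have \<tau>0: "0 <= \<tau> (opp_face e a)" if "a \<in> verts e" for a using \<tau> that by (auto split: if_splits simp: less_imp_le)
 have split: "bdry_integral e (%F x. (q x \<bullet> outer_normal e F + \<tau> F * u x) * u x) =
  bdry_integral e (%F x. u x * (q x \<bullet> outer_normal e F)) + (\<Sum>a\<in>verts e. \<tau> (opp_face e a) * surface_integral (opp_face e a) (%x. (u x)^2))"
  unfolding bdry_integral_simplex[OF e] sum.distrib[symmetric]
 proof (intro sum.cong refl)
  fix a assume a: "a \<in> verts e"
  let ?F = "opp_face e a"
  have i1: "integrable (face_measure ?F) (%x. u x * (q x \<bullet> outer_normal e ?F))"
   using polyfn_mult[OF up polyfn_inner_components[OF qp, of 0 "%_. outer_normal e ?F"]] polyfn.const
   by (intro polyfn_surface_integrable[OF opp_face_flat[OF e a]]) auto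
  have i2: "integrable (face_measure ?F) (%x. (u x)^2)"
   by (intro polyfn_surface_integrable[OF opp_face_flat[OF e a] u2])
  show "surface_integral ?F (%x. (q x \<bullet> outer_normal e ?F + \<tau> ?F * u x) * u x) =
   surface_integral ?F (%x. u x * (q x \<bullet> outer_normal e ?F)) + \<tau> ?F * surface_integral ?F (%x. (u x)^2)"
  proof -
   have "(%x. (q x \<bullet> outer_normal e ?F + \<tau> ?F * u x) * u x) = (%x. u x * (q x \<bullet> outer_normal e ?F) + \<tau> ?F * (u x)^2)"
    by (auto simp: algebra_simps power2_eq_square)
   then show ?thesis using i1 i2 by simp
  qed
 qed
 have "(1 / c) * (LBINT x:e. q x \<bullet> q x) + (\<Sum>a\<in>verts e. \<tau> (opp_face e a) * surface_integral (opp_face e a) (%x. (u x)^2)) = 0"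
  using H1[OF q] H2[OF u] split integration_by_parts[OF e up qp] by linarith
 moreover have qq0: "0 <= (LBINT x:e. q x \<bullet> q x)"
  unfolding set_lebesgue_integral_def by (intro integral_nonneg_AE) auto
 moreover have surf0: "0 <= surface_integral (opp_face e a) (%x. (u x)^2)" for a by (intro integral_nonneg_AE) auto
 ultimately have z: "(LBINT x:e. q x \<bullet> q x) = 0"
  "(\<Sum>a\<in>verts e. \<tau> (opp_face e a) * surface_integral (opp_face e a) (%x. (u x)^2)) = 0"
  using c \<tau>0 by (smt (verit) divide_nonneg_pos mult_nonneg_nonneg mult_pos_pos sum_nonneg zero_less_divide_1_iff)+
 have q0: "q x = 0" if "x \<in> e" for x by (rule polyfn_field_zero[OF e qp z(1) that])
 have H1': "(LBINT x:e. u x * divergence r x) = 0" if "r \<in> W_loc S p" for r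
 proof -
  have "(LBINT x:e. q x \<bullet> r x) = 0"
   unfolding set_lebesgue_integral_def using q0 by (intro Bochner_Integration.integral_eq_zero_AE) (auto simp: indicator_def)
  then show ?thesis using H1[OF that] by simp
 qed
 show "q x = 0" by (rule q0[OF x])
 show "u x = 0"
 proof (cases "S = LDG_H \<or> S = EDG")
  case False
  then have "S = RT_H \<or> S = BDM_H" by (cases S) auto
  from divergence_surjective[OF this p u] obtain r where "r \<in> W_loc S p" "!!x. divergence r x = u x" by blast
  with H1'[of r] have "(LBINT x:e. (u x)^2) = 0" by (simp add: power2_eq_square)
  then show ?thesis by (rule polyfn_zero_of_L2[OF e up _ x])
 next
  case True
  have "\<tau> (opp_face e a) * surface_integral (opp_face e a) (%x. (u x)^2) = 0" if "a \<in> verts e" for a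
   using z(2) \<tau>0 surf0 that simplex_verts(2)[OF e] by (subst (asm) sum_nonneg_eq_0_iff) auto
  then have face0: "surface_integral (opp_face e a) (%x. (u x)^2) = 0" if "a \<in> verts e" for a
   using \<tau> True that by fastforce
  have u0: "u y = 0" if "a \<in> verts e" "y \<in> opp_face e a" for a y
   by (rule polyfn_zero_of_face_L2[OF e that(1) up face0[OF that(1)] that(2)])
  have gW: "grad u \<in> W_loc S p" using True polyfn_grad[OF up] by (auto simp: vec_polys_def polys_iff_polyfn)
  have gp: "!!i. polyfn p (%x. grad u x $ i)" by (rule polyfn_grad[OF up])
  have "bdry_integral e (%F x. u x * (grad u x \<bullet> outer_normal e F)) = 0"
   unfolding bdry_integral_simplex[OF e]
  proof (intro sum.neutral ballI)
   fix a assume a: "a \<in> verts e"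
   have "surface_integral (opp_face e a) (%x. u x * (grad u x \<bullet> outer_normal e (opp_face e a))) =
    surface_integral (opp_face e a) (%x. 0)"
    using polyfn_borel[OF polyfn_mult[OF up polyfn_inner_components[OF gp, of 0 "%_. outer_normal e (opp_face e a)"]]] polyfn.const u0[OF a]
    by (intro surface_integral_cong[OF opp_face_flat[OF e a]]) auto
   then show "surface_integral (opp_face e a) (%x. u x * (grad u x \<bullet> outer_normal e (opp_face e a))) = 0" by simp
  qed
  then have gg: "(LBINT x:e. grad u x \<bullet> grad u x) = 0"
   using integration_by_parts[OF e up gp] H1'[OF gW] by simp
  have g0: "grad u x = 0" if "x \<in> e" for x by (rule polyfn_field_zero[OF e gp gg that])
  obtain a where a: "a \<in> verts e" using verts_nonempty[OF e] by blast
  obtain y where y: "y \<in> opp_face e a" using opp_face_flat[OF e a] by (auto simp: flat_def)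
  have "\<exists>k. \<forall>x\<in>e. u x = k"
  proof (rule has_derivative_zero_constant[OF simplex_convex[OF e]])
   show "(u has_derivative (%h. 0)) (at x within e)" if "x \<in> e" for x
    using polyfn_gderiv[OF up, of x] g0[OF that] by (auto simp: gderiv_def intro: has_derivative_at_withinI)
  qed
  then show ?thesis using u0[OF a y] x y by (auto simp: opp_face_def)
 qed
qed

section \<open>Vertex stars in a triangulation\<close>

lemma negligible_affine_zero:
 fixes g :: "'a::euclidean_space"
 assumes "h0 + g \<bullet> w \<noteq> 0" shows "negligible {z. h0 + g \<bullet> z = 0}"
proof (cases "g = 0")
 case False
 then have "negligible {z. g \<bullet> z = - h0}" by (intro negligible_hyperplane) auto
 moreover have "{z. h0 + g \<bullet> z = 0} = {z. g \<bullet> z = - h0}" by auto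
 ultimately show ?thesis by simp
qed (use assms in auto)

lemma negligible_UN:
 "finite I ==> (!!i. i \<in> I ==> negligible (A i)) ==> negligible (\<Union>i\<in>I. A i)"
 by (induction I rule: finite_induct) auto

lemma open_avoids_negligible:
 "open (U :: 'a::euclidean_space set) ==> U \<noteq> {} ==> negligible N ==> \<exists>z\<in>U. z \<notin> N"
 using open_not_negligible[of U] negligible_subset[of N U] by blast

lemma rtrancl_avoid:
 "(a, b) \<in> r\<^sup>* ==> b = a \<or> (\<exists>c. (a, c) \<in> r \<and> c \<noteq> a \<and> (c, b) \<in> (r \<inter> (- {a}) \<times> (- {a}))\<^sup>*)"
proof (induction rule: rtrancl_induct)
 case (step b b')
 show ?case
 proof (cases "b' = a")
  case False
  show ?thesis
  proof (cases "b = a")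
   case True
   then show ?thesis using step False by auto
  next
   case nb: False
   then obtain c where c: "(a, c) \<in> r" "c \<noteq> a" "(c, b) \<in> (r \<inter> (- {a}) \<times> (- {a}))\<^sup>*" using step by blast
   have "(b, b') \<in> r \<inter> (- {a}) \<times> (- {a})" using step(2) nb False by auto
   with c show ?thesis by (meson rtrancl.rtrancl_into_rtrancl)
  qed
 qed simp
qed simp

text \<open>Induction along a path inside a finite set that never returns to its starting point.\<close>

lemma rtrancl_finite_induct:
 assumes fin: "finite P" and path: "(a, b) \<in> (r \<inter> P \<times> P)\<^sup>*" and a: "a \<in> P"
  and base: "!!P a. finite P ==> a \<in> P ==> Q P a a"
  and step: "!!P a c b. finite P ==> a \<in> P ==> c \<in> P - {a} ==> (a, c) \<in> r ==> Q (P - {a}) c b ==> Q P a b"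
 shows "Q P a b"
 using fin path a
proof (induction P arbitrary: a rule: finite_psubset_induct)
 case (psubset P)
 show ?case
 proof (cases "b = a")
  case True
  then show ?thesis using base psubset by blast
 next
  case False
  then obtain c where c: "(a, c) \<in> r \<inter> P \<times> P" "c \<noteq> a" "(c, b) \<in> ((r \<inter> P \<times> P) \<inter> (- {a}) \<times> (- {a}))\<^sup>*"
   using rtrancl_avoid[OF psubset(3)] by blast
  have "(r \<inter> P \<times> P) \<inter> (- {a}) \<times> (- {a}) \<subseteq> r \<inter> (P - {a}) \<times> (P - {a})" by auto
  then have "(c, b) \<in> (r \<inter> (P - {a}) \<times> (P - {a}))\<^sup>*" using c(3) rtrancl_mono by blast
  moreover have "P - {a} \<subset> P" "c \<in> P - {a}" using psubset(4) c by auto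
  ultimately have "Q (P - {a}) c b" using psubset(2) by blast
  then show ?thesis using c psubset(1,4) by (intro step[of P a c b]) auto
 qed
qed

lemma negligible_bary_zero:
 assumes "full_simplex e" "a \<in> verts e" shows "negligible {z. bary e a z = 0}"
proof -
 define h0 where "h0 = bary e a 0"
 have h: "bary e a z = h0 + bary_grad e a \<bullet> z" for z unfolding h0_def by (rule bary_affine[OF assms])
 have "h0 + bary_grad e a \<bullet> a \<noteq> 0" using bary_vert[OF assms assms(2)] by (simp flip: h)
 from negligible_affine_zero[OF this] show ?thesis by (simp add: h)
qed

text \<open>The second assumption on the domain excludes slits: points of the boundary can be approached from outside of
  the closure. So the interior of the closure is the domain, and a facet inside of the domain has an element on
  either side.\<close>

locale regular_mesh =
 fixes \<kappa> :: real and \<Omega> :: "(real^'n) set" and \<T> :: "(real^'n) set set"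
 assumes mesh: "simplicial_mesh \<kappa> \<Omega> \<T>"
  and open_domain: "open \<Omega>"
  and regular: "frontier \<Omega> \<subseteq> closure (- closure \<Omega>)"
begin

lemma finite_mesh [simp]: "finite \<T>"
 using mesh by (simp add: simplicial_mesh_def triangulation_def)

lemma full: "E \<in> \<T> ==> full_simplex E"
 using mesh by (simp add: simplicial_mesh_def)

lemma Int_face: "E \<in> \<T> ==> E' \<in> \<T> ==> E \<inter> E' face_of E"
 using mesh by (simp add: simplicial_mesh_def triangulation_def)

lemma Union_mesh: "\<Union>\<T> = closure \<Omega>"
 using mesh by (simp add: simplicial_mesh_def)

lemma shape: "E \<in> \<T> ==> \<exists>x r. cball x r \<subseteq> E \<and> 0 < r \<and> diameter E <= \<kappa> * r"
 using mesh by (simp add: simplicial_mesh_def)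

lemma interior_closure_domain: "interior (closure \<Omega>) \<subseteq> \<Omega>"
proof
 fix x assume x: "x \<in> interior (closure \<Omega>)"
 then have "x \<notin> frontier \<Omega>" using regular by (auto simp: closure_complement)
 moreover have "x \<in> closure \<Omega>" using x interior_subset by blast
 ultimately show "x \<in> \<Omega>" using open_domain by (auto simp: frontier_def interior_open)
qed

lemma interior_element: "E \<in> \<T> ==> interior E \<subseteq> \<Omega>"
 using interior_closure_domain interior_mono[of E "closure \<Omega>"] Union_mesh by blast

lemma disjoint_interior:
 assumes E: "E \<in> \<T>" "E' \<in> \<T>" "E \<noteq> E'" shows "E \<inter> interior E' = {}"
proof (cases "E \<inter> E' = E'")
 case False
 have "E \<inter> E' face_of E'" using Int_face[OF E(2,1)] by (simp add: Int_commute)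
 then have "(E \<inter> E') \<inter> interior E' = {}" using False by (rule face_of_disjoint_interior)
 then show ?thesis using interior_subset by blast
next
 case True
 then have "E' face_of E" "E' \<subseteq> E" using Int_face[OF E(1,2)] by auto
 then have "E' \<inter> interior E = {}" using E(3) by (intro face_of_disjoint_interior) auto
 then have "interior E' = {}" using interior_mono[OF \<open>E' \<subseteq> E\<close>] interior_subset[of E'] by blast
 then show ?thesis by simp
qed

lemma closure_interior_element: "E \<in> \<T> ==> closure (interior E) = E"
 using convex_closure_interior[OF simplex_convex[OF full] simplex_interior_nonempty[OF full]]
  compact_imp_closed[OF simplex_compact[OF full]] closure_closed by blast

text \<open>A relative interior point of the facet that lies in the domain is a limit of points of the domain outside of
  \<open>E\<close>, hence belongs to a second element. The common face contains the facet, because it contains that point, and it is a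
  proper face of \<open>E\<close>.\<close>

lemma facet_dichotomy:
 assumes E: "E \<in> \<T>" and F: "F facet_of E" and nf: "\<not> F \<subseteq> frontier \<Omega>"
 shows "\<exists>E'\<in>\<T>. E' \<noteq> E \<and> F facet_of E'"
proof -
 have dimE: "aff_dim E'' = int CARD('n)" if "E'' \<in> \<T>" for E'' using aff_dim_simplex[OF full[OF that]] by simp
 have Fd: "F face_of E" "F \<noteq> {}" "aff_dim F = int CARD('n) - 1" using F dimE[OF E] by (auto simp: facet_of_def)
 have Fc: "convex F" using Fd(1) simplex_convex[OF full[OF E]] face_of_imp_convex by blast
 have "F \<subseteq> closure (rel_interior F)" using convex_closure_rel_interior[OF Fc] closure_subset by metis
 then obtain y where y: "y \<in> rel_interior F" "y \<notin> frontier \<Omega>"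
  using nf closure_minimal[OF _ frontier_closed[of \<Omega>]] by blast
 have yF: "y \<in> F" "y \<in> E" using y(1) rel_interior_subset face_of_imp_subset[OF Fd(1)] by blast+
 then have y\<Omega>: "y \<in> \<Omega>" using y(2) E Union_mesh open_domain by (auto simp: frontier_def interior_open)
 obtain a where a: "a \<in> verts E" "F = opp_face E a" using F facet_iff[OF full[OF E]] by blast
 let ?U = "\<Union>(\<T> - {E})"
 have cl: "closed ?U" using simplex_compact[OF full] by (intro closed_Union) (auto intro: compact_imp_closed)
 have "y \<in> closure ?U"
 proof (rule closure_approachable[THEN iffD2], intro allI impI)
  fix \<epsilon> :: real assume "\<epsilon> > 0"
  obtain \<delta> where \<delta>: "\<delta> > 0" "ball y \<delta> \<subseteq> \<Omega>" using open_domain y\<Omega> open_contains_ball by blast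
  define t where "t = min \<delta> \<epsilon> / 2"
  have t: "0 < t" "t < \<delta>" "t < \<epsilon>" using \<delta>(1) \<open>\<epsilon> > 0\<close> by (auto simp: t_def)
  define g where "g = bary_grad E a"
  have g: "g \<noteq> 0" unfolding g_def by (rule bary_grad_nonzero[OF full[OF E] a(1)])
  define z where "z = y - (t / norm g) *\<^sub>R g"
  have d: "dist z y = t" using t g by (simp add: z_def dist_norm)
  have "bary E a z = bary E a y - t * norm g"
   using bary_diff[OF full[OF E] a(1), of z y] g
   by (simp add: z_def g_def[symmetric] power2_norm_eq_inner[symmetric] power2_eq_square)
  moreover have "bary E a y = 0" using yF(1) a(2) by (simp add: opp_face_def)
  ultimately have "bary E a z < 0" using t(1) g by simp
  then have "z \<notin> E" using a(1) simplex_iff_bary[OF full[OF E], of z] by (meson not_le)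
  moreover have "z \<in> \<Union>\<T>" using \<delta>(2) d t Union_mesh closure_subset[of \<Omega>] by (auto simp: dist_commute)
  ultimately show "\<exists>z\<in>?U. dist z y < \<epsilon>" using d t(3) by blast
 qed
 then obtain E' where E': "E' \<in> \<T>" "E' \<noteq> E" "y \<in> E'" using cl by auto
 let ?G = "E \<inter> E'"
 have G: "?G face_of E" "?G face_of E'" using Int_face[OF E E'(1)] Int_face[OF E'(1) E] by (auto simp: Int_commute)
 have "?G \<noteq> E" "?G \<noteq> E'"
  using disjoint_interior[OF E'(1) E] disjoint_interior[OF E E'(1)] E'(2) interior_subset
   simplex_interior_nonempty[OF full[OF E]] simplex_interior_nonempty[OF full[OF E'(1)]] by blast+
 then have dG: "aff_dim ?G < int CARD('n)"
  using face_of_aff_dim_lt[OF simplex_convex[OF full[OF E]] G(1)] dimE[OF E] by simp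
 have FG: "F \<subseteq> ?G"
  using y(1) yF E' face_of_imp_subset[OF Fd(1)] by (intro subset_of_face_of[OF G(1)]) auto
 then have "F face_of ?G" using face_of_subset[OF Fd(1)] by blast
 moreover have "\<not> aff_dim F < aff_dim ?G" using dG Fd(3) by simp
 moreover have "convex ?G" by (intro convex_Int simplex_convex[OF full] E E'(1))
 ultimately have "F = ?G" using face_of_aff_dim_lt by blast
 then have "F facet_of E'" using G(2) Fd dimE[OF E'(1)] by (simp add: facet_of_def)
 then show ?thesis using E' by blast
qed

text \<open>Near a relative interior point of a common facet, every point has a nonnegative coordinate with
  respect to the vertex of \<open>E\<close> or of \<open>E'\<close> opposite to the facet: otherwise the two simplices would lie on
  the same side and overlap.\<close>

lemma shared_facet_interior:
 assumes E: "E \<in> \<T>" "E' \<in> \<T>" "E \<noteq> E'" and a: "a \<in> verts E"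
  and F: "opp_face E a facet_of E'" and y: "bary E a y = 0" "!!b. b \<in> verts E ==> b \<noteq> a ==> 0 < bary E b y"
 shows "y \<in> interior (E \<union> E')"
proof -
 note s = full[OF E(1)] and s' = full[OF E(2)]
 obtain a' where a': "a' \<in> verts E'" "opp_face E a = opp_face E' a'" using F facet_iff[OF s'] by blast
 have V: "verts E - {a} = verts E' - {a'}"
 proof -
  have ext: "{x. x extreme_point_of (opp_face G b)} = verts G - {b}" if "full_simplex G" "b \<in> verts G" for G b
   using extreme_point_of_convex_hull_affine_independent[OF affine_independent_subset[OF simplex_verts(1)[OF that(1)]], of "verts G - {b}"]
    opp_face_hull[OF that] by auto
  show ?thesis using ext[OF s a] ext[OF s' a'(1)] a'(2) by simp
 qed
 define c where "c = bary E' a' a"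
 have scal: "bary E' a' z = c * bary E a z" for z
 proof -
  have "bary E' a' z = (\<Sum>b\<in>verts E. bary E b z * bary E' a' b)"
   by (rule affine_bary[OF s, of _ "bary E' a' 0" "bary_grad E' a'"]) (rule bary_affine[OF s' a'(1)])
  also have "... = (\<Sum>b\<in>verts E. if b = a then c * bary E a z else 0)"
  proof (intro sum.cong refl)
   fix b assume b: "b \<in> verts E"
   show "bary E b z * bary E' a' b = (if b = a then c * bary E a z else 0)"
   proof (cases "b = a")
    case False
    with b V have "b \<in> verts E'" "b \<noteq> a'" by blast+
    with False bary_vert[OF s' a'(1), of b] show ?thesis by simp
   qed (simp add: c_def)
  qed
  finally show ?thesis using a simplex_verts(2)[OF s] by simp
 qed
 have cnz: "c \<noteq> 0" using scal[of a'] bary_vert[OF s' a'(1) a'(1)] by auto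
 have same: "bary E' b y = bary E b y" if b: "b \<in> verts E - {a}" for b
 proof -
  let ?u = "%b. if b = a' then 0 else bary E b y"
  have "sum ?u (verts E') = (\<Sum>b\<in>verts E' - {a'}. bary E b y)"
   using a'(1) simplex_verts(2)[OF s'] by (subst sum.remove[of _ a']) (auto intro!: sum.cong)
  also have "... = (\<Sum>b\<in>verts E. bary E b y)"
   using a y(1) simplex_verts(2)[OF s] by (subst sum.remove[of "verts E" a]) (auto simp: V)
  finally have 1: "sum ?u (verts E') = 1" by (simp add: bary_sum[OF s])
  have "(\<Sum>b\<in>verts E'. ?u b *\<^sub>R b) = (\<Sum>b\<in>verts E' - {a'}. bary E b y *\<^sub>R b)"
   using a'(1) simplex_verts(2)[OF s'] by (subst sum.remove[of _ a']) (auto intro!: sum.cong)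
  also have "... = (\<Sum>b\<in>verts E. bary E b y *\<^sub>R b)"
   using a y(1) simplex_verts(2)[OF s] by (subst sum.remove[of "verts E" a]) (auto simp: V)
  finally have 2: "(\<Sum>b\<in>verts E'. ?u b *\<^sub>R b) = y" by (simp add: bary_sum[OF s])
  have "bary E' b y = ?u b" using b V by (intro bary_unique[OF s' 1 2]) auto
  then show ?thesis using b V by auto
 qed
 define N where "N = (\<Inter>b\<in>verts E - {a}. {z. 0 < bary E b z}) \<inter> (\<Inter>b\<in>verts E' - {a'}. {z. 0 < bary E' b z})"
 have N: "open N" unfolding N_def
  using simplex_verts(2)[OF s] simplex_verts(2)[OF s']
  by (intro open_Int open_INT ballI open_Collect_less continuous_on_const bary_continuous[OF s] bary_continuous[OF s']) auto
 have yN: "y \<in> N" using y(2) same V by (auto simp: N_def)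
 have "\<not> c > 0"
 proof
  assume c: "c > 0"
  define g where "g = bary_grad E a"
  obtain \<delta> where \<delta>: "\<delta> > 0" "ball y \<delta> \<subseteq> N" using N yN open_contains_ball by blast
  have g: "g \<noteq> 0" unfolding g_def by (rule bary_grad_nonzero[OF s a])
  define z where "z = y + (\<delta> / 2 / norm g) *\<^sub>R g"
  have "z \<in> N" using \<delta> g by (intro subsetD[OF \<delta>(2)]) (simp add: z_def dist_norm)
  moreover have pos: "bary E a z > 0"
  proof -
   have "bary E a z = g \<bullet> (z - y)" using bary_diff[OF s a, of z y] y(1) by (simp add: g_def)
   also have "... = (\<delta> / 2 / norm g) * (norm g)^2" by (simp add: z_def power2_norm_eq_inner)
   finally show ?thesis using \<delta>(1) g by simp
  qed
  ultimately have "z \<in> interior E" "z \<in> interior E'"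
   using scal[of z] c by (auto intro!: bary_pos_interior[OF s] bary_pos_interior[OF s'] simp: N_def)
  then show False using disjoint_interior[OF E] interior_subset by blast
 qed
 then have c: "c < 0" using cnz by simp
 have "N \<subseteq> E \<union> E'"
 proof
  fix z assume z: "z \<in> N"
  show "z \<in> E \<union> E'"
  proof (cases "0 <= bary E a z")
   case True
   then have "0 <= bary E b z" if "b \<in> verts E" for b
    using z that by (cases "b = a") (auto simp: N_def intro: less_imp_le)
   then show ?thesis using simplex_iff_bary[OF s] by blast
  next
   case False
   then have "0 <= bary E' a' z" using scal[of z] c by (simp add: mult_nonpos_nonpos)
   then have "0 <= bary E' b z" if "b \<in> verts E'" for b
    using z that by (cases "b = a'") (auto simp: N_def intro: less_imp_le)
   then show ?thesis using simplex_iff_bary[OF s'] by blast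
  qed
 qed
 then show ?thesis using N yN by (auto simp: interior_def)
qed

text \<open>Elements are connected around a point \<open>x\<close> through facets that contain \<open>x\<close>, since traces are only
  compared across facets.\<close>

definition adj :: "real^'n => ((real^'n) set \<times> (real^'n) set) set" where
 "adj x = {(E, E'). E \<in> \<T> \<and> E' \<in> \<T> \<and> (\<exists>F. F facet_of E \<and> F facet_of E' \<and> x \<in> F)}"

definition reach :: "real^'n => (real^'n) set => (real^'n) set set" where
 "reach x E = {E'. (E, E') \<in> (adj x)\<^sup>*}"

lemma reach_refl: "E \<in> reach x E"
 by (simp add: reach_def)

lemma reach_star:
 assumes "E \<in> \<T>" "x \<in> E" "E' \<in> reach x E" shows "E' \<in> \<T>" "x \<in> E'"
proof -
 have "(E, E') \<in> (adj x)\<^sup>*" using assms(3) by (simp add: reach_def)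
 then have "E' \<in> \<T> \<and> x \<in> E'"
  using assms(1,2) by (induction rule: rtrancl_induct) (auto simp: adj_def facet_of_def dest: face_of_imp_subset)
 then show "E' \<in> \<T>" "x \<in> E'" by auto
qed

text \<open>If no element reached from \<open>E\<^sub>0\<close> has a boundary facet at \<open>x\<close>, then the reached elements cover a
  neighbourhood of \<open>x\<close>: a generic segment from \<open>E\<^sub>0\<close> to an uncovered point would leave their union
  through the relative interior of a facet.\<close>

lemma reach_covers:
 assumes E0: "E0 \<in> \<T>" "x \<in> E0"
  and nb: "!!E F. E \<in> reach x E0 ==> F facet_of E ==> x \<in> F ==> \<not> F \<subseteq> frontier \<Omega>"
 shows "\<exists>\<rho>>0. ball x \<rho> \<subseteq> \<Union>(reach x E0)"
proof -
 let ?C = "reach x E0"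
 have CT: "E \<in> \<T>" "x \<in> E" if "E \<in> ?C" for E using reach_star[OF E0 that] by auto
 have finC: "finite ?C" using CT by (intro finite_subset[OF _ finite_mesh]) auto
 have clC: "closed (\<Union>?C)" using finC CT simplex_compact[OF full] by (intro closed_Union) (auto intro: compact_imp_closed)
 define N where "N = (\<Inter>E\<in>?C. \<Inter>a\<in>{a\<in>verts E. 0 < bary E a x}. {z. 0 < bary E a z})"
 have "open N" unfolding N_def
  using finC CT full simplex_verts(2)[OF full]
  by (intro open_INT ballI open_Collect_less continuous_on_const bary_continuous) auto
 moreover have "x \<in> N" by (auto simp: N_def)
 ultimately obtain \<rho> where \<rho>: "\<rho> > 0" "ball x \<rho> \<subseteq> N" using open_contains_ball by blast
 have "ball x \<rho> \<subseteq> \<Union>?C"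
 proof (rule ccontr)
  assume "\<not> ball x \<rho> \<subseteq> \<Union>?C"
  then have ne: "ball x \<rho> \<inter> - \<Union>?C \<noteq> {}" by blast
  have "x \<in> closure (interior E0)" using E0 closure_interior_element by simp
  then obtain z0 where "z0 \<in> interior E0" "dist z0 x < \<rho>" using \<rho>(1) closure_approachable by blast
  then have neN: "ball x \<rho> \<inter> interior E0 \<noteq> {}" by (auto simp: dist_commute)
  have negN: "negligible (\<Union>E\<in>?C. \<Union>a\<in>verts E. {z. bary E a z = 0})"
  proof (intro negligible_UN finC)
   fix E a assume E: "E \<in> ?C" and a: "a \<in> verts E"
   show "negligible {z. bary E a z = 0}" by (rule negligible_bary_zero[OF full[OF CT(1)[OF E]] a])
  qed (use simplex_verts(2)[OF full] CT in auto)
  obtain p where p': "p \<in> ball x \<rho> \<inter> interior E0" "p \<notin> (\<Union>E\<in>?C. \<Union>a\<in>verts E. {z. bary E a z = 0})"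
   using open_avoids_negligible[OF open_Int[OF open_ball open_interior] neN negN] by (rule bexE)
  then have p: "p \<in> ball x \<rho>" "p \<in> interior E0" "!!E a. E \<in> ?C ==> a \<in> verts E ==> bary E a p \<noteq> 0"
   by auto
  define H where "H E a b = {q. bary E a q * bary E b p - bary E b q * bary E a p = 0}" for E a b
  have "negligible (\<Union>E\<in>?C. \<Union>a\<in>verts E. \<Union>b\<in>verts E - {a}. H E a b)"
  proof (intro negligible_UN finC)
   fix E a b assume E: "E \<in> ?C" and a: "a \<in> verts E" and b: "b \<in> verts E - {a}"
   note s = full[OF CT(1)[OF E]]
   define h0 g where "h0 = bary E a 0 * bary E b p - bary E b 0 * bary E a p"
    and "g = bary E b p *\<^sub>R bary_grad E a - bary E a p *\<^sub>R bary_grad E b"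
   have h: "bary E a q * bary E b p - bary E b q * bary E a p = h0 + g \<bullet> q" for q
    using bary_affine[OF s a, of q] bary_affine[OF s, of b q] b by (simp add: h0_def g_def inner_diff_left algebra_simps)
   have "h0 + g \<bullet> a \<noteq> 0"
    using bary_vert[OF s, of a a] bary_vert[OF s, of b a] a b p(3)[OF E, of b] by (simp add: h[symmetric])
   then show "negligible (H E a b)" using negligible_affine_zero[of h0 g a] by (simp add: H_def h)
  qed (use simplex_verts(2)[OF full] CT in auto)
  moreover have "open (ball x \<rho> \<inter> - \<Union>?C)" using clC by (intro open_Int) auto
  ultimately obtain q where q: "q \<in> ball x \<rho>" "q \<notin> \<Union>?C" "!!E a b. E \<in> ?C ==> a \<in> verts E ==> b \<in> verts E - {a} ==> q \<notin> H E a b"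
   using open_avoids_negligible[OF _ ne] by (smt (verit, del_insts) ComplD IntD1 IntD2 UN_I)
  have seg: "closed_segment p q \<subseteq> ball x \<rho>" using p(1) q(1) convex_ball by (simp add: closed_segment_subset)
  have key: "z \<in> interior (\<Union>?C)" if z: "z \<in> closed_segment p q" "z \<in> \<Union>?C" for z
  proof -
   obtain E where E: "E \<in> ?C" "z \<in> E" using z(2) by blast
   note s = full[OF CT(1)[OF E(1)]]
   obtain t where t: "z = p + t *\<^sub>R (q - p)" using z(1) by (auto simp: closed_segment_def algebra_simps)
   have two: "\<not> (bary E a z = 0 \<and> bary E b z = 0)" if ab: "a \<in> verts E" "b \<in> verts E - {a}" for a b
   proof
    assume zz: "bary E a z = 0 \<and> bary E b z = 0"
    have e1: "(1 - t) * bary E a p + t * bary E a q = 0" "(1 - t) * bary E b p + t * bary E b q = 0"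
     using zz bary_line[OF s ab(1), of p t q] bary_line[OF s, of b p t q] ab(2) t by auto
    have "t \<noteq> 0" using e1 p(3)[OF E(1) ab(1)] by auto
    have ta: "t * bary E a q = - ((1 - t) * bary E a p)" and tb: "t * bary E b q = - ((1 - t) * bary E b p)"
     using e1 by linarith+
    have "t * (bary E a q * bary E b p - bary E b q * bary E a p) =
     (t * bary E a q) * bary E b p - (t * bary E b q) * bary E a p" by (simp add: algebra_simps)
    also have "... = 0" unfolding ta tb by (simp add: algebra_simps)
    finally have "q \<in> H E a b" using \<open>t \<noteq> 0\<close> by (simp add: H_def)
    with q(3)[OF E(1) ab] show False by blast
   qed
   show ?thesis
   proof (cases "\<exists>a\<in>verts E. bary E a z = 0")
    case False
    then have "z \<in> interior E" using E(2) simplex_iff_bary[OF s] by (intro bary_pos_interior[OF s]) force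
    then show ?thesis using E(1) interior_mono[of E "\<Union>?C"] by blast
   next
    case True
    then obtain a where a: "a \<in> verts E" "bary E a z = 0" by blast
    then have zpos: "0 < bary E b z" if "b \<in> verts E" "b \<noteq> a" for b
    proof -
     have "bary E b z \<noteq> 0" using two[of a b] a that by blast
     moreover have "0 <= bary E b z" using E(2) simplex_iff_bary[OF s] that by blast
     ultimately show ?thesis by linarith
    qed
    have "\<not> 0 < bary E a x" using a z(1) seg \<rho>(2) E(1) unfolding N_def by fastforce
    then have "bary E a x = 0" using CT(2)[OF E(1)] a(1) simplex_iff_bary[OF s] by force
    then have xF: "x \<in> opp_face E a" using CT(2)[OF E(1)] by (simp add: opp_face_def)
    have F: "opp_face E a facet_of E" using facet_iff[OF s] a(1) by blast
    from facet_dichotomy[OF CT(1)[OF E(1)] F nb[OF E(1) F xF]]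
    obtain E' where E': "E' \<in> \<T>" "E' \<noteq> E" "opp_face E a facet_of E'" by blast
    then have "(E, E') \<in> adj x" using F xF CT(1)[OF E(1)] by (auto simp: adj_def)
    then have "E' \<in> ?C" using E(1) by (auto simp: reach_def)
    moreover have "z \<in> interior (E \<union> E')"
     using E' a zpos CT(1)[OF E(1)] by (intro shared_facet_interior[of E E' a]) auto
    ultimately show ?thesis using E(1) interior_mono[of "E \<union> E'" "\<Union>?C"] by blast
   qed
  qed
  have "interior (\<Union>?C) \<inter> closed_segment p q = {} \<or> - \<Union>?C \<inter> closed_segment p q = {}"
  proof (rule connectedD[OF connected_segment])
   show "interior (\<Union>?C) \<inter> - \<Union>?C \<inter> closed_segment p q = {}" using interior_subset[of "\<Union>?C"] by blast
   show "closed_segment p q \<subseteq> interior (\<Union>?C) \<union> - \<Union>?C" using key by blast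
  qed (use clC in \<open>auto simp: open_Compl\<close>)
  moreover have "p \<in> interior (\<Union>?C)" using p(2) interior_mono[of E0 "\<Union>?C"] reach_refl[of E0 x] by blast
  ultimately show False using q(2) by auto
 qed
 with \<rho>(1) show ?thesis by blast
qed

lemma reach_boundary_facet:
 assumes "E \<in> \<T>" "x \<in> E" "x \<in> frontier \<Omega>"
 shows "\<exists>E'\<in>reach x E. \<exists>F. F facet_of E' \<and> x \<in> F \<and> F \<subseteq> frontier \<Omega>"
proof (rule ccontr)
 assume "\<not> ?thesis"
 then obtain \<rho> where \<rho>: "\<rho> > 0" "ball x \<rho> \<subseteq> \<Union>(reach x E)" using reach_covers[OF assms(1,2)] by blast
 then have "ball x \<rho> \<subseteq> closure \<Omega>" using reach_star[OF assms(1,2)] Union_mesh by blast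
 then have "x \<in> interior (closure \<Omega>)" using \<rho>(1) by (metis centre_in_ball interiorI open_ball)
 then have "x \<in> \<Omega>" using interior_closure_domain by blast
 with assms(3) open_domain show False by (simp add: frontier_def interior_open)
qed

lemma reach_interior_vertex:
 assumes E: "E \<in> \<T>" "x \<in> E" and x: "x \<in> \<Omega>" and E': "E' \<in> \<T>" "x \<in> E'"
 shows "E' \<in> reach x E"
proof -
 have "x \<notin> frontier \<Omega>" using x open_domain by (simp add: frontier_def interior_open)
 then obtain \<rho> where \<rho>: "\<rho> > 0" "ball x \<rho> \<subseteq> \<Union>(reach x E)" using reach_covers[OF E] by blast
 have "x \<in> closure (interior E')" using E' closure_interior_element by simp
 then obtain z where z: "z \<in> interior E'" "z \<in> ball x \<rho>"
  using \<rho>(1) by (auto simp: closure_approachable dist_commute)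
 then obtain E'' where "E'' \<in> reach x E" "z \<in> E''" using \<rho>(2) by blast
 with disjoint_interior[of E'' E'] z(1) E' reach_star[OF E] show ?thesis by blast
qed

lemma in_domain_iff: "x \<in> E ==> E \<in> \<T> ==> x \<in> \<Omega> \<longleftrightarrow> x \<notin> frontier \<Omega>"
 using Union_mesh open_domain by (auto simp: frontier_def interior_open)

lemma finite_reach: "E \<in> \<T> ==> x \<in> E ==> finite (reach x E)"
 using reach_star(1) by (intro finite_subset[OF _ finite_mesh]) auto

lemma reach_path:
 assumes "E' \<in> reach x E" shows "(E, E') \<in> (adj x \<inter> reach x E \<times> reach x E)\<^sup>*"
proof -
 have "(E, E') \<in> (adj x)\<^sup>*" using assms by (simp add: reach_def)
 then show ?thesis
 proof (induction rule: rtrancl_induct)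
  case (step y z)
  then have "(y, z) \<in> adj x \<inter> reach x E \<times> reach x E" by (auto simp: reach_def)
  with step show ?case by (meson rtrancl.rtrancl_into_rtrancl)
 qed simp
qed

text \<open>The jumps are summed along a path that visits no element twice. An element contributes on entering and
  on leaving, the two ends only once.\<close>

lemma chain_bound:
 fixes v d :: "(real^'n) set => real"
 assumes E: "E \<in> \<T>" "x \<in> E" and d: "!!E'. 0 <= d E'"
  and jump: "!!E1 E2. (E1, E2) \<in> adj x ==> \<bar>v E1 - v E2\<bar> <= d E1 + d E2"
  and E': "E' \<in> reach x E"
 shows "\<bar>v E - v E'\<bar> <= 2 * (\<Sum>E''\<in>reach x E. d E'') - d E - d E'"
 by (rule rtrancl_finite_induct[OF finite_reach[OF E] reach_path[OF E'] reach_refl,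
    where Q="%P a b. \<bar>v a - v b\<bar> <= 2 * sum d P - d a - d b"])
   (use d in \<open>force simp: sum.remove intro: sum_nonneg\<close>, use jump in \<open>fastforce simp: sum.remove\<close>)

lemma chain_comparable:
 fixes s :: "(real^'n) set => real"
 assumes E: "E \<in> \<T>" "x \<in> E" and c: "1 <= c" and s: "!!E'. 0 <= s E'"
  and cmp: "!!E1 E2. (E1, E2) \<in> adj x ==> s E1 <= c * s E2"
  and E': "E' \<in> reach x E"
 shows "s E <= c ^ card (reach x E) * s E'"
proof (rule rtrancl_finite_induct[OF finite_reach[OF E] reach_path[OF E'] reach_refl,
    where Q="%P a b. s a <= c ^ card P * s b"])
 show "s a <= c ^ card P * s a" for P a
  using mult_right_mono[OF one_le_power[OF c, of "card P"] s[of a]] by simp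
 fix P a b e assume P: "finite P" "a \<in> P" "b \<in> P - {a}" "(a, b) \<in> adj x" "s b <= c ^ card (P - {a}) * s e"
 have "s a <= c * s b" by (rule cmp[OF P(4)])
 also have "... <= c * (c ^ card (P - {a}) * s e)" using P(5) c by simp
 also have "... = c ^ card P * s e" using card.remove[OF P(1,2)] by simp
 finally show "s a <= c ^ card P * s e" .
qed

section \<open>Shape regularity\<close>

lemma diameter_pos: assumes "E \<in> \<T>" shows "0 < diameter E"
proof -
 obtain x r where r: "cball x r \<subseteq> E" "0 < r" using shape[OF assms] by blast
 have "bounded E" using simplex_compact[OF full[OF assms]] by (rule compact_imp_bounded)
 then have "diameter (cball x r) <= diameter E" by (rule diameter_subset[OF r(1)])
 then show ?thesis using r(2) by simp
qed

lemma inscribed_ball: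
 assumes "E \<in> \<T>" obtains x r where "cball x r \<subseteq> E" "0 < r" "diameter E <= \<kappa> * r" "2 * r <= diameter E"
proof -
 obtain x r where r: "cball x r \<subseteq> E" "0 < r" "diameter E <= \<kappa> * r" using shape[OF assms] by blast
 have "bounded E" using simplex_compact[OF full[OF assms]] by (rule compact_imp_bounded)
 then have "diameter (cball x r) <= diameter E" by (rule diameter_subset[OF r(1)])
 then have "2 * r <= diameter E" using r(2) by simp
 with r that show thesis by blast
qed

lemma kappa_ge_2: assumes "E \<in> \<T>" shows "2 <= \<kappa>"
proof -
 obtain x r where "cball x r \<subseteq> E" "0 < r" "diameter E <= \<kappa> * r" "2 * r <= diameter E"
  using inscribed_ball[OF assms] by blast
 then have "2 * r <= \<kappa> * r" by linarith
 then show ?thesis using \<open>0 < r\<close> by simp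
qed

lemma dist_le_diameter: "E \<in> \<T> ==> x \<in> E ==> y \<in> E ==> dist x y <= diameter E"
 using diameter_bounded_bound[OF compact_imp_bounded[OF simplex_compact[OF full]]] by blast

lemma volume_bounds:
 assumes E: "E \<in> \<T>"
 defines "\<omega> \<equiv> vol (ball (0::real^'n) 1)"
 shows "vol E <= \<omega> * diameter E ^ CARD('n)" "\<omega> * diameter E ^ CARD('n) <= \<kappa> ^ CARD('n) * vol E"
  "0 < \<omega>"
proof -
 have ball: "vol (ball x r) = \<omega> * r ^ CARD('n)" if "0 <= r" for x :: "real^'n" and r
  using content_ball_conv_unit_ball[OF that, of x] by (simp add: \<omega>_def mult.commute)
 have cball: "vol (cball x r) = \<omega> * r ^ CARD('n)" if "0 <= r" for x :: "real^'n" and r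
  using content_cball_conv_ball[of x r] ball[OF that] by simp
 have cE: "compact E" by (rule simplex_compact[OF full[OF E]])
 obtain y where y: "y \<in> E" using verts_nonempty[OF full[OF E]] verts_subset by blast
 have "E \<subseteq> cball y (diameter E)" using dist_le_diameter[OF E y] by auto
 then have "vol E <= vol (cball y (diameter E))"
  using cE by (intro measure_mono_fmeasurable) (auto intro: borel_compact fmeasurable_compact)
 then show "vol E <= \<omega> * diameter E ^ CARD('n)" using cball diameter_pos[OF E] by simp
 obtain x r where r: "cball x r \<subseteq> E" "0 < r" "diameter E <= \<kappa> * r" using shape[OF E] by blast
 have "vol (cball x r) <= vol E"
  using r(1) cE by (intro measure_mono_fmeasurable) (auto intro: fmeasurable_compact)
 then have 1: "\<omega> * r ^ CARD('n) <= vol E" using cball r(2) by simp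
 show "0 < \<omega>" unfolding \<omega>_def by (rule content_ball_pos) simp
 have "diameter E ^ CARD('n) <= (\<kappa> * r) ^ CARD('n)" using r(3) diameter_pos[OF E] by (intro power_mono) auto
 then have "\<omega> * diameter E ^ CARD('n) <= \<kappa> ^ CARD('n) * (\<omega> * r ^ CARD('n))"
  using \<open>0 < \<omega>\<close> by (simp add: power_mult_distrib mult.left_commute mult.commute)
 also have "... <= \<kappa> ^ CARD('n) * vol E"
  using 1 kappa_ge_2[OF E] by (intro mult_left_mono) auto
 finally show "\<omega> * diameter E ^ CARD('n) <= \<kappa> ^ CARD('n) * vol E" .
qed

text \<open>From one vertex to another the coordinate changes by one, and between opposite points of an inscribed
  ball, in the direction of the gradient, by at most one.\<close>

lemma bary_grad_bounds:
 assumes E: "E \<in> \<T>" and a: "a \<in> verts E"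
 shows "1 <= norm (bary_grad E a) * diameter E" "2 * norm (bary_grad E a) * diameter E <= \<kappa>"
proof -
 note s = full[OF E]
 obtain b where b: "b \<in> verts E" "b \<noteq> a" using other_vertex[OF s] by blast
 have "1 = bary_grad E a \<bullet> (a - b)" using bary_diff[OF s a, of a b] bary_vert[OF s a] a b by auto
 also have "... <= norm (bary_grad E a) * norm (a - b)" by (rule norm_cauchy_schwarz)
 also have "... <= norm (bary_grad E a) * diameter E"
  using dist_le_diameter[OF E, of a b] a b verts_subset by (intro mult_left_mono) (auto simp: dist_norm)
 finally show "1 <= norm (bary_grad E a) * diameter E" .
 obtain x r where r: "cball x r \<subseteq> E" "0 < r" "diameter E <= \<kappa> * r" using shape[OF E] by blast
 define g where "g = bary_grad E a"
 have g: "g \<noteq> 0" unfolding g_def by (rule bary_grad_nonzero[OF s a])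
 define u where "u = (r / norm g) *\<^sub>R g"
 have nu: "norm u = r" using g r by (simp add: u_def)
 then have "x + u \<in> E" "x - u \<in> E" using r by (auto intro!: subsetD[OF r(1)] simp: dist_norm)
 then have "bary E a (x + u) - bary E a (x - u) <= 1"
  using bary_le_1[OF s _ a] simplex_iff_bary[OF s] a by (smt (verit))
 then have "2 * (g \<bullet> u) <= 1" 
 proof -
  have "(x + u) - (x - u) = 2 *\<^sub>R u" by (simp add: scaleR_2)
  with bary_diff[OF s a, of "x + u" "x - u"] \<open>bary E a (x + u) - bary E a (x - u) <= 1\<close> show ?thesis
   by (simp only: g_def inner_scaleR_right)
 qed
 moreover have "g \<bullet> u = r * norm g" using g by (simp add: u_def power2_norm_eq_inner[symmetric] power2_eq_square)
 ultimately have "2 * (r * norm g) <= 1" by simp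
 have "2 * norm g * diameter E <= 2 * norm g * (\<kappa> * r)" using r(3) by (intro mult_left_mono) auto
 also have "... = \<kappa> * (2 * (r * norm g))" by simp
 also have "... <= \<kappa> * 1" using \<open>2 * (r * norm g) <= 1\<close> kappa_ge_2[OF E] by (intro mult_left_mono) auto
 finally show "2 * norm (bary_grad E a) * diameter E <= \<kappa>" by (simp add: g_def)
qed

definition perimeter :: "(real^'n) set => real" where
 "perimeter E = bdry_integral E (%F x. 1)"

lemma perimeter_bounds:
 assumes E: "E \<in> \<T>" and a: "a \<in> verts E"
 shows "0 < perimeter E" "perimeter E <= real (CARD('n) + 1) * \<kappa> * area (opp_face E a)"
proof -
 note s = full[OF E]
 have p: "perimeter E = (\<Sum>b\<in>verts E. area (opp_face E b))"
  by (simp add: perimeter_def bdry_integral_simplex[OF s] area_def)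
 show "0 < perimeter E"
  unfolding p using area_pos(2)[OF s] simplex_verts(2)[OF s] verts_nonempty[OF s] by (intro sum_pos) auto
 have "area (opp_face E b) <= \<kappa> * area (opp_face E a)" if b: "b \<in> verts E" for b
 proof -
  have "norm (bary_grad E b) * diameter E <= \<kappa> * (norm (bary_grad E a) * diameter E)"
   using bary_grad_bounds(2)[OF E b] bary_grad_bounds(1)[OF E a] kappa_ge_2[OF E]
    mult_left_mono[OF bary_grad_bounds(1)[OF E a], of \<kappa>] diameter_pos[OF E] mult_nonneg_nonneg[of "norm (bary_grad E b)" "diameter E"]
   by linarith
  then have "norm (bary_grad E b) <= \<kappa> * norm (bary_grad E a)" using diameter_pos[OF E] by simp
  then have "(real CARD('n) * vol E) * norm (bary_grad E b) <= (real CARD('n) * vol E) * (\<kappa> * norm (bary_grad E a))"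
   by (intro mult_left_mono) auto
  then show ?thesis using area_pos(1)[OF s] a b by (simp add: mult_ac)
 qed
 then have "perimeter E <= (\<Sum>b\<in>verts E. \<kappa> * area (opp_face E a))" unfolding p by (intro sum_mono)
 also have "... = real (CARD('n) + 1) * \<kappa> * area (opp_face E a)" using simplex_verts(3)[OF s] by simp
 finally show "perimeter E <= real (CARD('n) + 1) * \<kappa> * area (opp_face E a)" .
qed

text \<open>Disjoint balls of comparable size inside the elements around \<open>x\<close> bound their number.\<close>

lemma card_star:
 assumes "E0 \<in> \<T>" shows "real (card {E\<in>\<T>. x \<in> E}) <= \<kappa> ^ CARD('n)"
proof -
 let ?S = "{E\<in>\<T>. x \<in> E}"
 define \<rho> where "\<rho> = Min (diameter ` \<T>)"
 have \<rho>: "0 < \<rho>" "!!E. E \<in> \<T> ==> \<rho> <= diameter E"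
 proof -
  have ne: "diameter ` \<T> \<noteq> {}" using assms by auto
  show "0 < \<rho>" unfolding \<rho>_def using diameter_pos by (subst Min_gr_iff[OF _ ne]) auto
  show "\<rho> <= diameter E" if "E \<in> \<T>" for E unfolding \<rho>_def using that by (intro Min_le) auto
 qed
 have \<kappa>: "2 <= \<kappa>" by (rule kappa_ge_2[OF assms])
 have "\<exists>y. ball y (\<rho> / \<kappa>) \<subseteq> interior E \<inter> ball x (2 * \<rho>) \<and> ball y (\<rho> / \<kappa>) \<subseteq> cball x \<rho>" if E: "E \<in> ?S" for E
 proof -
  obtain c r where r: "cball c r \<subseteq> E" "0 < r" "diameter E <= \<kappa> * r" using shape E by blast
  define s where "s = \<rho> / diameter E"
  have s: "0 < s" "s <= 1" "s * diameter E = \<rho>" using \<rho> E diameter_pos[of E] by (auto simp: s_def)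
  define y where "y = x + s *\<^sub>R (c - x)"
  have sr: "\<rho> / \<kappa> <= s * r" using s r(3) \<kappa> mult_left_mono[OF r(3), of s] by (simp add: divide_le_eq mult_ac)
  have in_both: "z \<in> E \<and> dist x z <= \<rho>" if "z \<in> ball y (\<rho> / \<kappa>)" for z
  proof -
   define z' where "z' = c + (1 / s) *\<^sub>R (z - y)"
   have "norm (z - y) <= s * r" using that sr by (simp add: dist_norm norm_minus_commute)
   then have "z' \<in> E" using s r by (intro subsetD[OF r(1)]) (simp add: z'_def dist_norm divide_le_eq mult.commute)
   moreover have zz: "z = x + s *\<^sub>R (z' - x)" using s by (simp add: z'_def y_def algebra_simps)
   moreover have "dist x z = s * dist x z'" using s(1) by (subst zz) (simp add: dist_norm norm_minus_commute)
   moreover have "dist x z' <= diameter E" using E \<open>z' \<in> E\<close> dist_le_diameter by blast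
   moreover have "(1 - s) *\<^sub>R x + s *\<^sub>R z' \<in> E"
    using simplex_convex[OF full] E \<open>z' \<in> E\<close> s by (auto simp: convex_alt)
   moreover have "z = (1 - s) *\<^sub>R x + s *\<^sub>R z'" using zz by (simp add: algebra_simps)
   ultimately show ?thesis using s mult_left_mono[of "dist x z'" "diameter E" s] by auto
  qed
  then have "ball y (\<rho> / \<kappa>) \<subseteq> interior E" by (intro interior_maximal) auto
  moreover have "ball y (\<rho> / \<kappa>) \<subseteq> cball x \<rho>" using in_both by auto
  moreover have "cball x \<rho> \<subseteq> ball x (2 * \<rho>)" using \<rho>(1) by auto
  ultimately show ?thesis by blast
 qed
 then obtain y where y: "!!E. E \<in> ?S ==> ball (y E) (\<rho> / \<kappa>) \<subseteq> interior E"
  "!!E. E \<in> ?S ==> ball (y E) (\<rho> / \<kappa>) \<subseteq> cball x \<rho>" by (metis (no_types, lifting) le_inf_iff)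
 define \<omega> where "\<omega> = vol (ball (0::real^'n) 1)"
 have \<omega>: "0 < \<omega>" unfolding \<omega>_def by (rule content_ball_pos) simp
 have ball: "vol (ball z r) = \<omega> * r ^ CARD('n)" if "0 <= r" for z :: "real^'n" and r
  using content_ball_conv_unit_ball[OF that, of z] by (simp add: \<omega>_def mult.commute)
 have "disjoint_family_on (%E. ball (y E) (\<rho> / \<kappa>)) ?S"
  unfolding disjoint_family_on_def
 proof (intro ballI impI)
  fix E E' assume E: "E \<in> ?S" "E' \<in> ?S" "E \<noteq> E'"
  then have "interior E \<inter> interior E' = {}" using disjoint_interior[of E E'] interior_subset by blast
  then show "ball (y E) (\<rho> / \<kappa>) \<inter> ball (y E') (\<rho> / \<kappa>) = {}" using y(1)[OF E(1)] y(1)[OF E(2)] by blast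
 qed
 moreover have fin: "emeasure lborel (ball z r) \<noteq> \<infinity>" for z :: "real^'n" and r
  using emeasure_lborel_ball_finite[of z r] by auto
 ultimately have "vol (\<Union>E\<in>?S. ball (y E) (\<rho> / \<kappa>)) = (\<Sum>E\<in>?S. vol (ball (y E) (\<rho> / \<kappa>)))"
  by (intro measure_finite_Union) (auto simp: fin)
 also have "... = real (card ?S) * (\<omega> * (\<rho> / \<kappa>) ^ CARD('n))" using ball \<rho>(1) \<kappa> by simp
 finally have "real (card ?S) * (\<omega> * (\<rho> / \<kappa>) ^ CARD('n)) = vol (\<Union>E\<in>?S. ball (y E) (\<rho> / \<kappa>))" ..
 also have "... <= vol (cball x \<rho>)"
  using y(2) by (intro measure_mono_fmeasurable) (auto intro!: fmeasurable_compact sets.finite_UN)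
 also have "... = \<omega> * \<rho> ^ CARD('n)" using content_cball_conv_ball[of x \<rho>] ball[of \<rho> x] \<rho>(1) by simp
 finally have "real (card ?S) * (\<omega> * (\<rho> / \<kappa>) ^ CARD('n)) <= \<omega> * \<rho> ^ CARD('n)" .
 then show ?thesis using \<omega> \<rho>(1) \<kappa> by (simp add: power_divide field_simps)
qed

text \<open>Every point of \<open>E\<close> lies on a segment from a point of the facet to the opposite vertex \<open>a\<close>. In a
  direction orthogonal to one such segment, \<open>E\<close> is therefore no wider than the facet, whose diameter is at
  most that of \<open>E'\<close>. In one dimension there is no such direction, and the statement fails.\<close>

lemma neighbour_size:
 assumes d: "2 <= CARD('n)" and E: "E \<in> \<T>" "E' \<in> \<T>" and F: "F facet_of E" "F facet_of E'"
 shows "diameter E <= \<kappa> * diameter E'"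
proof -
 note s = full[OF E(1)]
 obtain a where a: "a \<in> verts E" "F = opp_face E a" using F(1) facet_iff[OF s] by blast
 obtain x r where r: "cball x r \<subseteq> E" "0 < r" "diameter E <= \<kappa> * r" using shape[OF E(1)] by blast
 obtain y0 where y0: "y0 \<in> F" using opp_face_flat[OF s a(1)] a(2) by (auto simp: flat_def)
 obtain w where w: "w \<noteq> 0" "orthogonal (y0 - a) w" using vector_in_orthogonal_basis d
  by (metis DIM_cart DIM_real mult.right_neutral orthogonal_to_vector_exists)
 define u where "u = w /\<^sub>R norm w"
 have u: "norm u = 1" "u \<bullet> (y0 - a) = 0" using w by (auto simp: u_def orthogonal_def inner_commute)
 have FE': "F \<subseteq> E'" using F(2) by (auto simp: facet_of_def dest: face_of_imp_subset)
 have slab: "\<bar>u \<bullet> (z - a)\<bar> <= diameter E'" if zE: "z \<in> E" for z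
 proof -
  obtain y t where yt: "z = a + t *\<^sub>R (y - a)" "y \<in> F" "t \<in> {0..1}"
   using subsetD[OF equalityD1[OF simplex_as_cone[OF s a(1)]] zE] unfolding a(2) by blast
  have "u \<bullet> (z - a) = t * (u \<bullet> (y - y0))" unfolding yt(1) using u(2) by (simp add: inner_diff_right)
  moreover have "\<bar>u \<bullet> (y - y0)\<bar> <= norm u * norm (y - y0)" by (rule Cauchy_Schwarz_ineq2)
  moreover have "norm (y - y0) <= diameter E'" using dist_le_diameter[OF E(2), of y y0] yt y0 FE' by (auto simp: dist_norm)
  ultimately have "\<bar>u \<bullet> (z - a)\<bar> <= t * diameter E'" using u yt(3) by (simp add: abs_mult mult_left_mono)
  also have "... <= diameter E'" using yt(3) diameter_pos[OF E(2)] by (simp add: mult_left_le_one_le)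
  finally show ?thesis .
 qed
 have "x + r *\<^sub>R u \<in> E" "x - r *\<^sub>R u \<in> E" using r u by (auto intro!: subsetD[OF r(1)] simp: dist_norm)
 moreover have "u \<bullet> u = 1" using u(1) by (simp add: norm_eq_1)
 ultimately have "\<bar>u \<bullet> x + r - u \<bullet> a\<bar> <= diameter E'" "\<bar>u \<bullet> x - r - u \<bullet> a\<bar> <= diameter E'"
  using slab[of "x + r *\<^sub>R u"] slab[of "x - r *\<^sub>R u"] by (simp_all add: inner_diff_right inner_add_right)
 then have "r <= diameter E'" by linarith
 then have "\<kappa> * r <= \<kappa> * diameter E'" using kappa_ge_2[OF E(1)] by (intro mult_left_mono) auto
 with r(3) show ?thesis by linarith
qed

end

section \<open>Conforming piecewise affine functions\<close>

lemma polyfn_affine: "polyfn 1 f \<longleftrightarrow> (\<exists>h0 w. \<forall>z. f z = h0 + w \<bullet> z)"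
proof
 have 0: "polyfn k f ==> k = 0 ==> \<exists>c. f = (%x. c)" for k and f :: "real^'n => real"
  by (induction rule: polyfn.induct) auto
 have "polyfn k f ==> k = 1 ==> \<exists>h0 w. \<forall>z. f z = h0 + w \<bullet> z" for k and f :: "real^'n => real"
 proof (induction rule: polyfn.induct)
  case (const k c)
  show ?case by (intro exI[of _ c] exI[of _ 0]) simp
 next
  case (coord k f i)
  then obtain c where "f = (%x. c)" using 0 by auto
  then have "z $ i * f z = 0 + (c *\<^sub>R axis i 1) \<bullet> z" for z by (simp add: inner_axis' mult.commute)
  then show ?case by blast
 next
  case (add k f g)
  then obtain h0 w h0' w' where "!!z. f z = h0 + w \<bullet> z" "!!z. g z = h0' + w' \<bullet> z" by metis
  then show ?case by (intro exI[of _ "h0 + h0'"] exI[of _ "w + w'"]) (simp add: inner_add_left)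
 qed
 then show "polyfn 1 f ==> \<exists>h0 w. \<forall>z. f z = h0 + w \<bullet> z" by blast
next
 assume "\<exists>h0 w. \<forall>z. f z = h0 + w \<bullet> z"
 then obtain h0 w where "f = (%z. h0 + w \<bullet> z)" by auto
 then show "polyfn 1 f" using polyfn.add[OF polyfn.const[of 1 h0] polyfn_inner[of w]] by simp
qed

lemma face_contains_carrier:
 assumes e: "full_simplex e" and G: "G face_of e" and z: "z \<in> G" and b: "b \<in> verts e" "bary e b z \<noteq> 0"
 shows "b \<in> G"
proof -
 have ze: "z \<in> e" using G z face_of_imp_subset by blast
 have be: "b \<in> e" using b(1) verts_subset by blast
 define l where "l = bary e b z"
 have l: "0 < l" "l <= 1" using b ze simplex_iff_bary[OF e] bary_le_1[OF e ze b(1)] by (auto simp: l_def less_le)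
 show ?thesis
 proof (cases "l = 1")
  case True
  have "bary e c z = (if c = b then 1 else 0)" if c: "c \<in> verts e" for c
  proof (cases "c = b")
   case False
   have "bary e b z + bary e c z <= (\<Sum>c\<in>verts e. bary e c z)"
    using sum_mono2[of "verts e" "{b, c}" "%c. bary e c z"] False simplex_verts(2)[OF e] b c
     simplex_iff_bary[OF e] ze by auto
   then have "bary e c z <= 0" using True bary_sum(1)[OF e, of z] by (simp add: l_def)
   moreover have "0 <= bary e c z" using ze simplex_iff_bary[OF e] c by blast
   ultimately show ?thesis using False by simp
  qed (use True in \<open>auto simp: l_def\<close>)
  then have "(\<Sum>c\<in>verts e. bary e c z *\<^sub>R c) = (\<Sum>c\<in>verts e. if c = b then b else 0)"
   by (intro sum.cong) auto
  also have "... = b" using b(1) simplex_verts(2)[OF e] by simp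
  finally have "z = b" using bary_sum(2)[OF e, of z] by simp
  then show ?thesis using z by simp
 next
  case False
  with l have l1: "l < 1" by simp
  define z' where "z' = b + (1 / (1 - l)) *\<^sub>R (z - b)"
  have bz': "bary e c z' = (if c = b then 0 else bary e c z / (1 - l))" if c: "c \<in> verts e" for c
  proof -
   have "bary e c z' = (1 - 1 / (1 - l)) * bary e c b + (1 / (1 - l)) * bary e c z"
    unfolding z'_def by (rule bary_line[OF e c])
   moreover have "bary e c b = (if c = b then 1 else 0)" by (rule bary_vert[OF e c b(1)])
   moreover have "(1 - 1 / (1 - l)) * 1 + (1 / (1 - l)) * l = 0" using l1 by (simp add: field_simps)
   ultimately show ?thesis by (auto simp: l_def)
  qed
  then have "z' \<in> e" using ze l1 simplex_iff_bary[OF e] by auto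
  moreover have "z' \<noteq> b" using bz'[OF b(1)] bary_vert[OF e b(1) b(1)] by auto
  moreover have "z = (1 - (1 - l)) *\<^sub>R b + (1 - l) *\<^sub>R z'"
   using l1 by (simp add: z'_def algebra_simps)
  ultimately have "z \<in> open_segment b z'"
   unfolding in_segment using l l1 by (auto intro!: exI[of _ "1 - l"])
  then show ?thesis using face_ofD[OF G] z be \<open>z' \<in> e\<close> by blast
 qed
qed

definition local_interp :: "(real^'n) set => (real^'n => real) => real^'n => real" where
 "local_interp e val z = (\<Sum>b\<in>verts e. bary e b z * val b)"

lemma local_interp_affine:
 assumes "full_simplex e"
 shows "local_interp e val z = (\<Sum>b\<in>verts e. bary e b 0 * val b) + (\<Sum>b\<in>verts e. val b *\<^sub>R bary_grad e b) \<bullet> z"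
proof -
 have "local_interp e val z = (\<Sum>b\<in>verts e. bary e b 0 * val b + (val b *\<^sub>R bary_grad e b) \<bullet> z)"
  unfolding local_interp_def
 proof (intro sum.cong refl)
  fix b assume "b \<in> verts e"
  then show "bary e b z * val b = bary e b 0 * val b + (val b *\<^sub>R bary_grad e b) \<bullet> z"
   using bary_affine[OF assms, of b z] by (simp add: algebra_simps)
 qed
 then show ?thesis by (simp add: sum.distrib inner_sum_left)
qed

lemma local_interp_vertex:
 assumes e: "full_simplex e" and b: "b \<in> verts e" shows "local_interp e val b = val b"
proof -
 have "local_interp e val b = (\<Sum>c\<in>verts e. if c = b then val b else 0)"
  unfolding local_interp_def by (intro sum.cong refl) (auto simp: bary_vert[OF e _ b])
 then show ?thesis using b simplex_verts(2)[OF e] by simp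
qed

lemma local_interp_diff:
 assumes e: "full_simplex e"
 shows "local_interp e val x - local_interp e val y = (\<Sum>b\<in>verts e. val b *\<^sub>R bary_grad e b) \<bullet> (x - y)"
 by (simp add: local_interp_affine[OF e] inner_diff_right)

text \<open>The values of an affine interpolant are convex combinations of the vertex values.\<close>

lemma local_interp_bound:
 assumes e: "full_simplex e" and z: "z \<in> e" and val: "!!b. b \<in> verts e ==> \<bar>val b - c\<bar> <= B"
 shows "\<bar>local_interp e val z - c\<bar> <= B"
proof -
 have "local_interp e val z - c = (\<Sum>b\<in>verts e. bary e b z * (val b - c))"
  using bary_sum(1)[OF e, of z] by (simp add: local_interp_def right_diff_distrib sum_subtractf sum_distrib_right[symmetric])
 also have "\<bar>...\<bar> <= (\<Sum>b\<in>verts e. \<bar>bary e b z * (val b - c)\<bar>)" by (rule sum_abs)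
 also have "... <= (\<Sum>b\<in>verts e. bary e b z * B)"
 proof (rule sum_mono)
  fix b assume b: "b \<in> verts e"
  then have "0 <= bary e b z" using z simplex_iff_bary[OF e] by blast
  then show "\<bar>bary e b z * (val b - c)\<bar> <= bary e b z * B" using val[OF b] by (simp add: abs_mult mult_left_mono)
 qed
 also have "... = B" using bary_sum(1)[OF e, of z] by (simp add: sum_distrib_right[symmetric])
 finally show ?thesis .
qed

context regular_mesh
begin

lemma local_interp_consistent:
 assumes E: "E \<in> \<T>" "E' \<in> \<T>" and z: "z \<in> E" "z \<in> E'"
 shows "local_interp E val z = local_interp E' val z"
proof -
 note s = full[OF E(1)] and s' = full[OF E(2)]
 let ?G = "E \<inter> E'" and ?V = "verts E \<inter> verts E'"
 have G: "?G face_of E" "?G face_of E'" using Int_face[OF E] Int_face[OF E(2,1)] by (auto simp: Int_commute)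
 have zero: "bary E b z = 0" if "b \<in> verts E" "b \<notin> ?V" for b
 proof (rule ccontr)
  assume "bary E b z \<noteq> 0"
  then have "b \<in> ?G" using face_contains_carrier[OF s G(1) _ that(1)] z by blast
  then have "b extreme_point_of ?G" using extreme_point_of_face[OF G(1)] that(1) by (simp add: verts_def)
  then have "b \<in> verts E'" using extreme_point_of_face[OF G(2)] by (simp add: verts_def)
  with that show False by blast
 qed
 let ?u = "%b. if b \<in> ?V then bary E b z else 0"
 have fin: "finite (verts E)" "finite (verts E')" using simplex_verts(2)[OF s] simplex_verts(2)[OF s'] by auto
 have tr: "(\<Sum>b\<in>verts E'. (if b \<in> ?V then bary E b z else 0) *\<^sub>R h b) = (\<Sum>b\<in>verts E. bary E b z *\<^sub>R h b)"
  for h :: "real^'n => 'b::real_vector"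
 proof -
  have "(\<Sum>b\<in>verts E'. (if b \<in> ?V then bary E b z else 0) *\<^sub>R h b) = (\<Sum>b\<in>?V. bary E b z *\<^sub>R h b)"
   using fin by (intro sum.mono_neutral_cong_right) auto
  also have "... = (\<Sum>b\<in>verts E. bary E b z *\<^sub>R h b)"
   using fin zero by (intro sum.mono_neutral_left) auto
  finally show ?thesis .
 qed
 have 1: "sum ?u (verts E') = 1" using tr[of "%_. 1 :: real"] bary_sum(1)[OF s, of z] by simp
 have 2: "(\<Sum>b\<in>verts E'. ?u b *\<^sub>R b) = z" using tr[of "%b. b"] bary_sum(2)[OF s, of z] by simp
 have "local_interp E' val z = (\<Sum>b\<in>verts E'. ?u b *\<^sub>R val b)"
  unfolding local_interp_def by (intro sum.cong refl) (simp add: bary_unique[OF s' 1 2])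
 then show ?thesis using tr[of val] by (simp add: local_interp_def)
qed

text \<open>The choice of the element does not matter, because the local interpolants agree on common faces.\<close>

definition interp :: "(real^'n) set set => (real^'n => real) => real^'n => real" where
 "interp S val z = (if z \<in> \<Union>S then local_interp (SOME e. e \<in> S \<and> z \<in> e) val z else 0)"

lemma interp_eq:
 assumes "S \<subseteq> \<T>" "e \<in> S" "z \<in> e" shows "interp S val z = local_interp e val z"
proof -
 define e0 where "e0 = (SOME e. e \<in> S \<and> z \<in> e)"
 have "e0 \<in> S \<and> z \<in> e0" unfolding e0_def by (rule someI[of _ e]) (use assms in auto)
 then have "local_interp e0 val z = local_interp e val z"
  using assms by (intro local_interp_consistent) auto
 moreover have "z \<in> \<Union>S" using assms by blast
 ultimately show ?thesis by (simp add: interp_def e0_def)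
qed

lemma interp_conforming:
 assumes S: "S \<subseteq> \<T>" shows "interp S val \<in> P1_conforming S"
proof -
 have p: "polyfn 1 (local_interp e val)" if "e \<in> S" for e
  using local_interp_affine[OF full] that S polyfn_affine by blast
 have "continuous_on (\<Union>e\<in>S. e) (interp S val)"
 proof (rule continuous_on_closed_Union)
  show "finite S" by (rule finite_subset[OF S finite_mesh])
  show "closed e" if "e \<in> S" for e using simplex_compact[OF full] that S by (auto intro: compact_imp_closed)
  show "continuous_on e (interp S val)" if "e \<in> S" for e
   using interp_eq[OF S that] by (intro continuous_on_eq[OF polyfn_continuous[OF p[OF that]]]) auto
 qed
 moreover have "\<exists>g\<in>polys 1. \<forall>x\<in>e. interp S val x = g x" if "e \<in> S" for e
  using p[OF that] interp_eq[OF S that] polys_iff_polyfn by blast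
 moreover have "interp S val x = 0" if "x \<notin> \<Union>S" for x using that by (simp add: interp_def)
 ultimately show ?thesis by (simp add: P1_conforming_def)
qed

lemma conforming_eq_interp:
 assumes S: "S \<subseteq> \<T>" and w: "w \<in> P1_conforming S" and v: "!!e b. e \<in> S ==> b \<in> verts e ==> w b = val b"
 shows "w = interp S val"
proof
 fix z
 show "w z = interp S val z"
 proof (cases "z \<in> \<Union>S")
  case True
  then obtain e where e: "e \<in> S" "z \<in> e" by blast
  obtain g where g: "g \<in> polys 1" "!!x. x \<in> e ==> w x = g x" using w e(1) unfolding P1_conforming_def by blast
  obtain h0 u where h: "!!z. g z = h0 + u \<bullet> z" using g(1) polyfn_affine polys_iff_polyfn by metis
  have "g z = (\<Sum>b\<in>verts e. bary e b z * g b)" by (rule affine_bary[OF full h]) (use e S in auto)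
  also have "... = local_interp e val z"
   unfolding local_interp_def
  proof (intro sum.cong refl)
   fix b assume b: "b \<in> verts e"
   then have "b \<in> e" using verts_subset by blast
   then show "bary e b z * g b = bary e b z * val b" using g(2)[of b] v[OF e(1) b] by simp
  qed
  finally show ?thesis using interp_eq[OF S e] g(2)[OF e(2)] by simp
 next
  case False
  then show ?thesis using w by (simp add: P1_conforming_def interp_def)
 qed
qed

definition vertex_mean :: "(real^'n) set set => ((real^'n) set => real^'n => real) => real^'n => real" where
 "vertex_mean S v x = (if x \<in> frontier \<Omega> then 0 else (\<Sum>e | e \<in> S \<and> x \<in> e. v e x) / card {e\<in>S. x \<in> e})"

lemma interp_vertex:
 assumes "S \<subseteq> \<T>" "e \<in> S" "b \<in> verts e" shows "interp S val b = val b"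
 using interp_eq[OF assms(1,2)] local_interp_vertex[OF full] assms verts_subset by fastforce

text \<open>The description of the averaging operator by its vertex values is unambiguous, since a conforming
  piecewise affine function is determined by them.\<close>

lemma avg_interp_eq:
 assumes S: "S \<subseteq> \<T>" shows "avg_interp \<Omega> S v = interp S (vertex_mean S v)"
 unfolding avg_interp_def
proof (rule the_equality)
 show "interp S (vertex_mean S v) \<in> P1_conforming S \<and> (\<forall>x. (\<exists>e\<in>S. x extreme_point_of e) \<longrightarrow>
  interp S (vertex_mean S v) x = (if x \<in> frontier \<Omega> then 0 else (\<Sum>e | e \<in> S \<and> x \<in> e. v e x) / card {e\<in>S. x \<in> e}))"
  using interp_conforming[OF S] interp_vertex[OF S] by (auto simp: vertex_mean_def verts_def)
 fix w assume "w \<in> P1_conforming S \<and> (\<forall>x. (\<exists>e\<in>S. x extreme_point_of e) \<longrightarrow>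
  w x = (if x \<in> frontier \<Omega> then 0 else (\<Sum>e | e \<in> S \<and> x \<in> e. v e x) / card {e\<in>S. x \<in> e}))"
 then show "w = interp S (vertex_mean S v)"
  by (intro conforming_eq_interp[OF S]) (auto simp: vertex_mean_def verts_def)
qed

lemma interp_borel:
 assumes S: "S \<subseteq> \<T>" shows "interp S val \<in> borel_measurable borel"
proof -
 have "closed (\<Union>S)" using simplex_compact[OF full] S finite_subset[OF S finite_mesh]
  by (intro closed_Union) (auto intro: compact_imp_closed)
 moreover have "continuous_on (\<Union>S) (interp S val)" using interp_conforming[OF S] by (simp add: P1_conforming_def)
 ultimately have "(%x. indicator (\<Union>S) x *\<^sub>R interp S val x) \<in> borel_measurable borel"
  by (intro borel_measurable_continuous_on_indicator) auto
 moreover have "(%x. indicator (\<Union>S) x *\<^sub>R interp S val x) = interp S val"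
  by (auto simp: interp_def indicator_def fun_eq_iff)
 ultimately show ?thesis by simp
qed

lemma interp_zero_on_face:
 assumes S: "S \<subseteq> \<T>" and e: "e \<in> S" and G: "G face_of e" and z: "z \<in> G"
  and v: "!!b. b \<in> verts e ==> b \<in> G ==> val b = 0"
 shows "interp S val z = 0"
proof -
 have s: "full_simplex e" using full e S by blast
 have "interp S val z = local_interp e val z" using interp_eq[OF S e] face_of_imp_subset[OF G] z by blast
 also have "... = 0" unfolding local_interp_def
 proof (intro sum.neutral ballI)
  fix b assume b: "b \<in> verts e"
  show "bary e b z * val b = 0" using face_contains_carrier[OF s G z b] v[OF b] by (cases "bary e b z = 0") auto
 qed
 finally show ?thesis .
qed

end

section \<open>Poincare and trace inequalities for piecewise Lipschitz functions\<close>

text \<open>Going along the interval from left to right, each piece is left at its last point in the interval and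
  never needed again, since the pieces are intervals.\<close>

lemma interval_chain:
 fixes I :: "'i => real set"
 assumes "finite S" and "!!e. e \<in> S ==> closed (I e)" and "!!e. e \<in> S ==> convex (I e)"
  and l: "!!e. e \<in> S ==> 0 <= l e"
  and lip: "!!e s t. e \<in> S ==> s \<in> I e ==> t \<in> I e ==> \<bar>\<phi> s - \<phi> t\<bar> <= l e * \<bar>s - t\<bar>"
  and "a <= b" "{a..b} \<subseteq> (\<Union>e\<in>S. I e)"
 shows "\<bar>\<phi> a - \<phi> b\<bar> <= (\<Sum>e\<in>S. l e * vol (I e \<inter> {a..b}))"
 using assms
proof (induction S arbitrary: a rule: finite_psubset_induct)
 case (psubset S)
 have "a \<in> (\<Union>e\<in>S. I e)" using psubset(7,8) by auto
 then obtain e where e: "e \<in> S" "a \<in> I e" by blast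
 let ?J = "I e \<inter> {a..b}"
 have J: "compact ?J" "a \<in> ?J" using psubset(3)[OF e(1)] e(2) psubset(7) by (auto simp: closed_Int_compact)
 define c where "c = Sup ?J"
 have c: "c \<in> ?J" unfolding c_def using J by (intro closed_contains_Sup compact_imp_closed bounded_imp_bdd_above compact_imp_bounded) auto
 have ub: "t <= c" if "t \<in> ?J" for t
  unfolding c_def using that J(1) by (intro cSup_upper bounded_imp_bdd_above compact_imp_bounded) auto
 have Jeq: "?J = {a..c}"
 proof
  show "?J \<subseteq> {a..c}" using ub by auto
  have "closed_segment a c \<subseteq> I e" using psubset(4)[OF e(1)] e(2) c by (intro closed_segment_subset) auto
  then show "{a..c} \<subseteq> ?J" using c by (auto simp: closed_segment_eq_real_ivl)
 qed
 have mJ: "vol ?J = c - a" using c by (simp add: Jeq)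
 have s1: "\<bar>\<phi> a - \<phi> c\<bar> <= l e * vol ?J"
  using psubset(6)[OF e(1) e(2), of c] c mJ by (simp add: abs_minus_commute)
 have rest: "(\<Sum>x\<in>S. l x * vol (I x \<inter> {a..b})) = l e * vol ?J + (\<Sum>x\<in>S - {e}. l x * vol (I x \<inter> {a..b}))"
  using psubset(1) e(1) by (simp add: sum.remove)
 show ?case
 proof (cases "c = b")
  case True
  have "0 <= (\<Sum>x\<in>S - {e}. l x * vol (I x \<inter> {a..b}))" using psubset(5) by (intro sum_nonneg) auto
  then show ?thesis using s1 rest True by simp
 next
  case False
  then have cb: "c < b" using c by simp
  let ?U = "\<Union>x\<in>S - {e}. I x"
  have clU: "closed ?U" using psubset(1,3) by (intro closed_UN) auto
  have "{c<..<b} \<subseteq> ?U"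
  proof
   fix t assume t: "t \<in> {c<..<b}"
   then have "t \<in> {a..b}" using c by auto
   then have "t \<in> (\<Union>e\<in>S. I e)" using psubset(8) by blast
   moreover have "t \<notin> I e" using ub[of t] t c by auto
   ultimately show "t \<in> ?U" by blast
  qed
  then have "closure {c<..<b} \<subseteq> ?U" using clU closure_minimal by blast
  then have "{c..b} \<subseteq> ?U" using cb by simp
  then have "\<bar>\<phi> c - \<phi> b\<bar> <= (\<Sum>x\<in>S - {e}. l x * vol (I x \<inter> {c..b}))"
   using psubset(3-6) cb e(1) by (intro psubset(2)) auto
  also have "... <= (\<Sum>x\<in>S - {e}. l x * vol (I x \<inter> {a..b}))"
  proof (intro sum_mono mult_left_mono measure_mono_fmeasurable)
   fix x assume x: "x \<in> S - {e}"
   then have cl: "closed (I x)" using psubset(3) by auto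
   show "I x \<inter> {c..b} \<subseteq> I x \<inter> {a..b}" using c by auto
   show "I x \<inter> {c..b} \<in> sets lborel" using cl by auto
   show "I x \<inter> {a..b} \<in> fmeasurable lborel" using cl by (intro fmeasurable_compact closed_Int_compact) auto
  qed (use psubset(5) in auto)
  finally show ?thesis using s1 rest by linarith
 qed
qed

lemma bounded_set_integrable:
 fixes f :: "'a::euclidean_space => real"
 assumes "A \<in> sets borel" "bounded A" "f \<in> borel_measurable borel" "!!x. x \<in> A ==> \<bar>f x\<bar> <= B"
 shows "set_integrable lborel A f"
 unfolding set_integrable_def using assms emeasure_bounded_finite[OF assms(2)]
 by (intro integrableI_bounded_set_indicator[where B=B]) auto

lemma integral_square_le:
 fixes D :: "real => real"
 assumes ab: "a <= b" and i: "set_integrable lborel {a..b} D" and i2: "set_integrable lborel {a..b} (%t. (D t)^2)"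
 shows "(LBINT t:{a..b}. D t)^2 <= (b - a) * (LBINT t:{a..b}. (D t)^2)"
proof (cases "a = b")
 case True
 have "(LBINT t:{b..b}. D t) = 0" unfolding set_lebesgue_integral_def
  by (rule integral_eq_zero_AE, rule eventually_mono[OF AE_lborel_singleton[of b]]) (simp add: indicator_def)
 with True show ?thesis by simp
next
 case False
 define c where "c = (LBINT t:{a..b}. D t) / (b - a)"
 have ic: "set_integrable lborel {a..b} (%t. c^2)"
  by (rule bounded_set_integrable[where B="c^2"]) auto
 have "0 <= (LBINT t:{a..b}. (D t - c)^2)" unfolding set_lebesgue_integral_def by (intro integral_nonneg_AE) auto
 also have "(LBINT t:{a..b}. (D t - c)^2) = (LBINT t:{a..b}. ((D t)^2 + c^2) - (2 * c) * D t)"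
  by (intro arg_cong[where f="%f. set_lebesgue_integral lborel {a..b} f"]) (auto simp: power2_eq_square algebra_simps)
 also have "... = (LBINT t:{a..b}. (D t)^2) + c^2 * (b - a) - 2 * c * (LBINT t:{a..b}. D t)"
  using i i2 ic ab by (simp add: set_integral_add set_integral_diff set_lebesgue_integral_def[of _ _ "%_. c^2"])
 finally have "2 * c * (LBINT t:{a..b}. D t) - c\<^sup>2 * (b - a) <= (LBINT t:{a..b}. (D t)^2)" by simp
 moreover have "(LBINT t:{a..b}. D t) = c * (b - a)" using False by (simp add: c_def)
 ultimately have "c^2 * (b - a) <= (LBINT t:{a..b}. (D t)^2)" by (simp add: power2_eq_square algebra_simps)
 then have "(b - a) * (c^2 * (b - a)) <= (b - a) * (LBINT t:{a..b}. (D t)^2)" using ab by (intro mult_left_mono) auto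
 then show ?thesis using \<open>_ = c * (b - a)\<close> by (simp add: power2_eq_square mult_ac)
qed

text \<open>Piecewise Lipschitz continuous functions on convex pieces; on overlaps of pieces, which may be
  arbitrary, the pointwise slope is the sum of the Lipschitz constants.\<close>

locale pw_lipschitz =
 fixes S :: "(real^'n) set set" and f :: "real^'n => real" and L :: "(real^'n) set => real"
 assumes finite_pieces: "finite S"
  and pieces: "!!e. e \<in> S ==> compact e" "!!e. e \<in> S ==> convex e"
  and L_nonneg: "!!e. e \<in> S ==> 0 <= L e"
  and lipschitz: "!!e x y. e \<in> S ==> x \<in> e ==> y \<in> e ==> \<bar>f x - f y\<bar> <= L e * norm (x - y)"
  and f_borel [measurable]: "f \<in> borel_measurable borel"
begin

definition slope :: "real^'n => real" where
 "slope x = (\<Sum>e\<in>S. L e * indicator e x)"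

lemma piece_borel: "e \<in> S ==> e \<in> sets borel"
 using pieces by (simp add: borel_compact)

lemma slope_borel [measurable]: "slope \<in> borel_measurable borel"
proof -
 have "(%x. L e * indicator e x) \<in> borel_measurable borel" if "e \<in> S" for e
  using piece_borel[OF that] by simp
 then show ?thesis unfolding slope_def[abs_def] by (rule borel_measurable_sum)
qed

lemma slope_nonneg: "0 <= slope x"
 unfolding slope_def using L_nonneg by (intro sum_nonneg) auto

lemma slope_le: "slope x <= (\<Sum>e\<in>S. L e)"
 unfolding slope_def using L_nonneg by (intro sum_mono) (auto simp: indicator_def)

text \<open>The fundamental theorem along a segment, in the form of an inequality, followed by Cauchy-Schwarz.\<close>

lemma segment_bound:
 assumes ab: "\<alpha> <= \<beta>" and seg: "!!t. \<alpha> <= t ==> t <= \<beta> ==> p + t *\<^sub>R w \<in> \<Union>S"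
 shows "ennreal ((f (p + \<alpha> *\<^sub>R w) - f (p + \<beta> *\<^sub>R w))^2) <=
  ennreal ((norm w)^2 * (\<beta> - \<alpha>)) * (\<integral>\<^sup>+t. ennreal ((slope (p + t *\<^sub>R w))^2) * indicator {\<alpha>..\<beta>} t \<partial>lborel)"
proof -
 define I where "I e = {t. p + t *\<^sub>R w \<in> e}" for e
 define D where "D t = slope (p + t *\<^sub>R w)" for t
 have clI: "closed (I e)" if "e \<in> S" for e
 proof -
  have "I e = (%t. p + t *\<^sub>R w) -` e" by (auto simp: I_def)
  then show ?thesis using pieces(1)[OF that]
   by (simp add: closed_vimage compact_imp_closed continuous_intros)
 qed
 have cvI: "convex (I e)" if "e \<in> S" for e
 proof (unfold convex_alt, intro ballI allI impI)
  fix s t u assume st: "s \<in> I e" "t \<in> I e" and u: "0 <= u \<and> u <= (1::real)"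
  have "p + ((1 - u) *\<^sub>R s + u *\<^sub>R t) *\<^sub>R w = (1 - u) *\<^sub>R (p + s *\<^sub>R w) + u *\<^sub>R (p + t *\<^sub>R w)"
   by (simp add: algebra_simps)
  then show "(1 - u) *\<^sub>R s + u *\<^sub>R t \<in> I e" using pieces(2)[OF that] st u by (simp add: I_def convex_alt)
 qed
 have bor: "D \<in> borel_measurable borel" unfolding D_def by measurable
 have Dint: "set_integrable lborel {\<alpha>..\<beta>} D" "set_integrable lborel {\<alpha>..\<beta>} (%t. (D t)^2)"
 proof -
  have 0: "0 <= D t" "D t <= (\<Sum>e\<in>S. L e)" for t using slope_nonneg slope_le by (simp_all add: D_def)
  then show "set_integrable lborel {\<alpha>..\<beta>} D"
   using bor by (intro bounded_set_integrable[where B="\<Sum>e\<in>S. L e"]) auto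
  show "set_integrable lborel {\<alpha>..\<beta>} (%t. (D t)^2)"
   using bor 0 by (intro bounded_set_integrable[where B="(\<Sum>e\<in>S. L e)^2"]) (auto intro!: power_mono)
 qed
 have "\<bar>f (p + \<alpha> *\<^sub>R w) - f (p + \<beta> *\<^sub>R w)\<bar> <= (\<Sum>e\<in>S. (L e * norm w) * vol (I e \<inter> {\<alpha>..\<beta>}))"
 proof (rule interval_chain[OF finite_pieces clI cvI, where \<phi>="%t. f (p + t *\<^sub>R w)"])
  show "{\<alpha>..\<beta>} \<subseteq> (\<Union>e\<in>S. I e)" using seg by (fastforce simp: I_def)
  fix e s t assume e: "e \<in> S" "s \<in> I e" "t \<in> I e"
  have "norm ((p + s *\<^sub>R w) - (p + t *\<^sub>R w)) = \<bar>s - t\<bar> * norm w"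
   by (metis add_diff_cancel_left norm_scaleR scaleR_diff_left)
  then show "\<bar>f (p + s *\<^sub>R w) - f (p + t *\<^sub>R w)\<bar> <= L e * norm w * \<bar>s - t\<bar>"
   using lipschitz[OF e(1), of "p + s *\<^sub>R w" "p + t *\<^sub>R w"] e by (simp add: I_def mult_ac)
 qed (use L_nonneg ab in auto)
 also have "... = norm w * (LBINT t:{\<alpha>..\<beta>}. D t)"
 proof -
  have "(LBINT t:{\<alpha>..\<beta>}. D t) = (LBINT t. (\<Sum>e\<in>S. L e * indicator (I e \<inter> {\<alpha>..\<beta>}) t))"
   unfolding set_lebesgue_integral_def D_def slope_def
   by (intro Bochner_Integration.integral_cong refl) (auto simp: sum_distrib_left I_def indicator_def intro!: sum.cong)
  also have "... = (\<Sum>e\<in>S. (LBINT t. L e * indicator (I e \<inter> {\<alpha>..\<beta>}) t))"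
  proof (rule Bochner_Integration.integral_sum)
   fix e assume "e \<in> S"
   then have "compact (I e \<inter> {\<alpha>..\<beta>})" using clI by (simp add: closed_Int_compact)
   then show "integrable lborel (%t. L e * indicator (I e \<inter> {\<alpha>..\<beta>}) t)"
    using emeasure_compact_finite[of "I e \<inter> {\<alpha>..\<beta>}"]
    by (intro integrable_mult_right integrable_real_indicator) (auto simp: borel_compact)
  qed
  also have "... = (\<Sum>e\<in>S. L e * vol (I e \<inter> {\<alpha>..\<beta>}))"
   using clI by (intro sum.cong refl) auto
  finally show ?thesis by (simp add: sum_distrib_left mult_ac)
 qed
 finally have 1: "\<bar>f (p + \<alpha> *\<^sub>R w) - f (p + \<beta> *\<^sub>R w)\<bar> <= norm w * (LBINT t:{\<alpha>..\<beta>}. D t)" .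
 then have "(f (p + \<alpha> *\<^sub>R w) - f (p + \<beta> *\<^sub>R w))^2 <= (norm w * (LBINT t:{\<alpha>..\<beta>}. D t))^2"
  using abs_le_square_iff[of "f (p + \<alpha> *\<^sub>R w) - f (p + \<beta> *\<^sub>R w)" "norm w * (LBINT t:{\<alpha>..\<beta>}. D t)"] by linarith
 also have "... <= (norm w)^2 * ((\<beta> - \<alpha>) * (LBINT t:{\<alpha>..\<beta>}. (D t)^2))"
  unfolding power_mult_distrib using integral_square_le[OF ab Dint] by (intro mult_left_mono) auto
 finally have "ennreal ((f (p + \<alpha> *\<^sub>R w) - f (p + \<beta> *\<^sub>R w))^2) <= ennreal ((norm w)^2 * (\<beta> - \<alpha>)) * ennreal (LBINT t:{\<alpha>..\<beta>}. (D t)^2)"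
  using ab by (subst ennreal_mult[symmetric]) (auto simp: set_lebesgue_integral_def mult.assoc intro!: integral_nonneg_AE ennreal_leI)
 also have "ennreal (LBINT t:{\<alpha>..\<beta>}. (D t)^2) = (\<integral>\<^sup>+t. ennreal ((D t)^2) * indicator {\<alpha>..\<beta>} t \<partial>lborel)"
  using nn_integral_eq_integral[OF Dint(2)[unfolded set_integrable_def]]
  by (simp add: set_lebesgue_integral_def ennreal_indicator[symmetric] ennreal_mult'' mult.commute)
 finally show ?thesis by (simp add: D_def)
qed

text \<open>The squared difference is integrated along the segment between \<open>x\<close> and \<open>y\<close>. For a parameter in
  one half of the unit interval the point on the segment is a contraction in \<open>x\<close> by a factor of at least
  one half, in the other half a contraction in \<open>y\<close>; so the Jacobians stay bounded.\<close>

lemma double_integral_bound: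
 assumes K: "compact K" "convex K" "K \<subseteq> \<Union>S" and H: "!!x y. x \<in> K ==> y \<in> K ==> norm (x - y) <= H"
 shows "(\<integral>\<^sup>+y. (\<integral>\<^sup>+x. ennreal ((f x - f y)^2) * indicator K x \<partial>lborel) * indicator K y \<partial>lborel)
  <= ennreal (H^2 * 2 ^ CARD('n)) * (\<integral>\<^sup>+x. ennreal ((slope x)^2) * indicator K x \<partial>lborel) * emeasure lborel K"
proof -
 have [measurable]: "K \<in> sets borel" using K(1) by (rule borel_compact)
 let ?g = "%x. ennreal ((slope x)^2)"
 let ?I = "\<integral>\<^sup>+x. ?g x * indicator K x \<partial>lborel"
 let ?h = "%x y t. ?g (y + t *\<^sub>R (x - y)) * indicator {0..1} t * indicator K x * indicator K y"
 have contr: "(\<integral>\<^sup>+y. ?g ((1 - \<theta>) *\<^sub>R x + \<theta> *\<^sub>R y) * indicator K y \<partial>lborel) <= ennreal (2 ^ CARD('n)) * ?I"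
  if "x \<in> K" "1 / 2 <= \<theta>" "\<theta> <= 1" for x \<theta>
 proof -
  have "(\<integral>\<^sup>+y. ?g ((1 - \<theta>) *\<^sub>R x + \<theta> *\<^sub>R y) * indicator K y \<partial>lborel) <= ennreal ((1 / \<theta>) ^ DIM(real^'n)) * ?I"
   using K that by (intro nn_integral_contraction) auto
  also have "... <= ennreal (2 ^ CARD('n)) * ?I"
  proof -
   have "1 / \<theta> <= 2" using that by (simp add: divide_le_eq)
   then show ?thesis using that by (intro mult_right_mono ennreal_leI) (auto intro!: power_mono)
  qed
  finally show ?thesis .
 qed
 have inner: "(\<integral>\<^sup>+y. (\<integral>\<^sup>+x. ?h x y t \<partial>lborel) \<partial>lborel) <= ennreal (2 ^ CARD('n)) * ?I * emeasure lborel K * indicator {0..1} t" for t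
 proof (cases "t \<in> {0..1}")
  case t: True
  have const: "(\<integral>\<^sup>+x. ennreal (2 ^ CARD('n)) * ?I * indicator K x \<partial>lborel) = ennreal (2 ^ CARD('n)) * ?I * emeasure lborel K"
   by (subst nn_integral_cmult_indicator) auto
  show ?thesis
  proof (cases "1 / 2 <= t")
   case True
   have "(\<integral>\<^sup>+y. (\<integral>\<^sup>+x. ?h x y t \<partial>lborel) \<partial>lborel) <= (\<integral>\<^sup>+y. ennreal (2 ^ CARD('n)) * ?I * indicator K y \<partial>lborel)"
   proof (intro nn_integral_mono)
    fix y :: "real^'n"
    have eq: "y + t *\<^sub>R (x - y) = (1 - t) *\<^sub>R y + t *\<^sub>R x" for x by (simp add: algebra_simps)
    show "(\<integral>\<^sup>+x. ?h x y t \<partial>lborel) <= ennreal (2 ^ CARD('n)) * ?I * indicator K y"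
     using contr[of y t] True t unfolding eq by (cases "y \<in> K") auto
   qed
   then show ?thesis using const t by simp
  next
   case False
   have "(\<integral>\<^sup>+y. (\<integral>\<^sup>+x. ?h x y t \<partial>lborel) \<partial>lborel) = (\<integral>\<^sup>+x. (\<integral>\<^sup>+y. ?h x y t \<partial>lborel) \<partial>lborel)"
    by (rule lborel_pair.Fubini') measurable
   also have "... <= (\<integral>\<^sup>+x. ennreal (2 ^ CARD('n)) * ?I * indicator K x \<partial>lborel)"
   proof (intro nn_integral_mono)
    fix x :: "real^'n"
    have eq: "y + t *\<^sub>R (x - y) = (1 - (1 - t)) *\<^sub>R x + (1 - t) *\<^sub>R y" for y by (simp add: algebra_simps)
    show "(\<integral>\<^sup>+y. ?h x y t \<partial>lborel) <= ennreal (2 ^ CARD('n)) * ?I * indicator K x"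
     using contr[of x "1 - t"] False t unfolding eq by (cases "x \<in> K") auto
   qed
   finally show ?thesis using const t by simp
  qed
 qed simp
 have "(\<integral>\<^sup>+y. (\<integral>\<^sup>+x. ennreal ((f x - f y)^2) * indicator K x \<partial>lborel) * indicator K y \<partial>lborel)
  = (\<integral>\<^sup>+y. (\<integral>\<^sup>+x. ennreal ((f x - f y)^2) * indicator K x * indicator K y \<partial>lborel) \<partial>lborel)"
  by (intro nn_integral_cong nn_integral_multc[symmetric]) measurable
 also have "... <= (\<integral>\<^sup>+y. (\<integral>\<^sup>+x. ennreal (H^2) * (\<integral>\<^sup>+t. ?h x y t \<partial>lborel) \<partial>lborel) \<partial>lborel)"
 proof (intro nn_integral_mono)
  fix x y :: "real^'n"
  show "ennreal ((f x - f y)^2) * indicator K x * indicator K y <= ennreal (H^2) * (\<integral>\<^sup>+t. ?h x y t \<partial>lborel)"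
  proof (cases "x \<in> K \<and> y \<in> K")
   case True
   have "y + t *\<^sub>R (x - y) \<in> \<Union>S" if "0 <= t" "t <= 1" for t
   proof -
    have "(1 - t) *\<^sub>R y + t *\<^sub>R x \<in> K" using K(2) True that by (simp add: convex_alt)
    then show ?thesis using K(3) by (auto simp: algebra_simps)
   qed
   then have "ennreal ((f (y + 0 *\<^sub>R (x - y)) - f (y + 1 *\<^sub>R (x - y)))^2) <=
    ennreal ((norm (x - y))^2 * (1 - 0)) * (\<integral>\<^sup>+t. ennreal ((slope (y + t *\<^sub>R (x - y)))^2) * indicator {0..1} t \<partial>lborel)"
    by (intro segment_bound) auto
   also have "... <= ennreal (H^2) * (\<integral>\<^sup>+t. ennreal ((slope (y + t *\<^sub>R (x - y)))^2) * indicator {0..1} t \<partial>lborel)"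
    using H True by (intro mult_right_mono ennreal_leI) (auto intro!: power_mono)
   finally show ?thesis using True by (simp add: power2_commute)
  qed (auto simp: indicator_def)
 qed
 also have "... = ennreal (H^2) * (\<integral>\<^sup>+y. (\<integral>\<^sup>+x. (\<integral>\<^sup>+t. ?h x y t \<partial>lborel) \<partial>lborel) \<partial>lborel)"
  by (subst nn_integral_cmult, measurable)+
 finally have outer: "(\<integral>\<^sup>+y. (\<integral>\<^sup>+x. ennreal ((f x - f y)^2) * indicator K x \<partial>lborel) * indicator K y \<partial>lborel)
  <= ennreal (H^2) * (\<integral>\<^sup>+y. (\<integral>\<^sup>+x. (\<integral>\<^sup>+t. ?h x y t \<partial>lborel) \<partial>lborel) \<partial>lborel)" .
 have "(\<integral>\<^sup>+y. (\<integral>\<^sup>+x. (\<integral>\<^sup>+t. ?h x y t \<partial>lborel) \<partial>lborel) \<partial>lborel) = (\<integral>\<^sup>+y. (\<integral>\<^sup>+t. (\<integral>\<^sup>+x. ?h x y t \<partial>lborel) \<partial>lborel) \<partial>lborel)"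
  by (intro nn_integral_cong lborel_pair.Fubini') measurable
 also have "... = (\<integral>\<^sup>+t. (\<integral>\<^sup>+y. (\<integral>\<^sup>+x. ?h x y t \<partial>lborel) \<partial>lborel) \<partial>lborel)"
  by (rule lborel_pair.Fubini') measurable
 also have "... <= (\<integral>\<^sup>+t. ennreal (2 ^ CARD('n)) * ?I * emeasure lborel K * indicator {0..1::real} t \<partial>lborel)"
  by (intro nn_integral_mono inner)
 also have "... = ennreal (2 ^ CARD('n)) * ?I * emeasure lborel K"
  by (subst nn_integral_cmult_indicator) auto
 finally have "ennreal (H^2) * (\<integral>\<^sup>+y. (\<integral>\<^sup>+x. (\<integral>\<^sup>+t. ?h x y t \<partial>lborel) \<partial>lborel) \<partial>lborel) <=
  ennreal (H^2) * (ennreal (2 ^ CARD('n)) * ?I * emeasure lborel K)" by (intro mult_left_mono) auto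
 moreover have "ennreal (H^2 * 2 ^ CARD('n)) = ennreal (H^2) * ennreal (2 ^ CARD('n))" by (rule ennreal_mult') simp
 ultimately show ?thesis using outer by (simp add: mult.assoc)
qed

lemma slope_square_integrable: "compact K ==> set_integrable lborel K (%x. (slope x)^2)"
 using slope_nonneg slope_le
 by (auto intro!: bounded_set_integrable[where B="(\<Sum>e\<in>S. L e)^2"] power_mono
   simp: compact_imp_bounded borel_compact)

lemma nn_slope_square:
 assumes "compact K"
 shows "(\<integral>\<^sup>+x. ennreal ((slope x)^2) * indicator K x \<partial>lborel) = ennreal (LBINT x:K. (slope x)^2)"
 using nn_integral_eq_integral[OF slope_square_integrable[OF assms, unfolded set_integrable_def]]
 by (simp add: set_lebesgue_integral_def ennreal_indicator[symmetric] ennreal_mult'' mult.commute)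

text \<open>The constant in Poincare's inequality is a point value: the double integral bounds the
  mean over \<open>y\<close> of the squared distance of \<open>f\<close> to \<open>f y\<close>.\<close>

lemma poincare:
 assumes K: "compact K" "convex K" "K \<subseteq> \<Union>S" and H: "!!x y. x \<in> K ==> y \<in> K ==> norm (x - y) <= H"
  and pos: "0 < vol K"
 shows "\<exists>c. (\<integral>\<^sup>+x. ennreal ((f x - c)^2) * indicator K x \<partial>lborel)
  <= ennreal (H^2 * 2 ^ CARD('n) * (LBINT x:K. (slope x)^2))"
proof (rule ccontr)
 assume no: "\<not> ?thesis"
 have [measurable]: "K \<in> sets borel" using K(1) by (rule borel_compact)
 let ?R = "ennreal (H^2 * 2 ^ CARD('n) * (LBINT x:K. (slope x)^2))"
 let ?\<phi> = "%y. \<integral>\<^sup>+x. ennreal ((f x - f y)^2) * indicator K x \<partial>lborel"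
 have gt: "?R < ?\<phi> y" for y using no by (auto simp: not_le)
 have fin: "emeasure lborel K \<noteq> \<infinity>" using emeasure_compact_finite[OF K(1)] by auto
 have "(\<integral>\<^sup>+y. ?R * indicator K y \<partial>lborel) < (\<integral>\<^sup>+y. ?\<phi> y * indicator K y \<partial>lborel)"
 proof (rule nn_integral_less)
  show "(\<integral>\<^sup>+y. ?R * indicator K y \<partial>lborel) \<noteq> \<infinity>"
   using fin by (subst nn_integral_cmult_indicator) (auto simp: ennreal_mult_eq_top_iff)
  show "AE y in lborel. ?R * indicator K y <= ?\<phi> y * indicator K y"
   using gt by (auto simp: indicator_def less_imp_le)
  show "\<not> (AE y in lborel. ?\<phi> y * indicator K y <= ?R * indicator K y)"
  proof
   assume "AE y in lborel. ?\<phi> y * indicator K y <= ?R * indicator K y"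
   then have "AE y in lborel. y \<notin> K"
   proof (rule AE_mp, intro AE_I2 impI notI)
    fix y assume "?\<phi> y * indicator K y <= ?R * indicator K y" "y \<in> K"
    with gt[of y] show False by (simp add: not_le[symmetric])
   qed
   then have "emeasure lborel K = 0" by (subst (asm) AE_iff_measurable[OF _ refl]) auto
   then show False using pos by (simp add: measure_def)
  qed
 qed measurable
 also have "... <= ennreal (H^2 * 2 ^ CARD('n)) * ennreal (LBINT x:K. (slope x)^2) * emeasure lborel K"
  using double_integral_bound[OF K H] unfolding nn_slope_square[OF K(1)] .
 also have "... = (\<integral>\<^sup>+y. ?R * indicator K y \<partial>lborel)"
  by (subst nn_integral_cmult_indicator) (auto simp: ennreal_mult')
 finally show False by simp
qed

text \<open>Radial projection from the vertex \<open>a\<close> onto the opposite facet: the projected function is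
  homogeneous of degree zero, so its mean over the simplex is the mean of \<open>f\<close> over the facet.\<close>

lemma radial_projection_bound:
 assumes E: "full_simplex E" "a \<in> verts E" "E \<subseteq> \<Union>S" and H: "!!x y. x \<in> E ==> y \<in> E ==> norm (x - y) <= H"
 shows "(\<integral>\<^sup>+z. ennreal ((f z - f (a + (1 / (1 - bary E a z)) *\<^sub>R (z - a)))^2) * indicator E z \<partial>lborel)
  <= ennreal (H^2 * (LBINT x:E. (slope x)^2))"
proof -
 have [measurable]: "E \<in> sets borel" using simplex_compact[OF E(1)] by (rule borel_compact)
 let ?g = "%x. ennreal ((slope x)^2) * indicator E x"
 let ?I = "\<integral>\<^sup>+x. ?g x \<partial>lborel"
 have pt: "ennreal ((f z - f (a + (1 / (1 - bary E a z)) *\<^sub>R (z - a)))^2) * indicator E z <=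
  (\<integral>\<^sup>+\<tau>. ennreal (H^2) * (ennreal (1 / \<tau>) * ?g (a + \<tau> *\<^sub>R (z - a)) * indicator {1..} \<tau>) \<partial>lborel)" for z
 proof (cases "z \<in> E \<and> z \<noteq> a")
  case True
  define s where "s = 1 - bary E a z"
  obtain y t where yt: "y \<in> opp_face E a" "t \<in> {0..1}" "z = a + t *\<^sub>R (y - a)"
   using subsetD[OF equalityD1[OF simplex_as_cone[OF E(1,2)]]] True by blast
  have "bary E a z = (1 - t) * bary E a a + t * bary E a y" unfolding yt(3) by (rule bary_line[OF E(1,2)])
  then have st: "s = t" using yt(1) bary_vert[OF E(1,2,2)] by (simp add: s_def opp_face_def)
  have s: "0 < s" "s <= 1" using st yt True by (auto simp: less_le)
  have aE: "a \<in> E" "y \<in> E" using E(2) verts_subset yt(1) by (auto simp: opp_face_def)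
  have inE: "a + \<tau> *\<^sub>R (z - a) \<in> E" if "0 <= \<tau>" "\<tau> <= 1 / s" for \<tau>
  proof -
   have "a + \<tau> *\<^sub>R (z - a) = (1 - \<tau> * s) *\<^sub>R a + (\<tau> * s) *\<^sub>R y" by (simp add: yt(3) st algebra_simps)
   moreover have "0 <= \<tau> * s" "\<tau> * s <= 1" using that s by (auto simp: field_simps)
   ultimately show ?thesis using simplex_convex[OF E(1)] aE by (simp add: convex_alt)
  qed
  have nz: "norm (z - a) <= s * H" using H[OF aE(2,1)] s by (simp add: yt(3) st)
  have H0: "0 <= H" using H[OF aE(1,1)] by simp
  have "ennreal ((f (a + 1 *\<^sub>R (z - a)) - f (a + (1 / s) *\<^sub>R (z - a)))^2) <=
   ennreal ((norm (z - a))^2 * (1 / s - 1)) * (\<integral>\<^sup>+\<tau>. ennreal ((slope (a + \<tau> *\<^sub>R (z - a)))^2) * indicator {1..1 / s} \<tau> \<partial>lborel)"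
  proof (rule segment_bound)
   show "a + \<tau> *\<^sub>R (z - a) \<in> \<Union>S" if "1 <= \<tau>" "\<tau> <= 1 / s" for \<tau>
    by (rule subsetD[OF E(3) inE]) (use that in auto)
  qed (use s in auto)
  also have "... <= ennreal (H^2 * s) * (\<integral>\<^sup>+\<tau>. ennreal ((slope (a + \<tau> *\<^sub>R (z - a)))^2) * indicator {1..1 / s} \<tau> \<partial>lborel)"
  proof (intro mult_right_mono ennreal_leI)
   have "(norm (z - a))^2 * (1 / s - 1) <= (s * H)^2 * (1 / s)"
    using nz s H0 by (intro mult_mono power_mono) auto
   also have "... = H^2 * s" using s by (simp add: power2_eq_square)
   finally show "(norm (z - a))^2 * (1 / s - 1) <= H^2 * s" .
  qed simp
  also have "... = (\<integral>\<^sup>+\<tau>. ennreal (H^2 * s) * (ennreal ((slope (a + \<tau> *\<^sub>R (z - a)))^2) * indicator {1..1 / s} \<tau>) \<partial>lborel)"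
   by (rule nn_integral_cmult[symmetric]) measurable
  also have "... <= (\<integral>\<^sup>+\<tau>. ennreal (H^2) * (ennreal (1 / \<tau>) * ?g (a + \<tau> *\<^sub>R (z - a)) * indicator {1..} \<tau>) \<partial>lborel)"
  proof (intro nn_integral_mono)
   fix \<tau> :: real
   show "ennreal (H^2 * s) * (ennreal ((slope (a + \<tau> *\<^sub>R (z - a)))^2) * indicator {1..1 / s} \<tau>) <=
    ennreal (H^2) * (ennreal (1 / \<tau>) * ?g (a + \<tau> *\<^sub>R (z - a)) * indicator {1..} \<tau>)"
   proof (cases "\<tau> \<in> {1..1 / s}")
    case \<tau>: True
    then have "s <= 1 / \<tau>" using s by (simp add: field_simps)
    then have "H^2 * s * (slope (a + \<tau> *\<^sub>R (z - a)))^2 <= H^2 * (1 / \<tau> * (slope (a + \<tau> *\<^sub>R (z - a)))^2)"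
     unfolding mult.assoc by (intro mult_left_mono mult_right_mono) auto
    then have "ennreal (H^2 * s) * ennreal ((slope (a + \<tau> *\<^sub>R (z - a)))^2) <=
     ennreal (H^2) * (ennreal (1 / \<tau>) * ennreal ((slope (a + \<tau> *\<^sub>R (z - a)))^2))"
     using s \<tau> by (simp add: ennreal_mult[symmetric] ennreal_leI)
    then show ?thesis using \<tau> inE by simp
   qed simp
  qed
  finally show ?thesis using True by (simp add: s_def)
 qed (auto simp: indicator_def)
 have "(\<integral>\<^sup>+z. ennreal ((f z - f (a + (1 / (1 - bary E a z)) *\<^sub>R (z - a)))^2) * indicator E z \<partial>lborel) <=
  (\<integral>\<^sup>+z. (\<integral>\<^sup>+\<tau>. ennreal (H^2) * (ennreal (1 / \<tau>) * ?g (a + \<tau> *\<^sub>R (z - a)) * indicator {1..} \<tau>) \<partial>lborel) \<partial>lborel)"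
  by (intro nn_integral_mono pt)
 also have "... = (\<integral>\<^sup>+\<tau>. (\<integral>\<^sup>+z. ennreal (H^2) * (ennreal (1 / \<tau>) * ?g (a + \<tau> *\<^sub>R (z - a)) * indicator {1..} \<tau>) \<partial>lborel) \<partial>lborel)"
  by (rule lborel_pair.Fubini') measurable
 also have "... <= (\<integral>\<^sup>+\<tau>. ennreal (H^2) * ?I * (ennreal (1 / \<tau>^2) * indicator {1..} \<tau>) \<partial>lborel)"
 proof (intro nn_integral_mono)
  fix \<tau> :: real
  show "(\<integral>\<^sup>+z. ennreal (H^2) * (ennreal (1 / \<tau>) * ?g (a + \<tau> *\<^sub>R (z - a)) * indicator {1..} \<tau>) \<partial>lborel) <=
   ennreal (H^2) * ?I * (ennreal (1 / \<tau>^2) * indicator {1..} \<tau>)"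
  proof (cases "\<tau> \<ge> 1")
   case True
   have eq: "a + \<tau> *\<^sub>R (z - a) = (a - \<tau> *\<^sub>R a) + \<tau> *\<^sub>R z" for z by (simp add: algebra_simps)
   have I: "?I = ennreal (\<tau> ^ CARD('n)) * (\<integral>\<^sup>+z. ?g (a + \<tau> *\<^sub>R (z - a)) \<partial>lborel)"
    using nn_integral_homothety[of ?g \<tau> "a - \<tau> *\<^sub>R a"] True unfolding eq by simp
   have "\<tau> ^ 1 <= \<tau> ^ CARD('n)" using True by (intro power_increasing) auto
   then have "ennreal (1 / \<tau>) <= ennreal (\<tau> ^ CARD('n)) * ennreal (1 / \<tau>^2)"
    using True by (simp add: ennreal_mult[symmetric] ennreal_leI power2_eq_square field_simps)
   then have "ennreal (1 / \<tau>) * (\<integral>\<^sup>+z. ?g (a + \<tau> *\<^sub>R (z - a)) \<partial>lborel) <= ?I * ennreal (1 / \<tau>^2)"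
    unfolding I by (metis (no_types, lifting) mult.assoc mult.commute mult_right_mono zero_le)
   then have "ennreal (H^2) * (ennreal (1 / \<tau>) * (\<integral>\<^sup>+z. ?g (a + \<tau> *\<^sub>R (z - a)) \<partial>lborel)) <= ennreal (H^2) * (?I * ennreal (1 / \<tau>^2))"
    by (intro mult_left_mono) auto
   moreover have "(\<integral>\<^sup>+z. ennreal (H^2) * (ennreal (1 / \<tau>) * ?g (a + \<tau> *\<^sub>R (z - a)) * indicator {1..} \<tau>) \<partial>lborel) =
    ennreal (H^2) * (ennreal (1 / \<tau>) * (\<integral>\<^sup>+z. ?g (a + \<tau> *\<^sub>R (z - a)) \<partial>lborel))"
   proof -
    have m: "(%z. ?g (a + \<tau> *\<^sub>R (z - a))) \<in> borel_measurable lborel"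
     "(%z. ennreal (1 / \<tau>) * ?g (a + \<tau> *\<^sub>R (z - a))) \<in> borel_measurable lborel" by measurable
    show ?thesis using True nn_integral_cmult[OF m(1), of "ennreal (1 / \<tau>)"] nn_integral_cmult[OF m(2), of "ennreal (H^2)"]
     by simp
   qed
   ultimately show ?thesis using True by (simp add: mult.assoc)
  qed simp
 qed
 also have "... = ennreal (H^2) * ?I * (\<integral>\<^sup>+\<tau>. ennreal (1 / \<tau>^2) * indicator {1..} \<tau> \<partial>lborel)"
  by (rule nn_integral_cmult) measurable
 also have "(\<integral>\<^sup>+\<tau>. ennreal (1 / \<tau>^2) * indicator {1..} \<tau> \<partial>lborel) = ennreal (0 - (- 1 / 1))"
 proof (rule nn_integral_FTC_atLeast[where F="%\<tau>. - 1 / \<tau>"])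
  show "((%\<tau>. - 1 / \<tau>) has_real_derivative 1 / x^2) (at x)" if "1 <= x" for x :: real
   using that by (auto intro!: derivative_eq_intros simp: power2_eq_square)
  show "((%\<tau>::real. - 1 / \<tau>) \<longlongrightarrow> 0) at_top"
   by (intro tendsto_divide_0[OF tendsto_const] filterlim_at_top_imp_at_infinity filterlim_ident)
 qed auto
 finally show ?thesis using nn_slope_square[OF simplex_compact[OF E(1)]]
  by (simp add: ennreal_mult')
qed

text \<open>Extended to the simplex by radial projection from \<open>a\<close>, the trace of \<open>f - c\<close> on the facet has the same
  mean value there as on the facet, by the cone formula of degree zero. Its distance to \<open>f - c\<close> on the
  simplex is bounded by the slopes along the rays.\<close>

lemma facet_trace:
 assumes E: "full_simplex E" "a \<in> verts E" "E \<subseteq> \<Union>S" and H: "!!x y. x \<in> E ==> y \<in> E ==> norm (x - y) <= H"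
  and B: "!!x. x \<in> E ==> \<bar>f x\<bar> <= B"
 shows "vol E * (surface_integral (opp_face E a) f / area (opp_face E a) - c)^2 <=
  2 * (H^2 * (LBINT x:E. (slope x)^2)) + 2 * (LBINT x:E. (f x - c)^2)"
proof -
 let ?F = "opp_face E a"
 have cE: "compact E" by (rule simplex_compact[OF E(1)])
 have [measurable]: "E \<in> sets borel" using cE by (rule borel_compact)
 have F: "flat ?F" by (rule opp_face_flat[OF E(1,2)])
 define y where "y z = a + (1 / (1 - bary E a z)) *\<^sub>R (z - a)" for z
 define h where "h z = f (y z) - c" for z
 have bm[measurable]: "bary E a \<in> borel_measurable borel"
  by (intro borel_measurable_continuous_onI bary_continuous[OF E(1,2)])
 have [measurable]: "y \<in> borel_measurable borel" unfolding y_def by measurable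
 have hm[measurable]: "h \<in> borel_measurable borel" unfolding h_def by measurable
 have yF: "y (a + s *\<^sub>R (x - a)) = x" if "x \<in> ?F" "0 < s" "s <= 1" for x s
 proof -
  have "bary E a (a + s *\<^sub>R (x - a)) = (1 - s) * bary E a a + s * bary E a x" by (rule bary_line[OF E(1,2)])
  then have "bary E a (a + s *\<^sub>R (x - a)) = 1 - s" using that bary_vert[OF E(1,2,2)] by (simp add: opp_face_def)
  then show ?thesis using that by (simp add: y_def)
 qed
 have hF: "h x = f x - c" if "x \<in> ?F" for x using yF[OF that, of 1] by (simp add: h_def)
 have FE: "?F \<subseteq> E" by (auto simp: opp_face_def)
 have Bh: "\<bar>h x\<bar> <= B + \<bar>c\<bar>" if "x \<in> ?F" for x using hF[OF that] B[of x] FE that by fastforce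
 have hom: "h (a + s *\<^sub>R (x - a)) = s ^ 0 * h x" if "x \<in> ?F" "0 < s" "s <= 1" for x s
  using yF[OF that] yF[OF that(1), of 1] by (simp add: h_def)
 have ih: "set_integrable lborel E h" by (rule cone_formula(1)[OF E(1,2) hm Bh hom])
 have "real (CARD('n) + 0) * (LBINT z:E. h z) = surface_integral ?F h / norm (bary_grad E a)"
  by (rule cone_formula(2)[OF E(1,2) hm Bh hom])
 moreover have "surface_integral ?F h = surface_integral ?F f - c * area ?F"
 proof -
  have "surface_integral ?F h = surface_integral ?F (%x. f x - c)"
   using hF by (intro surface_integral_cong[OF F]) auto
  also have "... = surface_integral ?F f - surface_integral ?F (%x. c)"
  proof (rule Bochner_Integration.integral_diff)
   show "integrable (face_measure ?F) f" by (rule surface_integrable[OF F f_borel, of B]) (use B FE in blast)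
   show "integrable (face_measure ?F) (%x. c)" by (rule surface_integrable[OF F, of _ "\<bar>c\<bar>"]) auto
  qed
  also have "surface_integral ?F (%x. c) = c * area ?F" by (simp add: area_def)
  finally show ?thesis .
 qed
 moreover have "surface_integral ?F f / area ?F - c = (surface_integral ?F f - c * area ?F) / area ?F"
  using area_pos(2)[OF E(1,2)] by (simp add: field_simps)
 ultimately have "surface_integral ?F f / area ?F - c = (real CARD('n) * (LBINT z:E. h z) * norm (bary_grad E a)) / area ?F"
  using bary_grad_nonzero[OF E(1,2)] by (simp add: field_simps)
 then have t: "(LBINT z:E. h z) = vol E * (surface_integral ?F f / area ?F - c)"
  using area_pos(1)[OF E(1,2)] bary_grad_nonzero[OF E(1,2)] simplex_measure_pos[OF E(1)] by simp
 have bdE: "\<bar>h z\<bar> <= B + \<bar>c\<bar> + (if z = a then 2 * \<bar>h a\<bar> else 0)" if z: "z \<in> E" for z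
 proof (cases "z = a")
  case False
  obtain x s where "x \<in> ?F" "s \<in> {0..1}" "z = a + s *\<^sub>R (x - a)"
   using subsetD[OF equalityD1[OF simplex_as_cone[OF E(1,2)]] z] by blast
  with False have "x \<in> ?F" "0 < s" "s <= 1" "z = a + s *\<^sub>R (x - a)" by (auto simp: less_le)
  then have "h z = h x" using hom[of x s] by simp
  then show ?thesis using Bh[OF \<open>x \<in> ?F\<close>] False by simp
 next
  case True
  have "0 <= B" using B[OF z] by linarith
  then show ?thesis using True by simp
 qed
 have i2: "set_integrable lborel E (%z. (h z)^2)"
  unfolding set_integrable_def
 proof (rule integrableI_bounded_set_indicator[where B="(B + \<bar>c\<bar> + 2 * \<bar>h a\<bar>)^2"])
  show "AE z in lborel. z \<in> E \<longrightarrow> norm ((h z)^2) <= (B + \<bar>c\<bar> + 2 * \<bar>h a\<bar>)^2"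
  proof (intro AE_I2 impI)
   fix z assume "z \<in> E"
   from bdE[OF this] have "\<bar>h z\<bar> <= B + \<bar>c\<bar> + 2 * \<bar>h a\<bar>" by (auto split: if_splits)
   then show "norm ((h z)^2) <= (B + \<bar>c\<bar> + 2 * \<bar>h a\<bar>)^2" by (simp add: abs_le_square_iff[symmetric])
  qed
 qed (use emeasure_compact_finite[OF cE] in auto)
 have CS: "(LBINT z:E. h z)^2 <= vol E * (LBINT z:E. (h z)^2)"
 proof -
  define m where "m = (LBINT z:E. h z)"
  define V where "V = vol E"
  have V: "0 < V" unfolding V_def by (rule simplex_measure_pos[OF E(1)])
  define k where "k = m / V"
  have ic: "set_integrable lborel E (%t. k^2)" using emeasure_compact_finite[OF cE] by (simp add: set_integrable_def)
  have cV: "(LBINT z:E. k^2) = k^2 * V" by (simp add: set_lebesgue_integral_def V_def)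
  have "0 <= (LBINT t:E. (h t - k)^2)" unfolding set_lebesgue_integral_def by (intro integral_nonneg_AE) auto
  also have "(LBINT t:E. (h t - k)^2) = (LBINT t:E. ((h t)^2 + k^2) - (2 * k) * h t)"
   by (intro arg_cong[where f="%f. set_lebesgue_integral lborel E f"]) (auto simp: power2_eq_square algebra_simps)
  also have "... = (LBINT t:E. (h t)^2) + k^2 * V - 2 * k * m"
   using ih i2 ic cV by (simp add: set_integral_add set_integral_diff m_def)
  finally have "2 * k * m - k\<^sup>2 * V <= (LBINT t:E. (h t)^2)" by simp
  then have "V * (2 * k * m - k\<^sup>2 * V) <= V * (LBINT t:E. (h t)^2)" using V by (intro mult_left_mono) auto
  moreover have "V * (2 * k * m - k\<^sup>2 * V) = m^2" using V by (simp add: k_def power2_eq_square field_simps)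
  ultimately show ?thesis by (simp add: m_def V_def)
 qed
 have ifc: "set_integrable lborel E (%z. (f z - c)^2)"
  unfolding set_integrable_def
 proof (rule integrableI_bounded_set_indicator[where B="(B + \<bar>c\<bar>)^2"])
  show "AE z in lborel. z \<in> E \<longrightarrow> norm ((f z - c)^2) <= (B + \<bar>c\<bar>)^2"
  proof (intro AE_I2 impI)
   fix z assume "z \<in> E"
   from B[OF this] have "\<bar>f z - c\<bar> <= \<bar>B + \<bar>c\<bar>\<bar>" by linarith
   then show "norm ((f z - c)^2) <= (B + \<bar>c\<bar>)^2" by (simp add: abs_le_square_iff)
  qed
 qed (use emeasure_compact_finite[OF cE] in auto)
 have toR: "ennreal (LBINT z:E. k z) = (\<integral>\<^sup>+z. ennreal (k z) * indicator E z \<partial>lborel)"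
  if "set_integrable lborel E k" "!!z. 0 <= k z" for k
  using nn_integral_eq_integral[OF that(1)[unfolded set_integrable_def]] that(2)
  by (simp add: set_lebesgue_integral_def ennreal_indicator[symmetric] ennreal_mult'' mult.commute)
 have "ennreal (LBINT z:E. (h z)^2) = (\<integral>\<^sup>+z. ennreal ((h z)^2) * indicator E z \<partial>lborel)"
  by (rule toR[OF i2]) simp
 also have "... <= (\<integral>\<^sup>+z. ennreal 2 * (ennreal ((f z - f (y z))^2) * indicator E z) + ennreal 2 * (ennreal ((f z - c)^2) * indicator E z) \<partial>lborel)"
 proof (intro nn_integral_mono)
  fix z
  have "(h z)^2 <= 2 * (f z - f (y z))^2 + 2 * (f z - c)^2"
   using sum_squares_bound[of "f z - f (y z)" "- (f z - c)"] by (simp add: h_def power2_eq_square algebra_simps)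
  then have "ennreal ((h z)^2) <= ennreal 2 * ennreal ((f z - f (y z))^2) + ennreal 2 * ennreal ((f z - c)^2)"
   by (simp add: ennreal_mult[symmetric] ennreal_plus[symmetric] ennreal_leI del: ennreal_plus ennreal_numeral)
  then show "ennreal ((h z)^2) * indicator E z <= ennreal 2 * (ennreal ((f z - f (y z))^2) * indicator E z) + ennreal 2 * (ennreal ((f z - c)^2) * indicator E z)"
   by (auto simp: indicator_def)
 qed
 also have "... = ennreal 2 * (\<integral>\<^sup>+z. ennreal ((f z - f (y z))^2) * indicator E z \<partial>lborel) + ennreal 2 * (\<integral>\<^sup>+z. ennreal ((f z - c)^2) * indicator E z \<partial>lborel)"
 proof -
  have m: "(%z. ennreal ((f z - f (y z))^2) * indicator E z) \<in> borel_measurable lborel"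
   "(%z. ennreal ((f z - c)^2) * indicator E z) \<in> borel_measurable lborel"
   "(%z. ennreal 2 * (ennreal ((f z - f (y z))^2) * indicator E z)) \<in> borel_measurable lborel"
   "(%z. ennreal 2 * (ennreal ((f z - c)^2) * indicator E z)) \<in> borel_measurable lborel" by measurable
  show ?thesis unfolding nn_integral_add[OF m(3,4)] nn_integral_cmult[OF m(1)] nn_integral_cmult[OF m(2)] by (rule refl)
 qed
 also have "... <= ennreal 2 * ennreal (H^2 * (LBINT x:E. (slope x)^2)) + ennreal 2 * ennreal (LBINT z:E. (f z - c)^2)"
  using radial_projection_bound[OF E H] toR[OF ifc] unfolding y_def by (intro add_mono mult_left_mono) auto
 also have "... = ennreal (2 * (H^2 * (LBINT x:E. (slope x)^2)) + 2 * (LBINT x:E. (f x - c)^2))"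
  by (subst ennreal_plus) (auto simp: ennreal_mult'' set_lebesgue_integral_def intro!: mult_nonneg_nonneg integral_nonneg_AE)
 finally have "(LBINT z:E. (h z)^2) <= 2 * (H^2 * (LBINT x:E. (slope x)^2)) + 2 * (LBINT x:E. (f x - c)^2)"
  by (subst (asm) ennreal_le_iff) (auto simp: set_lebesgue_integral_def intro!: add_nonneg_nonneg mult_nonneg_nonneg integral_nonneg_AE)
 moreover have "vol E * (surface_integral ?F f / area ?F - c)^2 <= (LBINT z:E. (h z)^2)"
  using CS simplex_measure_pos[OF E(1)] unfolding t by (simp add: power2_eq_square mult_ac)
 ultimately show ?thesis by linarith
qed

end

section \<open>Bounded Borel functions on a simplex\<close>

definition bounded_borel :: "'a::euclidean_space set => ('a => real) => bool" where
 "bounded_borel K f \<longleftrightarrow> f \<in> borel_measurable borel \<and> (\<exists>B. \<forall>x\<in>K. \<bar>f x\<bar> <= B)"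

lemma bounded_borel_const: "bounded_borel K (%x. c)"
 by (auto simp: bounded_borel_def)

lemma bounded_borel_add: "bounded_borel K f ==> bounded_borel K g ==> bounded_borel K (%x. f x + g x)"
proof -
 assume "bounded_borel K f" "bounded_borel K g"
 then obtain B C where "f \<in> borel_measurable borel" "g \<in> borel_measurable borel"
  "!!x. x \<in> K ==> \<bar>f x\<bar> <= B" "!!x. x \<in> K ==> \<bar>g x\<bar> <= C" by (auto simp: bounded_borel_def)
 then show ?thesis unfolding bounded_borel_def
  by (intro conjI exI[of _ "B + C"] ballI order_trans[OF abs_triangle_ineq] add_mono) auto
qed

lemma bounded_borel_mult: "bounded_borel K f ==> bounded_borel K g ==> bounded_borel K (%x. f x * g x)"
proof -
 assume "bounded_borel K f" "bounded_borel K g"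
 then obtain B C where "f \<in> borel_measurable borel" "g \<in> borel_measurable borel"
  "!!x. x \<in> K ==> \<bar>f x\<bar> <= B" "!!x. x \<in> K ==> \<bar>g x\<bar> <= C" by (auto simp: bounded_borel_def)
 then show ?thesis unfolding bounded_borel_def abs_mult
  by (intro conjI exI[of _ "\<bar>B\<bar> * \<bar>C\<bar>"] ballI mult_mono) (auto intro: order_trans[OF _ abs_ge_self])
qed

lemma bounded_borel_diff: "bounded_borel K f ==> bounded_borel K g ==> bounded_borel K (%x. f x - g x)"
 using bounded_borel_add[of K f "%x. -1 * g x"] bounded_borel_mult[OF bounded_borel_const[of K "-1"], of g] by simp

lemma bounded_borel_square: "bounded_borel K f ==> bounded_borel K (%x. (f x)^2)"
 using bounded_borel_mult[of K f f] by (simp add: power2_eq_square)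

lemma bounded_borel_polyfn: assumes "polyfn k f" "compact K" shows "bounded_borel K f"
proof -
 have "bounded (f ` K)"
  using polyfn_continuous[OF assms(1)] assms(2) by (intro compact_imp_bounded compact_continuous_image) auto
 then show ?thesis using polyfn_borel[OF assms(1)] by (auto simp: bounded_borel_def bounded_iff)
qed

lemma bounded_borel_integrable: "bounded_borel K f ==> compact K ==> set_integrable lborel K f"
 unfolding bounded_borel_def by (auto intro!: bounded_set_integrable borel_compact compact_imp_bounded)

lemmas bounded_borel_intros = bounded_borel_const bounded_borel_add bounded_borel_mult bounded_borel_diff
 bounded_borel_square

lemma set_integral_nonneg:
 fixes f :: "'a::euclidean_space => real"
 shows "(!!x. x \<in> K ==> 0 <= f x) ==> 0 <= (LBINT x:K. f x)"
 unfolding set_lebesgue_integral_def by (intro integral_nonneg_AE) (auto simp: indicator_def)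

lemma set_integral_const:
 fixes K :: "'a::euclidean_space set"
 assumes "compact K" shows "(LBINT x:K. c :: real) = c * vol K"
 using assms by (simp add: set_lebesgue_integral_def borel_compact)

lemma set_integral_mono_on:
 fixes f :: "'a::euclidean_space => real"
 assumes "compact K" "bounded_borel K f" "bounded_borel K g" "!!x. x \<in> K ==> f x <= g x"
 shows "(LBINT x:K. f x) <= (LBINT x:K. g x)"
 using assms by (intro set_integral_mono bounded_borel_integrable)

text \<open>\<open>(x - z)\<^sup>2 \<le> 2 (x - y)\<^sup>2 + 2 (y - z)\<^sup>2\<close>, integrated.\<close>

lemma set_integral_square_triangle:
 fixes f :: "'a::euclidean_space => real"
 assumes K: "compact K" and f: "bounded_borel K f" "bounded_borel K g" "bounded_borel K h"
 shows "(LBINT x:K. (f x - h x)^2) <= 2 * (LBINT x:K. (f x - g x)^2) + 2 * (LBINT x:K. (g x - h x)^2)"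
proof -
 have b: "bounded_borel K (%x. 2 * (f x - g x)^2)" "bounded_borel K (%x. 2 * (g x - h x)^2)"
  "bounded_borel K (%x. (f x - h x)^2)"
  by (intro bounded_borel_mult bounded_borel_const bounded_borel_square bounded_borel_diff f)+
 have "(LBINT x:K. (f x - h x)^2) <= (LBINT x:K. 2 * (f x - g x)^2 + 2 * (g x - h x)^2)"
 proof (rule set_integral_mono_on[OF K b(3) bounded_borel_add[OF b(1,2)]])
  fix x
  show "(f x - h x)^2 <= 2 * (f x - g x)^2 + 2 * (g x - h x)^2"
   using sum_squares_bound[of "f x - g x" "g x - h x"] by (simp add: power2_eq_square algebra_simps)
 qed
 also have "... = 2 * (LBINT x:K. (f x - g x)^2) + 2 * (LBINT x:K. (g x - h x)^2)"
  using bounded_borel_integrable[OF b(1) K] bounded_borel_integrable[OF b(2) K] by (simp add: set_integral_add)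
 finally show ?thesis .
qed

section \<open>The elementwise projection onto polynomials\<close>

text \<open>On a line through an interior point of the simplex the polynomial has infinitely many zeros.\<close>

lemma polyfn_zero_everywhere:
 fixes e :: "(real^'n) set"
 assumes e: "full_simplex e" and f: "polyfn k f" and z: "!!x. x \<in> e ==> f x = 0"
 shows "f x = 0"
proof -
 obtain c where "c \<in> interior e" using simplex_interior_nonempty[OF e] by blast
 then obtain \<delta> where \<delta>: "\<delta> > 0" "ball c \<delta> \<subseteq> e" using mem_interior by blast
 obtain q where q: "!!t. f (c + t *\<^sub>R (x - c)) = poly q t" using polyfn_line[OF f] by blast
 define r where "r = \<delta> / (norm (x - c) + 1)"
 have r: "0 < r" using \<delta>(1) by (simp add: r_def add_nonneg_pos)
 have "poly q t = 0" if "t \<in> {0<..<r}" for t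
 proof -
  have "t * (norm (x - c) + 1) < \<delta>" using that by (simp add: r_def less_divide_eq add_nonneg_pos)
  then have "t * norm (x - c) < \<delta>" using that by (simp add: algebra_simps)
  then have "norm (t *\<^sub>R (x - c)) < \<delta>" using that by simp
  then have "c + t *\<^sub>R (x - c) \<in> e" by (intro subsetD[OF \<delta>(2)]) (simp add: dist_norm)
  then show ?thesis using z q by metis
 qed
 then have "{0<..<r} \<subseteq> {t. poly q t = 0}" by auto
 moreover have "infinite {0<..<r}" using r by (simp add: infinite_Ioo)
 ultimately have "q = 0" using poly_roots_finite[of q] finite_subset by blast
 then show ?thesis using q[of 1] by simp
qed

text \<open>Gram-Schmidt, one generator at a time: a generator that depends on the earlier ones has a vanishing residual, and
  the zero from the division by its norm is then the right coefficient.\<close>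

lemma projection_exists_span:
 fixes e :: "(real^'n) set" and m :: "'j => real^'n => real"
 assumes e: "full_simplex e" and m: "!!j. j \<in> J ==> polyfn k (m j)" and fin: "finite J"
 shows "bounded_borel e g ==> \<exists>c. \<forall>i\<in>J. (LBINT x:e. (g x - (\<Sum>j\<in>J. c j * m j x)) * m i x) = 0"
 using fin m
proof (induction J arbitrary: g rule: finite_induct)
 case (insert b J)
 have ce: "compact e" by (rule simplex_compact[OF e])
 have bm: "bounded_borel e (m i)" if "i \<in> insert b J" for i using bounded_borel_polyfn[OF insert.prems(2)[OF that] ce] .
 have bsum: "bounded_borel e (%x. \<Sum>j\<in>J. c j * m j x)" for c
  using insert.prems(2) by (intro bounded_borel_polyfn[OF _ ce, of k] polyfn_sum polyfn_cmult) auto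
 obtain cg where cg: "!!i. i \<in> J ==> (LBINT x:e. (g x - (\<Sum>j\<in>J. cg j * m j x)) * m i x) = 0"
  using insert.IH[OF insert.prems(1)] insert.prems(2) by auto
 obtain cb where cb: "!!i. i \<in> J ==> (LBINT x:e. (m b x - (\<Sum>j\<in>J. cb j * m j x)) * m i x) = 0"
  using insert.IH[OF bm[of b]] insert.prems(2) by auto
 define Pg Pb where "Pg x = (\<Sum>j\<in>J. cg j * m j x)" and "Pb x = (\<Sum>j\<in>J. cb j * m j x)" for x
 define r where "r x = m b x - Pb x" for x
 have pr: "polyfn k r" unfolding r_def Pb_def
  using insert.prems(2) by (intro polyfn_diff polyfn_sum polyfn_cmult) auto
 have bd: "bounded_borel e Pg" "bounded_borel e Pb" "bounded_borel e r" "bounded_borel e (m b)"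
  using bsum bm[of b] bounded_borel_polyfn[OF pr ce] by (auto simp: Pg_def[abs_def] Pb_def[abs_def])
 have int: "set_integrable lborel e (%x. f x * h x)" if "bounded_borel e f" "bounded_borel e h" for f h
  by (rule bounded_borel_integrable[OF bounded_borel_mult[OF that] ce])
 have orth: "(LBINT x:e. f x * (\<Sum>j\<in>J. c j * m j x)) = 0"
  if f: "bounded_borel e f" and z: "!!i. i \<in> J ==> (LBINT x:e. f x * m i x) = 0" for f c
 proof -
  have "(LBINT x:e. f x * (\<Sum>j\<in>J. c j * m j x)) = (LBINT x:e. (\<Sum>j\<in>J. c j * (f x * m j x)))"
   by (simp add: sum_distrib_left mult.left_commute)
  also have "... = (\<Sum>j\<in>J. (LBINT x:e. c j * (f x * m j x)))"
   unfolding set_lebesgue_integral_def scaleR_sum_right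
   using int[OF f bm] by (intro Bochner_Integration.integral_sum) (auto simp: set_integrable_def mult.left_commute[of "indicator _ _"])
  finally show ?thesis using z by simp
 qed
 define \<rho> where "\<rho> = (LBINT x:e. r x * r x)"
 define l where "l = (LBINT x:e. (g x - Pg x) * r x) / \<rho>"
 have gP: "bounded_borel e (%x. g x - Pg x)" using insert.prems(1) bd by (intro bounded_borel_intros)
 have key: "(LBINT x:e. (g x - Pg x) * r x) = l * \<rho>"
 proof (cases "\<rho> = 0")
  case True
  then have "r x = 0" if "x \<in> e" for x using polyfn_zero_of_L2[OF e pr _ that] by (simp add: \<rho>_def power2_eq_square)
  then have "(LBINT x:e. (g x - Pg x) * r x) = 0"
   unfolding set_lebesgue_integral_def by (intro integral_eq_zero_AE) (auto simp: indicator_def)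
  then show ?thesis using True by simp
 qed (simp add: l_def)
 define c where "c j = (if j = b then l else cg j - l * cb j)" for j
 have sum_c: "(\<Sum>j\<in>insert b J. c j * m j x) = Pg x + l * r x" for x
 proof -
  have "(\<Sum>j\<in>J. c j * m j x) = (\<Sum>j\<in>J. cg j * m j x - l * (cb j * m j x))"
   using insert.hyps(2) by (intro sum.cong) (auto simp: c_def algebra_simps)
  also have "... = Pg x - l * Pb x" by (simp add: Pg_def Pb_def sum_subtractf sum_distrib_left)
  finally show ?thesis using insert.hyps by (simp add: r_def c_def algebra_simps)
 qed
 have onJ: "(LBINT x:e. (g x - (Pg x + l * r x)) * m i x) = 0" if "i \<in> J" for i
 proof -
  have "(LBINT x:e. (g x - (Pg x + l * r x)) * m i x) = (LBINT x:e. (g x - Pg x) * m i x - l * (r x * m i x))"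
   by (simp add: algebra_simps)
  also have "... = 0"
   using int[OF gP bm[of i]] int[OF bd(3) bm[of i]] cg[OF that] cb[OF that] that
   by (simp add: set_integral_diff Pg_def r_def Pb_def)
  finally show ?thesis .
 qed
 have "(LBINT x:e. (g x - (Pg x + l * r x)) * m b x) = 0"
 proof -
  have bF: "bounded_borel e (%x. g x - (Pg x + l * r x))" using insert.prems(1) bd by (intro bounded_borel_intros)
  have "(LBINT x:e. (g x - (Pg x + l * r x)) * m b x) =
   (LBINT x:e. ((g x - Pg x) * r x - l * (r x * r x)) + (g x - (Pg x + l * r x)) * Pb x)"
   by (intro arg_cong[where f="set_lebesgue_integral lborel e"] ext) (simp add: r_def algebra_simps)
  also have "... = ((LBINT x:e. (g x - Pg x) * r x) - l * \<rho>) + (LBINT x:e. (g x - (Pg x + l * r x)) * Pb x)"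
   using int[OF gP bd(3)] int[OF bd(3,3)] int[OF bF bd(2)] by (simp add: set_integral_add set_integral_diff \<rho>_def)
  also have "... = 0" using key orth[OF bF onJ, of cb] by (simp add: Pb_def)
  finally show ?thesis .
 qed
 then show ?case using onJ by (intro exI[of _ c]) (auto simp: sum_c)
qed simp

text \<open>The projection is stable against subtraction of constants, since constants belong to the local space.\<close>

lemma L2_proj_props:
 fixes E :: "(real^'n) set"
 assumes E: "full_simplex E" and g: "bounded_borel E (v E)"
 shows "polyfn p (L2_proj S p v E)"
  and "(LBINT x:E. (L2_proj S p v E x - c)^2) <= (LBINT x:E. (v E x - c)^2)"
proof -
 have cE: "compact E" by (rule simplex_compact[OF E])
 let ?k = "V_deg S p"
 let ?J = "{j :: 'n => nat. (\<Sum>i\<in>UNIV. j i) <= ?k}"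
 let ?m = "%j (x::real^'n). \<Prod>i\<in>UNIV. (x $ i) ^ j i"
 let ?P = "%h. h \<in> V_loc S p \<and> (\<forall>\<phi>\<in>V_loc S p. (LINT x|lebesgue_on E. h x * \<phi> x) = (LINT x|lebesgue_on E. v E x * \<phi> x))"
 have int: "set_integrable lborel E (%x. f x * h x)" if "bounded_borel E f" "bounded_borel E h" for f h
  by (rule bounded_borel_integrable[OF bounded_borel_mult[OF that] cE])
 have leb: "(LINT x|lebesgue_on E. f x * h x) = (LBINT x:E. f x * h x)"
  if "bounded_borel E f" "bounded_borel E h" for f h
  by (rule simplex_set_integral_lebesgue[OF cE, symmetric]) (use that in \<open>auto simp: bounded_borel_def\<close>)
 have bV: "bounded_borel E \<phi>" if "\<phi> \<in> V_loc S p" for \<phi> using bounded_borel_polyfn[OF V_loc_polyfn[OF that] cE] .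
 have iff: "?P h \<longleftrightarrow> h \<in> V_loc S p \<and> (\<forall>\<phi>\<in>V_loc S p. (LBINT x:E. (v E x - h x) * \<phi> x) = 0)" for h
 proof -
  have "(LBINT x:E. (v E x - h x) * \<phi> x) = (LBINT x:E. v E x * \<phi> x) - (LBINT x:E. h x * \<phi> x)"
   if "h \<in> V_loc S p" "\<phi> \<in> V_loc S p" for \<phi>
   using int[OF g bV] int[OF bV bV] that by (simp add: left_diff_distrib set_integral_diff)
  moreover have "(LINT x|lebesgue_on E. h x * \<phi> x) = (LBINT x:E. h x * \<phi> x)"
    "(LINT x|lebesgue_on E. v E x * \<phi> x) = (LBINT x:E. v E x * \<phi> x)"
   if "h \<in> V_loc S p" "\<phi> \<in> V_loc S p" for \<phi> using leb[OF bV bV] leb[OF g bV] that by auto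
  ultimately show ?thesis by auto
 qed
 obtain c0 where c0: "!!i. i \<in> ?J ==> (LBINT x:E. (v E x - (\<Sum>j\<in>?J. c0 j * ?m j x)) * ?m i x) = 0"
  using projection_exists_span[OF E, of ?J ?k ?m "v E"] polyfn_monomial finite_multiindices g by blast
 define h where "h x = (\<Sum>j\<in>?J. c0 j * ?m j x)" for x
 have hV: "h \<in> V_loc S p" unfolding V_loc_iff h_def by (intro polyfn_sum polyfn_cmult polyfn_monomial) auto
 have bh: "bounded_borel E (%x. v E x - h x)" using g bV[OF hV] by (intro bounded_borel_intros)
 have "?P h" unfolding iff
 proof (intro conjI hV ballI)
  fix \<phi> :: "real^'n => real" assume "\<phi> \<in> V_loc S p"
  then have "\<phi> \<in> polys ?k" by (simp add: V_loc_iff polys_iff_polyfn)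
  then obtain c where c: "\<phi> = (%x. \<Sum>j\<in>?J. c j * ?m j x)" by (auto simp: polys_def)
  have bm: "bounded_borel E (?m j)" if "j \<in> ?J" for j
   using polyfn_monomial that by (intro bounded_borel_polyfn[OF _ cE, of ?k]) auto
  have "(LBINT x:E. (v E x - h x) * \<phi> x) = (LBINT x:E. (\<Sum>j\<in>?J. c j * ((v E x - h x) * ?m j x)))"
   by (simp add: c sum_distrib_left mult.left_commute)
  also have "... = (\<Sum>j\<in>?J. (LBINT x:E. c j * ((v E x - h x) * ?m j x)))"
   unfolding set_lebesgue_integral_def scaleR_sum_right
   using int[OF bh bm] by (intro Bochner_Integration.integral_sum) (auto simp: set_integrable_def mult.left_commute[of "indicator _ _"])
  also have "... = 0" using c0 by (intro sum.neutral ballI) (simp add: h_def)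
  finally show "(LBINT x:E. (v E x - h x) * \<phi> x) = 0" .
 qed
 moreover have "h' = h" if h': "?P h'" for h'
 proof -
  have d: "(%x. h' x - h x) \<in> V_loc S p" using h' hV by (auto simp: V_loc_iff intro: polyfn_diff)
  have "(LBINT x:E. (v E x - h x) * (h' x - h x)) = 0" "(LBINT x:E. (v E x - h' x) * (h' x - h x)) = 0"
   using \<open>?P h\<close> h' d unfolding iff by auto
  moreover have "bounded_borel E (%x. v E x - h' x)" using g bV h' by (intro bounded_borel_intros) auto
  ultimately have "(LBINT x:E. (v E x - h x) * (h' x - h x) - (v E x - h' x) * (h' x - h x)) = 0"
   using int[OF bh bV[OF d]] int[OF _ bV[OF d]] by (simp add: set_integral_diff)
  then have "(LBINT x:E. (h' x - h x)^2) = 0" by (simp add: power2_eq_square algebra_simps)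
  then have "h' x - h x = 0" if "x \<in> E" for x
   using polyfn_zero_of_L2[OF E V_loc_polyfn[OF d] _ that] by simp
  then have "h' x - h x = 0" for x using polyfn_zero_everywhere[OF E V_loc_polyfn[OF d]] by blast
  then show ?thesis by (auto simp: fun_eq_iff)
 qed
 ultimately have P: "?P (L2_proj S p v E)" unfolding L2_proj_def by (rule theI)
 define q where "q = L2_proj S p v E"
 have q: "q \<in> V_loc S p" "!!\<phi>. \<phi> \<in> V_loc S p ==> (LBINT x:E. (v E x - q x) * \<phi> x) = 0"
  using P unfolding iff q_def by auto
 show "polyfn p (L2_proj S p v E)" using V_loc_polyfn[OF q(1)] by (simp add: q_def)
 have qc: "(%x. q x - c) \<in> V_loc S p" using q(1) by (auto simp: V_loc_iff intro: polyfn_diff polyfn.const)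
 have b1: "bounded_borel E (%x. v E x - q x)" "bounded_borel E (%x. q x - c)"
  by (intro bounded_borel_diff bounded_borel_const g bV[OF q(1)])+
 have "(LBINT x:E. (v E x - c)^2) =
  (LBINT x:E. ((v E x - q x)^2 + (q x - c)^2) + 2 * ((v E x - q x) * (q x - c)))"
  by (intro arg_cong[where f="set_lebesgue_integral lborel E"] ext) (simp add: power2_eq_square algebra_simps)
 also have "... = (LBINT x:E. (v E x - q x)^2) + (LBINT x:E. (q x - c)^2)"
  using bounded_borel_integrable[OF bounded_borel_square[OF b1(1)] cE] bounded_borel_integrable[OF bounded_borel_square[OF b1(2)] cE]
   int[OF b1] q(2)[OF qc] by (simp add: set_integral_add)
 finally show "(LBINT x:E. (L2_proj S p v E x - c)^2) <= (LBINT x:E. (v E x - c)^2)"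
  using set_integral_nonneg[of E "%x. (v E x - q x)^2"] by (simp add: q_def)
qed

section \<open>Summation over vertex stars\<close>

context regular_mesh
begin

lemma vertex_consistent:
 assumes E: "E \<in> \<T>" "E' \<in> \<T>" and x: "x \<in> verts E" "x \<in> E'" shows "x \<in> verts E'"
proof -
 have G: "E \<inter> E' face_of E" "E \<inter> E' face_of E'" using Int_face[OF E] Int_face[OF E(2,1)] by (auto simp: Int_commute)
 have "x \<in> E" using x(1) verts_subset by blast
 then have "x extreme_point_of (E \<inter> E')" using extreme_point_of_face[OF G(1)] x by (simp add: verts_def)
 then show ?thesis using extreme_point_of_face[OF G(2)] by (simp add: verts_def)
qed

definition star_size :: nat where "star_size = nat \<lceil>\<kappa> ^ CARD('n)\<rceil>"

lemma card_reach: assumes "E \<in> \<T>" "x \<in> E" shows "card (reach x E) <= star_size"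
proof -
 have "reach x E \<subseteq> {E\<in>\<T>. x \<in> E}" using reach_star[OF assms] by blast
 then have "card (reach x E) <= card {E\<in>\<T>. x \<in> E}" by (intro card_mono) auto
 then have "real (card (reach x E)) <= \<kappa> ^ CARD('n)" using card_star[OF assms(1), of x] by linarith
 then show ?thesis unfolding star_size_def by linarith
qed

lemma volume_comparable:
 assumes c: "1 <= c" and cmp: "!!x E E'. (E, E') \<in> adj x ==> diameter E <= c * diameter E'"
  and E: "E \<in> \<T>" "x \<in> E" and E': "E' \<in> reach x E"
 shows "vol E <= c ^ (star_size * CARD('n)) * \<kappa> ^ CARD('n) * vol E'"
proof -
 define s where "s E = (if E \<in> \<T> then diameter E else 0)" for E
 have E'T: "E' \<in> \<T>" using reach_star[OF E E'] by blast
 have "s E <= c ^ card (reach x E) * s E'"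
 proof (rule chain_comparable[OF E c _ _ E'])
  show "0 <= s E" for E using diameter_pos[of E] by (auto simp: s_def)
  show "s E1 <= c * s E2" if "(E1, E2) \<in> adj x" for E1 E2
   using cmp[OF that] that by (auto simp: s_def adj_def)
 qed
 also have "... <= c ^ star_size * s E'"
  using card_reach[OF E] c diameter_pos[OF E'T] by (intro mult_right_mono power_increasing) (auto simp: s_def)
 finally have d: "diameter E <= c ^ star_size * diameter E'" using E(1) E'T by (simp add: s_def)
 define \<omega> where "\<omega> = vol (ball (0::real^'n) 1)"
 have "vol E <= \<omega> * diameter E ^ CARD('n)" using volume_bounds(1)[OF E(1)] by (simp add: \<omega>_def)
 also have "... <= \<omega> * (c ^ star_size * diameter E') ^ CARD('n)"
  using d diameter_pos[OF E(1)] volume_bounds(3)[OF E(1)] by (intro mult_left_mono power_mono) (auto simp: \<omega>_def)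
 also have "... = c ^ (star_size * CARD('n)) * (\<omega> * diameter E' ^ CARD('n))"
  by (simp add: power_mult_distrib power_mult[symmetric] mult_ac)
 also have "... <= c ^ (star_size * CARD('n)) * (\<kappa> ^ CARD('n) * vol E')"
  using volume_bounds(2)[OF E'T] c by (intro mult_left_mono) (auto simp: \<omega>_def)
 finally show ?thesis by (simp add: mult.assoc)
qed

definition star_sum_const :: "real => real" where
 "star_sum_const c = \<kappa> ^ CARD('n) * (c ^ (star_size * CARD('n)) * \<kappa> ^ CARD('n)) * (real (CARD('n) + 1) * \<kappa> ^ CARD('n))"

text \<open>Each star contains a bounded number of elements, of comparable volumes, and each element belongs to a
  bounded number of stars.\<close>

lemma star_sum:
 fixes Y :: "(real^'n) set => real"
 assumes c: "1 <= c" and cmp: "!!x E E'. (E, E') \<in> adj x ==> diameter E <= c * diameter E'"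
 shows "(\<Sum>E\<in>\<T>. \<Sum>x\<in>verts E. vol E * (\<Sum>E'\<in>reach x E. Y E')^2)
  <= star_sum_const c * (\<Sum>E\<in>\<T>. vol E * (Y E)^2)"
proof -
 define cv where "cv = c ^ (star_size * CARD('n)) * \<kappa> ^ CARD('n)"
 define k where "k = \<kappa> ^ CARD('n)"
 define g where "g E = k * cv * (vol E * (Y E)^2)" for E
 define V where "V = (\<Union>E\<in>\<T>. verts E)"
 have finV: "finite V" using simplex_verts(2)[OF full] by (auto simp: V_def)
 have k0: "0 <= k" if "E \<in> \<T>" for E using kappa_ge_2[OF that] by (simp add: k_def)
 have cv0: "0 <= cv" if "E \<in> \<T>" for E using kappa_ge_2[OF that] c by (simp add: cv_def)
 have g0: "0 <= g E" if "E \<in> \<T>" for E using k0[OF that] cv0[OF that] by (simp add: g_def)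
 have one: "vol E * (\<Sum>E'\<in>reach x E. Y E')^2 <= (\<Sum>E'\<in>\<T>. if x \<in> verts E' \<and> x \<in> E then g E' else 0)"
  if E: "E \<in> \<T>" and x: "x \<in> verts E" for E x
 proof -
  have xE: "x \<in> E" using x verts_subset by blast
  have "(\<Sum>E'\<in>reach x E. Y E')^2 <= (\<Sum>E'\<in>reach x E. 1^2) * (\<Sum>E'\<in>reach x E. (Y E')^2)"
   using Cauchy_Schwarz_ineq_sum[of "%_. 1" Y "reach x E"] by simp
  also have "... <= k * (\<Sum>E'\<in>reach x E. (Y E')^2)"
  proof -
   have "reach x E \<subseteq> {E\<in>\<T>. x \<in> E}" using reach_star[OF E xE] by blast
   then have "card (reach x E) <= card {E\<in>\<T>. x \<in> E}" by (intro card_mono) auto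
   then have "real (card (reach x E)) <= k" using card_star[OF E, of x] by (simp add: k_def)
   then show ?thesis by (intro mult_right_mono sum_nonneg) auto
  qed
  finally have "vol E * (\<Sum>E'\<in>reach x E. Y E')^2 <= vol E * (k * (\<Sum>E'\<in>reach x E. (Y E')^2))"
   by (intro mult_left_mono) auto
  also have "... = (\<Sum>E'\<in>reach x E. k * (vol E * (Y E')^2))" by (simp add: sum_distrib_left mult_ac)
  also have "... <= (\<Sum>E'\<in>reach x E. g E')"
  proof (rule sum_mono)
   fix E' assume E': "E' \<in> reach x E"
   have "vol E * (Y E')^2 <= (cv * vol E') * (Y E')^2"
    using volume_comparable[OF c cmp E xE E'] by (intro mult_right_mono) (auto simp: cv_def)
   then have "k * (vol E * (Y E')^2) <= k * ((cv * vol E') * (Y E')^2)"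
    using k0[OF E] by (intro mult_left_mono)
   then show "k * (vol E * (Y E')^2) <= g E'" by (simp add: g_def mult.assoc)
  qed
  also have "... = (\<Sum>E'\<in>reach x E. if x \<in> verts E' \<and> x \<in> E then g E' else 0)"
   using reach_star[OF E xE] vertex_consistent[OF E _ x] xE by (intro sum.cong) auto
  also have "... <= (\<Sum>E'\<in>\<T>. if x \<in> verts E' \<and> x \<in> E then g E' else 0)"
   using reach_star[OF E xE] g0 by (intro sum_mono2) auto
  finally show ?thesis .
 qed
 have "(\<Sum>E\<in>\<T>. \<Sum>x\<in>verts E. vol E * (\<Sum>E'\<in>reach x E. Y E')^2)
  <= (\<Sum>E\<in>\<T>. \<Sum>x\<in>verts E. \<Sum>E'\<in>\<T>. if x \<in> verts E' \<and> x \<in> E then g E' else 0)"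
  by (intro sum_mono one)
 also have "... <= (\<Sum>E\<in>\<T>. \<Sum>x\<in>V. \<Sum>E'\<in>\<T>. if x \<in> verts E' \<and> x \<in> E then g E' else 0)"
  using finV g0 by (intro sum_mono sum_mono2 sum_nonneg) (auto simp: V_def)
 also have "... = (\<Sum>x\<in>V. \<Sum>E'\<in>\<T>. \<Sum>E\<in>\<T>. if x \<in> verts E' \<and> x \<in> E then g E' else 0)"
 proof -
  have "(\<Sum>E\<in>\<T>. \<Sum>x\<in>V. \<Sum>E'\<in>\<T>. if x \<in> verts E' \<and> x \<in> E then g E' else 0)
   = (\<Sum>x\<in>V. \<Sum>E\<in>\<T>. \<Sum>E'\<in>\<T>. if x \<in> verts E' \<and> x \<in> E then g E' else 0)" by (rule sum.swap)
  also have "... = (\<Sum>x\<in>V. \<Sum>E'\<in>\<T>. \<Sum>E\<in>\<T>. if x \<in> verts E' \<and> x \<in> E then g E' else 0)"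
   by (rule sum.cong[OF refl]) (rule sum.swap)
  finally show ?thesis .
 qed
 also have "... = (\<Sum>E'\<in>\<T>. \<Sum>x\<in>V. \<Sum>E\<in>\<T>. if x \<in> verts E' \<and> x \<in> E then g E' else 0)"
  by (rule sum.swap)
 also have "... <= (\<Sum>E'\<in>\<T>. real (CARD('n) + 1) * k * g E')"
 proof (rule sum_mono)
  fix E' assume E': "E' \<in> \<T>"
  have "(\<Sum>E\<in>\<T>. if x \<in> verts E' \<and> x \<in> E then g E' else 0) <= (if x \<in> verts E' then k * g E' else 0)" for x
  proof -
   have "(\<Sum>E\<in>\<T>. if x \<in> E then g E' else 0) = real (card {E\<in>\<T>. x \<in> E}) * g E'"
    by (simp add: sum.If_cases Int_def)
   moreover have "... <= k * g E'" using card_star[OF E', of x] g0[OF E'] by (intro mult_right_mono) (auto simp: k_def)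
   ultimately show ?thesis by simp
  qed
  then have "(\<Sum>x\<in>V. \<Sum>E\<in>\<T>. if x \<in> verts E' \<and> x \<in> E then g E' else 0) <= (\<Sum>x\<in>V. if x \<in> verts E' then k * g E' else 0)"
   by (intro sum_mono)
  also have "... = (\<Sum>x\<in>V \<inter> verts E'. k * g E')"
   using finV by (rule sum.inter_restrict[symmetric])
  also have "... = (\<Sum>x\<in>verts E'. k * g E')"
   using E' by (intro sum.cong) (auto simp: V_def)
  also have "... = real (CARD('n) + 1) * k * g E'" using simplex_verts(3)[OF full[OF E']] by simp
  finally show "(\<Sum>x\<in>V. \<Sum>E\<in>\<T>. if x \<in> verts E' \<and> x \<in> E then g E' else 0) <= real (CARD('n) + 1) * k * g E'" .
 qed
 also have "... = star_sum_const c * (\<Sum>E\<in>\<T>. vol E * (Y E)^2)"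
  by (simp add: sum_distrib_left g_def star_sum_const_def k_def cv_def mult_ac)
 finally show ?thesis .
qed

lemma star_sum_const_nonneg: "E \<in> \<T> ==> 1 <= c ==> 0 <= star_sum_const c"
 using kappa_ge_2[of E] by (simp add: star_sum_const_def)

end

section \<open>Broken polynomials with controlled jumps\<close>

text \<open>The oscillation of a polynomial on a simplex is bounded by the \<open>L\<^sup>2\<close>-norm of its gradient, by
  the inverse estimate for the components of the gradient.\<close>

lemma (in regular_mesh) polyfn_oscillation:
 assumes e: "e \<in> \<T>" and f: "polyfn p f" and xy: "x \<in> e" "y \<in> e"
 shows "\<bar>f x - f y\<bar> <= diameter e * sqrt (inverse_const p CARD('n) / vol e * (LBINT z:e. (norm (grad f z))^2))"
proof -
 note s = full[OF e]
 let ?I = "LBINT z:e. (norm (grad f z))^2"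
 let ?B = "sqrt (inverse_const p CARD('n) / vol e * ?I)"
 have pg: "polyfn p (%x. grad f x $ i)" for i by (rule polyfn_grad[OF f])
 have nsum: "(norm (grad f z))^2 = (\<Sum>i\<in>UNIV. (grad f z $ i)^2)" for z
  unfolding power2_norm_eq_inner by (simp add: inner_vec_def power2_eq_square)
 have sq: "set_integrable lborel e (%z. (grad f z $ i)^2)" for i
  using polyfn_set_integrable[OF polyfn_mult[OF pg pg] simplex_compact[OF s]] by (simp add: power2_eq_square)
 have I: "?I = (\<Sum>i\<in>UNIV. (LBINT z:e. (grad f z $ i)^2))"
  unfolding nsum set_lebesgue_integral_def scaleR_sum_right
  by (rule Bochner_Integration.integral_sum) (use sq in \<open>simp add: set_integrable_def\<close>)
 have gb: "norm (grad f z) <= ?B" if z: "z \<in> e" for z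
 proof -
  have "vol e * (norm (grad f z))^2 = (\<Sum>i\<in>UNIV. vol e * (grad f z $ i)^2)"
   unfolding nsum by (rule sum_distrib_left)
  also have "... <= (\<Sum>i\<in>UNIV. inverse_const p CARD('n) * (LBINT z:e. (grad f z $ i)^2))"
   by (intro sum_mono simplex_inverse_estimate[OF s pg z])
  also have "... = inverse_const p CARD('n) * ?I" by (simp add: I sum_distrib_left)
  finally have "(norm (grad f z))^2 <= inverse_const p CARD('n) / vol e * ?I"
   using simplex_measure_pos[OF s] by (simp add: pos_le_divide_eq mult.commute)
  then show ?thesis by (rule real_le_rsqrt)
 qed
 have der: "(f has_derivative (%h. h \<bullet> grad f z)) (at z within e)" for z
 proof -
  obtain G where "!!x. GDERIV f x :> G x" using polyfn_has_gradient[OF f] by blast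
  then have "GDERIV f z :> grad f z" using grad_eqI by metis
  then show ?thesis unfolding gderiv_def by (rule has_derivative_at_withinI)
 qed
 have "norm (f x - f y) <= ?B * norm (x - y)"
 proof (rule differentiable_bound[OF simplex_convex[OF s] der _ xy])
  fix z assume z: "z \<in> e"
  show "onorm (%h. h \<bullet> grad f z) <= ?B"
  proof (rule onorm_bound)
   show "0 <= ?B" using gb[OF z] norm_ge_zero order_trans by blast
   show "norm (h \<bullet> grad f z) <= ?B * norm h" for h
    using Cauchy_Schwarz_ineq2[of h "grad f z"] mult_left_mono[OF gb[OF z], of "norm h"] by (simp add: mult.commute)
  qed
 qed
 also have "... <= ?B * diameter e"
  using dist_le_diameter[OF e xy] order_trans[OF norm_ge_zero gb[OF xy(1)]] by (intro mult_left_mono) (simp_all only: dist_norm)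
 finally show ?thesis by (simp add: mult.commute)
qed

text \<open>In the application \<open>v\<close> is the scalar part of the local solution for \<open>w\<close>. The jumps of \<open>v\<close> across
  facets and its boundary values are small because \<open>w\<close> is single-valued and vanishes on the boundary.\<close>

locale broken_function = regular_mesh \<kappa> \<Omega> \<T>
 for \<kappa> :: real and \<Omega> :: "(real^'n) set" and \<T> :: "(real^'n) set set" +
 fixes p :: nat and c :: real and v w :: "(real^'n) set => real^'n => real" and j :: "(real^'n) set => real"
 assumes polynomial: "!!e. e \<in> \<T> ==> polyfn p (v e)"
  and j_nonneg: "!!e. 0 <= j e"
  and face_jump: "!!e F x. e \<in> \<T> ==> F facet_of e ==> x \<in> F ==> \<bar>v e x - w F x\<bar> <= j e"
  and face_boundary: "!!e F x. e \<in> \<T> ==> F facet_of e ==> F \<subseteq> frontier \<Omega> ==> x \<in> F ==> w F x = 0"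
  and c_ge_1: "1 <= c"
  and comparable: "!!x e e'. (e, e') \<in> adj x ==> diameter e <= c * diameter e'"
begin

definition star_jump :: "(real^'n) set => real^'n => real" where
 "star_jump e x = (\<Sum>e'\<in>reach x e. j e')"

definition osc :: "(real^'n) set => real" where
 "osc e = diameter e * sqrt (inverse_const p CARD('n) / vol e * (LBINT z:e. (norm (grad (v e) z))^2))"

text \<open>A bound for the distance between \<open>v e\<close> and any vertex average around \<open>e\<close>. All later estimates of
  interpolants on the fine mesh are in terms of this number.\<close>

definition \<rho> :: "(real^'n) set => real" where
 "\<rho> e = 2 * (\<Sum>x\<in>verts e. star_jump e x) + osc e"

lemma star_jump_nonneg: "0 <= star_jump e x"
 unfolding star_jump_def using j_nonneg by (intro sum_nonneg)

lemma osc_nonneg: "e \<in> \<T> ==> 0 <= osc e"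
 unfolding osc_def using diameter_pos[of e] inverse_const_pos[of p "CARD('n)"]
 by (intro mult_nonneg_nonneg) (auto intro!: mult_nonneg_nonneg divide_nonneg_nonneg set_integral_nonneg)

lemma \<rho>_nonneg: "e \<in> \<T> ==> 0 <= \<rho> e"
 unfolding \<rho>_def using osc_nonneg star_jump_nonneg by (intro add_nonneg_nonneg) (auto intro: sum_nonneg)

lemma star_difference:
 assumes e: "e \<in> \<T>" "x \<in> e" and e': "e' \<in> reach x e"
 shows "\<bar>v e x - v e' x\<bar> <= 2 * star_jump e x - j e - j e'"
 unfolding star_jump_def
proof (rule chain_bound[where v="%e. v e x", OF e j_nonneg _ e'])
 fix e1 e2 assume "(e1, e2) \<in> adj x"
 then obtain F where F: "e1 \<in> \<T>" "e2 \<in> \<T>" "F facet_of e1" "F facet_of e2" "x \<in> F" by (auto simp: adj_def)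
 show "\<bar>v e1 x - v e2 x\<bar> <= j e1 + j e2"
  using face_jump[OF F(1,3,5)] face_jump[OF F(2,4,5)] by linarith
qed

text \<open>At a boundary vertex the average is set to zero, and some element around the vertex has a boundary facet,
  on which its trace is small. At an interior vertex all elements are connected through facets.\<close>

lemma vertex_error:
 assumes S: "S \<subseteq> \<T>" and e: "e \<in> S" "x \<in> verts e"
 shows "\<bar>v e x - vertex_mean S v x\<bar> <= 2 * star_jump e x"
proof -
 have eT: "e \<in> \<T>" "x \<in> e" using S e verts_subset by auto
 show ?thesis
 proof (cases "x \<in> frontier \<Omega>")
  case True
  obtain e' F where e': "e' \<in> reach x e" and F: "F facet_of e'" "x \<in> F" "F \<subseteq> frontier \<Omega>"
   using reach_boundary_facet[OF eT True] by blast
  have e'T: "e' \<in> \<T>" using reach_star[OF eT e'] by blast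
  have "\<bar>v e' x\<bar> <= j e'" using face_jump[OF e'T F(1,2)] face_boundary[OF e'T F(1,3,2)] by simp
  then show ?thesis using star_difference[OF eT e'] j_nonneg[of e] True by (simp add: vertex_mean_def)
 next
  case False
  then have x: "x \<in> \<Omega>" using in_domain_iff[OF eT(2,1)] by simp
  let ?A = "{e \<in> S. x \<in> e}"
  have A: "finite ?A" "card ?A > 0" using finite_subset[OF S finite_mesh] e eT by (auto simp: card_gt_0_iff)
  have "\<bar>v e x - v e' x\<bar> <= 2 * star_jump e x" if "e' \<in> ?A" for e'
   using star_difference[OF eT reach_interior_vertex[OF eT x]] j_nonneg[of e] j_nonneg[of e'] that S by fastforce
  then have "\<bar>\<Sum>e'\<in>?A. v e x - v e' x\<bar> <= (\<Sum>e'\<in>?A. 2 * star_jump e x)"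
   by (intro order_trans[OF sum_abs] sum_mono)
  then have "\<bar>card ?A * v e x - (\<Sum>e'\<in>?A. v e' x)\<bar> <= card ?A * (2 * star_jump e x)"
   by (simp add: sum_subtractf)
  then have "\<bar>card ?A * v e x - (\<Sum>e'\<in>?A. v e' x)\<bar> / card ?A <= 2 * star_jump e x"
   using A(2) by (simp add: pos_divide_le_eq mult.commute)
  moreover have "v e x - vertex_mean S v x = (card ?A * v e x - (\<Sum>e'\<in>?A. v e' x)) / card ?A"
   using A(2) False by (simp add: vertex_mean_def diff_divide_distrib)
  ultimately show ?thesis by (simp add: abs_divide)
 qed
qed

lemma vertex_value_error:
 assumes S: "S \<subseteq> \<T>" and e: "e \<in> S" and b: "b \<in> verts e" and z: "z \<in> e"
 shows "\<bar>vertex_mean S v b - v e z\<bar> <= \<rho> e"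
proof -
 have eT: "e \<in> \<T>" "b \<in> e" using S e b verts_subset by auto
 have "star_jump e b <= (\<Sum>x\<in>verts e. star_jump e x)"
  using simplex_verts(2)[OF full[OF eT(1)]] b star_jump_nonneg by (intro member_le_sum) auto
 moreover have "\<bar>v e b - v e z\<bar> <= osc e"
  unfolding osc_def by (rule polyfn_oscillation[OF eT(1) polynomial[OF eT(1)] eT(2) z])
 ultimately show ?thesis using vertex_error[OF S e b] unfolding \<rho>_def by linarith
qed

lemma interp_error:
 assumes S: "S \<subseteq> \<T>" and e: "e \<in> S" and z: "z \<in> e"
 shows "\<bar>interp S (vertex_mean S v) z - v e z\<bar> <= \<rho> e"
proof -
 have "e \<in> \<T>" using S e by auto
 then show ?thesis
  unfolding interp_eq[OF S e z] by (rule local_interp_bound[OF full z vertex_value_error[OF S e _ z]])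
qed

text \<open>Since the gradients of the barycentric coordinates add up to zero, the slope of the interpolant
  only sees differences of vertex values.\<close>

lemma interp_lipschitz:
 assumes S: "S \<subseteq> \<T>" and e: "e \<in> S" and x: "x \<in> e" and y: "y \<in> e"
 shows "\<bar>interp S (vertex_mean S v) x - interp S (vertex_mean S v) y\<bar>
  <= (real (CARD('n) + 1) * \<kappa> / 2) * (\<rho> e / diameter e) * norm (x - y)"
proof -
 let ?val = "vertex_mean S v"
 have eT: "e \<in> \<T>" using S e by auto
 note s = full[OF eT]
 have d: "0 < diameter e" by (rule diameter_pos[OF eT])
 have zero: "(\<Sum>b\<in>verts e. bary_grad e b \<bullet> (x - y)) = 0"
 proof -
  have "bary_grad e b \<bullet> (x - y) = bary e b x - bary e b y" if "b \<in> verts e" for b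
   using bary_affine[OF s that, of x] bary_affine[OF s that, of y] by (simp add: inner_diff_right)
  then have "(\<Sum>b\<in>verts e. bary_grad e b \<bullet> (x - y)) = (\<Sum>b\<in>verts e. bary e b x - bary e b y)" by (intro sum.cong) auto
  then show ?thesis using bary_sum(1)[OF s] by (simp add: sum_subtractf)
 qed
 have "interp S ?val x - interp S ?val y = (\<Sum>b\<in>verts e. ?val b *\<^sub>R bary_grad e b) \<bullet> (x - y)"
  unfolding interp_eq[OF S e x] interp_eq[OF S e y] by (rule local_interp_diff[OF s])
 also have "... = (\<Sum>b\<in>verts e. ?val b * (bary_grad e b \<bullet> (x - y))) - v e x * (\<Sum>b\<in>verts e. bary_grad e b \<bullet> (x - y))"
  unfolding zero by (simp add: inner_sum_left)
 also have "... = (\<Sum>b\<in>verts e. (?val b - v e x) * (bary_grad e b \<bullet> (x - y)))"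
  by (simp add: left_diff_distrib sum_subtractf sum_distrib_left)
 finally have "\<bar>interp S ?val x - interp S ?val y\<bar> <= (\<Sum>b\<in>verts e. \<bar>(?val b - v e x) * (bary_grad e b \<bullet> (x - y))\<bar>)"
  by (simp add: sum_abs)
 also have "... <= (\<Sum>b\<in>verts e. \<rho> e * (\<kappa> / (2 * diameter e) * norm (x - y)))"
 proof (rule sum_mono)
  fix b assume b: "b \<in> verts e"
  have "norm (bary_grad e b) <= \<kappa> / (2 * diameter e)"
   using bary_grad_bounds(2)[OF eT b] d by (simp add: pos_le_divide_eq mult_ac)
  then have "norm (bary_grad e b) * norm (x - y) <= \<kappa> / (2 * diameter e) * norm (x - y)"
   by (intro mult_right_mono) auto
  then have "\<bar>bary_grad e b \<bullet> (x - y)\<bar> <= \<kappa> / (2 * diameter e) * norm (x - y)"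
   using Cauchy_Schwarz_ineq2[of "bary_grad e b" "x - y"] by linarith
  then show "\<bar>(?val b - v e x) * (bary_grad e b \<bullet> (x - y))\<bar> <= \<rho> e * (\<kappa> / (2 * diameter e) * norm (x - y))"
   unfolding abs_mult using vertex_value_error[OF S e b x] \<rho>_nonneg[OF eT] by (intro mult_mono) auto
 qed
 also have "... = (real (CARD('n) + 1) * \<kappa> / 2) * (\<rho> e / diameter e) * norm (x - y)"
  using simplex_verts(3)[OF s] d by (simp add: field_simps)
 finally show ?thesis .
qed

definition \<rho>_const :: real where
 "\<rho>_const = 8 * real (CARD('n) + 1) * star_sum_const c + 2 * inverse_const p CARD('n)"

lemma \<rho>_sum:
 assumes h: "!!e. e \<in> \<T> ==> diameter e <= h"
  and jsum: "(\<Sum>e\<in>\<T>. vol e * (j e)^2) <= h^2 * R"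
  and gsum: "(\<Sum>e\<in>\<T>. LBINT z:e. (norm (grad (v e) z))^2) <= R"
  and ne: "\<T> \<noteq> {}"
 shows "(\<Sum>e\<in>\<T>. vol e * (\<rho> e)^2) <= \<rho>_const * (h^2 * R)"
proof -
 define d1 where "d1 = real (CARD('n) + 1)"
 let ?G = "%e. LBINT z:e. (norm (grad (v e) z))^2"
 have one: "vol e * (\<rho> e)^2 <= 8 * d1 * (\<Sum>x\<in>verts e. vol e * (star_jump e x)^2)
  + 2 * inverse_const p CARD('n) * (h^2 * ?G e)" if e: "e \<in> \<T>" for e
 proof -
  note s = full[OF e]
  have m: "0 < vol e" by (rule simplex_measure_pos[OF s])
  have G0: "0 <= ?G e" by (rule set_integral_nonneg) simp
  have "(\<Sum>x\<in>verts e. star_jump e x)^2 <= (\<Sum>x\<in>verts e. 1^2) * (\<Sum>x\<in>verts e. (star_jump e x)^2)"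
   using Cauchy_Schwarz_ineq_sum[of "%_. 1" "star_jump e" "verts e"] by simp
  then have 1: "(\<Sum>x\<in>verts e. star_jump e x)^2 <= d1 * (\<Sum>x\<in>verts e. (star_jump e x)^2)"
   using simplex_verts(3)[OF s] by (simp add: d1_def)
  have "vol e * (osc e)^2 = (diameter e)^2 * (inverse_const p CARD('n) * ?G e)"
   using m G0 inverse_const_pos[of p "CARD('n)"] by (simp add: osc_def power_mult_distrib)
  also have "... <= h^2 * (inverse_const p CARD('n) * ?G e)"
   using h[OF e] diameter_pos[OF e] G0 inverse_const_pos[of p "CARD('n)"]
   by (intro mult_right_mono power_mono) auto
  finally have 2: "vol e * (osc e)^2 <= h^2 * (inverse_const p CARD('n) * ?G e)" .
  have "(\<rho> e)^2 <= 8 * (\<Sum>x\<in>verts e. star_jump e x)^2 + 2 * (osc e)^2"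
   using sum_squares_bound[of "2 * (\<Sum>x\<in>verts e. star_jump e x)" "osc e"]
   by (simp add: \<rho>_def power2_eq_square algebra_simps)
  also have "... <= 8 * (d1 * (\<Sum>x\<in>verts e. (star_jump e x)^2)) + 2 * (osc e)^2" using 1 by linarith
  finally have "vol e * (\<rho> e)^2 <= vol e * (8 * (d1 * (\<Sum>x\<in>verts e. (star_jump e x)^2)) + 2 * (osc e)^2)"
   using m by (intro mult_left_mono) auto
  also have "... = 8 * d1 * (\<Sum>x\<in>verts e. vol e * (star_jump e x)^2) + 2 * (vol e * (osc e)^2)"
   by (simp add: sum_distrib_left distrib_left mult_ac)
  also have "... <= 8 * d1 * (\<Sum>x\<in>verts e. vol e * (star_jump e x)^2) + 2 * (h^2 * (inverse_const p CARD('n) * ?G e))"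
   using 2 by linarith
  finally show ?thesis by (simp add: mult_ac)
 qed
 have "(\<Sum>e\<in>\<T>. vol e * (\<rho> e)^2) <= (\<Sum>e\<in>\<T>. 8 * d1 * (\<Sum>x\<in>verts e. vol e * (star_jump e x)^2)
  + 2 * inverse_const p CARD('n) * (h^2 * ?G e))" by (intro sum_mono one)
 also have "... = 8 * d1 * (\<Sum>e\<in>\<T>. \<Sum>x\<in>verts e. vol e * (star_jump e x)^2)
  + 2 * inverse_const p CARD('n) * (h^2 * (\<Sum>e\<in>\<T>. ?G e))"
  by (simp add: sum.distrib sum_distrib_left)
 also have "... <= 8 * d1 * (star_sum_const c * (h^2 * R)) + 2 * inverse_const p CARD('n) * (h^2 * R)"
 proof (intro add_mono mult_left_mono)
  obtain e where "e \<in> \<T>" using ne by blast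
  then have "0 <= star_sum_const c" using star_sum_const_nonneg c_ge_1 by blast
  then have R: "star_sum_const c * (\<Sum>e\<in>\<T>. vol e * (j e)^2) <= star_sum_const c * (h^2 * R)"
   using jsum by (intro mult_left_mono)
  show "(\<Sum>e\<in>\<T>. \<Sum>x\<in>verts e. vol e * (star_jump e x)^2) <= star_sum_const c * (h^2 * R)"
   unfolding star_jump_def by (rule order_trans[OF star_sum[OF c_ge_1 comparable] R])
 qed (use gsum inverse_const_pos[of p "CARD('n)"] in \<open>auto simp: d1_def\<close>)
 also have "... = \<rho>_const * (h^2 * R)" by (simp add: \<rho>_const_def d1_def algebra_simps)
 finally show ?thesis .
qed

end

section \<open>Integrals over unions of elements\<close>

context regular_mesh
begin

lemma AE_not_frontier: "AE x in lborel. \<forall>e\<in>\<T>. x \<notin> frontier e"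
proof -
 have "AE x in lborel. x \<notin> frontier e" if "e \<in> \<T>" for e
 proof (rule AE_not_in)
  have "negligible (frontier e)" by (rule negligible_convex_frontier[OF simplex_convex[OF full[OF that]]])
  then have "emeasure lebesgue (frontier e) = 0" by (simp add: negligible_iff_null_sets null_sets_def)
  then show "frontier e \<in> null_sets lborel" by (simp add: null_sets_def borel_closed)
 qed
 then show ?thesis by (intro AE_finite_allI) auto
qed

lemma unique_element:
 assumes x: "\<forall>e\<in>\<T>. x \<notin> frontier e" and e: "e \<in> \<T>" "x \<in> e" "e' \<in> \<T>" "x \<in> e'" shows "e' = e"
proof (rule ccontr)
 assume "e' \<noteq> e"
 moreover have "x \<in> interior e" using x e(1,2) closure_subset[of e] by (auto simp: frontier_def)
 ultimately show False using disjoint_interior[OF e(3,1)] e(4) by blast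
qed

lemma indicator_Union:
 assumes x: "\<forall>e\<in>\<T>. x \<notin> frontier e" and S: "S \<subseteq> \<T>"
 shows "(\<Sum>e\<in>S. indicator e x) = (indicator (\<Union>S) x :: real)"
proof (cases "x \<in> \<Union>S")
 case True
 then obtain e where e: "e \<in> S" "x \<in> e" by blast
 have "(\<Sum>e'\<in>S. indicator e' x) = (\<Sum>e'\<in>S. if e' = e then 1 else (0::real))"
  using unique_element[OF x _ e(2)] e S by (intro sum.cong) (auto simp: indicator_def)
 also have "... = 1" using e(1) finite_subset[OF S finite_mesh] by simp
 finally show ?thesis using True by simp
qed (auto simp: indicator_def)

lemma integral_Union:
 fixes f :: "real^'n => real"
 assumes S: "S \<subseteq> \<T>" and f: "!!e. e \<in> S ==> set_integrable lborel e f" and fm: "f \<in> borel_measurable borel"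
 shows "(LBINT x:\<Union>S. f x) = (\<Sum>e\<in>S. LBINT x:e. f x)"
proof -
 have fin: "finite S" by (rule finite_subset[OF S finite_mesh])
 have sb: "e \<in> sets borel" if "e \<in> S" for e using simplex_compact[OF full] S that by (auto intro: borel_compact)
 have m: "(%x. (\<Sum>e\<in>S. indicator e x *\<^sub>R f x)) \<in> borel_measurable lborel"
  using sb fm by (intro borel_measurable_sum borel_measurable_scaleR borel_measurable_indicator) auto
 have m2: "(%x. indicator (\<Union>S) x *\<^sub>R f x) \<in> borel_measurable lborel"
  using sb fin fm by (intro borel_measurable_scaleR borel_measurable_indicator) auto
 have "(LBINT x:\<Union>S. f x) = (LBINT x. (\<Sum>e\<in>S. indicator e x *\<^sub>R f x))"
  unfolding set_lebesgue_integral_def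
 proof (rule integral_cong_AE[OF m2 m], rule eventually_mono[OF AE_not_frontier])
  fix x assume "\<forall>e\<in>\<T>. x \<notin> frontier e"
  then show "indicator (\<Union>S) x *\<^sub>R f x = (\<Sum>e\<in>S. indicator e x *\<^sub>R f x)"
   using indicator_Union[OF _ S] by (simp add: sum_distrib_right[symmetric])
 qed
 also have "... = (\<Sum>e\<in>S. LBINT x. indicator e x *\<^sub>R f x)"
  using f by (intro Bochner_Integration.integral_sum) (simp add: set_integrable_def)
 finally show ?thesis by (simp add: set_lebesgue_integral_def)
qed

end

section \<open>Error of the projection onto a coarse mesh\<close>

text \<open>The number \<open>\<Theta>\<close> bounds the squared ratio of coarse and fine diameters. It enters where a gradient on the
  fine mesh is integrated over a coarse diameter. The last assumption says that \<open>v\<close> is in the kernel of the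
  quasi-interpolation.\<close>

locale two_level = broken_function \<kappa> \<Omega> \<T>h p c v w j + coarse: regular_mesh \<kappa> \<Omega> \<T>H
 for \<kappa> :: real and \<Omega> :: "(real^'n) set" and \<T>h \<T>H :: "(real^'n) set set" and p c v w j +
 fixes S :: hdg_scheme and \<Theta> cH :: real
 assumes nested: "refines \<T>h \<T>H"
  and ratio: "!!e E. e \<in> \<T>h ==> E \<in> \<T>H ==> e \<subseteq> E ==> (diameter E)^2 <= \<Theta> * (diameter e)^2"
  and \<Theta>_ge_1: "1 <= \<Theta>"
  and cH_ge_1: "1 <= cH"
  and coarse_comparable: "!!x E E'. (E, E') \<in> coarse.adj x ==> diameter E <= cH * diameter E'"
  and in_kernel: "!!E x. E \<in> \<T>H ==> x \<in> verts E ==> x \<notin> frontier \<Omega> ==>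
   coarse.vertex_mean \<T>H (L2_proj S p (%E. avg_interp \<Omega> {e\<in>\<T>h. e \<subseteq> E} v)) x = 0"
begin

definition children :: "(real^'n) set => (real^'n) set set" where "children E = {e\<in>\<T>h. e \<subseteq> E}"

definition ghat :: "real^'n => real" where "ghat = interp \<T>h (vertex_mean \<T>h v)"

text \<open>The local averages on the coarse elements jump across their boundaries; \<open>ghat\<close> averages over all fine
  elements and is conforming. Both are close to \<open>v\<close>, so \<open>ghat\<close> can stand in for \<open>gloc\<close>.\<close>

definition gloc :: "(real^'n) set => real^'n => real" where
 "gloc E = interp (children E) (vertex_mean (children E) v)"

definition proj :: "(real^'n) set => real^'n => real" where
 "proj = L2_proj S p (%E. avg_interp \<Omega> {e\<in>\<T>h. e \<subseteq> E} v)"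

definition T :: "(real^'n) set => real" where "T E = (\<Sum>e\<in>children E. vol e * (\<rho> e)^2)"

lemma children_subset: "children E \<subseteq> \<T>h" by (auto simp: children_def)

lemma finite_children: "finite (children E)" by (rule finite_subset[OF children_subset finite_mesh])

lemma T_nonneg: "0 <= T E"
 unfolding T_def by (intro sum_nonneg) auto

lemma parent_unique:
 assumes e: "e \<in> \<T>h" "e \<subseteq> E" "e \<subseteq> E'" and E: "E \<in> \<T>H" "E' \<in> \<T>H" shows "E' = E"
proof (rule ccontr)
 assume ne: "E' \<noteq> E"
 obtain x where x: "x \<in> interior e" using simplex_interior_nonempty[OF full[OF e(1)]] by blast
 then have "x \<in> interior E" "x \<in> E'" using interior_mono[OF e(2)] interior_subset[of e] e(3) by auto
 then show False using coarse.disjoint_interior[OF E(2,1) ne] by blast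
qed

lemma Union_children:
 assumes E: "E \<in> \<T>H" shows "\<Union>(children E) = E"
proof
 show "\<Union>(children E) \<subseteq> E" by (auto simp: children_def)
 have "interior E \<subseteq> \<Union>(children E)"
 proof
  fix x assume x: "x \<in> interior E"
  then have "x \<in> \<Union>\<T>h" using coarse.Union_mesh Union_mesh interior_subset[of E] E by blast
  then obtain e where e: "e \<in> \<T>h" "x \<in> e" by blast
  obtain E' where E': "E' \<in> \<T>H" "e \<subseteq> E'" using nested e(1) by (auto simp: refines_def)
  have "E' = E" using coarse.disjoint_interior[OF E'(1) E] x e(2) E'(2) by blast
  then show "x \<in> \<Union>(children E)" using e E' by (auto simp: children_def)
 qed
 moreover have "closed (\<Union>(children E))"
 proof (rule closed_Union[OF finite_children], rule ballI)
  fix e assume "e \<in> children E"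
  then have "e \<in> \<T>h" using children_subset by blast
  then show "closed e" using compact_imp_closed[OF simplex_compact[OF full]] by blast
 qed
 ultimately show "E \<subseteq> \<Union>(children E)"
  using closure_minimal coarse.closure_interior_element[OF E] by blast
qed

lemma sum_children:
 fixes g :: "(real^'n) set => real"
 shows "(\<Sum>E\<in>\<T>H. \<Sum>e\<in>children E. g e) = (\<Sum>e\<in>\<T>h. g e)"
proof -
 have "(\<Sum>e\<in>(\<Union>E\<in>\<T>H. children E). g e) = (\<Sum>E\<in>\<T>H. \<Sum>e\<in>children E. g e)"
  using parent_unique by (intro sum.UNION_disjoint) (auto simp: finite_children, auto simp: children_def)
 moreover have "(\<Union>E\<in>\<T>H. children E) = \<T>h" using nested by (auto simp: children_def refines_def)
 ultimately show ?thesis by simp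
qed

lemma ghat_error: "e \<in> \<T>h ==> z \<in> e ==> \<bar>ghat z - v e z\<bar> <= \<rho> e"
 unfolding ghat_def by (rule interp_error) auto

lemma gloc_error: "e \<in> children E ==> z \<in> e ==> \<bar>gloc E z - v e z\<bar> <= \<rho> e"
 unfolding gloc_def by (rule interp_error[OF children_subset])

lemma bounded_on_children:
 assumes E: "E \<in> \<T>H" and f: "f \<in> borel_measurable borel" and b: "!!e z. e \<in> children E ==> z \<in> e ==> \<bar>f z - v e z\<bar> <= \<rho> e"
 shows "bounded_borel E f"
proof -
 have "\<exists>B. \<forall>z\<in>e. \<bar>v e z\<bar> <= B" if "e \<in> children E" for e
 proof -
  have e: "e \<in> \<T>h" using that children_subset by blast
  then show ?thesis using bounded_borel_polyfn[OF polynomial simplex_compact[OF full]] by (auto simp: bounded_borel_def)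
 qed
 then obtain B where B: "!!e z. e \<in> children E ==> z \<in> e ==> \<bar>v e z\<bar> <= B e" by metis
 have nn: "0 <= \<bar>B e\<bar> + \<rho> e" if "e \<in> children E" for e using \<rho>_nonneg that children_subset by fastforce
 have "\<bar>f z\<bar> <= (\<Sum>e\<in>children E. \<bar>B e\<bar> + \<rho> e)" if z: "z \<in> E" for z
 proof -
  obtain e where e: "e \<in> children E" "z \<in> e" using z Union_children[OF E] by blast
  have "\<bar>f z\<bar> <= \<bar>B e\<bar> + \<rho> e" using b[OF e] B[OF e] by linarith
  also have "... <= (\<Sum>e\<in>children E. \<bar>B e\<bar> + \<rho> e)"
   using nn e(1) finite_children by (intro member_le_sum) auto
  finally show ?thesis .
 qed
 then show ?thesis using f by (auto simp: bounded_borel_def)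
qed

lemma ghat_borel: "ghat \<in> borel_measurable borel" unfolding ghat_def by (rule interp_borel) simp

lemma bounded_ghat: "E \<in> \<T>H ==> bounded_borel E ghat"
 using ghat_error children_subset by (intro bounded_on_children ghat_borel) auto

lemma bounded_gloc: "E \<in> \<T>H ==> bounded_borel E (gloc E)"
 by (intro bounded_on_children gloc_error) (auto simp: gloc_def intro!: interp_borel[OF children_subset])

definition slope_const :: real where "slope_const = (real (CARD('n) + 1) * \<kappa> / 2)^2"

definition el_slope :: "(real^'n) set => real" where
 "el_slope e = (real (CARD('n) + 1) * \<kappa> / 2) * (\<rho> e / diameter e)"

lemma pw_lipschitz_ghat: assumes "E \<in> \<T>H" shows "pw_lipschitz (children E) ghat el_slope"
proof
 show "finite (children E)" by (rule finite_children)
 show "ghat \<in> borel_measurable borel" by (rule ghat_borel)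
 fix e assume e0: "e \<in> children E"
 then have e: "e \<in> \<T>h" using children_subset by blast
 show "compact e" "convex e" using simplex_compact[OF full[OF e]] simplex_convex[OF full[OF e]] by auto
 show "0 <= el_slope e"
  using \<rho>_nonneg[OF e] diameter_pos[OF e] kappa_ge_2[OF e] by (simp add: el_slope_def)
 show "\<bar>ghat x - ghat y\<bar> <= el_slope e * norm (x - y)" if "x \<in> e" "y \<in> e" for x y
  using interp_lipschitz[OF subset_refl e that] by (simp add: ghat_def el_slope_def)
qed

text \<open>On \<open>e\<close> the slope of \<open>ghat\<close> is at most \<open>\<rho> e / diameter e\<close> up to a constant. The factor \<open>\<Theta>\<close> is
  the price for the coarse diameter in the Poincare inequality.\<close>

lemma slope_integral:
 assumes E: "E \<in> \<T>H"
 shows "(diameter E)^2 * (LBINT x:E. (pw_lipschitz.slope (children E) el_slope x)^2) <= slope_const * (\<Theta> * T E)"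
proof -
 interpret pw: pw_lipschitz "children E" ghat el_slope by (rule pw_lipschitz_ghat[OF E])
 have int: "(LBINT x:e. (pw.slope x)^2) = (el_slope e)^2 * vol e" if e: "e \<in> children E" for e
 proof -
  have eT: "e \<in> \<T>h" using e children_subset by blast
  have cp: "compact e" by (rule simplex_compact[OF full[OF eT]])
  have "(LBINT x:e. (pw.slope x)^2) = (LBINT x:e. (el_slope e)^2)"
   unfolding set_lebesgue_integral_def
  proof (rule integral_cong_AE)
   show "AE x in lborel. indicator e x *\<^sub>R (pw.slope x)\<^sup>2 = indicator e x *\<^sub>R (el_slope e)\<^sup>2"
   proof (rule eventually_mono[OF AE_not_frontier])
    fix x assume x: "\<forall>e\<in>\<T>h. x \<notin> frontier e"
    show "indicator e x *\<^sub>R (pw.slope x)\<^sup>2 = indicator e x *\<^sub>R (el_slope e)\<^sup>2"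
    proof (cases "x \<in> e")
     case True
     have "pw.slope x = (\<Sum>e'\<in>children E. if e' = e then el_slope e else 0)"
      unfolding pw.slope_def using unique_element[OF x eT True] True children_subset
      by (intro sum.cong) (auto simp: indicator_def)
     then show ?thesis using e finite_children by simp
    qed simp
   qed
   have [measurable]: "e \<in> sets borel" using cp by (rule borel_compact)
   show "(%x. indicator e x *\<^sub>R (pw.slope x)\<^sup>2) \<in> borel_measurable lborel" by measurable
   show "(%x. indicator e x *\<^sub>R (el_slope e)\<^sup>2) \<in> borel_measurable lborel" by measurable
  qed
  then show ?thesis using set_integral_const[OF cp] by simp
 qed
 have "(LBINT x:E. (pw.slope x)^2) = (LBINT x:\<Union>(children E). (pw.slope x)^2)"
  using Union_children[OF E] by simp
 also have "... = (\<Sum>e\<in>children E. LBINT x:e. (pw.slope x)^2)"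
  using children_subset pw.pieces(1) pw.slope_borel
  by (intro integral_Union pw.slope_square_integrable) auto
 also have "... = (\<Sum>e\<in>children E. (el_slope e)^2 * vol e)" by (intro sum.cong int) auto
 finally have "(diameter E)^2 * (LBINT x:E. (pw.slope x)^2) = (\<Sum>e\<in>children E. (diameter E)^2 * ((el_slope e)^2 * vol e))"
  by (simp add: sum_distrib_left)
 also have "... <= (\<Sum>e\<in>children E. slope_const * (\<Theta> * (vol e * (\<rho> e)^2)))"
 proof (rule sum_mono)
  fix e assume "e \<in> children E"
  then have e: "e \<in> \<T>h" "e \<subseteq> E" by (auto simp: children_def)
  have d: "0 < diameter e" by (rule diameter_pos[OF e(1)])
  have "(diameter E)^2 * ((el_slope e)^2 * vol e) <= (\<Theta> * (diameter e)^2) * ((el_slope e)^2 * vol e)"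
   using ratio[OF e(1) E e(2)] by (intro mult_right_mono) auto
  also have "... = slope_const * (\<Theta> * (vol e * (\<rho> e)^2))"
   using d by (simp add: el_slope_def slope_const_def power_mult_distrib power_divide)
  finally show "(diameter E)^2 * ((el_slope e)^2 * vol e) <= slope_const * (\<Theta> * (vol e * (\<rho> e)^2))" .
 qed
 also have "... = slope_const * (\<Theta> * T E)" by (simp add: T_def sum_distrib_left)
 finally show ?thesis .
qed

definition mean_const :: real where "mean_const = 2 ^ CARD('n) * slope_const"

definition facet_mean :: "(real^'n) set => real" where "facet_mean F = surface_integral F ghat / area F"

text \<open>Almost the mean value of \<open>ghat\<close> over \<open>E\<close>: a value for which the Poincare inequality holds.\<close>

definition el_mean :: "(real^'n) set => real" where
 "el_mean E = (SOME m. (LBINT x:E. (ghat x - m)^2) <= mean_const * (\<Theta> * T E))"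

lemma slope_const_nonneg: "0 <= slope_const" by (simp add: slope_const_def)
lemma mean_const_nonneg: "0 <= mean_const" by (simp add: mean_const_def slope_const_nonneg)

lemma el_mean_error:
 assumes E: "E \<in> \<T>H" shows "(LBINT x:E. (ghat x - el_mean E)^2) <= mean_const * (\<Theta> * T E)"
proof -
 interpret pw: pw_lipschitz "children E" ghat el_slope by (rule pw_lipschitz_ghat[OF E])
 note s = coarse.full[OF E]
 have cE: "compact E" by (rule simplex_compact[OF s])
 let ?R = "(diameter E)^2 * 2 ^ CARD('n) * (LBINT x:E. (pw.slope x)^2)"
 have "\<exists>m. (\<integral>\<^sup>+x. ennreal ((ghat x - m)^2) * indicator E x \<partial>lborel) <= ennreal ?R"
  using coarse.dist_le_diameter[OF E] simplex_measure_pos[OF s] Union_children[OF E]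
  by (intro pw.poincare cE simplex_convex[OF s]) (auto simp: dist_norm)
 then obtain m where m: "(\<integral>\<^sup>+x. ennreal ((ghat x - m)^2) * indicator E x \<partial>lborel) <= ennreal ?R" by blast
 have bb: "bounded_borel E (%x. (ghat x - m)^2)" by (intro bounded_borel_intros bounded_ghat[OF E])
 have "ennreal (LBINT x:E. (ghat x - m)^2) = (\<integral>\<^sup>+x. ennreal ((ghat x - m)^2) * indicator E x \<partial>lborel)"
  using nn_integral_eq_integral[OF bounded_borel_integrable[OF bb cE, unfolded set_integrable_def]]
  by (simp add: set_lebesgue_integral_def ennreal_indicator[symmetric] ennreal_mult'' mult.commute)
 then have "ennreal (LBINT x:E. (ghat x - m)^2) <= ennreal ?R" using m by simp
 moreover have "0 <= ?R" by (intro mult_nonneg_nonneg set_integral_nonneg) auto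
 ultimately have "(LBINT x:E. (ghat x - m)^2) <= ?R" by (simp add: ennreal_le_iff)
 also have "... = 2 ^ CARD('n) * ((diameter E)^2 * (LBINT x:E. (pw.slope x)^2))" by simp
 also have "... <= 2 ^ CARD('n) * (slope_const * (\<Theta> * T E))" by (intro mult_left_mono slope_integral[OF E]) auto
 finally have "(LBINT x:E. (ghat x - m)^2) <= mean_const * (\<Theta> * T E)" by (simp add: mean_const_def)
 then show ?thesis unfolding el_mean_def by (rule someI)
qed

definition jump_const :: real where
 "jump_const = (2 * slope_const + 2 * mean_const) + inverse_const p CARD('n) * (8 + 2 * mean_const)"

text \<open>A common bound for the distances of the element mean from the mean over a facet and from the values of
  the projection.\<close>

definition \<delta> :: "(real^'n) set => real" where
 "\<delta> E = (if E \<in> \<T>H then sqrt (jump_const * (\<Theta> * T E) / vol E) else 0)"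

lemma jump_const_nonneg: "0 <= jump_const"
 using slope_const_nonneg mean_const_nonneg inverse_const_pos[of p "CARD('n)"] by (simp add: jump_const_def)

lemma \<delta>_square: "E \<in> \<T>H ==> vol E * (\<delta> E)^2 = jump_const * (\<Theta> * T E)"
 using simplex_measure_pos[OF coarse.full, of E] jump_const_nonneg \<Theta>_ge_1 T_nonneg[of E] by (simp add: \<delta>_def)

lemma \<delta>_nonneg: "0 <= \<delta> E"
 using jump_const_nonneg \<Theta>_ge_1 T_nonneg[of E] by (simp add: \<delta>_def)

lemma \<delta>_bound:
 assumes E: "E \<in> \<T>H" and y: "vol E * y^2 <= k * (\<Theta> * T E)" "k <= jump_const" shows "\<bar>y\<bar> <= \<delta> E"
proof -
 have m: "0 < vol E" by (rule simplex_measure_pos[OF coarse.full[OF E]])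
 have "0 <= \<Theta> * T E" using \<Theta>_ge_1 T_nonneg[of E] by simp
 then have "vol E * y^2 <= jump_const * (\<Theta> * T E)"
  by (rule order_trans[OF y(1) mult_right_mono[OF y(2)]])
 then have "vol E * y^2 <= vol E * (\<delta> E)^2" using \<delta>_square[OF E] by simp
 then have "y^2 <= (\<delta> E)^2" using m by simp
 then show ?thesis using \<delta>_nonneg abs_le_square_iff[of y "\<delta> E"] by simp
qed

lemma facet_mean_error:
 assumes E: "E \<in> \<T>H" and F: "F facet_of E" shows "\<bar>el_mean E - facet_mean F\<bar> <= \<delta> E"
proof -
 interpret pw: pw_lipschitz "children E" ghat el_slope by (rule pw_lipschitz_ghat[OF E])
 note s = coarse.full[OF E]
 obtain a where a: "a \<in> verts E" "F = opp_face E a" using F facet_iff[OF s] by blast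
 obtain B where B: "!!x. x \<in> E ==> \<bar>ghat x\<bar> <= B" using bounded_ghat[OF E] by (auto simp: bounded_borel_def)
 have "vol E * (facet_mean F - el_mean E)^2 <=
  2 * ((diameter E)^2 * (LBINT x:E. (pw.slope x)^2)) + 2 * (LBINT x:E. (ghat x - el_mean E)^2)"
  unfolding facet_mean_def a(2)
  using coarse.dist_le_diameter[OF E] Union_children[OF E] B by (intro pw.facet_trace[OF s a(1)]) (auto simp: dist_norm)
 also have "... <= (2 * slope_const + 2 * mean_const) * (\<Theta> * T E)"
  using slope_integral[OF E] el_mean_error[OF E] by (simp add: algebra_simps)
 finally have "\<bar>facet_mean F - el_mean E\<bar> <= \<delta> E"
  using mean_const_nonneg inverse_const_pos[of p "CARD('n)"] by (intro \<delta>_bound[OF E]) (auto simp: jump_const_def)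
 then show ?thesis by (simp add: abs_minus_commute)
qed

lemma facet_mean_boundary:
 assumes E: "E \<in> \<T>H" and F: "F facet_of E" "F \<subseteq> frontier \<Omega>" shows "facet_mean F = 0"
proof -
 obtain a where a: "a \<in> verts E" "F = opp_face E a" using F(1) facet_iff[OF coarse.full[OF E]] by blast
 have "ghat z = 0" if z: "z \<in> F" for z
 proof -
  have "F face_of E" using F(1) by (simp add: facet_of_def)
  then have "z \<in> E" using z face_of_imp_subset by blast
  then obtain e where e: "e \<in> children E" "z \<in> e" using Union_children[OF E] by blast
  then have eT: "e \<in> \<T>h" "e \<subseteq> E" by (auto simp: children_def)
  have "(F \<inter> e) face_of (E \<inter> e)"
   by (rule face_of_slice[OF \<open>F face_of E\<close> simplex_convex[OF full[OF eT(1)]]])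
  moreover have "E \<inter> e = e" using eT by blast
  ultimately have G: "(F \<inter> e) face_of e" by simp
  show ?thesis unfolding ghat_def
   using F(2) e(2) z by (intro interp_zero_on_face[OF subset_refl eT(1) G]) (auto simp: vertex_mean_def)
 qed
 then have "surface_integral F ghat = surface_integral F (%_. 0)"
  using opp_face_flat[OF coarse.full[OF E] a(1)] ghat_borel by (intro surface_integral_cong) (auto simp: a(2))
 then show ?thesis by (simp add: facet_mean_def)
qed

lemma proj_error:
 assumes E: "E \<in> \<T>H" and x: "x \<in> E" shows "\<bar>proj E x - el_mean E\<bar> <= \<delta> E"
proof -
 note s = coarse.full[OF E]
 have cE: "compact E" by (rule simplex_compact[OF s])
 let ?m = "el_mean E"
 have avg: "avg_interp \<Omega> {e\<in>\<T>h. e \<subseteq> E} v = gloc E"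
  using avg_interp_eq[OF children_subset, of E v] by (simp add: gloc_def children_def)
 have bg: "bounded_borel E (gloc E)" "bounded_borel E ghat" using bounded_gloc[OF E] bounded_ghat[OF E] by auto
 have P: "polyfn p (proj E)" "(LBINT x:E. (proj E x - ?m)^2) <= (LBINT x:E. (gloc E x - ?m)^2)"
  using L2_proj_props(1)[OF s, where v="%E. avg_interp \<Omega> {e\<in>\<T>h. e \<subseteq> E} v" and p=p and S=S]
   L2_proj_props(2)[OF s, where v="%E. avg_interp \<Omega> {e\<in>\<T>h. e \<subseteq> E} v" and p=p and S=S and c="?m"] bg(1) unfolding avg proj_def by auto
 have bd: "bounded_borel E (%x. (gloc E x - ghat x)^2)"
  by (intro bounded_borel_square bounded_borel_diff bg)
 have "(LBINT x:E. (gloc E x - ghat x)^2) = (LBINT x:\<Union>(children E). (gloc E x - ghat x)^2)"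
  using Union_children[OF E] by simp
 also have "... = (\<Sum>e\<in>children E. LBINT x:e. (gloc E x - ghat x)^2)"
 proof (rule integral_Union[OF children_subset])
  show "(%x. (gloc E x - ghat x)^2) \<in> borel_measurable borel" using bd by (simp add: bounded_borel_def)
  fix e assume e: "e \<in> children E"
  then have "bounded_borel e (%x. (gloc E x - ghat x)^2)" using bd by (auto simp: bounded_borel_def children_def)
  then show "set_integrable lborel e (%x. (gloc E x - ghat x)^2)"
   using e children_subset simplex_compact[OF full] by (intro bounded_borel_integrable) auto
 qed
 also have "... <= (\<Sum>e\<in>children E. 4 * (vol e * (\<rho> e)^2))"
 proof (rule sum_mono)
  fix e assume e: "e \<in> children E"
  then have eT: "e \<in> \<T>h" "e \<subseteq> E" by (auto simp: children_def)
  have ce: "compact e" by (rule simplex_compact[OF full[OF eT(1)]])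
  have "(LBINT x:e. (gloc E x - ghat x)^2) <= (LBINT x:e. (2 * \<rho> e)^2)"
  proof (rule set_integral_mono_on[OF ce _ bounded_borel_const])
   show "bounded_borel e (%x. (gloc E x - ghat x)^2)" using bd eT by (auto simp: bounded_borel_def)
   fix z assume z: "z \<in> e"
   have "\<bar>gloc E z - ghat z\<bar> <= 2 * \<rho> e" using gloc_error[OF e z] ghat_error[OF eT(1) z] by linarith
   then show "(gloc E z - ghat z)^2 <= (2 * \<rho> e)^2" using abs_le_square_iff[of "gloc E z - ghat z" "2 * \<rho> e"] by linarith
  qed
  then show "(LBINT x:e. (gloc E x - ghat x)^2) <= 4 * (vol e * (\<rho> e)^2)"
   unfolding set_integral_const[OF ce] by (simp add: power_mult_distrib mult_ac)
 qed
 also have "... = 4 * T E" by (simp add: T_def sum_distrib_left)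
 also have "... <= 4 * (\<Theta> * T E)" using mult_right_mono[OF \<Theta>_ge_1 T_nonneg[of E]] by simp
 finally have d: "(LBINT x:E. (gloc E x - ghat x)^2) <= 4 * (\<Theta> * T E)" .
 have "(LBINT x:E. (gloc E x - ?m)^2) <= 2 * (LBINT x:E. (gloc E x - ghat x)^2) + 2 * (LBINT x:E. (ghat x - ?m)^2)"
  by (rule set_integral_square_triangle[OF cE bg bounded_borel_const])
 also have "... <= (8 + 2 * mean_const) * (\<Theta> * T E)" using d el_mean_error[OF E] by (simp add: algebra_simps)
 finally have "(LBINT x:E. (proj E x - ?m)^2) <= (8 + 2 * mean_const) * (\<Theta> * T E)" using P(2) by linarith
 then have "inverse_const p CARD('n) * (LBINT x:E. (proj E x - ?m)^2) <= inverse_const p CARD('n) * ((8 + 2 * mean_const) * (\<Theta> * T E))"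
  using inverse_const_pos[of p "CARD('n)"] by (intro mult_left_mono) auto
 moreover have "polyfn p (%x. proj E x - ?m)" by (intro polyfn_diff P polyfn.const)
 ultimately have "vol E * (proj E x - ?m)^2 <= (inverse_const p CARD('n) * (8 + 2 * mean_const)) * (\<Theta> * T E)"
  using simplex_inverse_estimate[OF s _ x, of p "%x. proj E x - ?m"] by (simp add: mult.assoc)
 then show ?thesis using slope_const_nonneg mean_const_nonneg by (intro \<delta>_bound[OF E]) (auto simp: jump_const_def)
qed

text \<open>The element means are connected by the means over the facets around a vertex. At the boundary
  these vanish, and at an interior vertex the average of the projections does.\<close>

lemma el_mean_bound:
 assumes E: "E \<in> \<T>H" and x: "x \<in> verts E" shows "\<bar>el_mean E\<bar> <= 2 * (\<Sum>E'\<in>coarse.reach x E. \<delta> E')"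
proof -
 have xE: "x \<in> E" using x verts_subset by blast
 let ?s = "2 * (\<Sum>E'\<in>coarse.reach x E. \<delta> E')"
 have diff: "\<bar>el_mean E - el_mean E'\<bar> <= ?s - \<delta> E - \<delta> E'" if "E' \<in> coarse.reach x E" for E'
 proof (rule coarse.chain_bound[OF E xE \<delta>_nonneg _ that])
  fix E1 E2 assume "(E1, E2) \<in> coarse.adj x"
  then obtain F where "E1 \<in> \<T>H" "E2 \<in> \<T>H" "F facet_of E1" "F facet_of E2" by (auto simp: coarse.adj_def)
  then show "\<bar>el_mean E1 - el_mean E2\<bar> <= \<delta> E1 + \<delta> E2"
   using facet_mean_error[of E1 F] facet_mean_error[of E2 F] by linarith
 qed
 show ?thesis
 proof (cases "x \<in> frontier \<Omega>")
  case True
  obtain E' F where E': "E' \<in> coarse.reach x E" and F: "F facet_of E'" "x \<in> F" "F \<subseteq> frontier \<Omega>"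
   using coarse.reach_boundary_facet[OF E xE True] by blast
  have E'T: "E' \<in> \<T>H" using coarse.reach_star[OF E xE E'] by blast
  have "\<bar>el_mean E'\<bar> <= \<delta> E'" using facet_mean_error[OF E'T F(1)] facet_mean_boundary[OF E'T F(1,3)] by simp
  then show ?thesis using diff[OF E'] \<delta>_nonneg[of E] by linarith
 next
  case False
  then have xO: "x \<in> \<Omega>" using coarse.in_domain_iff[OF xE E] by simp
  let ?A = "{E \<in> \<T>H. x \<in> E}"
  have A: "0 < card ?A" using E xE by (auto simp: card_gt_0_iff)
  have "(\<Sum>E'\<in>?A. proj E' x) / card ?A = 0"
   using in_kernel[OF E x False] False by (simp add: coarse.vertex_mean_def proj_def)
  then have z: "(\<Sum>E'\<in>?A. proj E' x) = 0" using E xE by auto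
  have "\<bar>el_mean E - proj E' x\<bar> <= ?s" if "E' \<in> ?A" for E'
   using diff[OF coarse.reach_interior_vertex[OF E xE xO, of E']] proj_error[of E' x] \<delta>_nonneg[of E] that by auto
  then have "\<bar>\<Sum>E'\<in>?A. el_mean E - proj E' x\<bar> <= (\<Sum>E'\<in>?A. ?s)"
   by (intro order_trans[OF sum_abs] sum_mono)
  then have "card ?A * \<bar>el_mean E\<bar> <= card ?A * ?s" using z by (simp add: sum_subtractf abs_mult)
  then show ?thesis using A by simp
 qed
qed

definition two_level_const :: real where
 "two_level_const = 3 + 3 * mean_const + 12 * (coarse.star_sum_const cH * jump_const)"

text \<open>On each fine element, \<open>v\<close> differs from \<open>ghat\<close> by \<open>\<rho>\<close>, that function from the mean over the coarse
  element by the Poincare inequality, and this mean is bounded by the \<open>\<delta>\<close> in the star of any vertex.\<close>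

theorem kernel_estimate:
 "(\<Sum>e\<in>\<T>h. LBINT x:e. (v e x)^2) <= two_level_const * (\<Theta> * (\<Sum>e\<in>\<T>h. vol e * (\<rho> e)^2))"
proof -
 let ?m = el_mean
 have one: "(LBINT x:e. (v e x)^2) <= 3 * (vol e * (\<rho> e)^2) + 3 * (LBINT x:e. (ghat x - ?m E)^2) + 3 * ((?m E)^2 * vol e)"
  if E: "E \<in> \<T>H" and e: "e \<in> children E" for e E
 proof -
  have eT: "e \<in> \<T>h" "e \<subseteq> E" using e by (auto simp: children_def)
  have ce: "compact e" by (rule simplex_compact[OF full[OF eT(1)]])
  have "bounded_borel e ghat" using bounded_ghat[OF E] eT(2) by (auto simp: bounded_borel_def)
  then have bg: "bounded_borel e (%x. 3 * (ghat x - ?m E)^2)" by (intro bounded_borel_intros)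
  have bv: "bounded_borel e (v e)" by (rule bounded_borel_polyfn[OF polynomial[OF eT(1)] ce])
  have "(LBINT x:e. (v e x)^2) <= (LBINT x:e. (3 * (\<rho> e)^2 + 3 * (?m E)^2) + 3 * (ghat x - ?m E)^2)"
  proof (rule set_integral_mono_on[OF ce bounded_borel_square[OF bv] bounded_borel_add[OF bounded_borel_const bg]])
   fix x assume x: "x \<in> e"
   let ?a = "v e x - ghat x" and ?b = "ghat x - ?m E"
   have "\<bar>?a\<bar> <= \<rho> e" using ghat_error[OF eT(1) x] by simp
   then have "?a\<^sup>2 <= (\<rho> e)^2" using abs_le_square_iff[of ?a "\<rho> e"] by linarith
   moreover have "(v e x)^2 = (?a + ?b + ?m E)^2" by simp
   moreover have "(?a + ?b + ?m E)^2 <= 3 * ?a\<^sup>2 + 3 * ?b\<^sup>2 + 3 * (?m E)^2"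
    using sum_squares_bound[of ?a ?b] sum_squares_bound[of ?a "?m E"] sum_squares_bound[of ?b "?m E"]
    by (simp add: power2_eq_square algebra_simps)
   ultimately show "(v e x)^2 <= (3 * (\<rho> e)^2 + 3 * (?m E)^2) + 3 * ?b\<^sup>2" by linarith
  qed
  also have "... = (3 * (\<rho> e)^2 + 3 * (?m E)^2) * vol e + 3 * (LBINT x:e. (ghat x - ?m E)^2)"
   using bounded_borel_integrable[OF bounded_borel_const ce] bounded_borel_integrable[OF bg ce] set_integral_const[OF ce]
   by (simp add: set_integral_add)
  finally show ?thesis by (simp add: algebra_simps)
 qed
 have two: "(\<Sum>e\<in>children E. LBINT x:e. (v e x)^2) <= (3 + 3 * mean_const) * (\<Theta> * T E) + 3 * (vol E * (?m E)^2)"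
  if E: "E \<in> \<T>H" for E
 proof -
  have cE: "compact E" by (rule simplex_compact[OF coarse.full[OF E]])
  have bb: "bounded_borel E (%x. (ghat x - ?m E)^2)" by (intro bounded_borel_intros bounded_ghat[OF E])
  have split: "(\<Sum>e\<in>children E. LBINT x:e. f x) = (LBINT x:E. f x)" if f: "bounded_borel E f" for f
  proof -
   have "set_integrable lborel e f" if "e \<in> children E" for e
    using that f simplex_compact[OF full, of e] by (intro bounded_borel_integrable) (auto simp: bounded_borel_def children_def)
   then show ?thesis using integral_Union[OF children_subset, of E f] f Union_children[OF E] by (simp add: bounded_borel_def)
  qed
  have "(\<Sum>e\<in>children E. LBINT x:e. (v e x)^2) <=
   (\<Sum>e\<in>children E. 3 * (vol e * (\<rho> e)^2) + 3 * (LBINT x:e. (ghat x - ?m E)^2) + 3 * ((?m E)^2 * vol e))"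
   by (intro sum_mono one[OF E])
  also have "... = 3 * T E + 3 * (\<Sum>e\<in>children E. LBINT x:e. (ghat x - ?m E)^2) + 3 * (\<Sum>e\<in>children E. (?m E)^2 * vol e)"
   by (simp add: sum.distrib sum_distrib_left T_def)
  also have "(\<Sum>e\<in>children E. (?m E)^2 * vol e) = (\<Sum>e\<in>children E. LBINT x:e. (?m E)^2)"
   using children_subset simplex_compact[OF full] by (intro sum.cong refl set_integral_const[symmetric]) auto
  also have "... = vol E * (?m E)^2" using split[OF bounded_borel_const] set_integral_const[OF cE] by simp
  also have "(\<Sum>e\<in>children E. LBINT x:e. (ghat x - ?m E)^2) = (LBINT x:E. (ghat x - ?m E)^2)" by (rule split[OF bb])
  finally show ?thesis
   using el_mean_error[OF E] mult_right_mono[OF \<Theta>_ge_1 T_nonneg[of E]] by (simp add: algebra_simps)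
 qed
 have three: "vol E * (?m E)^2 <= 4 * (\<Sum>x\<in>verts E. vol E * (\<Sum>E'\<in>coarse.reach x E. \<delta> E')^2)"
  if E: "E \<in> \<T>H" for E
 proof -
  let ?s = "%x. \<Sum>E'\<in>coarse.reach x E. \<delta> E'"
  obtain x where x: "x \<in> verts E" using verts_nonempty[OF coarse.full[OF E]] by blast
  have s0: "0 <= ?s x" using \<delta>_nonneg by (intro sum_nonneg)
  have "(?m E)^2 <= (2 * ?s x)^2" using el_mean_bound[OF E x] s0 abs_le_square_iff[of "?m E" "2 * ?s x"] by simp
  then have "vol E * (?m E)^2 <= vol E * (2 * ?s x)^2" by (intro mult_left_mono) auto
  also have "... = 4 * (vol E * (?s x)^2)" by (simp add: power_mult_distrib)
  also have "... <= 4 * (\<Sum>x\<in>verts E. vol E * (?s x)^2)"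
   using x simplex_verts(2)[OF coarse.full[OF E]] by (intro mult_left_mono member_le_sum) auto
  finally show ?thesis .
 qed
 have sumT: "(\<Sum>E\<in>\<T>H. T E) = (\<Sum>e\<in>\<T>h. vol e * (\<rho> e)^2)"
  unfolding T_def by (rule sum_children)
 have "(\<Sum>e\<in>\<T>h. LBINT x:e. (v e x)^2) = (\<Sum>E\<in>\<T>H. \<Sum>e\<in>children E. LBINT x:e. (v e x)^2)"
  by (rule sum_children[symmetric])
 also have "... <= (\<Sum>E\<in>\<T>H. (3 + 3 * mean_const) * (\<Theta> * T E) + 3 * (vol E * (?m E)^2))" by (intro sum_mono two)
 also have "... = (3 + 3 * mean_const) * (\<Theta> * (\<Sum>E\<in>\<T>H. T E)) + 3 * (\<Sum>E\<in>\<T>H. vol E * (?m E)^2)"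
  by (simp add: sum.distrib sum_distrib_left)
 also have "(\<Sum>E\<in>\<T>H. vol E * (?m E)^2) <= (\<Sum>E\<in>\<T>H. 4 * (\<Sum>x\<in>verts E. vol E * (\<Sum>E'\<in>coarse.reach x E. \<delta> E')^2))"
  by (intro sum_mono three)
 also have "... = 4 * (\<Sum>E\<in>\<T>H. \<Sum>x\<in>verts E. vol E * (\<Sum>E'\<in>coarse.reach x E. \<delta> E')^2)"
  by (simp add: sum_distrib_left)
 also have "(\<Sum>E\<in>\<T>H. \<Sum>x\<in>verts E. vol E * (\<Sum>E'\<in>coarse.reach x E. \<delta> E')^2)
  <= coarse.star_sum_const cH * (\<Sum>E\<in>\<T>H. vol E * (\<delta> E)^2)"
  by (rule coarse.star_sum[OF cH_ge_1 coarse_comparable])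
 also have "(\<Sum>E\<in>\<T>H. vol E * (\<delta> E)^2) = jump_const * (\<Theta> * (\<Sum>E\<in>\<T>H. T E))"
  by (simp add: \<delta>_square sum_distrib_left)
 finally show ?thesis by (simp add: sumT two_level_const_def algebra_simps)
qed

end

section \<open>Multiples of the identity matrix\<close>

lemma mat_mult_vector: "mat c *v x = c *\<^sub>R (x :: real^'n)"
 by (simp add: vec_eq_iff matrix_vector_mult_def mat_def if_distrib[of "%c. c * _"] cong: if_cong)

lemma mat_times_mat: "(mat a :: real^'n^'n) ** mat b = mat (a * b)"
 unfolding matrix_eq matrix_vector_mul_assoc[symmetric] by (simp add: mat_mult_vector)

lemma matrix_inv_mat:
 assumes "c \<noteq> 0" shows "matrix_inv (mat c :: real^'n^'n) = mat (1 / c)"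
proof -
 have i: "(mat c :: real^'n^'n) ** mat (1 / c) = mat 1" "(mat (1 / c) :: real^'n^'n) ** mat c = mat 1"
  using assms by (simp_all add: mat_times_mat)
 then have "(mat c :: real^'n^'n) ** matrix_inv (mat c) = mat 1"
  unfolding matrix_inv_def by (metis (mono_tags, lifting) someI_ex)
 then have "mat (1 / c) ** ((mat c :: real^'n^'n) ** matrix_inv (mat c)) = mat (1 / c)" by simp
 then show ?thesis using i(2) by (simp add: matrix_mul_assoc)
qed

text \<open>A positive semidefinite square root \<open>B\<close> of \<open>s\<^sup>2\<close> is \<open>s\<close>: since \<open>(B + s) (B - s) = 0\<close>, a vector
  in the range of \<open>B - s\<close> would be an eigenvector for \<open>- s\<close>.\<close>

lemma matrix_inv_sqrt_mat:
 assumes c: "0 < c" shows "matrix_inv_sqrt (mat c :: real^'n^'n) = mat (1 / sqrt c)"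
 unfolding matrix_inv_sqrt_def
proof (rule the_equality)
 let ?s = "1 / sqrt c"
 have s: "0 < ?s" "?s * ?s = 1 / c" using c by simp_all
 have t: "transpose (mat ?s :: real^'n^'n) = mat ?s" by (rule transpose_mat)
 show "transpose (mat ?s :: real^'n^'n) = mat ?s \<and> (\<forall>\<xi>. 0 <= ((mat ?s :: real^'n^'n) *v \<xi>) \<bullet> \<xi>) \<and> (mat ?s :: real^'n^'n) ** mat ?s = matrix_inv (mat c)"
  using c s by (simp add: t mat_mult_vector mat_times_mat matrix_inv_mat)
 fix B :: "real^'n^'n"
 assume "transpose B = B \<and> (\<forall>\<xi>. 0 <= (B *v \<xi>) \<bullet> \<xi>) \<and> B ** B = matrix_inv (mat c)"
 then have B: "!!\<xi>. 0 <= (B *v \<xi>) \<bullet> \<xi>" "B ** B = mat (1 / c)" using c by (auto simp: matrix_inv_mat)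
 have "B *v \<xi> = mat ?s *v \<xi>" for \<xi>
 proof -
  define \<eta> where "\<eta> = B *v \<xi> - ?s *\<^sub>R \<xi>"
  have "B *v (B *v \<xi>) = (1 / c) *\<^sub>R \<xi>" by (simp add: matrix_vector_mul_assoc B(2) mat_mult_vector)
  then have "B *v \<eta> = (?s * ?s) *\<^sub>R \<xi> - ?s *\<^sub>R (B *v \<xi>)"
   unfolding \<eta>_def s(2) by (simp add: matrix_vector_mult_diff_distrib matrix_vector_mult_scaleR)
  also have "... = - ?s *\<^sub>R \<eta>" by (simp add: \<eta>_def algebra_simps)
  finally have "0 <= - (?s * (\<eta> \<bullet> \<eta>))" using B(1)[of \<eta>] by simp
  then have "\<eta> \<bullet> \<eta> <= 0" using s(1) by (simp add: mult_le_0_iff divide_le_0_iff)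
  then have "\<eta> = 0" by (metis inner_eq_zero_iff inner_ge_zero order_antisym)
  then show ?thesis by (simp add: \<eta>_def mat_mult_vector)
 qed
 then show "B = mat ?s" by (simp add: matrix_eq)
qed

section \<open>Integrals of functions known almost everywhere on the elements\<close>

text \<open>Lebesgue measure is complete, so a function that agrees almost everywhere with a Borel function is measurable.\<close>

lemma lebesgue_on_integral_AE:
 fixes f g :: "'a::euclidean_space => real"
 assumes e: "compact e" and g: "g \<in> borel_measurable borel" and ae: "AE x in lebesgue_on e. f x = g x"
 shows "(LINT x|lebesgue_on e. f x) = (LBINT x:e. g x)"
proof -
 have eb: "e \<in> sets borel" using e by (rule borel_compact)
 have m: "(%x. indicator e x *\<^sub>R g x) \<in> borel_measurable lborel"
  using eb g by (intro borel_measurable_scaleR borel_measurable_indicator) auto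
 then have m': "(%x. indicator e x *\<^sub>R g x) \<in> borel_measurable lebesgue" by (rule measurable_completion)
 have "AE x in lebesgue. x \<in> e \<longrightarrow> f x = g x" using ae eb by (subst (asm) AE_restrict_space_iff) auto
 then have ae': "AE x in lebesgue. indicator e x *\<^sub>R g x = indicator e x *\<^sub>R f x"
  by (rule eventually_mono) (auto simp: indicator_def)
 have "(LINT x|lebesgue_on e. f x) = (LINT x|lebesgue. indicator e x *\<^sub>R f x)"
  using eb by (subst integral_restrict_space) auto
 also have "... = (LINT x|lebesgue. indicator e x *\<^sub>R g x)"
  by (rule integral_cong_AE[symmetric, OF m' borel_measurable_AE[OF m' ae'] ae'])
 also have "... = (LBINT x. indicator e x *\<^sub>R g x)" by (rule integral_completion[OF m])
 finally show ?thesis by (simp add: set_lebesgue_integral_def)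
qed

context regular_mesh
begin

text \<open>Almost every point of the domain lies in exactly one element, in its interior.\<close>

lemma domain_integral:
 fixes f :: "real^'n => real" and g :: "(real^'n) set => real^'n => real"
 assumes g: "!!e. e \<in> \<T> ==> bounded_borel e (g e)" and ae: "!!e. e \<in> \<T> ==> AE x in lebesgue_on e. f x = g e x"
 shows "integrable (lebesgue_on \<Omega>) f" and "(LINT x|lebesgue_on \<Omega>. f x) = (\<Sum>e\<in>\<T>. LBINT x:e. g e x)"
proof -
 define G where "G x = (\<Sum>e\<in>\<T>. indicator e x *\<^sub>R g e x)" for x
 have ie: "integrable lborel (%x. indicator e x *\<^sub>R g e x)" if "e \<in> \<T>" for e
  using bounded_borel_integrable[OF g[OF that] simplex_compact[OF full[OF that]]] by (simp add: set_integrable_def)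
 have iG: "integrable lborel G" unfolding G_def[abs_def] by (rule Bochner_Integration.integrable_sum[OF ie])
 have LG: "integral\<^sup>L lborel G = (\<Sum>e\<in>\<T>. LBINT x:e. g e x)"
  unfolding G_def[abs_def] set_lebesgue_integral_def by (rule Bochner_Integration.integral_sum[OF ie])
 have mG: "G \<in> borel_measurable lborel" using iG by (rule borel_measurable_integrable)
 then have mG': "G \<in> borel_measurable lebesgue" by (rule measurable_completion)
 have O: "\<Omega> \<in> sets borel" using open_domain by simp
 have "AE x in lebesgue. x \<in> e \<longrightarrow> f x = g e x" if "e \<in> \<T>" for e
  using ae[OF that] borel_compact[OF simplex_compact[OF full[OF that]]] by (subst (asm) AE_restrict_space_iff) auto
 then have 1: "AE x in lebesgue. \<forall>e\<in>\<T>. x \<in> e \<longrightarrow> f x = g e x" by (intro AE_finite_allI) auto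
 have 2: "AE x in lebesgue. \<forall>e\<in>\<T>. x \<notin> frontier e" by (rule AE_completion[OF AE_not_frontier])
 have ae': "AE x in lebesgue. G x = indicator \<Omega> x *\<^sub>R f x"
 proof (rule eventually_rev_mp[OF 1], rule eventually_mono[OF 2], rule impI)
  fix x assume x: "\<forall>e\<in>\<T>. x \<notin> frontier e" and fx: "\<forall>e\<in>\<T>. x \<in> e \<longrightarrow> f x = g e x"
  show "G x = indicator \<Omega> x *\<^sub>R f x"
  proof (cases "x \<in> \<Omega>")
   case True
   then obtain e where e: "e \<in> \<T>" "x \<in> e" using Union_mesh closure_subset[of \<Omega>] by blast
   have "indicator e' x *\<^sub>R g e' x = (if e' = e then f x else 0)" if e': "e' \<in> \<T>" for e'
   proof (cases "e' = e")
    case True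
    then show ?thesis using fx e by simp
   next
    case False
    then have "x \<notin> e'" using unique_element[OF x e e'] by blast
    then show ?thesis using False by simp
   qed
   then have "G x = (\<Sum>e'\<in>\<T>. if e' = e then f x else 0)"
    unfolding G_def by (rule sum.cong[OF refl])
   then show ?thesis using e True by simp
  next
   case False
   have "x \<notin> e" if e: "e \<in> \<T>" for e
   proof
    assume "x \<in> e"
    then have "x \<in> interior e" using x e closure_subset[of e] by (auto simp: frontier_def)
    then show False using interior_element[OF e] False by blast
   qed
   then show ?thesis using False by (simp add: G_def)
  qed
 qed
 have mf: "(%x. indicator \<Omega> x *\<^sub>R f x) \<in> borel_measurable lebesgue" by (rule borel_measurable_AE[OF mG' ae'])
 have "integrable lebesgue G" using iG by (simp add: integrable_completion[OF mG])
 then have "integrable lebesgue (%x. indicator \<Omega> x *\<^sub>R f x)"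
  using integrable_cong_AE[OF mG' mf ae'] by blast
 then show "integrable (lebesgue_on \<Omega>) f" using O by (subst integrable_restrict_space) auto
 have "(LINT x|lebesgue_on \<Omega>. f x) = (LINT x|lebesgue. indicator \<Omega> x *\<^sub>R f x)"
  using O by (subst integral_restrict_space) auto
 also have "... = integral\<^sup>L lebesgue G" by (rule integral_cong_AE[symmetric, OF mG' mf ae'])
 also have "... = integral\<^sup>L lborel G" by (rule integral_completion[OF mG])
 finally show "(LINT x|lebesgue_on \<Omega>. f x) = (\<Sum>e\<in>\<T>. LBINT x:e. g e x)" by (simp add: LG)
qed

lemma bulk_interior:
 assumes e: "e \<in> \<T>" and x: "x \<in> interior e" shows "bulk \<T> v x = v e x"
proof -
 have "indicator (interior e') x *\<^sub>R v e' x = (if e' = e then v e x else 0)" if e': "e' \<in> \<T>" for e'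
  using disjoint_interior[OF e e'] x interior_subset[of e] by (auto simp: indicator_def)
 then have "bulk \<T> v x = (\<Sum>e'\<in>\<T>. if e' = e then v e x else 0)" unfolding bulk_def by (intro sum.cong) auto
 then show ?thesis using e by simp
qed

lemma bulk_AE: assumes e: "e \<in> \<T>" shows "AE x in lebesgue_on e. bulk \<T> v x = v e x"
proof -
 have "AE x in lebesgue. x \<in> e \<longrightarrow> bulk \<T> v x = v e x"
 proof (rule eventually_mono[OF AE_completion[OF AE_not_frontier]], rule impI)
  fix x assume "\<forall>e\<in>\<T>. x \<notin> frontier e" "x \<in> e"
  then show "bulk \<T> v x = v e x" using e closure_subset[of e] by (intro bulk_interior) (auto simp: frontier_def)
 qed
 then show ?thesis using borel_compact[OF simplex_compact[OF full[OF e]]] by (subst AE_restrict_space_iff) auto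
qed

lemma bounded_borel_inner:
 fixes q r :: "real^'n => real^'n"
 assumes "compact K" "!!i. polyfn k (%x. q x $ i)" "!!i. polyfn l (%x. r x $ i)"
 shows "bounded_borel K (%x. q x \<bullet> r x)"
 using bounded_borel_polyfn[OF polyfn_inner_components[OF assms(2,3)] assms(1)] .

lemma L2norm_square:
 fixes f :: "real^'n => 'b::euclidean_space"
 assumes g: "!!e. e \<in> \<T> ==> bounded_borel e (%x. (norm (g e x))^2)" and ae: "!!e. e \<in> \<T> ==> AE x in lebesgue_on e. f x = g e x"
 shows "(L2norm \<Omega> f)^2 = (\<Sum>e\<in>\<T>. LBINT x:e. (norm (g e x))^2)"
proof -
 have "0 <= (LINT x|lebesgue_on \<Omega>. (norm (f x))^2)" by (intro integral_nonneg_AE) auto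
 then have "(L2norm \<Omega> f)^2 = (LINT x|lebesgue_on \<Omega>. (norm (f x))^2)" by (simp add: L2norm_def)
 also have "... = (\<Sum>e\<in>\<T>. LBINT x:e. (norm (g e x))^2)"
 proof (rule domain_integral(2)[OF g])
  show "AE x in lebesgue_on e. (norm (f x))^2 = (norm (g e x))^2" if "e \<in> \<T>" for e
   by (rule eventually_mono[OF ae[OF that]]) simp
 qed
 finally show ?thesis .
qed

end

lemma integral_Cauchy_Schwarz:
 fixes f g :: "'a => real"
 assumes f: "f \<in> borel_measurable M" "integrable M (%x. (f x)^2)" and g: "g \<in> borel_measurable M" "integrable M (%x. (g x)^2)"
 shows "(LINT x|M. f x * g x) <= sqrt (LINT x|M. (f x)^2) * sqrt (LINT x|M. (g x)^2)"
proof -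
 let ?F = "LINT x|M. (f x)^2" and ?G = "LINT x|M. (g x)^2" and ?X = "LINT x|M. f x * g x"
 have fg: "integrable M (%x. f x * g x)"
 proof (rule Bochner_Integration.integrable_bound)
  show "integrable M (%x. (f x)^2 + (g x)^2)" using f(2) g(2) by (rule Bochner_Integration.integrable_add)
  show "(%x. f x * g x) \<in> borel_measurable M" using f(1) g(1) by (rule borel_measurable_times)
  have "\<bar>f x * g x\<bar> <= (f x)^2 + (g x)^2" for x
   using sum_squares_bound[of "\<bar>f x\<bar>" "\<bar>g x\<bar>"] mult_nonneg_nonneg[of "\<bar>f x\<bar>" "\<bar>g x\<bar>"]
   unfolding abs_mult power2_abs by linarith
  then show "AE x in M. norm (f x * g x) <= norm ((f x)^2 + (g x)^2)" by (simp add: abs_of_nonneg)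
 qed
 have q: "2 * s * ?X <= s^2 * ?F + ?G" for s
 proof -
  have "0 <= (LINT x|M. (s * f x - g x)^2)" by (intro integral_nonneg_AE) auto
  also have "(LINT x|M. (s * f x - g x)^2) = (LINT x|M. (s^2 * (f x)^2 + (g x)^2) - (2 * s) * (f x * g x))"
   by (intro Bochner_Integration.integral_cong) (auto simp: power2_eq_square algebra_simps)
  also have "... = s^2 * ?F + ?G - 2 * s * ?X" using f(2) g(2) fg by simp
  finally show ?thesis by simp
 qed
 have F0: "0 <= ?F" and G0: "0 <= ?G" by (intro integral_nonneg_AE; simp)+
 have "?X\<^sup>2 <= ?F * ?G"
 proof (cases "?F = 0")
  case True
  have "?X = 0"
  proof (rule ccontr)
   assume n: "?X \<noteq> 0"
   show False using q[of "(?G + 1) / ?X"] n True G0 by simp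
  qed
  then show ?thesis using True by simp
 next
  case False
  then have "0 < ?F" using F0 by linarith
  then show ?thesis using q[of "?X / ?F"] by (simp add: power2_eq_square field_simps)
 qed
 then have "?X <= sqrt (?F * ?G)" by (rule real_le_rsqrt)
 then show ?thesis by (simp add: real_sqrt_mult)
qed

section \<open>Boundary integrals of bounded functions\<close>

definition bdry_bounded :: "(real^'n) set => ((real^'n) set => real^'n => real) => bool" where
 "bdry_bounded e g \<longleftrightarrow> (\<forall>F. F facet_of e \<longrightarrow> bounded_borel F (g F))"

lemma bdry_bounded_const: "bdry_bounded e (%F x. c F)"
 by (simp add: bdry_bounded_def bounded_borel_const)

lemma bdry_bounded_mult: "bdry_bounded e g ==> bdry_bounded e h ==> bdry_bounded e (%F x. g F x * h F x)"
 by (simp add: bdry_bounded_def bounded_borel_mult)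

lemma bdry_bounded_add: "bdry_bounded e g ==> bdry_bounded e h ==> bdry_bounded e (%F x. g F x + h F x)"
 by (simp add: bdry_bounded_def bounded_borel_add)

lemma bdry_bounded_diff: "bdry_bounded e g ==> bdry_bounded e h ==> bdry_bounded e (%F x. g F x - h F x)"
 by (simp add: bdry_bounded_def bounded_borel_diff)

lemma facet_flat:
 fixes e :: "(real^'n) set"
 assumes "full_simplex e" "F facet_of e" shows "flat F"
proof -
 obtain a where "a \<in> verts e" "F = opp_face e a" using facet_iff[OF assms(1)] assms(2) by blast
 then show ?thesis using opp_face_flat[OF assms(1)] by simp
qed

lemma bdry_bounded_polyfn:
 fixes e :: "(real^'n) set"
 assumes "full_simplex e" "!!F. polyfn k (g F)" shows "bdry_bounded e g"
 unfolding bdry_bounded_def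
proof (intro allI impI)
 fix F assume "F facet_of e"
 then have "compact F" using facet_flat[OF assms(1)] by (simp add: flat_def)
 then show "bounded_borel F (g F)" by (rule bounded_borel_polyfn[OF assms(2)])
qed

lemma bdry_bounded_integrable:
 assumes "full_simplex e" "bdry_bounded e g" "F facet_of e" shows "integrable (face_measure F) (g F)"
proof -
 have "bounded_borel F (g F)" using assms(2,3) by (simp add: bdry_bounded_def)
 then obtain B where "g F \<in> borel_measurable borel" "!!x. x \<in> F ==> \<bar>g F x\<bar> <= B" by (auto simp: bounded_borel_def)
 then show ?thesis by (rule surface_integrable[OF facet_flat[OF assms(1,3)]])
qed

lemma bdry_integral_diff:
 assumes e: "full_simplex e" and g: "bdry_bounded e g" "bdry_bounded e h"
 shows "bdry_integral e (%F x. g F x - h F x) = bdry_integral e g - bdry_integral e h"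
 unfolding bdry_integral_def sum_subtractf[symmetric]
 using bdry_bounded_integrable[OF e g(1)] bdry_bounded_integrable[OF e g(2)] by (intro sum.cong) auto

lemma bdry_integral_cong:
 assumes e: "full_simplex e" and g: "bdry_bounded e g" "bdry_bounded e h"
  and eq: "!!F x. F facet_of e ==> x \<in> F ==> g F x = h F x"
 shows "bdry_integral e g = bdry_integral e h"
 unfolding bdry_integral_def
 using g facet_flat[OF e] eq by (intro sum.cong refl surface_integral_cong) (auto simp: bdry_bounded_def bounded_borel_def)

lemma bdry_integral_nonneg:
 fixes e :: "(real^'n) set"
 assumes e: "full_simplex e" and "!!F x. F facet_of e ==> x \<in> F ==> 0 <= g F x"
 shows "0 <= bdry_integral e g"
 unfolding bdry_integral_def using assms facet_flat[OF e] by (intro sum_nonneg surface_integral_nonneg) auto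

section \<open>The hybridized form\<close>

locale hdg_problem = regular_mesh \<kappa> \<Omega> \<T>
 for \<kappa> :: real and \<Omega> :: "(real^'n) set" and \<T> :: "(real^'n) set set" +
 fixes S :: hdg_scheme and p :: nat and A :: "real^'n => real^'n^'n" and \<alpha> :: real and \<tau> :: "(real^'n) set => real"
  and U :: "((real^'n) set => real^'n => real) => (real^'n) set => real^'n => real"
  and Q :: "((real^'n) set => real^'n => real) => (real^'n) set => real^'n => real^'n"
 assumes p_ge_1: "1 <= p" and \<alpha>_pos: "0 < \<alpha>"
  and coefficient: "!!e. e \<in> \<T> ==> \<exists>c\<ge>\<alpha>. AE x in lebesgue_on e. A x = mat c"
  and stabilization: "if S = LDG_H \<or> S = EDG then \<forall>F\<in>faces \<T>. 0 < \<tau> F else \<forall>F\<in>faces \<T>. \<tau> F = 0"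
  and solvers: "local_solvers S p \<T> A \<tau> U Q"
begin

abbreviation "M \<equiv> M_space S p \<Omega> \<T>"
abbreviation "a \<equiv> hdg_form \<Omega> \<T> A \<tau> U Q"

text \<open>The coefficient is a multiple of the identity on each element, so its inverse and the square root of its inverse
  reduce to divisions by numbers.\<close>

definition coef :: "(real^'n) set => real" where
 "coef e = (SOME c. \<alpha> <= c \<and> (AE x in lebesgue_on e. A x = mat c))"

lemma coef:
 assumes "e \<in> \<T>" shows "\<alpha> <= coef e" "0 < coef e" "AE x in lebesgue_on e. A x = mat (coef e)"
proof -
 have "\<exists>c. \<alpha> <= c \<and> (AE x in lebesgue_on e. A x = mat c)" using coefficient[OF assms] by blast
 from someI_ex[OF this] have "\<alpha> <= coef e \<and> (AE x in lebesgue_on e. A x = mat (coef e))" unfolding coef_def .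
 then show "\<alpha> <= coef e" "0 < coef e" "AE x in lebesgue_on e. A x = mat (coef e)" using \<alpha>_pos by auto
qed

lemma matrix_inv_AE: assumes "e \<in> \<T>" shows "AE x in lebesgue_on e. \<forall>y. matrix_inv (A x) *v y = (1 / coef e) *\<^sub>R y"
proof (rule eventually_mono[OF coef(3)[OF assms]])
 fix x assume x: "A x = mat (coef e)"
 have "coef e \<noteq> 0" using coef(2)[OF assms] by simp
 then show "\<forall>y. matrix_inv (A x) *v y = (1 / coef e) *\<^sub>R y" unfolding x by (simp only: matrix_inv_mat mat_mult_vector simp_thms)
qed

lemma compact_element: "e \<in> \<T> ==> compact e" using simplex_compact[OF full] .

subsection \<open>Skeleton functions\<close>

lemma M_L2_faces: "m \<in> M ==> m \<in> L2_faces \<T>" by (simp add: M_space_def)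

lemma M_trace:
 assumes "m \<in> M" "e \<in> \<T>" "F facet_of e" obtains g where "polyfn p g" "!!x. x \<in> F ==> m F x = g x"
proof -
 have "F \<in> faces \<T>" using assms(2,3) by (auto simp: faces_def)
 then show ?thesis using assms(1) that by (auto simp: M_space_def polys_iff_polyfn)
qed

lemma M_bounded: assumes "m \<in> M" "e \<in> \<T>" shows "bdry_bounded e m"
 unfolding bdry_bounded_def
proof (intro allI impI)
 fix F assume F: "F facet_of e"
 then have FT: "F \<in> faces \<T>" using assms(2) by (auto simp: faces_def)
 obtain g where g: "polyfn p g" "!!x. x \<in> F ==> m F x = g x" using M_trace[OF assms F] by blast
 have "compact F" using facet_flat[OF full[OF assms(2)] F] by (simp add: flat_def)
 from bounded_borel_polyfn[OF g(1) this] have "\<exists>B. \<forall>x\<in>F. \<bar>m F x\<bar> <= B" using g(2) by (simp add: bounded_borel_def)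
 moreover have "m F \<in> borel_measurable borel" using assms(1) FT by (simp add: M_space_def L2_faces_def)
 ultimately show "bounded_borel F (m F)" by (simp add: bounded_borel_def)
qed

lemma M_diff:
 assumes m: "m \<in> M" "m' \<in> M" shows "(%F x. m F x - m' F x) \<in> M"
proof -
 have "(%F x. m F x - m' F x) \<in> skel_support \<T>" using m by (auto simp: M_space_def L2_faces_def skel_support_def)
 moreover have "(%x. m F x - m' F x) \<in> borel_measurable borel \<and> integrable (face_measure F) (%x. (m F x - m' F x)^2)"
  if F: "F \<in> faces \<T>" for F
 proof -
  obtain e where e: "e \<in> \<T>" "F facet_of e" using F by (auto simp: faces_def)
  have b: "bdry_bounded e (%F x. m F x - m' F x)" using m e by (intro bdry_bounded_diff M_bounded)
  then have "bounded_borel F (%x. m F x - m' F x)" using e(2) by (simp add: bdry_bounded_def)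
  then show ?thesis using bdry_bounded_integrable[OF full[OF e(1)] bdry_bounded_mult[OF b b] e(2)]
   by (simp add: bounded_borel_def power2_eq_square)
 qed
 ultimately have "(%F x. m F x - m' F x) \<in> L2_faces \<T>" by (simp add: L2_faces_def)
 moreover have "\<exists>g\<in>polys p. \<forall>x\<in>F. m F x - m' F x = g x" if F: "F \<in> faces \<T>" for F
 proof -
  obtain e where e: "e \<in> \<T>" "F facet_of e" using F by (auto simp: faces_def)
  obtain g where g: "polyfn p g" "!!x. x \<in> F ==> m F x = g x" using M_trace[OF m(1) e] by blast
  obtain g' where g': "polyfn p g'" "!!x. x \<in> F ==> m' F x = g' x" using M_trace[OF m(2) e] by blast
  show ?thesis using polyfn_diff[OF g(1) g'(1)] g(2) g'(2)
   by (intro bexI[of _ "%x. g x - g' x"]) (auto simp: polys_iff_polyfn)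
 qed
 moreover have "\<exists>c. continuous_on (\<Union>(faces \<T>)) c \<and> (\<forall>F\<in>faces \<T>. \<forall>x\<in>F. m F x - m' F x = c x)" if "S = EDG"
 proof -
  have "\<exists>c. continuous_on (\<Union>(faces \<T>)) c \<and> (\<forall>F\<in>faces \<T>. \<forall>x\<in>F. m F x = c x)"
   and "\<exists>c. continuous_on (\<Union>(faces \<T>)) c \<and> (\<forall>F\<in>faces \<T>. \<forall>x\<in>F. m' F x = c x)"
   using m that by (simp_all add: M_space_def)
  then obtain c c' where "continuous_on (\<Union>(faces \<T>)) c" "\<forall>F\<in>faces \<T>. \<forall>x\<in>F. m F x = c x"
   "continuous_on (\<Union>(faces \<T>)) c'" "\<forall>F\<in>faces \<T>. \<forall>x\<in>F. m' F x = c' x" by blast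
  then show ?thesis by (intro exI[of _ "%x. c x - c' x"]) (auto intro: continuous_on_diff)
 qed
 ultimately show ?thesis using m by (simp add: M_space_def)
qed

subsection \<open>Linearity of the local solvers\<close>

lemma U_V_loc: "m \<in> M ==> e \<in> \<T> ==> U m e \<in> V_loc S p"
 and Q_W_loc: "m \<in> M ==> e \<in> \<T> ==> Q m e \<in> W_loc S p"
 using solvers M_L2_faces by (auto simp: local_solvers_def is_local_solution_def)

lemma U_polyfn: "m \<in> M ==> e \<in> \<T> ==> polyfn p (U m e)" using U_V_loc V_loc_polyfn by blast

lemma Q_polyfn: "m \<in> M ==> e \<in> \<T> ==> polyfn (Suc p) (%x. Q m e x $ i)" using Q_W_loc W_loc_polyfn by blast

lemma polyfn_inner_const: "(!!i. polyfn k (%x. q x $ i)) ==> polyfn k (%x. q x \<bullet> (n :: real^'n))"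
proof -
 assume q: "!!i. polyfn k (%x. q x $ i)"
 have "polyfn (k + 0) (%x. q x \<bullet> n)" by (rule polyfn_inner_components[OF q polyfn.const])
 then show ?thesis by simp
qed

lemma local_equations:
 assumes m: "m \<in> M" and e: "e \<in> \<T>"
 shows "r \<in> W_loc S p ==> (1 / coef e) * (LBINT x:e. Q m e x \<bullet> r x) - (LBINT x:e. U m e x * divergence r x)
   = - bdry_integral e (%F x. m F x * (r x \<bullet> outer_normal e F))"
  and "v \<in> V_loc S p ==> bdry_integral e (%F x. (Q m e x \<bullet> outer_normal e F + \<tau> F * U m e x) * v x)
   - (LBINT x:e. Q m e x \<bullet> grad v x) = bdry_integral e (%F x. \<tau> F * m F x * v x)"
proof -
 have sol: "is_local_solution S p A \<tau> e m (U m e) (Q m e)" using solvers M_L2_faces[OF m] e by (simp add: local_solvers_def)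
 note ce = compact_element[OF e]
 {
  assume r: "r \<in> W_loc S p"
  have rp: "polyfn (Suc p) (%x. r x $ i)" for i by (rule W_loc_polyfn[OF r])
  have qr: "bounded_borel e (%x. (1 / coef e) * (Q m e x \<bullet> r x))"
   by (intro bounded_borel_mult bounded_borel_const bounded_borel_inner[OF ce Q_polyfn[OF m e] rp])
  have eq: "(LINT x|lebesgue_on e. (matrix_inv (A x) *v Q m e x) \<bullet> r x) - (LINT x|lebesgue_on e. U m e x * divergence r x) =
   - bdry_integral e (%F x. m F x * (r x \<bullet> outer_normal e F))"
   using sol r unfolding is_local_solution_def by blast
  have 1: "(LINT x|lebesgue_on e. (matrix_inv (A x) *v Q m e x) \<bullet> r x) = (LBINT x:e. (1 / coef e) * (Q m e x \<bullet> r x))"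
   using qr by (intro lebesgue_on_integral_AE[OF ce] eventually_mono[OF matrix_inv_AE[OF e]]) (auto simp: bounded_borel_def)
  have 2: "(LINT x|lebesgue_on e. U m e x * divergence r x) = (LBINT x:e. U m e x * divergence r x)"
   by (rule simplex_set_integral_lebesgue[OF ce polyfn_borel[OF polyfn_mult[OF U_polyfn[OF m e] polyfn_divergence[OF rp]]], symmetric])
  show "(1 / coef e) * (LBINT x:e. Q m e x \<bullet> r x) - (LBINT x:e. U m e x * divergence r x)
   = - bdry_integral e (%F x. m F x * (r x \<bullet> outer_normal e F))"
   using eq unfolding 1 2 set_integral_mult_right .
 next
  assume v: "v \<in> V_loc S p"
  have eq: "bdry_integral e (%F x. (Q m e x \<bullet> outer_normal e F + \<tau> F * U m e x) * v x)
   - (LINT x|lebesgue_on e. Q m e x \<bullet> grad v x) = bdry_integral e (%F x. \<tau> F * m F x * v x)"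
   using sol v unfolding is_local_solution_def by blast
  have 1: "(LINT x|lebesgue_on e. Q m e x \<bullet> grad v x) = (LBINT x:e. Q m e x \<bullet> grad v x)"
   by (rule simplex_set_integral_lebesgue[OF ce polyfn_borel[OF polyfn_grad_inner[OF V_loc_polyfn[OF v] Q_polyfn[OF m e]]], symmetric])
  show "bdry_integral e (%F x. (Q m e x \<bullet> outer_normal e F + \<tau> F * U m e x) * v x)
   - (LBINT x:e. Q m e x \<bullet> grad v x) = bdry_integral e (%F x. \<tau> F * m F x * v x)"
   using eq unfolding 1 .
 }
qed

text \<open>The residual of the superposition solves the homogeneous local problem.\<close>

lemma solvers_diff:
 assumes m: "m \<in> M" "m' \<in> M" and e: "e \<in> \<T>" and x: "x \<in> e"
 shows "U (%F x. m F x - m' F x) e x = U m e x - U m' e x"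
  and "Q (%F x. m F x - m' F x) e x = Q m e x - Q m' e x"
proof -
 let ?d = "%F x. m F x - m' F x"
 note s = full[OF e] and ce = compact_element[OF e] and md = M_diff[OF m]
 define u where "u x = U ?d e x - (U m e x - U m' e x)" for x
 define q where "q x = Q ?d e x - (Q m e x - Q m' e x)" for x
 have Vd: "(%x. f x - g x) \<in> V_loc S p" if "f \<in> V_loc S p" "g \<in> V_loc S p" for f g :: "real^'n => real"
  using that polyfn_diff by (simp add: V_loc_iff)
 have uV: "u \<in> V_loc S p" unfolding u_def[abs_def] using U_V_loc[OF _ e] m md by (intro Vd)
 have qW: "q \<in> W_loc S p" unfolding q_def[abs_def] using Q_W_loc[OF _ e] m md by (intro W_loc_diff)
 have \<tau>: "if S = LDG_H \<or> S = EDG then \<forall>a\<in>verts e. 0 < \<tau> (opp_face e a) else \<forall>a\<in>verts e. \<tau> (opp_face e a) = 0"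
 proof -
  have "opp_face e a \<in> faces \<T>" if "a \<in> verts e" for a using facet_iff[OF s] e that by (auto simp: faces_def)
  then show ?thesis using stabilization by auto
 qed
 have H1: "(1 / coef e) * (LBINT x:e. q x \<bullet> r x) - (LBINT x:e. u x * divergence r x) = 0"
  if r: "r \<in> W_loc S p" for r
 proof -
  have rp: "polyfn (Suc p) (%x. r x $ i)" for i by (rule W_loc_polyfn[OF r])
  have iq: "set_integrable lborel e (%x. Q m e x \<bullet> r x)" if "m \<in> M" for m
   by (rule bounded_borel_integrable[OF bounded_borel_inner[OF ce Q_polyfn[OF that e] rp] ce])
  have iu: "set_integrable lborel e (%x. U m e x * divergence r x)" if "m \<in> M" for m
   by (rule polyfn_set_integrable[OF polyfn_mult[OF U_polyfn[OF that e] polyfn_divergence[OF rp]] ce])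
  have bn: "bdry_bounded e (%F x. m F x * (r x \<bullet> outer_normal e F))" if "m \<in> M" for m
   by (rule bdry_bounded_mult[OF M_bounded[OF that e] bdry_bounded_polyfn[OF s polyfn_inner_const[OF rp]]])
  have "bdry_integral e (%F x. ?d F x * (r x \<bullet> outer_normal e F)) =
   bdry_integral e (%F x. m F x * (r x \<bullet> outer_normal e F)) - bdry_integral e (%F x. m' F x * (r x \<bullet> outer_normal e F))"
   using bdry_integral_diff[OF s bn[OF m(1)] bn[OF m(2)]] by (simp add: left_diff_distrib)
  moreover have "(LBINT x:e. q x \<bullet> r x) = (LBINT x:e. Q ?d e x \<bullet> r x) - ((LBINT x:e. Q m e x \<bullet> r x) - (LBINT x:e. Q m' e x \<bullet> r x))"
   unfolding q_def inner_diff_left using iq[OF md] iq[OF m(1)] iq[OF m(2)] by (simp add: set_integral_diff)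
  moreover have "(LBINT x:e. u x * divergence r x) = (LBINT x:e. U ?d e x * divergence r x)
   - ((LBINT x:e. U m e x * divergence r x) - (LBINT x:e. U m' e x * divergence r x))"
   unfolding u_def left_diff_distrib using iu[OF md] iu[OF m(1)] iu[OF m(2)] by (simp add: set_integral_diff)
  ultimately show ?thesis
   using local_equations(1)[OF md e r] local_equations(1)[OF m(1) e r] local_equations(1)[OF m(2) e r]
   by (simp add: right_diff_distrib)
 qed
 have H2: "bdry_integral e (%F x. (q x \<bullet> outer_normal e F + \<tau> F * u x) * v x) - (LBINT x:e. q x \<bullet> grad v x) = 0"
  if v: "v \<in> V_loc S p" for v
 proof -
  have vp: "polyfn p v" by (rule V_loc_polyfn[OF v])
  have ig: "set_integrable lborel e (%x. Q m e x \<bullet> grad v x)" if "m \<in> M" for m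
   by (rule polyfn_set_integrable[OF polyfn_grad_inner[OF vp Q_polyfn[OF that e]] ce])
  have bv: "bdry_bounded e (%F. v)" by (rule bdry_bounded_polyfn[OF s vp])
  have b1: "bdry_bounded e (%F x. (Q m e x \<bullet> outer_normal e F + \<tau> F * U m e x) * v x)" if "m \<in> M" for m
   by (intro bdry_bounded_mult bdry_bounded_add bdry_bounded_const bv
     bdry_bounded_polyfn[OF s polyfn_inner_const[OF Q_polyfn[OF that e]]] bdry_bounded_polyfn[OF s U_polyfn[OF that e]])
  have b2: "bdry_bounded e (%F x. \<tau> F * m F x * v x)" if "m \<in> M" for m
   by (intro bdry_bounded_mult bdry_bounded_const bv M_bounded that e)
  have "bdry_integral e (%F x. \<tau> F * ?d F x * v x) = bdry_integral e (%F x. \<tau> F * m F x * v x) - bdry_integral e (%F x. \<tau> F * m' F x * v x)"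
   using bdry_integral_diff[OF s b2[OF m(1)] b2[OF m(2)]] by (simp add: left_diff_distrib right_diff_distrib)
  moreover have "bdry_integral e (%F x. (q x \<bullet> outer_normal e F + \<tau> F * u x) * v x) =
   bdry_integral e (%F x. (Q ?d e x \<bullet> outer_normal e F + \<tau> F * U ?d e x) * v x)
   - (bdry_integral e (%F x. (Q m e x \<bullet> outer_normal e F + \<tau> F * U m e x) * v x)
    - bdry_integral e (%F x. (Q m' e x \<bullet> outer_normal e F + \<tau> F * U m' e x) * v x))"
   unfolding bdry_integral_diff[OF s b1[OF m(1)] b1[OF m(2)], symmetric]
    bdry_integral_diff[OF s b1[OF md] bdry_bounded_diff[OF b1[OF m(1)] b1[OF m(2)]], symmetric]
   by (intro arg_cong[where f="bdry_integral e"] ext) (simp add: q_def u_def inner_diff_left algebra_simps)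
  moreover have "(LBINT x:e. q x \<bullet> grad v x) = (LBINT x:e. Q ?d e x \<bullet> grad v x)
   - ((LBINT x:e. Q m e x \<bullet> grad v x) - (LBINT x:e. Q m' e x \<bullet> grad v x))"
   unfolding q_def inner_diff_left using ig[OF md] ig[OF m(1)] ig[OF m(2)] by (simp add: set_integral_diff)
  ultimately show ?thesis
   using local_equations(2)[OF md e v] local_equations(2)[OF m(1) e v] local_equations(2)[OF m(2) e v] by simp
 qed
 have "u x = 0" "q x = 0"
  using homogeneous_local_problem[OF s p_ge_1 coef(2)[OF e] uV qW \<tau> H1 H2 x] by auto
 then show "U ?d e x = U m e x - U m' e x" "Q ?d e x = Q m e x - Q m' e x" by (simp_all add: u_def q_def)
qed

subsection \<open>Bilinearity, symmetry and positivity\<close>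

definition el_form :: "(real^'n) set => ((real^'n) set => real^'n => real) => ((real^'n) set => real^'n => real) => real" where
 "el_form e m \<mu> = (LBINT x:e. (1 / coef e) * (Q m e x \<bullet> Q \<mu> e x)) +
   bdry_integral e (%F x. \<tau> F * (U m e x - m F x) * (U \<mu> e x - \<mu> F x))"

lemma QQ_bounded: "m \<in> M ==> \<mu> \<in> M ==> e \<in> \<T> ==> bounded_borel e (%x. k * (Q m e x \<bullet> Q \<mu> e x))"
 by (rule bounded_borel_mult[OF bounded_borel_const bounded_borel_inner[OF compact_element Q_polyfn Q_polyfn]])

lemma jump_bounded: "m \<in> M ==> e \<in> \<T> ==> bdry_bounded e (%F x. U m e x - m F x)"
 by (rule bdry_bounded_diff[OF bdry_bounded_polyfn[OF full U_polyfn] M_bounded])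

lemma stab_bounded: "m \<in> M ==> \<mu> \<in> M ==> e \<in> \<T> ==> bdry_bounded e (%F x. \<tau> F * (U m e x - m F x) * (U \<mu> e x - \<mu> F x))"
 by (intro bdry_bounded_mult bdry_bounded_const jump_bounded)

lemma form_eq:
 assumes m: "m \<in> M" "\<mu> \<in> M" shows "a m \<mu> = (\<Sum>e\<in>\<T>. el_form e m \<mu>)"
proof -
 have "(LINT x|lebesgue_on \<Omega>. (matrix_inv (A x) *v bulk \<T> (Q m) x) \<bullet> bulk \<T> (Q \<mu>) x) =
  (\<Sum>e\<in>\<T>. LBINT x:e. (1 / coef e) * (Q m e x \<bullet> Q \<mu> e x))"
 proof (rule domain_integral(2)[OF QQ_bounded[OF m]])
  fix e assume e: "e \<in> \<T>"
  show "AE x in lebesgue_on e. (matrix_inv (A x) *v bulk \<T> (Q m) x) \<bullet> bulk \<T> (Q \<mu>) x = 1 / coef e * (Q m e x \<bullet> Q \<mu> e x)"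
   by (rule eventually_rev_mp[OF bulk_AE[OF e, of "Q m"]], rule eventually_rev_mp[OF bulk_AE[OF e, of "Q \<mu>"]],
     rule eventually_mono[OF matrix_inv_AE[OF e]]) simp
 qed
 then show ?thesis by (simp add: hdg_form_def el_form_def sum.distrib)
qed

lemma form_sym: "a m \<mu> = a \<mu> m" if "m \<in> M" "\<mu> \<in> M"
 unfolding form_eq[OF that] form_eq[OF that(2,1)] el_form_def
 by (simp add: inner_commute mult.assoc mult.commute[of "U m _ _ - _"])

lemma form_diff_left:
 assumes m: "m \<in> M" "m' \<in> M" and \<mu>: "\<mu> \<in> M" shows "a (%F x. m F x - m' F x) \<mu> = a m \<mu> - a m' \<mu>"
proof -
 let ?d = "%F x. m F x - m' F x"
 note md = M_diff[OF m]
 have "el_form e ?d \<mu> = el_form e m \<mu> - el_form e m' \<mu>" if e: "e \<in> \<T>" for e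
 proof -
  note s = full[OF e] and ce = compact_element[OF e]
  have "(LBINT x:e. (1 / coef e) * (Q ?d e x \<bullet> Q \<mu> e x)) =
   (LBINT x:e. (1 / coef e) * (Q m e x \<bullet> Q \<mu> e x) - (1 / coef e) * (Q m' e x \<bullet> Q \<mu> e x))"
   using borel_compact[OF ce] solvers_diff(2)[OF m e]
   by (intro set_lebesgue_integral_cong) (auto simp: inner_diff_left right_diff_distrib)
  also have "... = (LBINT x:e. (1 / coef e) * (Q m e x \<bullet> Q \<mu> e x)) - (LBINT x:e. (1 / coef e) * (Q m' e x \<bullet> Q \<mu> e x))"
   by (rule set_integral_diff(2)[OF bounded_borel_integrable[OF QQ_bounded[OF m(1) \<mu> e] ce] bounded_borel_integrable[OF QQ_bounded[OF m(2) \<mu> e] ce]])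
  finally have 1: "(LBINT x:e. (1 / coef e) * (Q ?d e x \<bullet> Q \<mu> e x)) =
   (LBINT x:e. (1 / coef e) * (Q m e x \<bullet> Q \<mu> e x)) - (LBINT x:e. (1 / coef e) * (Q m' e x \<bullet> Q \<mu> e x))" .
  have "bdry_integral e (%F x. \<tau> F * (U ?d e x - ?d F x) * (U \<mu> e x - \<mu> F x)) =
   bdry_integral e (%F x. \<tau> F * (U m e x - m F x) * (U \<mu> e x - \<mu> F x) - \<tau> F * (U m' e x - m' F x) * (U \<mu> e x - \<mu> F x))"
  proof (rule bdry_integral_cong[OF s stab_bounded[OF md \<mu> e] bdry_bounded_diff[OF stab_bounded[OF m(1) \<mu> e] stab_bounded[OF m(2) \<mu> e]]])
   fix F x assume "F facet_of e" "x \<in> F"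
   then have "x \<in> e" by (auto simp: facet_of_def dest: face_of_imp_subset)
   then show "\<tau> F * (U ?d e x - ?d F x) * (U \<mu> e x - \<mu> F x) =
    \<tau> F * (U m e x - m F x) * (U \<mu> e x - \<mu> F x) - \<tau> F * (U m' e x - m' F x) * (U \<mu> e x - \<mu> F x)"
    unfolding solvers_diff(1)[OF m e \<open>x \<in> e\<close>] by (simp add: algebra_simps)
  qed
  also have "... = bdry_integral e (%F x. \<tau> F * (U m e x - m F x) * (U \<mu> e x - \<mu> F x))
   - bdry_integral e (%F x. \<tau> F * (U m' e x - m' F x) * (U \<mu> e x - \<mu> F x))"
   by (rule bdry_integral_diff[OF s stab_bounded[OF m(1) \<mu> e] stab_bounded[OF m(2) \<mu> e]])
  finally show ?thesis using 1 by (simp add: el_form_def)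
 qed
 then show ?thesis by (simp add: form_eq[OF md \<mu>] form_eq[OF m(1) \<mu>] form_eq[OF m(2) \<mu>] sum_subtractf)
qed

lemma form_diff_right:
 assumes m: "m \<in> M" "m' \<in> M" and \<mu>: "\<mu> \<in> M" shows "a \<mu> (%F x. m F x - m' F x) = a \<mu> m - a \<mu> m'"
 using form_diff_left[OF m \<mu>] form_sym[OF \<mu> M_diff[OF m]] form_sym[OF \<mu> m(1)] form_sym[OF \<mu> m(2)] by simp

lemma form_ge_flux:
 assumes m: "m \<in> M" shows "(\<Sum>e\<in>\<T>. LBINT x:e. (1 / coef e) * (norm (Q m e x))^2) <= a m m"
proof -
 have "0 <= bdry_integral e (%F x. \<tau> F * (U m e x - m F x) * (U m e x - m F x))" if e: "e \<in> \<T>" for e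
 proof (rule bdry_integral_nonneg[OF full[OF e]])
  fix F x assume "F facet_of e"
  then have "F \<in> faces \<T>" using e by (auto simp: faces_def)
  then have "0 <= \<tau> F" using stabilization by (auto split: if_splits simp: less_imp_le)
  then show "0 <= \<tau> F * (U m e x - m F x) * (U m e x - m F x)" by (simp add: mult.assoc)
 qed
 then show ?thesis unfolding form_eq[OF m m] el_form_def power2_norm_eq_inner by (intro sum_mono) simp
qed

lemma form_nonneg: "m \<in> M ==> 0 <= a m m"
proof -
 assume m: "m \<in> M"
 have "0 <= (\<Sum>e\<in>\<T>. LBINT x:e. (1 / coef e) * (norm (Q m e x))^2)"
  using coef(2) by (intro sum_nonneg set_integral_nonneg mult_nonneg_nonneg) (auto intro: less_imp_le)
 then show ?thesis using form_ge_flux[OF m] by linarith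
qed

lemma Q_square_bounded: "m \<in> M ==> e \<in> \<T> ==> bounded_borel e (%x. k * (norm (Q m e x))^2)"
 unfolding power2_norm_eq_inner by (rule QQ_bounded)

lemma norm_scaled_flux: "0 < k ==> (norm ((1 / k) *\<^sub>R q))^2 = (1 / k^2) * (norm q)^2"
 by (simp add: power_mult_distrib power_divide)

lemma inv_flux_norm:
 assumes m: "m \<in> M"
 shows "(L2norm \<Omega> (%x. matrix_inv (A x) *v bulk \<T> (Q m) x))^2 = (\<Sum>e\<in>\<T>. LBINT x:e. (1 / (coef e)^2) * (norm (Q m e x))^2)"
proof -
 have "(L2norm \<Omega> (%x. matrix_inv (A x) *v bulk \<T> (Q m) x))^2 = (\<Sum>e\<in>\<T>. LBINT x:e. (norm ((1 / coef e) *\<^sub>R Q m e x))^2)"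
 proof (rule L2norm_square)
  fix e assume e: "e \<in> \<T>"
  show "bounded_borel e (%x. (norm ((1 / coef e) *\<^sub>R Q m e x))^2)"
   unfolding norm_scaled_flux[OF coef(2)[OF e]] by (rule Q_square_bounded[OF m e])
  show "AE x in lebesgue_on e. matrix_inv (A x) *v bulk \<T> (Q m) x = (1 / coef e) *\<^sub>R Q m e x"
   by (rule eventually_rev_mp[OF bulk_AE[OF e, of "Q m"]], rule eventually_mono[OF matrix_inv_AE[OF e]]) simp
 qed
 also have "... = (\<Sum>e\<in>\<T>. LBINT x:e. (1 / (coef e)^2) * (norm (Q m e x))^2)"
  by (intro sum.cong refl) (simp only: norm_scaled_flux[OF coef(2)])
 finally show ?thesis .
qed

lemma inv_flux_le_form:
 assumes m: "m \<in> M" shows "\<alpha> * (L2norm \<Omega> (%x. matrix_inv (A x) *v bulk \<T> (Q m) x))^2 <= a m m"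
proof -
 have "\<alpha> * (LBINT x:e. (1 / (coef e)^2) * (norm (Q m e x))^2) <= (LBINT x:e. (1 / coef e) * (norm (Q m e x))^2)"
  if e: "e \<in> \<T>" for e
 proof -
  have le: "\<alpha> * (1 / (coef e)^2) <= 1 / coef e" using coef[OF e] by (simp add: power2_eq_square divide_simps)
  have "\<alpha> * (LBINT x:e. (1 / (coef e)^2) * (norm (Q m e x))^2) = (LBINT x:e. (\<alpha> * (1 / (coef e)^2)) * (norm (Q m e x))^2)" by simp
  also have "... <= (LBINT x:e. (1 / coef e) * (norm (Q m e x))^2)"
   by (intro set_integral_mono_on[OF compact_element[OF e]] Q_square_bounded[OF m e] mult_right_mono[OF le]) auto
  finally show ?thesis .
 qed
 then have "\<alpha> * (\<Sum>e\<in>\<T>. LBINT x:e. (1 / (coef e)^2) * (norm (Q m e x))^2) <= (\<Sum>e\<in>\<T>. LBINT x:e. (1 / coef e) * (norm (Q m e x))^2)"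
  unfolding sum_distrib_left by (intro sum_mono)
 then show ?thesis using form_ge_flux[OF m] by (simp add: inv_flux_norm[OF m])
qed

lemma energy_flux_le_form:
 assumes m: "m \<in> M" "m' \<in> M"
 shows "(L2norm \<Omega> (%x. matrix_inv_sqrt (A x) *v (bulk \<T> (Q m) x - bulk \<T> (Q m') x)))^2 <= a (%F x. m F x - m' F x) (%F x. m F x - m' F x)"
proof -
 let ?d = "%F x. m F x - m' F x"
 note md = M_diff[OF m]
 have sq: "(norm ((1 / sqrt (coef e)) *\<^sub>R Q ?d e x))^2 = (1 / coef e) * (norm (Q ?d e x))^2" if "e \<in> \<T>" for e x
  using coef(2)[OF that] norm_scaled_flux[of "sqrt (coef e)"] by simp
 have "(L2norm \<Omega> (%x. matrix_inv_sqrt (A x) *v (bulk \<T> (Q m) x - bulk \<T> (Q m') x)))^2 =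
  (\<Sum>e\<in>\<T>. LBINT x:e. (norm ((1 / sqrt (coef e)) *\<^sub>R Q ?d e x))^2)"
 proof (rule L2norm_square)
  fix e assume e: "e \<in> \<T>"
  show "bounded_borel e (%x. (norm ((1 / sqrt (coef e)) *\<^sub>R Q ?d e x))^2)"
   unfolding sq[OF e] by (rule Q_square_bounded[OF md e])
  have inside: "AE x in lebesgue_on e. x \<in> e" by (rule AE_I2) simp
  show "AE x in lebesgue_on e. matrix_inv_sqrt (A x) *v (bulk \<T> (Q m) x - bulk \<T> (Q m') x) = (1 / sqrt (coef e)) *\<^sub>R Q ?d e x"
  proof (rule eventually_rev_mp[OF bulk_AE[OF e, of "Q m"]], rule eventually_rev_mp[OF bulk_AE[OF e, of "Q m'"]],
    rule eventually_rev_mp[OF inside], rule eventually_mono[OF coef(3)[OF e]], intro impI)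
   fix x assume x: "A x = mat (coef e)" "x \<in> e" "bulk \<T> (Q m') x = Q m' e x" "bulk \<T> (Q m) x = Q m e x"
   show "matrix_inv_sqrt (A x) *v (bulk \<T> (Q m) x - bulk \<T> (Q m') x) = (1 / sqrt (coef e)) *\<^sub>R Q ?d e x"
    unfolding x(1,3,4) matrix_inv_sqrt_mat[OF coef(2)[OF e]] mat_mult_vector solvers_diff(2)[OF m e x(2)] by (rule refl)
  qed
 qed
 also have "... = (\<Sum>e\<in>\<T>. LBINT x:e. (1 / coef e) * (norm (Q ?d e x))^2)"
  by (intro sum.cong refl) (simp only: sq)
 also have "... <= a ?d ?d" by (rule form_ge_flux[OF md])
 finally show ?thesis .
qed

lemma bulk_U_norm:
 assumes m: "m \<in> M" shows "(L2norm \<Omega> (bulk \<T> (U m)))^2 = (\<Sum>e\<in>\<T>. LBINT x:e. (U m e x)^2)"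
proof -
 have "(L2norm \<Omega> (bulk \<T> (U m)))^2 = (\<Sum>e\<in>\<T>. LBINT x:e. (norm (U m e x))^2)"
  using bounded_borel_square[OF bounded_borel_polyfn[OF U_polyfn[OF m] compact_element]] by (intro L2norm_square bulk_AE) auto
 then show ?thesis by simp
qed

lemma bulk_U_diff:
 assumes m: "m \<in> M" "m' \<in> M"
 shows "L2norm \<Omega> (%x. bulk \<T> (U m) x - bulk \<T> (U m') x) = L2norm \<Omega> (bulk \<T> (U (%F x. m F x - m' F x)))"
proof -
 have "bulk \<T> (U m) x - bulk \<T> (U m') x = bulk \<T> (U (%F x. m F x - m' F x)) x" for x
 proof -
  have "indicator (interior e) x *\<^sub>R U m e x - indicator (interior e) x *\<^sub>R U m' e x =
   indicator (interior e) x *\<^sub>R U (%F x. m F x - m' F x) e x" if "e \<in> \<T>" for e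
   using solvers_diff(1)[OF m that, of x] interior_subset[of e] by (cases "x \<in> interior e") auto
  then show ?thesis unfolding bulk_def sum_subtractf[symmetric] by (intro sum.cong) auto
 qed
 then show ?thesis by simp
qed

lemma load_bound:
 assumes m: "m \<in> M" and f: "f \<in> L2 \<Omega>"
 shows "(LINT x|lebesgue_on \<Omega>. f x * bulk \<T> (U m) x) <= L2norm \<Omega> f * L2norm \<Omega> (bulk \<T> (U m))"
proof -
 have sq: "integrable (lebesgue_on \<Omega>) (%x. (bulk \<T> (U m) x)^2)"
 proof (rule domain_integral(1))
  fix e assume e: "e \<in> \<T>"
  show "bounded_borel e (%x. (U m e x)^2)" by (rule bounded_borel_square[OF bounded_borel_polyfn[OF U_polyfn[OF m e] compact_element[OF e]]])
  show "AE x in lebesgue_on e. (bulk \<T> (U m) x)^2 = (U m e x)^2" by (rule eventually_mono[OF bulk_AE[OF e, of "U m"]]) simp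
 qed
 have "integrable (lebesgue_on \<Omega>) (bulk \<T> (U m))"
  by (rule domain_integral(1)[OF bounded_borel_polyfn[OF U_polyfn[OF m] compact_element] bulk_AE])
 then have "bulk \<T> (U m) \<in> borel_measurable (lebesgue_on \<Omega>)" by (rule borel_measurable_integrable)
 then show ?thesis using integral_Cauchy_Schwarz[of f "lebesgue_on \<Omega>" "bulk \<T> (U m)"] f sq by (simp add: L2_def L2norm_def)
qed

subsection \<open>Galerkin orthogonality\<close>

text \<open>The error is \<open>(m - C m) - mH + C m\<close>. Galerkin orthogonality makes it orthogonal to the first two
  terms, and \<open>mH\<close> is orthogonal to the third by the definition of the corrector.\<close>

lemma multiscale_error_energy:
 assumes C: "!!\<xi>. \<xi> \<in> M ==> C \<xi> \<in> W" "!!\<xi> \<eta>. \<xi> \<in> M ==> \<eta> \<in> W ==> a (C \<xi>) \<eta> = a \<xi> \<eta>" and W: "W \<subseteq> M"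
  and m: "m \<in> M" "!!\<mu>. \<mu> \<in> M ==> a m \<mu> = l \<mu>"
  and mH: "mH \<in> multiscale_space S p \<Omega> \<T> C" "!!\<mu>. \<mu> \<in> multiscale_space S p \<Omega> \<T> C ==> a mH \<mu> = l \<mu>"
 shows "mH \<in> M" "a (%F x. m F x - mH F x) (%F x. m F x - mH F x) = l (C m)" "a (C m) (C m) = l (C m)"
proof -
 obtain \<xi> where \<xi>: "\<xi> \<in> M" "mH = (%F x. \<xi> F x - C \<xi> F x)" using mH(1) by (auto simp: multiscale_space_def)
 have CM: "C \<mu> \<in> M" if "\<mu> \<in> M" for \<mu> using C(1)[OF that] W by blast
 show mHM: "mH \<in> M" unfolding \<xi>(2) by (rule M_diff[OF \<xi>(1) CM[OF \<xi>(1)]])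
 define d where "d F x = m F x - mH F x" for F x
 define k where "k F x = m F x - C m F x" for F x
 have dM: "d \<in> M" unfolding d_def[abs_def] by (rule M_diff[OF m(1) mHM])
 have kM: "k \<in> M" unfolding k_def[abs_def] by (rule M_diff[OF m(1) CM[OF m(1)]])
 have kX: "k \<in> multiscale_space S p \<Omega> \<T> C" unfolding k_def[abs_def] multiscale_space_def using m(1) by blast
 have orth: "a d \<mu> = 0" if "\<mu> \<in> multiscale_space S p \<Omega> \<T> C" "\<mu> \<in> M" for \<mu>
  using form_diff_left[OF m(1) mHM that(2)] m(2)[OF that(2)] mH(2)[OF that(1)] by (simp add: d_def[abs_def])
 have "a d (C m) = a d m - a d k"
 proof -
  have "C m = (%F x. m F x - k F x)" by (simp add: k_def fun_eq_iff)
  then show ?thesis using form_diff_right[OF m(1) kM dM] by simp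
 qed
 then have "a d m = a d (C m)" using orth[OF kX kM] by simp
 moreover have "a d d = a d m - a d mH" using form_diff_right[OF m(1) mHM dM] by (simp add: d_def[abs_def])
 moreover have "a d mH = 0" by (rule orth[OF mH(1) mHM])
 moreover have "a d (C m) = a m (C m) - a mH (C m)"
  using form_diff_left[OF m(1) mHM CM[OF m(1)]] by (simp add: d_def[abs_def])
 moreover have "a mH (C m) = 0"
  using form_diff_left[OF \<xi>(1) CM[OF \<xi>(1)] CM[OF m(1)]] C(2)[OF \<xi>(1) C(1)[OF m(1)]] by (simp add: \<xi>(2))
 ultimately have "a d d = l (C m)" using m(2)[OF CM[OF m(1)]] by simp
 then show "a (%F x. m F x - mH F x) (%F x. m F x - mH F x) = l (C m)" by (simp add: d_def[abs_def])
 show "a (C m) (C m) = l (C m)" using C(2)[OF m(1) C(1)[OF m(1)]] m(2)[OF CM[OF m(1)]] by simp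
qed

end

section \<open>The domain lies on one side of its boundary\<close>

text \<open>Moving from a boundary point against the direction of the local graph, one arrives at points that have a
  neighbourhood below the graph.\<close>

lemma lipschitz_polytope_exterior:
 fixes \<Omega> :: "'a::euclidean_space set"
 assumes "lipschitz_polytope \<Omega>" shows "open \<Omega>" "frontier \<Omega> \<subseteq> closure (- closure \<Omega>)"
proof -
 show op: "open \<Omega>" using assms by (simp add: lipschitz_polytope_def)
 show "frontier \<Omega> \<subseteq> closure (- closure \<Omega>)"
 proof
  fix x assume x: "x \<in> frontier \<Omega>"
  then obtain r n L and g :: "'a => real" where r: "r > 0" and n: "norm n = 1" and g: "L-lipschitz_on {z. z \<bullet> n = 0} g"
   and iff: "!!y. y \<in> ball x r ==> y \<in> \<Omega> \<longleftrightarrow> g (y - (y \<bullet> n) *\<^sub>R n) < y \<bullet> n"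
   using assms unfolding lipschitz_polytope_def by meson
  have nn: "n \<bullet> n = 1" using n by (simp add: norm_eq_1)
  have L0: "0 <= L" using g by (rule lipschitz_on_nonneg)
  define \<pi> where "\<pi> y = y - (y \<bullet> n) *\<^sub>R n" for y
  have \<pi>0: "\<pi> y \<in> {z. z \<bullet> n = 0}" for y by (simp add: \<pi>_def inner_diff_left nn)
  have \<pi>le: "norm (\<pi> y - \<pi> z) <= norm (y - z)" for y z
  proof -
   let ?w = "y - z"
   have "\<pi> y - \<pi> z = ?w - (?w \<bullet> n) *\<^sub>R n" by (simp add: \<pi>_def inner_diff_left algebra_simps)
   moreover have "(norm (?w - (?w \<bullet> n) *\<^sub>R n))^2 = (norm ?w)^2 - (?w \<bullet> n)\<^sup>2"
    unfolding power2_norm_eq_inner by (simp add: inner_diff_left inner_diff_right nn inner_commute power2_eq_square)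
   ultimately have "(norm (\<pi> y - \<pi> z))^2 <= (norm ?w)^2" by simp
   then show ?thesis by (rule power2_le_imp_le) simp
  qed
  have "x \<notin> \<Omega>" using x op by (simp add: frontier_def interior_open)
  then have gx: "x \<bullet> n <= g (\<pi> x)" using iff[of x] r by (simp add: \<pi>_def not_less)
  show "x \<in> closure (- closure \<Omega>)" unfolding closure_approachable
  proof (intro allI impI)
   fix \<epsilon> :: real assume \<epsilon>: "0 < \<epsilon>"
   define s where "s = min (\<epsilon> / 2) (r / 2)"
   have s: "0 < s" "s < \<epsilon>" "s < r" using \<epsilon> r by (auto simp: s_def)
   define y where "y = x - s *\<^sub>R n"
   have dy: "dist y x = s" using s n by (simp add: y_def dist_norm)
   define \<delta> where "\<delta> = min (s / (L + 1)) (r - s)"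
   have \<delta>: "0 < \<delta>" using s L0 by (auto simp: \<delta>_def)
   have yn: "y \<bullet> n = x \<bullet> n - s" by (simp add: y_def inner_diff_left nn)
   have \<pi>y: "\<pi> y = \<pi> x" unfolding \<pi>_def yn by (simp add: y_def algebra_simps)
   have "z \<notin> \<Omega>" if z: "dist z y < \<delta>" for z
   proof -
    have "dist x z < r" using dist_triangle[of x z y] z dy by (simp add: \<delta>_def dist_commute)
    then have zi: "z \<in> \<Omega> \<longleftrightarrow> g (\<pi> z) < z \<bullet> n" using iff[of z] by (simp add: \<pi>_def)
    have "\<bar>g (\<pi> z) - g (\<pi> x)\<bar> <= L * norm (\<pi> z - \<pi> x)"
     using lipschitz_onD[OF g \<pi>0 \<pi>0, of z x] by (simp add: dist_norm)
    also have "... <= L * norm (z - y)" using \<pi>le[of z y] L0 unfolding \<pi>y by (intro mult_left_mono)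
    finally have 1: "g (\<pi> x) - L * norm (z - y) <= g (\<pi> z)" by linarith
    have "(z - y) \<bullet> n <= norm (z - y)" using norm_cauchy_schwarz[of "z - y" n] n by simp
    then have 2: "z \<bullet> n <= x \<bullet> n - s + norm (z - y)" by (simp add: inner_diff_left yn)
    have "norm (z - y) < s / (L + 1)" using z by (simp add: \<delta>_def dist_norm)
    then have "norm (z - y) * (L + 1) < s" using L0 by (simp add: pos_less_divide_eq)
    then have "L * norm (z - y) + norm (z - y) < s" by (simp add: algebra_simps)
    then show ?thesis using zi 1 2 gx by linarith
   qed
   then have "y \<notin> closure \<Omega>" unfolding closure_approachable using \<delta> by blast
   then show "\<exists>y\<in>- closure \<Omega>. dist y x < \<epsilon>" using dy s by (intro bexI[of _ y]) auto
  qed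
 qed
qed

section \<open>Sizes of elements\<close>

lemma bdry_integral_mono:
 fixes e :: "(real^'n) set"
 assumes e: "full_simplex e" and g: "bdry_bounded e g" "bdry_bounded e h"
  and le: "!!F x. F facet_of e ==> x \<in> F ==> g F x <= h F x"
 shows "bdry_integral e g <= bdry_integral e h"
 unfolding bdry_integral_def
proof (rule sum_mono)
 fix F assume "F \<in> {F. F facet_of e}"
 then have F: "F facet_of e" by simp
 show "surface_integral F (g F) <= surface_integral F (h F)"
  by (rule surface_integral_mono[OF facet_flat[OF e F] bdry_bounded_integrable[OF e g(1) F] bdry_bounded_integrable[OF e g(2) F] le[OF F]])
qed

lemma diameter_ratio_of_volumes:
 fixes w k :: real
 assumes w: "0 < w" and k: "0 <= k" and pos: "0 <= D1" "0 <= d2" "0 <= D2" "0 <= d1"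
  and l1: "w * D1 ^ n <= k ^ n * M1" and l2: "w * d2 ^ n <= k ^ n * m2" and u1: "M2 <= w * D2 ^ n" and u2: "m1 <= w * d1 ^ n"
  and m: "0 <= M2" "0 <= m1" and cross: "M1 * m2 = M2 * m1" and n: "0 < n"
 shows "D1 * d2 <= k^2 * (D2 * d1)"
proof -
 have "(w * D1 ^ n) * (w * d2 ^ n) <= (k ^ n * M1) * (k ^ n * m2)"
  by (rule mult_mono[OF l1 l2 order_trans[OF _ l1]]) (use w pos in auto)
 also have "... = (k ^ n * k ^ n) * (M1 * m2)" by (simp only: mult_ac)
 also have "... <= (k ^ n * k ^ n) * ((w * D2 ^ n) * (w * d1 ^ n))"
  unfolding cross
 proof (rule mult_left_mono)
  show "M2 * m1 <= (w * D2 ^ n) * (w * d1 ^ n)"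
   by (rule mult_mono[OF u1 u2]) (use w pos m in auto)
 qed (use k in simp)
 finally have "(w * w) * (D1 * d2) ^ n <= (w * w) * (k^2 * (D2 * d1)) ^ n"
  by (simp only: power_mult_distrib power2_eq_square mult_ac)
 then have le: "(D1 * d2) ^ n <= (k^2 * (D2 * d1)) ^ n" using w by simp
 show ?thesis
 proof (rule power_le_imp_le_base[of _ "n - 1"])
  show "(D1 * d2) ^ Suc (n - 1) <= (k^2 * (D2 * d1)) ^ Suc (n - 1)" using le n by simp
 qed (use pos in simp)
qed

context regular_mesh
begin

lemma contained_element: assumes "e \<in> \<T>" "e' \<in> \<T>" "e' \<subseteq> e" shows "e' = e"
proof (rule ccontr)
 assume "e' \<noteq> e"
 moreover obtain x where "x \<in> interior e'" using simplex_interior_nonempty[OF full[OF assms(2)]] by blast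
 moreover have "interior e' \<subseteq> interior e" by (rule interior_mono[OF assms(3)])
 ultimately show False using disjoint_interior[OF assms(2,1)] interior_subset[of e'] by blast
qed

lemma measure_element: "e \<in> \<T> ==> measure lebesgue e = vol e"
 using borel_compact[OF simplex_compact[OF full, of e]] by (simp add: measure_completion)

lemma mesh_norm_square:
 assumes S: "S \<subseteq> \<T>" shows "0 <= mesh_ip S g g" "(mesh_norm S g)^2 = mesh_ip S g g" "0 <= mesh_norm S g"
proof -
 show 1: "0 <= mesh_ip S g g" unfolding mesh_ip_def
 proof (rule sum_nonneg)
  fix E assume "E \<in> S"
  then have E: "E \<in> \<T>" using S by blast
  have "0 <= bdry_integral E (%F x. g E F x * g E F x)" "0 <= bdry_integral E (%F x. 1)"
   by (rule bdry_integral_nonneg[OF full[OF E]]; simp)+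
  then show "0 <= measure lebesgue E / bdry_integral E (%F x. 1) * bdry_integral E (%F x. g E F x * g E F x)"
   by (intro mult_nonneg_nonneg divide_nonneg_nonneg) auto
 qed
 then show "(mesh_norm S g)^2 = mesh_ip S g g" "0 <= mesh_norm S g" by (simp_all add: mesh_norm_def)
qed

text \<open>In one dimension the facet opposite to a vertex is the other vertex, and it is its own relative
  interior.\<close>

lemma shared_vertex:
 assumes d: "CARD('n) = 1" and adj: "(E, E') \<in> adj x" and ne: "E \<noteq> E'"
 shows "E \<in> \<T>" "E' \<in> \<T>" "x \<in> verts E" "x \<in> verts E'" "x \<in> \<Omega>"
proof -
 obtain F where E: "E \<in> \<T>" "E' \<in> \<T>" and F: "F facet_of E" "F facet_of E'" "x \<in> F" using adj by (auto simp: adj_def)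
 note s = full[OF E(1)]
 obtain a where a: "a \<in> verts E" "F = opp_face E a" using F(1) facet_iff[OF s] by blast
 have "card (verts E - {a}) = 1" using simplex_verts(2,3)[OF s] a(1) d by simp
 then obtain b where b: "verts E - {a} = {b}" by (auto simp: card_1_singleton_iff)
 have "F = {b}" unfolding a(2) opp_face_hull[OF s a(1)] b by simp
 then have x: "x = b" using F(3) by simp
 then show xE: "x \<in> verts E" using b by blast
 have xE': "x \<in> E'" using F(2,3) by (auto simp: facet_of_def dest: face_of_imp_subset)
 show "x \<in> verts E'" by (rule vertex_consistent[OF E xE xE'])
 have "x \<in> interior (E \<union> E')"
 proof (rule shared_facet_interior[OF E ne a(1)])
  show "opp_face E a facet_of E'" using F(2) a(2) by simp
  show "bary E a x = 0" using F(3) a(2) by (simp add: opp_face_def)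
  show "0 < bary E c x" if "c \<in> verts E" "c \<noteq> a" for c
   using that b x bary_vert[OF s that(1) xE] by auto
 qed
 moreover have "E \<union> E' \<subseteq> closure \<Omega>" using E Union_mesh by blast
 ultimately show "x \<in> \<Omega>" using interior_mono interior_closure_domain by blast
 show "E \<in> \<T>" "E' \<in> \<T>" by (rule E)+
qed

end

section \<open>The multiscale problem\<close>

locale multiscale_problem = hdg_problem \<kappa> \<Omega> \<T>h S p A \<alpha> \<tau> U Q + coarse: regular_mesh \<kappa> \<Omega> \<T>H
 for \<kappa> :: real and \<Omega> :: "(real^'n) set" and \<T>h \<T>H :: "(real^'n) set set" and S p A \<alpha> \<tau> U Q +
 fixes K \<beta> :: real
 assumes properties: "local_solver_properties K S p \<Omega> \<T>h A \<alpha> \<beta> \<tau> U Q"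
  and uniform: "uniformly_refines \<T>h \<T>H"
  and fine_nonempty: "\<T>h \<noteq> {}"
  and \<beta>_pos: "0 < \<beta>"
begin

abbreviation "h \<equiv> mesh_size \<T>h"
abbreviation "H \<equiv> mesh_size \<T>H"

definition k1 :: real where "k1 = max K 1"

lemma k1: "K <= k1" "1 <= k1" by (simp_all add: k1_def)

lemma diameter_le_h: "e \<in> \<T>h ==> diameter e <= h" by (simp add: mesh_size_def)
lemma diameter_le_H: "E \<in> \<T>H ==> diameter E <= H" by (simp add: mesh_size_def)

lemma largest_fine: obtains e where "e \<in> \<T>h" "diameter e = h"
proof -
 have "h \<in> diameter ` \<T>h" unfolding mesh_size_def using fine_nonempty by (intro Max_in) auto
 then show ?thesis using that by (metis imageE)
qed

lemma h_pos: "0 < h" using largest_fine diameter_pos by metis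

lemma kappa_2: "2 <= \<kappa>" using kappa_ge_2 fine_nonempty by blast

lemma parent: assumes "e \<in> \<T>h" obtains E where "E \<in> \<T>H" "e \<subseteq> E"
 using uniform assms unfolding uniformly_refines_def refines_def by blast

lemma flux_norm_nonneg: "0 <= L2norm X f"
 unfolding L2norm_def by (intro real_sqrt_ge_zero integral_nonneg_AE) auto

text \<open>Uniform refinement: the size ratio between coarse and fine elements is everywhere the same up
  to shape regularity, since the volume ratio is.\<close>

lemma size_ratio:
 assumes e: "e \<in> \<T>h" "E \<in> \<T>H" "e \<subseteq> E" and e': "e' \<in> \<T>h" "E' \<in> \<T>H" "e' \<subseteq> E'"
 shows "diameter E * diameter e' <= \<kappa>^2 * (diameter E' * diameter e)"
proof -
 obtain N where N: "!!E e. E \<in> \<T>H ==> e \<in> \<T>h ==> e \<subseteq> E ==> measure lebesgue e = measure lebesgue E / real N"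
  using uniform unfolding uniformly_refines_def by blast
 have eq: "vol e = vol E / real N" "vol e' = vol E' / real N"
  using N[OF e(2,1,3)] N[OF e'(2,1,3)]
  unfolding measure_element[OF e(1)] measure_element[OF e'(1)] coarse.measure_element[OF e(2)] coarse.measure_element[OF e'(2)] .
 have pos: "0 <= diameter e" "0 <= diameter e'" "0 <= diameter E" "0 <= diameter E'"
  using diameter_pos[OF e(1)] diameter_pos[OF e'(1)] coarse.diameter_pos[OF e(2)] coarse.diameter_pos[OF e'(2)]
  by (simp_all only: less_imp_le)
 have k0: "0 <= \<kappa>" using kappa_2 by linarith
 have cross: "vol E * vol e' = vol E' * vol e" unfolding eq by simp
 show ?thesis
  by (rule diameter_ratio_of_volumes[OF volume_bounds(3)[OF e(1)] k0 pos(3,2,4,1) coarse.volume_bounds(2)[OF e(2)]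
    volume_bounds(2)[OF e'(1)] coarse.volume_bounds(1)[OF e'(2)] volume_bounds(1)[OF e(1)] measure_nonneg measure_nonneg cross zero_less_card_finite])
qed

subsection \<open>Consequences of the properties of the local solvers\<close>

definition inv_flux :: "((real^'n) set => real^'n => real) => real" where
 "inv_flux \<mu> = L2norm \<Omega> (%x. matrix_inv (A x) *v bulk \<T>h (Q \<mu>) x)"

definition jump_norm :: "((real^'n) set => real^'n => real) => real" where
 "jump_norm \<mu> = mesh_norm \<T>h (%e F x. U \<mu> e x - \<mu> F x)"

lemma inv_flux_nonneg: "0 <= inv_flux \<mu>" unfolding inv_flux_def by (rule flux_norm_nonneg)

lemma jump_norm_nonneg: "0 <= jump_norm \<mu>" unfolding jump_norm_def by (rule mesh_norm_square(3)) simp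

lemmas properties' = properties[unfolded local_solver_properties_def Let_def]

lemma jump_bound: assumes "\<mu> \<in> M" shows "jump_norm \<mu> <= k1 * h * inv_flux \<mu>"
proof -
 have "jump_norm \<mu> <= K * h * inv_flux \<mu>"
  unfolding jump_norm_def inv_flux_def by (rule properties'[THEN conjunct1, rule_format, OF assms])
 also have "... <= k1 * h * inv_flux \<mu>"
  using k1 h_pos inv_flux_nonneg[of \<mu>] by (intro mult_right_mono) auto
 finally show ?thesis .
qed

lemma local_flux_bound:
 assumes "\<mu> \<in> M" "e \<in> \<T>h"
 shows "L2norm e (%x. matrix_inv (A x) *v bulk \<T>h (Q \<mu>) x) <= k1 / h * mesh_norm {e} (%_. \<mu>)"
proof -
 have "{e'\<in>\<T>h. e' \<subseteq> e} = {e}" using contained_element[OF assms(2)] assms(2) by auto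
 then have "\<beta> * L2norm e (%x. matrix_inv (A x) *v bulk \<T>h (Q \<mu>) x) <= K * \<beta> * inverse h * mesh_norm {e} (%_. \<mu>)"
  using properties'[THEN conjunct2, THEN conjunct1, rule_format, OF assms] by simp
 also have "... <= k1 * \<beta> * inverse h * mesh_norm {e} (%_. \<mu>)"
  using k1 h_pos \<beta>_pos mesh_norm_square(3)[of "{e}"] assms(2) by (intro mult_right_mono) auto
 finally have "\<beta> * L2norm e (%x. matrix_inv (A x) *v bulk \<T>h (Q \<mu>) x) <= \<beta> * (k1 / h * mesh_norm {e} (%_. \<mu>))"
  by (simp add: divide_inverse mult_ac)
 then show ?thesis using \<beta>_pos by (rule mult_left_le_imp_le)
qed

lemma gradient_defect_bound:
 assumes "\<mu> \<in> M"
 shows "L2norm \<Omega> (%x. matrix_inv (A x) *v bulk \<T>h (Q \<mu>) x + bulk \<T>h (%e. grad (U \<mu> e)) x) <= k1^2 * inv_flux \<mu>"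
proof -
 have "L2norm \<Omega> (%x. matrix_inv (A x) *v bulk \<T>h (Q \<mu>) x + bulk \<T>h (%e. grad (U \<mu> e)) x) <= K * inverse h * jump_norm \<mu>"
  unfolding jump_norm_def by (rule properties'[THEN conjunct2, THEN conjunct2, THEN conjunct2, THEN conjunct2, THEN conjunct1, rule_format, OF assms])
 also have "... <= k1 * inverse h * (k1 * h * inv_flux \<mu>)"
  using k1 h_pos jump_bound[OF assms] jump_norm_nonneg[of \<mu>] by (intro mult_mono) auto
 also have "... = k1^2 * inv_flux \<mu>" using h_pos by (simp add: power2_eq_square)
 finally show ?thesis .
qed

lemma bulk_bound:
 assumes "\<mu> \<in> M" shows "sqrt \<alpha> * L2norm \<Omega> (bulk \<T>h (U \<mu>)) <= k1^2 * sqrt (a \<mu> \<mu>)"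
proof -
 let ?n = "mesh_norm \<T>h (%_. \<mu>)"
 have n0: "0 <= ?n" by (rule mesh_norm_square(3)) simp
 have "L2norm \<Omega> (bulk \<T>h (U \<mu>)) <= K * ?n"
  by (rule properties'[THEN conjunct2, THEN conjunct2, THEN conjunct1, rule_format, OF assms])
 also have "... <= k1 * ?n" using k1 n0 by (intro mult_right_mono)
 finally have 1: "L2norm \<Omega> (bulk \<T>h (U \<mu>)) <= k1 * ?n" .
 have "\<alpha> * ?n\<^sup>2 <= K * a \<mu> \<mu>"
  by (rule properties'[THEN conjunct2, THEN conjunct2, THEN conjunct2, THEN conjunct2, THEN conjunct2, THEN conjunct2, rule_format, OF assms, THEN conjunct1])
 also have "... <= k1 * a \<mu> \<mu>" using k1 form_nonneg[OF assms] by (intro mult_right_mono)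
 also have "... <= k1^2 * a \<mu> \<mu>"
  using k1(2) form_nonneg[OF assms] mult_left_mono[OF k1(2), of k1] by (intro mult_right_mono) (auto simp: power2_eq_square)
 finally have "sqrt (\<alpha> * ?n\<^sup>2) <= sqrt (k1^2 * a \<mu> \<mu>)" by (rule real_sqrt_le_mono)
 then have 2: "sqrt \<alpha> * ?n <= k1 * sqrt (a \<mu> \<mu>)" using n0 k1(2) by (simp add: real_sqrt_mult)
 have "sqrt \<alpha> * L2norm \<Omega> (bulk \<T>h (U \<mu>)) <= sqrt \<alpha> * (k1 * ?n)" using 1 \<alpha>_pos by (intro mult_left_mono) auto
 also have "... = k1 * (sqrt \<alpha> * ?n)" by simp
 also have "... <= k1 * (k1 * sqrt (a \<mu> \<mu>))" using 2 k1(2) by (intro mult_left_mono) auto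
 finally show ?thesis by (simp add: power2_eq_square mult.assoc)
qed

text \<open>For the hat function of an interior vertex the flux is its gradient, whose size is at least the
  inverse of the diameter; its mesh norm on an element is at most the square root of the volume. So
  elements at interior vertices cannot be small.\<close>

lemma vertex_size:
 assumes e: "e \<in> \<T>h" and x: "x \<in> verts e" "x \<in> \<Omega>" shows "h <= k1 * diameter e"
proof -
 note s = full[OF e] and ce = compact_element[OF e]
 define val :: "real^'n => real" where "val y = (if y = x then 1 else 0)" for y
 define \<phi> where "\<phi> = interp \<T>h val"
 have loc: "\<phi> z = local_interp e' val z" if "e' \<in> \<T>h" "z \<in> e'" for e' z
  unfolding \<phi>_def by (rule interp_eq[OF subset_refl that])
 have range: "0 <= \<phi> z" "\<phi> z <= 1" if "e' \<in> \<T>h" "z \<in> e'" for e' z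
 proof -
  have "\<bar>local_interp e' val z - 1 / 2\<bar> <= 1 / 2"
   by (rule local_interp_bound[OF full[OF that(1)] that(2)]) (simp add: val_def)
  then show "0 <= \<phi> z" "\<phi> z <= 1" unfolding loc[OF that] by linarith+
 qed
 have conf: "\<phi> \<in> P1_conforming \<T>h" unfolding \<phi>_def by (rule interp_conforming) simp
 have zero: "\<phi> z = 0" if z: "z \<in> frontier \<Omega>" for z
 proof -
  have "z \<in> \<Union>\<T>h" using z Union_mesh by (simp add: frontier_def)
  then obtain e0 where e0: "e0 \<in> \<T>h" "z \<in> e0" by blast
  obtain e' F where e': "e' \<in> reach z e0" and F: "F facet_of e'" "z \<in> F" "F \<subseteq> frontier \<Omega>"
   using reach_boundary_facet[OF e0 z] by blast
  have e'T: "e' \<in> \<T>h" using reach_star[OF e0 e'] by blast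
  have xf: "x \<notin> frontier \<Omega>" using x(2) open_domain by (simp add: frontier_def interior_open)
  show ?thesis unfolding \<phi>_def
   using F xf by (intro interp_zero_on_face[OF subset_refl e'T _ F(2)]) (auto simp: val_def facet_of_def)
 qed
 have Vb: "\<phi> \<in> Vbar \<Omega> \<T>h" using conf zero by (simp add: Vbar_def)
 define \<mu> where "\<mu> = skel_trace \<T>h \<phi>"
 have \<phi>m: "\<phi> \<in> borel_measurable borel" unfolding \<phi>_def by (rule interp_borel) simp
 have \<mu>F: "\<mu> F z = \<phi> z" if "F \<in> faces \<T>h" "z \<in> F" for F z using that by (simp add: \<mu>_def skel_trace_def)
 have face: "\<mu> F \<in> borel_measurable borel \<and> integrable (face_measure F) (%x. (\<mu> F x)^2)
   \<and> (\<exists>g\<in>polys p. \<forall>x\<in>F. \<mu> F x = g x)" if F: "F \<in> faces \<T>h" for F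
 proof -
  obtain e' where e': "e' \<in> \<T>h" "F facet_of e'" using F by (auto simp: faces_def)
  have Fe: "F \<subseteq> e'" using e'(2) by (auto simp: facet_of_def dest: face_of_imp_subset)
  have fl: "flat F" by (rule facet_flat[OF full[OF e'(1)] e'(2)])
  then have Fb: "F \<in> sets borel" by (auto simp: flat_def intro: borel_compact)
  have "\<mu> F = (%x. indicator F x * \<phi> x)" using F by (auto simp: fun_eq_iff \<mu>_def skel_trace_def indicator_def)
  then have m: "\<mu> F \<in> borel_measurable borel" using Fb \<phi>m by simp
  have "integrable (face_measure F) (%x. (\<mu> F x)^2)"
  proof (rule surface_integrable[OF fl])
   show "(%x. (\<mu> F x)^2) \<in> borel_measurable borel" using m by (rule borel_measurable_power)
   show "\<bar>(\<mu> F z)\<^sup>2\<bar> <= 1" if "z \<in> F" for z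
    using range[OF e'(1)] Fe that by (auto simp: \<mu>F[OF F that] power_le_one)
  qed
  moreover have "polyfn p (local_interp e' val)"
   using polyfn_affine[of "local_interp e' val"] local_interp_affine[OF full[OF e'(1)], of val] polyfn_mono[of 1 _ p] p_ge_1 by blast
  then have "\<exists>g\<in>polys p. \<forall>x\<in>F. \<mu> F x = g x"
   using loc[OF e'(1)] Fe \<mu>F[OF F] by (intro bexI[of _ "local_interp e' val"]) (auto simp: polys_iff_polyfn)
  ultimately show ?thesis using m by blast
 qed
 have facesT: "\<Union>(faces \<T>h) \<subseteq> \<Union>\<T>h" by (fastforce simp: faces_def facet_of_def dest: face_of_imp_subset)
 have cont: "\<exists>c. continuous_on (\<Union>(faces \<T>h)) c \<and> (\<forall>F\<in>faces \<T>h. \<forall>x\<in>F. \<mu> F x = c x)"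
  using conf continuous_on_subset[OF _ facesT, of \<phi>] \<mu>F by (intro exI[of _ \<phi>]) (simp add: P1_conforming_def)
 have "\<mu> \<in> skel_support \<T>h" by (auto simp: \<mu>_def skel_trace_def skel_support_def)
 then have "\<mu> \<in> L2_faces \<T>h" using face by (simp add: L2_faces_def)
 moreover have "\<forall>F\<in>faces \<T>h. F \<subseteq> frontier \<Omega> \<longrightarrow> (\<forall>x\<in>F. \<mu> F x = 0)" using zero \<mu>F by auto
 ultimately have \<mu>M: "\<mu> \<in> M" using face cont by (simp add: M_space_def)
 define g where "g = bary_grad e x"
 have G: "(\<Sum>b\<in>verts e. val b *\<^sub>R bary_grad e b) = g"
 proof -
  have "(\<Sum>b\<in>verts e. val b *\<^sub>R bary_grad e b) = (\<Sum>b\<in>verts e. if b = x then g else 0)"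
   by (intro sum.cong) (auto simp: val_def g_def)
  then show ?thesis using x(1) simplex_verts(2)[OF s] by simp
 qed
 have grad_\<phi>: "grad \<phi> z = g" if z: "z \<in> interior e" for z
 proof -
  let ?c = "\<Sum>b\<in>verts e. bary e b 0 * val b"
  have "((%z. ?c + g \<bullet> z) has_derivative (%h. h \<bullet> g)) (at z)"
   by (auto intro!: derivative_eq_intros simp: inner_commute)
  then have "(\<phi> has_derivative (%h. h \<bullet> g)) (at z)"
  proof (rule has_derivative_transform_within_open[OF _ open_interior z])
   fix y assume "y \<in> interior e"
   then have "y \<in> e" using interior_subset by blast
   then show "?c + g \<bullet> y = \<phi> y" unfolding loc[OF e \<open>y \<in> e\<close>] local_interp_affine[OF s] G by simp
  qed
  then show ?thesis by (intro grad_eqI) (simp add: gderiv_def)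
 qed
 have "AE y in lebesgue_on e. Q \<mu> e y = - (A y *v grad \<phi> y)"
  unfolding \<mu>_def
  by (rule properties'[THEN conjunct2, THEN conjunct2, THEN conjunct2, THEN conjunct2, THEN conjunct2, THEN conjunct1, rule_format, OF Vb e, THEN conjunct2])
 moreover have "AE y in lebesgue_on e. y \<in> interior e"
 proof -
  have "AE y in lebesgue. y \<in> e \<longrightarrow> y \<in> interior e"
   by (rule eventually_mono[OF AE_completion[OF AE_not_frontier]]) (use e closure_subset[of e] in \<open>auto simp: frontier_def\<close>)
  then show ?thesis using borel_compact[OF ce] by (subst AE_restrict_space_iff) auto
 qed
 ultimately have "AE y in lebesgue_on e. Q \<mu> e y = - (coef e *\<^sub>R g)"
  using coef(3)[OF e]
 proof eventually_elim
  case (elim y)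
  then show ?case using grad_\<phi> by (simp add: mat_mult_vector)
 qed
 then have AEg: "AE y in lebesgue_on e. (norm (matrix_inv (A y) *v bulk \<T>h (Q \<mu>) y))^2 = (norm g)^2"
  using bulk_AE[OF e, of "Q \<mu>"] matrix_inv_AE[OF e]
 proof eventually_elim
  case (elim y)
  then have "matrix_inv (A y) *v bulk \<T>h (Q \<mu>) y = - g" using coef(2)[OF e] by simp
  then show ?case by simp
 qed
 have "(LINT y|lebesgue_on e. (norm (matrix_inv (A y) *v bulk \<T>h (Q \<mu>) y))^2) = (norm g)^2 * vol e"
  using lebesgue_on_integral_AE[OF ce _ AEg] set_integral_const[OF ce] by simp
 then have 1: "L2norm e (%y. matrix_inv (A y) *v bulk \<T>h (Q \<mu>) y) = norm g * sqrt (vol e)"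
  by (simp add: L2norm_def real_sqrt_mult)
 have "bdry_integral e (%F z. \<mu> F z * \<mu> F z) <= bdry_integral e (%F z. 1)"
 proof (rule bdry_integral_mono[OF s bdry_bounded_mult[OF M_bounded[OF \<mu>M e] M_bounded[OF \<mu>M e]] bdry_bounded_const])
  fix F z assume F: "F facet_of e" "z \<in> F"
  then have "z \<in> e" "F \<in> faces \<T>h" using e by (auto simp: faces_def facet_of_def dest: face_of_imp_subset)
  then show "\<mu> F z * \<mu> F z <= 1" using range[OF e] F(2) by (simp add: \<mu>F mult_le_one)
 qed
 then have "vol e / perimeter e * bdry_integral e (%F z. \<mu> F z * \<mu> F z) <= vol e / perimeter e * perimeter e"
  using perimeter_bounds(1)[OF e x(1)] by (intro mult_left_mono) (auto simp: perimeter_def)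
 then have "mesh_ip {e} (%_. \<mu>) (%_. \<mu>) <= vol e"
  using perimeter_bounds(1)[OF e x(1)] by (simp add: mesh_ip_def perimeter_def measure_element[OF e])
 then have 2: "mesh_norm {e} (%_. \<mu>) <= sqrt (vol e)" by (simp add: mesh_norm_def)
 have "norm g * sqrt (vol e) <= k1 / h * sqrt (vol e)"
  using local_flux_bound[OF \<mu>M e] mult_left_mono[OF 2, of "k1 / h"] k1(2) h_pos unfolding 1 by simp
 moreover have "0 < sqrt (vol e)" using simplex_measure_pos[OF s] by simp
 ultimately have "norm g <= k1 / h" by (rule mult_right_le_imp_le)
 then have "norm g * h <= k1" using h_pos by (simp add: pos_le_divide_eq)
 have "h <= h * (norm g * diameter e)"
  using bary_grad_bounds(1)[OF e x(1)] h_pos by (simp add: g_def)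
 also have "... = norm g * h * diameter e" by simp
 also have "... <= k1 * diameter e" using \<open>norm g * h <= k1\<close> diameter_pos[OF e] by (intro mult_right_mono) auto
 finally show ?thesis .
qed

definition size_const :: real where "size_const = \<kappa>^2 * k1"

lemma size_const: "\<kappa> <= size_const" "k1 <= size_const" "1 <= size_const"
proof -
 have "\<kappa> * 2 <= \<kappa> * \<kappa>" using kappa_2 by (intro mult_left_mono) auto
 then have k: "\<kappa> <= \<kappa>^2" "1 <= \<kappa>^2" using kappa_2 unfolding power2_eq_square by linarith+
 show "\<kappa> <= size_const" "k1 <= size_const"
  using mult_mono[OF k(1) k1(2)] mult_mono[OF k(2) order_refl, of k1] kappa_2 k1(2) by (auto simp: size_const_def)
 then show "1 <= size_const" using k1(2) by linarith
qed

lemma fine_comparable: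
 assumes adj: "(e, e') \<in> adj x" shows "diameter e <= size_const * diameter e'"
proof -
 obtain F where e: "e \<in> \<T>h" "e' \<in> \<T>h" and F: "F facet_of e" "F facet_of e'" using adj by (auto simp: adj_def)
 have d': "0 < diameter e'" by (rule diameter_pos[OF e(2)])
 have "diameter e <= \<kappa> * diameter e' \<or> diameter e <= k1 * diameter e'"
 proof (cases "CARD('n) = 1")
  case True
  show ?thesis
  proof (cases "e = e'")
   case False
   then show ?thesis
    using vertex_size[OF e(2)] shared_vertex[OF True adj False] diameter_le_h[OF e(1)] by fastforce
  next
   case eq: True
   then show ?thesis using mult_right_mono[OF k1(2), of "diameter e'"] d' by simp
  qed
 next
  case False
  moreover have "0 < CARD('n)" by simp
  ultimately have "2 <= CARD('n)" by linarith
  then show ?thesis using neighbour_size[OF _ e F] by blast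
 qed
 then show ?thesis
  using mult_right_mono[OF size_const(1), of "diameter e'"] mult_right_mono[OF size_const(2), of "diameter e'"] d' by linarith
qed

lemma coarse_comparable:
 assumes adj: "(E, E') \<in> coarse.adj x" shows "diameter E <= size_const * diameter E'"
proof -
 obtain F where E: "E \<in> \<T>H" "E' \<in> \<T>H" and F: "F facet_of E" "F facet_of E'" using adj by (auto simp: coarse.adj_def)
 have d': "0 < diameter E'" by (rule coarse.diameter_pos[OF E(2)])
 show ?thesis
 proof (cases "CARD('n) = 1 \<and> E \<noteq> E'")
  case True
  then have x: "x \<in> verts E" "x \<in> verts E'" "x \<in> \<Omega>" using coarse.shared_vertex[OF _ adj] by auto
  have child: "\<exists>e\<in>\<T>h. e \<subseteq> D \<and> x \<in> verts e" if D: "D \<in> \<T>H" "x \<in> verts D" for D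
  proof -
   have "closed (\<Union>{e\<in>\<T>h. e \<subseteq> D})" using compact_imp_closed[OF compact_element] by (intro closed_Union) auto
   moreover have "interior D \<subseteq> \<Union>{e\<in>\<T>h. e \<subseteq> D}"
   proof
    fix y assume y: "y \<in> interior D"
    then have "y \<in> \<Union>\<T>h" using coarse.Union_mesh Union_mesh interior_subset[of D] D(1) by blast
    then obtain e where e: "e \<in> \<T>h" "y \<in> e" by blast
    obtain D' where D': "D' \<in> \<T>H" "e \<subseteq> D'" using parent[OF e(1)] by blast
    have "D' = D" using coarse.disjoint_interior[OF D'(1) D(1)] y e(2) D'(2) by blast
    then show "y \<in> \<Union>{e\<in>\<T>h. e \<subseteq> D}" using e D' by blast
   qed
   ultimately have "D \<subseteq> \<Union>{e\<in>\<T>h. e \<subseteq> D}"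
    using closure_minimal coarse.closure_interior_element[OF D(1)] by blast
   moreover have "x \<in> D" using D(2) verts_subset by blast
   ultimately obtain e where e: "e \<in> \<T>h" "e \<subseteq> D" "x \<in> e" by blast
   have "x extreme_point_of e" using D(2) e(2,3) by (auto simp: verts_def extreme_point_of_def)
   then show ?thesis using e by (auto simp: verts_def)
  qed
  obtain e where e: "e \<in> \<T>h" "e \<subseteq> E" "x \<in> verts e" using child[OF E(1) x(1)] by blast
  obtain e' where e': "e' \<in> \<T>h" "e' \<subseteq> E'" "x \<in> verts e'" using child[OF E(2) x(2)] by blast
  have "diameter E * diameter e' <= \<kappa>^2 * (diameter E' * diameter e)"
   by (rule size_ratio[OF e(1) E(1) e(2) e'(1) E(2) e'(2)])
  also have "... <= \<kappa>^2 * (diameter E' * (k1 * diameter e'))"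
   using vertex_size[OF e'(1,3) x(3)] diameter_le_h[OF e(1)] d' by (intro mult_left_mono) auto
  finally have "diameter E * diameter e' <= (size_const * diameter E') * diameter e'" by (simp add: size_const_def mult_ac)
  then show ?thesis using diameter_pos[OF e'(1)] by simp
 next
  case False
  have "diameter E <= \<kappa> * diameter E'"
  proof (cases "E = E'")
   case True
   then show ?thesis using mult_right_mono[of 1 \<kappa> "diameter E'"] kappa_2 d' by simp
  next
   case ne: False
   have "0 < CARD('n)" by simp
   then have "2 <= CARD('n)" using False ne by linarith
   then show ?thesis by (rule coarse.neighbour_size[OF _ E F])
  qed
  then show ?thesis using mult_right_mono[OF size_const(1), of "diameter E'"] d' by linarith
 qed
qed

definition \<Theta> :: real where "\<Theta> = (\<kappa>^2 * H / h)^2"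

lemma ratio:
 assumes e: "e \<in> \<T>h" "E \<in> \<T>H" "e \<subseteq> E" shows "(diameter E)^2 <= \<Theta> * (diameter e)^2"
proof -
 obtain e' where e': "e' \<in> \<T>h" "diameter e' = h" by (rule largest_fine)
 obtain E' where E': "E' \<in> \<T>H" "e' \<subseteq> E'" using parent[OF e'(1)] by blast
 have "diameter E * h <= \<kappa>^2 * (diameter E' * diameter e)"
  using size_ratio[OF e e'(1) E'] e'(2) by simp
 also have "... <= \<kappa>^2 * (H * diameter e)"
  using diameter_le_H[OF E'(1)] diameter_pos[OF e(1)] by (intro mult_left_mono mult_right_mono) auto
 finally have "diameter E <= (\<kappa>^2 * H / h) * diameter e" using h_pos by (simp add: pos_le_divide_eq mult_ac)
 then have "(diameter E)^2 <= ((\<kappa>^2 * H / h) * diameter e)^2" using coarse.diameter_pos[OF e(2)] by (intro power_mono) auto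
 then show ?thesis unfolding \<Theta>_def by (simp only: power_mult_distrib[of "\<kappa>^2 * H / h"])
qed

lemma \<Theta>_ge_1: "1 <= \<Theta>"
proof -
 obtain e where e: "e \<in> \<T>h" "diameter e = h" by (rule largest_fine)
 obtain E where E: "E \<in> \<T>H" "e \<subseteq> E" using parent[OF e(1)] by blast
 have "h <= diameter E"
  using diameter_subset[OF E(2) compact_imp_bounded[OF simplex_compact[OF coarse.full[OF E(1)]]]] e(2) by simp
 then have "h^2 <= (diameter E)^2" using h_pos by (intro power_mono) auto
 also have "... <= \<Theta> * h^2" using ratio[OF e(1) E] e(2) by simp
 finally show ?thesis using h_pos by simp
qed

subsection \<open>Functions in the kernel of the quasi-interpolation are small\<close>

definition face_const :: real where
 "face_const = inverse_const p CARD('n) * (real (CARD('n) + 1) * \<kappa>)"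

definition el_jump :: "((real^'n) set => real^'n => real) => (real^'n) set => real" where
 "el_jump w e = (if e \<in> \<T>h then sqrt (face_const * (bdry_integral e (%F x. (U w e x - w F x) * (U w e x - w F x)) / perimeter e)) else 0)"

lemma face_const_nonneg: "0 <= face_const"
 using inverse_const_pos[of p "CARD('n)"] kappa_2 by (simp add: face_const_def)

lemma bdry_square_nonneg: "e \<in> \<T>h ==> 0 <= bdry_integral e (%F x. g F x * g F x)"
 by (intro bdry_integral_nonneg[OF full]) auto

lemma perimeter_pos: "e \<in> \<T>h ==> 0 < perimeter e"
 using perimeter_bounds(1) verts_nonempty[OF full] by blast

lemma el_jump_square:
 "e \<in> \<T>h ==> (el_jump w e)^2 = face_const * (bdry_integral e (%F x. (U w e x - w F x) * (U w e x - w F x)) / perimeter e)"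
 using face_const_nonneg bdry_square_nonneg[of e "%F x. U w e x - w F x"] perimeter_pos[of e] by (simp add: el_jump_def)

lemma el_jump_nonneg: "0 <= el_jump w e"
 using face_const_nonneg bdry_square_nonneg[of e "%F x. U w e x - w F x"] perimeter_pos[of e]
 by (auto simp: el_jump_def intro!: divide_nonneg_pos mult_nonneg_nonneg)

text \<open>The trace difference is a polynomial on the facet, so the inverse estimate on the facet bounds it pointwise.
  By shape regularity no facet is much smaller than the boundary of the element.\<close>

lemma el_jump_bound:
 assumes w: "w \<in> M" and e: "e \<in> \<T>h" and F: "F facet_of e" and x: "x \<in> F"
 shows "\<bar>U w e x - w F x\<bar> <= el_jump w e"
proof -
 note s = full[OF e]
 let ?J = "%F x. (U w e x - w F x) * (U w e x - w F x)"
 obtain a where a: "a \<in> verts e" "F = opp_face e a" using F facet_iff[OF s] by blast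
 obtain g where g: "polyfn p g" "!!x. x \<in> F ==> w F x = g x" using M_trace[OF w e F] by blast
 have pd: "polyfn p (%x. U w e x - g x)" by (rule polyfn_diff[OF U_polyfn[OF w e] g(1)])
 have Jb: "bdry_bounded e ?J" by (intro bdry_bounded_mult jump_bounded[OF w e])
 have per: "0 < perimeter e" by (rule perimeter_pos[OF e])
 have ar: "0 < area F" unfolding a(2) by (rule area_pos(2)[OF s a(1)])
 have fin: "finite {F. F facet_of e}"
 proof -
  have "{F. F facet_of e} = opp_face e ` verts e" using facet_iff[OF s] by auto
  then show ?thesis using simplex_verts(2)[OF s] by simp
 qed
 have "surface_integral F (%x. (U w e x - g x)^2) = surface_integral F (?J F)"
 proof (rule surface_integral_cong[OF facet_flat[OF s F]])
  show "(%x. (U w e x - g x)^2) \<in> borel_measurable borel" using polyfn_borel[OF pd] by (rule borel_measurable_power)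
  show "?J F \<in> borel_measurable borel" using Jb F by (simp add: bdry_bounded_def bounded_borel_def)
 qed (simp add: g(2) power2_eq_square)
 also have "... <= bdry_integral e ?J"
  unfolding bdry_integral_def using fin F facet_flat[OF s]
  by (intro member_le_sum surface_integral_nonneg) auto
 finally have pt: "area F * (U w e x - g x)^2 <= inverse_const p CARD('n) * bdry_integral e ?J"
  using surface_inverse_estimate[OF facet_flat[OF s F] _ x pd] opp_face_convex[OF s a(1)] a(2)
   mult_left_mono[of _ _ "inverse_const p CARD('n)"] inverse_const_pos[of p "CARD('n)"]
  by (meson less_imp_le order_trans)
 have per2: "perimeter e <= real (CARD('n) + 1) * \<kappa> * area F" unfolding a(2) by (rule perimeter_bounds(2)[OF e a(1)])
 have "perimeter e * (area F * (U w e x - g x)^2) <= (real (CARD('n) + 1) * \<kappa> * area F) * (inverse_const p CARD('n) * bdry_integral e ?J)"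
  by (rule mult_mono[OF per2 pt]) (use ar kappa_2 in auto)
 then have "area F * (perimeter e * (U w e x - g x)^2) <= area F * (face_const * bdry_integral e ?J)"
  by (simp add: face_const_def mult_ac)
 then have "perimeter e * (U w e x - g x)^2 <= face_const * bdry_integral e ?J" using ar by simp
 then have "(U w e x - w F x)^2 <= (el_jump w e)^2"
  using per by (simp add: el_jump_square[OF e] g(2)[OF x] pos_le_divide_eq mult.commute)
 then show ?thesis using el_jump_nonneg abs_le_square_iff[of "U w e x - w F x" "el_jump w e"] by simp
qed

lemma el_jump_sum:
 assumes w: "w \<in> M"
 shows "(\<Sum>e\<in>\<T>h. vol e * (el_jump w e)^2) <= h^2 * (face_const * k1^2 * (inv_flux w)^2)"
proof -
 have "(\<Sum>e\<in>\<T>h. vol e * (el_jump w e)^2) = face_const * (jump_norm w)^2"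
  unfolding jump_norm_def mesh_norm_square(2)[OF subset_refl] mesh_ip_def sum_distrib_left
  by (intro sum.cong refl) (simp add: el_jump_square measure_element perimeter_def)
 also have "... <= face_const * (k1 * h * inv_flux w)^2"
  using jump_bound[OF w] jump_norm_nonneg face_const_nonneg by (intro mult_left_mono power_mono)
 finally show ?thesis by (simp add: power_mult_distrib mult_ac)
qed

lemma gradient_sum:
 assumes w: "w \<in> M"
 shows "(\<Sum>e\<in>\<T>h. LBINT z:e. (norm (grad (U w e) z))^2) <= (2 * k1 ^ 4 + 2) * (inv_flux w)^2"
proof -
 let ?s = "%e x. (1 / coef e) *\<^sub>R Q w e x" and ?g = "%e x. grad (U w e) x"
 have sq: "bounded_borel e (%x. (norm (f x))^2)" if "e \<in> \<T>h" "!!i. polyfn k (%x. f x $ i)" for e k and f :: "real^'n => real^'n"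
  unfolding power2_norm_eq_inner by (rule bounded_borel_inner[OF compact_element[OF that(1)] that(2) that(2)])
 have ps: "polyfn (Suc p) (%x. ?s e x $ i)" if "e \<in> \<T>h" for e i
  using polyfn_cmult[OF Q_polyfn[OF w that], of "1 / coef e" i] by simp
 have pg: "polyfn (Suc p) (%x. ?g e x $ i)" if "e \<in> \<T>h" for e i
  using polyfn_grad[OF U_polyfn[OF w that]] by (rule polyfn_mono) simp
 have psg: "polyfn (Suc p) (%x. (?s e x + ?g e x) $ i)" if "e \<in> \<T>h" for e i
  using polyfn.add[OF ps[OF that] pg[OF that]] by simp
 have bs: "bounded_borel e (%x. (norm (?s e x))^2)" and bsg: "bounded_borel e (%x. (norm (?s e x + ?g e x))^2)"
  and bg: "bounded_borel e (%x. (norm (?g e x))^2)" if "e \<in> \<T>h" for e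
  by (rule sq[OF that ps[OF that]], rule sq[OF that psg[OF that]], rule sq[OF that pg[OF that]])
 have AEs: "AE x in lebesgue_on e. matrix_inv (A x) *v bulk \<T>h (Q w) x = ?s e x" if e: "e \<in> \<T>h" for e
  by (rule eventually_rev_mp[OF bulk_AE[OF e, of "Q w"]], rule eventually_mono[OF matrix_inv_AE[OF e]]) simp
 have 1: "(inv_flux w)^2 = (\<Sum>e\<in>\<T>h. LBINT x:e. (norm (?s e x))^2)"
  unfolding inv_flux_def by (rule L2norm_square[OF bs AEs])
 have 2: "(L2norm \<Omega> (%x. matrix_inv (A x) *v bulk \<T>h (Q w) x + bulk \<T>h (%e. grad (U w e)) x))^2
  = (\<Sum>e\<in>\<T>h. LBINT x:e. (norm (?s e x + ?g e x))^2)"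
 proof (rule L2norm_square[OF bsg])
  show "AE x in lebesgue_on e. matrix_inv (A x) *v bulk \<T>h (Q w) x + bulk \<T>h (%e. grad (U w e)) x = ?s e x + ?g e x" if e: "e \<in> \<T>h" for e
   by (rule eventually_rev_mp[OF bulk_AE[OF e, of "%e. grad (U w e)"]], rule eventually_mono[OF AEs[OF e]]) simp
 qed
 have "(LBINT x:e. (norm (?g e x))^2) <= 2 * (LBINT x:e. (norm (?s e x + ?g e x))^2) + 2 * (LBINT x:e. (norm (?s e x))^2)"
  if e: "e \<in> \<T>h" for e
 proof -
  have b1: "bounded_borel e (%x. 2 * (norm (?s e x + ?g e x))^2)" and b2: "bounded_borel e (%x. 2 * (norm (?s e x))^2)"
   by (rule bounded_borel_mult[OF bounded_borel_const bsg[OF e]], rule bounded_borel_mult[OF bounded_borel_const bs[OF e]])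
  have "(LBINT x:e. (norm (?g e x))^2) <= (LBINT x:e. 2 * (norm (?s e x + ?g e x))^2 + 2 * (norm (?s e x))^2)"
  proof (rule set_integral_mono_on[OF compact_element[OF e] bg[OF e] bounded_borel_add[OF b1 b2]])
   fix x
   have "norm (?g e x) <= norm (?s e x + ?g e x) + norm (?s e x)" using norm_triangle_ineq4[of "?s e x + ?g e x" "?s e x"] by simp
   then have "(norm (?g e x))^2 <= (norm (?s e x + ?g e x) + norm (?s e x))^2" by (intro power_mono) auto
   also have "... <= 2 * (norm (?s e x + ?g e x))^2 + 2 * (norm (?s e x))^2"
    using sum_squares_bound[of "norm (?s e x + ?g e x)" "norm (?s e x)"] unfolding power2_sum by linarith
   finally show "(norm (?g e x))^2 <= 2 * (norm (?s e x + ?g e x))^2 + 2 * (norm (?s e x))^2" .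
  qed
  also have "... = (LBINT x:e. 2 * (norm (?s e x + ?g e x))^2) + (LBINT x:e. 2 * (norm (?s e x))^2)"
   by (rule set_integral_add(2)[OF bounded_borel_integrable[OF b1 compact_element[OF e]] bounded_borel_integrable[OF b2 compact_element[OF e]]])
  finally show ?thesis unfolding set_integral_mult_right .
 qed
 then have "(\<Sum>e\<in>\<T>h. LBINT z:e. (norm (?g e z))^2) <=
  (\<Sum>e\<in>\<T>h. 2 * (LBINT x:e. (norm (?s e x + ?g e x))^2) + 2 * (LBINT x:e. (norm (?s e x))^2))"
  by (intro sum_mono)
 also have "... = 2 * (L2norm \<Omega> (%x. matrix_inv (A x) *v bulk \<T>h (Q w) x + bulk \<T>h (%e. grad (U w e)) x))^2 + 2 * (inv_flux w)^2"
  unfolding 1 2 by (simp only: sum.distrib sum_distrib_left)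
 also have "... <= 2 * (k1^2 * inv_flux w)^2 + 2 * (inv_flux w)^2"
  using gradient_defect_bound[OF w] flux_norm_nonneg inv_flux_nonneg by (intro add_mono mult_left_mono power_mono) auto
 also have "... = (2 * k1 ^ 4 + 2) * (inv_flux w)^2" by (simp add: power_mult_distrib algebra_simps)
 finally show ?thesis .
qed

definition energy_const :: real where "energy_const = face_const * k1^2 + (2 * k1 ^ 4 + 2)"

definition error_const :: real where
 "error_const = sqrt (two_level.two_level_const TYPE('n) \<kappa> p size_const *
   (\<kappa> ^ 4 * (broken_function.\<rho>_const TYPE('n) \<kappa> p size_const * energy_const)))"

text \<open>Jumps and gradients of \<open>U w\<close> are bounded by the flux, through the properties of the local solvers. The
  kernel estimate turns them into a bound for \<open>U w\<close>, in which the factor \<open>\<Theta> h\<^sup>2\<close> is \<open>H\<^sup>2\<close> up to a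
  constant.\<close>

theorem fine_space_bound:
 assumes w: "w \<in> fine_space S p \<Omega> \<T>H \<T>h U"
 shows "L2norm \<Omega> (bulk \<T>h (U w)) <= error_const * H * inv_flux w"
proof -
 have wM: "w \<in> M" and Pi: "Pi_H S p \<Omega> \<T>H \<T>h U w = (%F x. 0)" using w by (auto simp: fine_space_def)
 let ?P = "L2_proj S p (%E. avg_interp \<Omega> {e\<in>\<T>h. e \<subseteq> E} (U w))"
 have kernel: "coarse.vertex_mean \<T>H ?P x = 0" if E: "E \<in> \<T>H" and x: "x \<in> verts E" for E x
 proof -
  obtain b where b: "b \<in> verts E" "b \<noteq> x" using other_vertex[OF coarse.full[OF E], of x] by blast
  have "x \<in> opp_face E b" using vert_in_opp_face[OF coarse.full[OF E] b(1) x] b(2) by auto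
  moreover have "opp_face E b \<in> faces \<T>H" using facet_iff[OF coarse.full[OF E]] b(1) E by (auto simp: faces_def)
  moreover have "skel_trace \<T>H (avg_interp \<Omega> \<T>H ?P) (opp_face E b) x = 0" using Pi by (simp add: Pi_H_def fun_eq_iff)
  ultimately have "avg_interp \<Omega> \<T>H ?P x = 0" by (simp add: skel_trace_def)
  then show ?thesis
   unfolding coarse.avg_interp_eq[OF subset_refl] coarse.interp_vertex[OF subset_refl E x] .
 qed
 interpret tl: two_level \<kappa> \<Omega> \<T>h \<T>H p size_const "U w" w "el_jump w" S \<Theta> size_const
 proof unfold_locales
  show "refines \<T>h \<T>H" using uniform by (simp add: uniformly_refines_def)
  show "polyfn p (U w e)" if "e \<in> \<T>h" for e by (rule U_polyfn[OF wM that])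
  show "w F x = 0" if "e \<in> \<T>h" "F facet_of e" "F \<subseteq> frontier \<Omega>" "x \<in> F" for e F x
   using wM that by (auto simp: M_space_def faces_def)
 qed (auto intro: el_jump_nonneg el_jump_bound[OF wM] size_const fine_comparable coarse_comparable ratio \<Theta>_ge_1 kernel)
 let ?R = "energy_const * (inv_flux w)^2"
 let ?tl = "two_level.two_level_const TYPE('n) \<kappa> p size_const" and ?rc = "broken_function.\<rho>_const TYPE('n) \<kappa> p size_const"
 have c0: "0 <= (inv_flux w)^2" "0 <= face_const * k1^2" "0 <= 2 * k1 ^ 4 + 2" using face_const_nonneg by auto
 have \<rho>: "(\<Sum>e\<in>\<T>h. vol e * (tl.\<rho> e)^2) <= ?rc * (h^2 * ?R)"
 proof (rule tl.\<rho>_sum[OF diameter_le_h _ _ fine_nonempty])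
  have "face_const * k1^2 * (inv_flux w)^2 <= ?R" unfolding energy_const_def using c0 by (intro mult_right_mono) auto
  then show "(\<Sum>e\<in>\<T>h. vol e * (el_jump w e)^2) <= h^2 * ?R"
   by (intro order_trans[OF el_jump_sum[OF wM]] mult_left_mono) auto
  have "(2 * k1 ^ 4 + 2) * (inv_flux w)^2 <= ?R" unfolding energy_const_def using c0 by (intro mult_right_mono) auto
  then show "(\<Sum>e\<in>\<T>h. LBINT z:e. (norm (grad (U w e) z))^2) <= ?R"
   by (rule order_trans[OF gradient_sum[OF wM]])
 qed
 obtain E where E: "E \<in> \<T>H" using fine_nonempty parent by blast
 have tl0: "0 <= ?tl"
  using tl.mean_const_nonneg tl.jump_const_nonneg coarse.star_sum_const_nonneg[OF E size_const(3)]
  unfolding tl.two_level_const_def by (intro add_nonneg_nonneg mult_nonneg_nonneg) auto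
 have "(L2norm \<Omega> (bulk \<T>h (U w)))^2 = (\<Sum>e\<in>\<T>h. LBINT x:e. (U w e x)^2)" by (rule bulk_U_norm[OF wM])
 also have "... <= ?tl * (\<Theta> * (\<Sum>e\<in>\<T>h. vol e * (tl.\<rho> e)^2))" by (rule tl.kernel_estimate)
 also have "... <= ?tl * (\<Theta> * (?rc * (h^2 * ?R)))" using \<rho> tl0 \<Theta>_ge_1 by (intro mult_left_mono) auto
 also have "... = (?tl * (\<kappa> ^ 4 * (?rc * energy_const))) * (H * inv_flux w)^2"
  using h_pos by (simp add: \<Theta>_def power_mult_distrib power_divide mult_ac)
 finally have "L2norm \<Omega> (bulk \<T>h (U w)) <= sqrt ((?tl * (\<kappa> ^ 4 * (?rc * energy_const))) * (H * inv_flux w)^2)"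
  by (rule real_le_rsqrt)
 also have "... = error_const * \<bar>H * inv_flux w\<bar>" unfolding real_sqrt_mult[of _ "(H * inv_flux w)^2"] error_const_def by simp
 also have "\<bar>H * inv_flux w\<bar> = H * inv_flux w"
  using inv_flux_nonneg[of w] diameter_le_H[OF E] coarse.diameter_pos[OF E] by simp
 finally show ?thesis by (simp add: mult.assoc)
qed

end

section \<open>The error estimate\<close>

context multiscale_problem
begin

text \<open>The energy of the error is the load applied to \<open>C m\<close>, which belongs to the kernel of the
  quasi-interpolation and has the same energy as the error. The bound for functions in that kernel
  therefore absorbs one factor of the energy norm.\<close>

theorem multiscale_error:
 assumes C: "is_corrector S p \<Omega> \<T>H \<T>h A \<tau> U Q C" and f: "f \<in> L2 \<Omega>"
  and m: "is_hdg_solution \<Omega> \<T>h A \<tau> U Q f M m"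
  and mH: "is_hdg_solution \<Omega> \<T>h A \<tau> U Q f (multiscale_space S p \<Omega> \<T>h C) mH"
 shows "hdg_norm \<Omega> \<T>h A \<tau> U Q (%F x. m F x - mH F x) <= \<bar>error_const\<bar> * (\<alpha> powr (- 1 / 2) * H * L2norm \<Omega> f)"
  and "sqrt \<alpha> * L2norm \<Omega> (%x. bulk \<T>h (U m) x - bulk \<T>h (U mH) x) +
    L2norm \<Omega> (%x. matrix_inv_sqrt (A x) *v (bulk \<T>h (Q m) x - bulk \<T>h (Q mH) x))
     <= (k1^2 + 1) * hdg_norm \<Omega> \<T>h A \<tau> U Q (%F x. m F x - mH F x)"
proof -
 let ?d = "%F x. m F x - mH F x"
 define l where "l \<mu> = (LINT x|lebesgue_on \<Omega>. f x * bulk \<T>h (U \<mu>) x)" for \<mu>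
 have mM: "m \<in> M" and ml: "!!\<mu>. \<mu> \<in> M ==> a m \<mu> = l \<mu>" using m by (auto simp: is_hdg_solution_def l_def)
 have mHX: "mH \<in> multiscale_space S p \<Omega> \<T>h C" "!!\<mu>. \<mu> \<in> multiscale_space S p \<Omega> \<T>h C ==> a mH \<mu> = l \<mu>"
  using mH by (auto simp: is_hdg_solution_def l_def)
 have CW: "!!\<xi>. \<xi> \<in> M ==> C \<xi> \<in> fine_space S p \<Omega> \<T>H \<T>h U"
  "!!\<xi> \<eta>. \<xi> \<in> M ==> \<eta> \<in> fine_space S p \<Omega> \<T>H \<T>h U ==> a (C \<xi>) \<eta> = a \<xi> \<eta>"
  using C by (auto simp: is_corrector_def)
 have WM: "fine_space S p \<Omega> \<T>H \<T>h U \<subseteq> M" by (auto simp: fine_space_def)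
 note energy = multiscale_error_energy[OF CW WM mM ml mHX]
 have mHM: "mH \<in> M" by (rule energy(1); assumption)
 have err: "a ?d ?d = l (C m)" "a (C m) (C m) = l (C m)" by (rule energy(2); assumption) (rule energy(3); assumption)
 have dM: "?d \<in> M" by (rule M_diff[OF mM mHM])
 have CM: "C m \<in> M" using CW(1)[OF mM] WM by blast
 define n where "n = hdg_norm \<Omega> \<T>h A \<tau> U Q ?d"
 have n: "n = sqrt (a ?d ?d)" by (simp add: n_def hdg_norm_def)
 have n0: "0 <= n" and nsq: "n^2 = a ?d ?d" using form_nonneg[OF dM] by (simp_all add: n)
 obtain E where "E \<in> \<T>H" using fine_nonempty parent by blast
 then have H0: "0 <= H" using diameter_le_H coarse.diameter_pos by (meson less_imp_le order_trans)
 have F0: "0 <= L2norm \<Omega> f" by (rule flux_norm_nonneg)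
 have "\<alpha> * (inv_flux (C m))^2 <= n^2"
  using inv_flux_le_form[OF CM] err by (simp add: inv_flux_def nsq)
 then have "sqrt (\<alpha> * (inv_flux (C m))^2) <= n" using n0 by (rule real_le_lsqrt[OF _, rotated])
 then have flux: "sqrt \<alpha> * inv_flux (C m) <= n" using inv_flux_nonneg by (simp add: real_sqrt_mult)
 have "n^2 = l (C m)" using err(1) nsq by simp
 also have "... <= L2norm \<Omega> f * L2norm \<Omega> (bulk \<T>h (U (C m)))" unfolding l_def by (rule load_bound[OF CM f])
 also have "... <= L2norm \<Omega> f * (error_const * H * inv_flux (C m))"
  by (rule mult_left_mono[OF fine_space_bound[OF CW(1)[OF mM]] F0])
 also have "... <= L2norm \<Omega> f * (\<bar>error_const\<bar> * H * inv_flux (C m))"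
  using H0 F0 inv_flux_nonneg by (intro mult_left_mono mult_right_mono) auto
 finally have main: "n^2 <= (\<bar>error_const\<bar> * H * L2norm \<Omega> f) * inv_flux (C m)" by (simp add: mult_ac)
 have c0: "0 <= \<bar>error_const\<bar> * H * L2norm \<Omega> f" using H0 F0 by simp
 have sa: "0 < sqrt \<alpha>" using \<alpha>_pos by simp
 have bound: "n <= \<bar>error_const\<bar> * H * L2norm \<Omega> f / sqrt \<alpha>"
 proof (cases "n = 0")
  case True
  then show ?thesis using c0 sa by simp
 next
  case False
  have "sqrt \<alpha> * n^2 <= (\<bar>error_const\<bar> * H * L2norm \<Omega> f) * (sqrt \<alpha> * inv_flux (C m))"
   using mult_left_mono[OF main, of "sqrt \<alpha>"] sa by (simp add: mult_ac)
  also have "... <= (\<bar>error_const\<bar> * H * L2norm \<Omega> f) * n" by (rule mult_left_mono[OF flux c0])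
  finally have "(sqrt \<alpha> * n) * n <= (\<bar>error_const\<bar> * H * L2norm \<Omega> f) * n" by (simp add: power2_eq_square)
  then have "sqrt \<alpha> * n <= \<bar>error_const\<bar> * H * L2norm \<Omega> f" using False n0 by (simp add: mult_le_cancel_right)
  then show ?thesis using sa by (simp add: pos_le_divide_eq mult.commute)
 qed
 have "\<alpha> powr (- 1 / 2) = 1 / sqrt \<alpha>" using \<alpha>_pos by (simp add: powr_minus_divide powr_half_sqrt)
 then show "n <= \<bar>error_const\<bar> * (\<alpha> powr (- 1 / 2) * H * L2norm \<Omega> f)" using bound by simp
 have 1: "sqrt \<alpha> * L2norm \<Omega> (%x. bulk \<T>h (U m) x - bulk \<T>h (U mH) x) <= k1^2 * n"
 proof -
  have "sqrt \<alpha> * L2norm \<Omega> (bulk \<T>h (U ?d)) <= k1^2 * n" unfolding n by (rule bulk_bound[OF dM])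
  then show ?thesis by (rule ord_eq_le_trans[OF arg_cong[OF bulk_U_diff[OF mM mHM], where f="%y. sqrt \<alpha> * y"]])
 qed
 have "L2norm \<Omega> (%x. matrix_inv_sqrt (A x) *v (bulk \<T>h (Q m) x - bulk \<T>h (Q mH) x)) <= n"
  unfolding n by (rule real_le_rsqrt[OF energy_flux_le_form[OF mM mHM]])
 then show "sqrt \<alpha> * L2norm \<Omega> (%x. bulk \<T>h (U m) x - bulk \<T>h (U mH) x) +
    L2norm \<Omega> (%x. matrix_inv_sqrt (A x) *v (bulk \<T>h (Q m) x - bulk \<T>h (Q mH) x)) <= (k1^2 + 1) * n"
  using 1 by (simp add: distrib_right)
qed

end

text \<open>The ellipticity constant bounds the element values of the coefficient from below, since an element
  meets the domain in a set of positive measure.\<close>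

lemma (in regular_mesh) element_coefficient:
 fixes A :: "real^'n => real^'n^'n"
 assumes adm: "admissible_coefficient \<Omega> \<T>\<epsilon> \<alpha> \<beta> A" and ref: "refines \<T> \<T>\<epsilon>" and e: "e \<in> \<T>"
  and closed: "!!e. e \<in> \<T>\<epsilon> ==> closed e"
 shows "\<exists>c\<ge>\<alpha>. AE x in lebesgue_on e. A x = mat c"
proof -
 obtain e0 where e0: "e0 \<in> \<T>\<epsilon>" "e \<subseteq> e0" using ref e by (auto simp: refines_def)
 obtain c where c: "AE x in lebesgue_on e0. A x = mat c" using adm e0(1) by (auto simp: admissible_coefficient_def)
 have eb: "e \<in> sets lebesgue" "e0 \<in> sets lebesgue" "\<Omega> \<in> sets lebesgue"
  using borel_compact[OF simplex_compact[OF full[OF e]]] closed[OF e0(1)] open_domain by auto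
 have 1: "AE x in lebesgue. x \<in> e0 \<longrightarrow> A x = mat c" using c eb by (subst (asm) AE_restrict_space_iff) auto
 have "AE x in lebesgue_on \<Omega>. \<forall>\<xi>. \<alpha> * (norm \<xi>)^2 <= (A x *v \<xi>) \<bullet> \<xi>"
  using adm unfolding admissible_coefficient_def by (auto elim: eventually_mono)
 then have 2: "AE x in lebesgue. x \<in> \<Omega> \<longrightarrow> (\<forall>\<xi>. \<alpha> * (norm \<xi>)^2 <= (A x *v \<xi>) \<bullet> \<xi>)"
  using eb by (subst (asm) AE_restrict_space_iff) auto
 have "\<alpha> <= c"
 proof (rule ccontr)
  assume n: "\<not> \<alpha> <= c"
  have "AE x in lebesgue. x \<notin> interior e"
   using 1 2
  proof eventually_elim
   case (elim x)
   show ?case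
   proof
    assume x: "x \<in> interior e"
    then have "x \<in> \<Omega>" "x \<in> e0" using interior_element[OF e] e0(2) interior_subset[of e] by auto
    then have A: "A x = mat c" and el: "\<forall>\<xi>. \<alpha> * (norm \<xi>)^2 <= (A x *v \<xi>) \<bullet> \<xi>" using elim by auto
    define \<xi> :: "real^'n" where "\<xi> = axis undefined 1"
    have "norm \<xi> = 1" by (simp add: \<xi>_def)
    moreover have "\<alpha> * (norm \<xi>)^2 <= (c *\<^sub>R \<xi>) \<bullet> \<xi>" using el unfolding A mat_mult_vector by blast
    ultimately show False using n by (simp add: power2_norm_eq_inner[symmetric])
   qed
  qed
  then have "interior e \<in> null_sets lebesgue" by (subst AE_iff_null_sets) auto
  then show False using open_not_negligible[of "interior e"] simplex_interior_nonempty[OF full[OF e]]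
   by (simp add: negligible_iff_null_sets)
 qed
 moreover have "AE x in lebesgue_on e. A x = mat c"
  using eb by (subst AE_restrict_space_iff) (auto intro: eventually_mono[OF 1] simp: subsetD[OF e0(2)])
 ultimately show ?thesis by blast
qed

theorem theorem5p1:
  fixes S :: hdg_scheme and p :: nat and \<kappa> K :: real
  assumes "CARD('n::finite) \<in> {1, 2, 3}" and "p \<ge> 1"
  shows "\<exists>C0>0. \<forall>(\<Omega> :: (real^'n) set) \<T>H \<T>\<epsilon> \<T>h A \<alpha> \<beta> \<tau> U Q J C f m mH.
     lipschitz_polytope \<Omega> \<longrightarrow>
     mesh_hierarchy \<kappa> \<Omega> \<T>H \<T>\<epsilon> \<T>h \<longrightarrow>
     admissible_coefficient \<Omega> \<T>\<epsilon> \<alpha> \<beta> A \<longrightarrow>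
     admissible_stabilization K S \<T>h \<tau> \<longrightarrow>
     local_solvers S p \<T>h A \<tau> U Q \<longrightarrow>
     local_solver_properties K S p \<Omega> \<T>h A \<alpha> \<beta> \<tau> U Q \<longrightarrow>
     mesh_injection K S p \<Omega> \<T>H \<T>h J \<longrightarrow>
     is_corrector S p \<Omega> \<T>H \<T>h A \<tau> U Q C \<longrightarrow>
     f \<in> L2 \<Omega> \<longrightarrow>
     is_hdg_solution \<Omega> \<T>h A \<tau> U Q f (M_space S p \<Omega> \<T>h) m \<longrightarrow>
     is_hdg_solution \<Omega> \<T>h A \<tau> U Q f (multiscale_space S p \<Omega> \<T>h C) mH \<longrightarrow>
       sqrt \<alpha> * L2norm \<Omega> (\<lambda>x. bulk \<T>h (U m) x - bulk \<T>h (U mH) x) +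
       L2norm \<Omega> (\<lambda>x. matrix_inv_sqrt (A x) *v (bulk \<T>h (Q m) x - bulk \<T>h (Q mH) x))
         \<le> C0 * hdg_norm \<Omega> \<T>h A \<tau> U Q (\<lambda>F x. m F x - mH F x) \<and>
       hdg_norm \<Omega> \<T>h A \<tau> U Q (\<lambda>F x. m F x - mH F x)
         \<le> C0 * (\<alpha> powr (- 1 / 2) * mesh_size \<T>H * L2norm \<Omega> f)"
proof -
 let ?err = "multiscale_problem.error_const TYPE('n) \<kappa> p K"
 let ?C0 = "\<bar>?err\<bar> + ((max K 1)^2 + 1)"
 have "?C0 > 0" by (intro add_nonneg_pos add_nonneg_pos) auto
 moreover have "sqrt \<alpha> * L2norm \<Omega> (%x. bulk \<T>h (U m) x - bulk \<T>h (U mH) x) +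
    L2norm \<Omega> (%x. matrix_inv_sqrt (A x) *v (bulk \<T>h (Q m) x - bulk \<T>h (Q mH) x))
     <= ?C0 * hdg_norm \<Omega> \<T>h A \<tau> U Q (%F x. m F x - mH F x) \<and>
    hdg_norm \<Omega> \<T>h A \<tau> U Q (%F x. m F x - mH F x)
     <= ?C0 * (\<alpha> powr (- 1 / 2) * mesh_size \<T>H * L2norm \<Omega> f)"
  if dom: "lipschitz_polytope \<Omega>" and mesh: "mesh_hierarchy \<kappa> \<Omega> \<T>H \<T>\<epsilon> \<T>h"
   and adm: "admissible_coefficient \<Omega> \<T>\<epsilon> \<alpha> \<beta> A" and stab: "admissible_stabilization K S \<T>h \<tau>"
   and sol: "local_solvers S p \<T>h A \<tau> U Q" and props: "local_solver_properties K S p \<Omega> \<T>h A \<alpha> \<beta> \<tau> U Q"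
   and C: "is_corrector S p \<Omega> \<T>H \<T>h A \<tau> U Q C" and f: "f \<in> L2 \<Omega>"
   and m: "is_hdg_solution \<Omega> \<T>h A \<tau> U Q f (M_space S p \<Omega> \<T>h) m"
   and mH: "is_hdg_solution \<Omega> \<T>h A \<tau> U Q f (multiscale_space S p \<Omega> \<T>h C) mH"
  for \<Omega> :: "(real^'n) set" and \<T>H \<T>\<epsilon> \<T>h A \<alpha> \<beta> \<tau> U Q C f m mH
 proof -
  note ext = lipschitz_polytope_exterior[OF dom]
  have meshes: "simplicial_mesh \<kappa> \<Omega> \<T>H" "simplicial_mesh \<kappa> \<Omega> \<T>\<epsilon>" "simplicial_mesh \<kappa> \<Omega> \<T>h"
   and ref: "refines \<T>h \<T>\<epsilon>" and unif: "uniformly_refines \<T>h \<T>H"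
   using mesh by (auto simp: mesh_hierarchy_def)
  interpret fine: regular_mesh \<kappa> \<Omega> \<T>h by unfold_locales (use meshes ext in auto)
  interpret mid: regular_mesh \<kappa> \<Omega> \<T>\<epsilon> by unfold_locales (use meshes ext in auto)
  have \<alpha>\<beta>: "0 < \<alpha>" "0 < \<beta>" using adm by (auto simp: admissible_coefficient_def)
  have "\<Omega> \<noteq> {}" using dom by (simp add: lipschitz_polytope_def)
  then have ne: "\<T>h \<noteq> {}" using fine.Union_mesh closure_subset[of \<Omega>] by auto
  interpret multiscale_problem \<kappa> \<Omega> \<T>h \<T>H S p A \<alpha> \<tau> U Q K \<beta>
  proof unfold_locales
   show "\<exists>c\<ge>\<alpha>. AE x in lebesgue_on e. A x = mat c" if "e \<in> \<T>h" for e
    using simplex_compact[OF mid.full] by (intro fine.element_coefficient[OF adm ref that]) (auto intro: compact_imp_closed)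
   show "if S = LDG_H \<or> S = EDG then \<forall>F\<in>faces \<T>h. 0 < \<tau> F else \<forall>F\<in>faces \<T>h. \<tau> F = 0"
    using stab by (auto simp: admissible_stabilization_def)
  qed (use assms \<alpha>\<beta> sol props unif ne meshes ext in auto)
  let ?n = "hdg_norm \<Omega> \<T>h A \<tau> U Q (%F x. m F x - mH F x)"
  let ?b = "\<alpha> powr (- 1 / 2) * mesh_size \<T>H * L2norm \<Omega> f"
  obtain E where E: "E \<in> \<T>H" using ne parent by blast
  have H0: "0 <= mesh_size \<T>H" using diameter_le_H[OF E] coarse.diameter_pos[OF E] by simp
  have b0: "0 <= ?b" using H0 flux_norm_nonneg by (intro mult_nonneg_nonneg) auto
  note est = multiscale_error[OF C f m mH]
  have n0: "0 <= ?n"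
  proof -
   have "0 <= (k1^2 + 1) * ?n"
    by (intro order_trans[OF _ est(2)] add_nonneg_nonneg mult_nonneg_nonneg flux_norm_nonneg real_sqrt_ge_zero less_imp_le[OF \<alpha>\<beta>(1)])
   moreover have "0 < k1\<^sup>2 + 1" by (intro add_nonneg_pos) auto
   ultimately show ?thesis by (simp add: zero_le_mult_iff)
  qed
  have "(k1^2 + 1) * ?n <= ?C0 * ?n" using n0 by (intro mult_right_mono) (auto simp: k1_def)
  moreover have "\<bar>error_const\<bar> * ?b <= ?C0 * ?b" using b0 by (intro mult_right_mono) auto
  ultimately show ?thesis using est by linarith
 qed
 ultimately show ?thesis by blast
qed

end
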